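(* Let $R$ be a $\Psi$-ring and let $M$ be a $\Psi$-module over $R$. Let $\mathbb{N}^{mult}$ be the multiplicative monoid of positive integers, regarded as a category with one object, and for each $q\ge0$ let $\mathcal{H}^{q}_{AQ}(R,M)$ be the natural system on $\mathbb{N}^{mult}$ given by $f\mapsto H^{q}_{AQ}(R,M^{f})$. Then there exists a spectral sequence $$E_{2}^{p,q}=H^{p}_{BW}\bigl(\mathbb{N}^{mult},\mathcal{H}^{q}_{AQ}(R,M)\bigr)\Rightarrow H^{p+q}_{\Psi}(R,M).$$
   Context: A $\Psi$-ring is a commutative ring $R$ with $1$ together with ring homomorphisms $\Psi^{n}:R\to R$, $n\ge1$, such that $\Psi^{1}=\mathrm{id}$ and $\Psi^{n}\Psi^{m}=\Psi^{nm}$; equivalently, a functor from the one-object category $\mathbb{N}^{mult}$ to commutative rings. A $\Psi$-module over $R$ is an $R$-module $M$ with additive maps $\Psi^{n}:M\to M$, $n\ge 1$, such that $\Psi^{1}=\mathrm{id}$, $\Psi^{n}(rm)=\Psi^{n}(r)\Psi^{n}(m)$, $\Psi^{n}\Psi^{l}=\Psi^{nl}$. The semidirect product $R\rtimes_{\Psi}M$ is the square-zero extension ring on $R\oplus M$ with $\Psi^{n}(r,m)=(\Psi^{n}(r),\Psi^{n}(m))$; it is an abelian group object in $\Psi$-rings over $R$. Comonad cohomology. For a comonad $\mathbb{G}=(G,\varepsilon,\delta)$ on a category $\mathfrak{C}$, an object $X$, and an abelian group object $N$ of $\mathfrak{C}/X$, $H^{*}_{\mathbb{G}}(X,N)$ is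 the cohomology of the complex with $n$-th term the group of sections of the pullback of $N$ along the augmentation $G^{n+1}(X)\to X$, $n\ge0$, with differential the alternating sum of the maps induced by the faces $G^{k}\varepsilon G^{n-k}$. $H^{*}_{AQ}(R,N)$ (André–Quillen cohomology of the commutative ring $R$ with coefficients in an $R$-module $N$) is the comonad cohomology for the comonad $FU$ on commutative rings associated with the free commutative ring/forgetful adjunction with sets, with coefficients in $R\rtimes N$. $H^{*}_{\Psi}(R,M)$ is the comonad cohomology for the comonad $FU$ on $\Psi$-rings associated with the free $\Psi$-ring/forgetful adjunction with sets, with coefficients in $R\rtimes_{\Psi}M$. For $f\in\mathbb{N}^{mult}$, $M^{f}$ is the abelian group $M$ with the $R$-action $(r,a)\mapsto\Psi^{f}(r)a$. The natural system $D_{f}=H^{q}_{AQ}(R,M^{f})$ has structure maps $u_{*}:D_{f}\to D_{uf}$ induced by $\Psi^{u}:M^{f}\to M^{uf}$ and $v^{*}:D_{f}\to D_{fv}$ induced by $\Psi^{v}:R\to R$. Natural systems and Baues–Wirsching cohomology. For a small category $I$, the category of factorizations $\mathcal{F}I$ has the morphisms of $I$ as objects; a morphism $f\to g$ is a pair $(\alpha,\beta)$ with $g=\alpha f\beta$, with composition $(\alpha',\beta')(\alpha,\beta)=(\alpha'\alpha,\beta\beta')$. A natural system on $I$ is a functor $D:\mathcal{F}I\to\mathfrak{Ab}$, with induced maps $\alpha_*:D(f)\to D(\alpha f)$, $\beta^*:D(f)\to D(f\beta)$. $H^{*}_{BW}(I,D)$ is the cohomology of $$C^{n}_{BW}(I,D)=\prod_{i_{n}\xrightarrow{\alpha_n}\cdots\xrightarrow{\alpha_1}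 i_{0}}D(\alpha_{1}\cdots\alpha_{n})$$ (for $n=0$: $\prod_iD(\mathrm{id}_i)$) with $$(df)(\alpha_{1},\dots,\alpha_{n+1})=(\alpha_{1})_{*}f(\alpha_{2},\dots,\alpha_{n+1})+\sum_{j=1}^{n}(-1)^{j}f(\alpha_{1},\dots,\alpha_{j}\alpha_{j+1},\dots,\alpha_{n+1})+(-1)^{n+1}(\alpha_{n+1})^{*}f(\alpha_{1},\dots,\alpha_{n}).$$ *)

theory Defs
  imports
    "HOL-Library.Poly_Mapping"
    "HOL-Library.Multiset"
    "HOL-Library.FSet"
    "HOL-Algebra.Module"
    "HOL-Algebra.Coset"
    "HOL-Algebra.Product_Groups"
    "HOL-Algebra.Chinese_Remainder"
begin

section \<open>Psi-rings and Psi-modules\<close>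

text \<open>Only the indices \<open>n \<ge> 1\<close> of the operations are constrained or ever used.\<close>

record 'a psi_ring = "'a ring" +
  psi :: "nat \<Rightarrow> 'a \<Rightarrow> 'a"

record ('a, 'b) psi_module = "('a, 'b) module" +
  mpsi :: "nat \<Rightarrow> 'b \<Rightarrow> 'b"

locale psi_ring = cring R for R :: "('a, 'x) psi_ring_scheme" (structure) +
  assumes psi_hom: "1 \<le> n \<Longrightarrow> psi R n \<in> ring_hom R R"
    and psi_one: "r \<in> carrier R \<Longrightarrow> psi R 1 r = r"
    and psi_comp: "\<lbrakk>1 \<le> n; 1 \<le> m; r \<in> carrier R\<rbrakk> \<Longrightarrow> psi R n (psi R m r) = psi R (n * m) r"

locale psi_module = psi_ring R + module R M
  for R :: "('a, 'x) psi_ring_scheme" (structure)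
    and M :: "('a, 'b, 'y) psi_module_scheme" (structure) +
  assumes mpsi_hom: "1 \<le> n \<Longrightarrow> mpsi M n \<in> hom (add_monoid M) (add_monoid M)"
    and mpsi_one: "m \<in> carrier M \<Longrightarrow> mpsi M 1 m = m"
    and mpsi_smult: "\<lbrakk>1 \<le> n; r \<in> carrier R; m \<in> carrier M\<rbrakk> \<Longrightarrow>
          mpsi M n (r \<odot>\<^bsub>M\<^esub> m) = psi R n r \<odot>\<^bsub>M\<^esub> mpsi M n m"
    and mpsi_comp: "\<lbrakk>1 \<le> n; 1 \<le> l; m \<in> carrier M\<rbrakk> \<Longrightarrow>
          mpsi M n (mpsi M l m) = mpsi M (n * l) m"

text \<open>\<open>twist R M f\<close> is \<open>M\<^sup>f\<close>, an \<open>R\<close>-module only.\<close>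

definition twist :: "('a, 'x) psi_ring_scheme \<Rightarrow> ('a, 'b, 'y) module_scheme \<Rightarrow> nat \<Rightarrow>
    ('a, 'b, 'y) module_scheme" where
  "twist R M f = M\<lparr>smult := (\<lambda>r a. psi R f r \<odot>\<^bsub>M\<^esub> a)\<rparr>"

definition semidirect :: "('a, 'x) ring_scheme \<Rightarrow> ('a, 'b, 'y) module_scheme \<Rightarrow>
    ('a \<times> 'b) ring" where
  "semidirect R M =
    \<lparr>carrier = carrier R \<times> carrier M,
     monoid.mult = (\<lambda>(r, m) (r', m'). (r \<otimes>\<^bsub>R\<^esub> r', r \<odot>\<^bsub>M\<^esub> m' \<oplus>\<^bsub>M\<^esub> r' \<odot>\<^bsub>M\<^esub> m)),
     one = (\<one>\<^bsub>R\<^esub>, \<zero>\<^bsub>M\<^esub>),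
     zero = (\<zero>\<^bsub>R\<^esub>, \<zero>\<^bsub>M\<^esub>),
     add = (\<lambda>(r, m) (r', m'). (r \<oplus>\<^bsub>R\<^esub> r', m \<oplus>\<^bsub>M\<^esub> m'))\<rparr>"

definition psi_semidirect :: "('a, 'x) psi_ring_scheme \<Rightarrow> ('a, 'b, 'y) psi_module_scheme \<Rightarrow>
    ('a \<times> 'b) psi_ring" where
  "psi_semidirect R M = ring.extend (semidirect R M)
     \<lparr>psi = (\<lambda>n (r, m). (psi R n r, mpsi M n m))\<rparr>"

text \<open>Addition of the abelian group object \<open>R \<rtimes> M\<close> over \<open>R\<close>; only applied to pairs of elements
  lying over the same element of \<open>R\<close>.\<close>

definition fibre_add :: "('a, 'b, 'y) module_scheme \<Rightarrow> 'a \<times> 'b \<Rightarrow> 'a \<times> 'b \<Rightarrow> 'a \<times> 'b" where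
  "fibre_add M = (\<lambda>(r, m) (r', m'). (r, m \<oplus>\<^bsub>M\<^esub> m'))"


section \<open>Free commutative rings and free Psi-rings\<close>

text \<open>The free commutative ring on a type \<open>'v\<close> of variables is \<^typ>\<open>'v multiset \<Rightarrow>\<^sub>0 int\<close>. To be able to
  iterate the construction inside one type we use a type containing the elements of a ring
  (\<open>Base\<close>), formal variables \<open>Op n s\<close> (standing for the free generator \<open>\<Psi>\<^sup>n s\<close> of a free Psi-ring) and,
  through \<open>poly_enc\<close>, all integer polynomials in its own elements: a polynomial is stored as the
  finite graph of its coefficient function.\<close>

datatype 'a poly_tower =
    Base (un_Base: 'a)
  | Op nat "'a poly_tower"
  | Poly "('a poly_tower multiset \<times> int) fset"

definition poly_enc :: "('a poly_tower multiset \<Rightarrow>\<^sub>0 int) \<Rightarrow> 'a poly_tower" where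
  "poly_enc p = Poly (Abs_fset ((\<lambda>m. (m, Poly_Mapping.lookup p m)) ` Poly_Mapping.keys p))"

definition poly_dec :: "'a poly_tower \<Rightarrow> ('a poly_tower multiset \<Rightarrow>\<^sub>0 int)" where
  "poly_dec = inv_into UNIV poly_enc"

lemma inj_poly_enc: "inj poly_enc"
proof (rule injI)
  fix p q :: "'a poly_tower multiset \<Rightarrow>\<^sub>0 int"
  assume "poly_enc p = poly_enc q"
  then have gr: "(\<lambda>m. (m, Poly_Mapping.lookup p m)) ` Poly_Mapping.keys p
        = (\<lambda>m. (m, Poly_Mapping.lookup q m)) ` Poly_Mapping.keys q"
    by (simp add: poly_enc_def Abs_fset_inject)
  show "p = q"
  proof (rule poly_mapping_eqI)
    fix m
    have "Poly_Mapping.lookup p m = c \<and> c \<noteq> 0 \<longleftrightarrow> Poly_Mapping.lookup q m = c \<and> c \<noteq> 0" for c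
    proof -
      have "(m, c) \<in> (\<lambda>m. (m, Poly_Mapping.lookup p m)) ` Poly_Mapping.keys p \<longleftrightarrow>
            (m, c) \<in> (\<lambda>m. (m, Poly_Mapping.lookup q m)) ` Poly_Mapping.keys q"
        by (simp only: gr)
      then show ?thesis by (auto simp: in_keys_iff)
    qed
    then show "Poly_Mapping.lookup p m = Poly_Mapping.lookup q m" by metis
  qed
qed

lemma poly_dec_enc [simp]: "poly_dec (poly_enc p) = p"
  by (simp add: poly_dec_def inj_poly_enc)

definition free_cring :: "'a poly_tower set \<Rightarrow> 'a poly_tower ring" where
  "free_cring S =
    \<lparr>carrier = poly_enc ` {p. \<forall>m\<in>Poly_Mapping.keys p. set_mset m \<subseteq> S},
     monoid.mult = (\<lambda>x y. poly_enc (poly_dec x * poly_dec y)),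
     one = poly_enc 1,
     zero = poly_enc 0,
     add = (\<lambda>x y. poly_enc (poly_dec x + poly_dec y))\<rparr>"

text \<open>The homomorphism from a free commutative ring to \<open>X\<close> extending a map \<open>g\<close> on the generators.\<close>

definition free_lift :: "('b, 'x) ring_scheme \<Rightarrow> ('a poly_tower \<Rightarrow> 'b) \<Rightarrow> 'a poly_tower \<Rightarrow> 'b" where
  "free_lift X g x =
    (\<Oplus>\<^bsub>X\<^esub>m\<in>Poly_Mapping.keys (poly_dec x).
       [Poly_Mapping.lookup (poly_dec x) m] \<cdot>\<^bsub>X\<^esub>
         (\<Otimes>\<^bsub>X\<^esub>v\<in>set_mset m. g v [^]\<^bsub>X\<^esub> count m v))"

text \<open>The homomorphism between free commutative rings induced by a map \<open>g\<close> of the generators.\<close>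

definition free_map :: "('a poly_tower \<Rightarrow> 'a poly_tower) \<Rightarrow> 'a poly_tower \<Rightarrow> 'a poly_tower" where
  "free_map g x =
    poly_enc (\<Sum>m\<in>Poly_Mapping.keys (poly_dec x).
      Poly_Mapping.single (image_mset g m) (Poly_Mapping.lookup (poly_dec x) m))"

text \<open>The free Psi-ring on \<open>S\<close> is the free commutative ring on the symbols \<open>\<Psi>\<^sup>n s\<close>.\<close>

fun op_mult :: "nat \<Rightarrow> 'a poly_tower \<Rightarrow> 'a poly_tower" where
  "op_mult m (Op n s) = Op (m * n) s"
| "op_mult m x = x"

fun op_map :: "('a poly_tower \<Rightarrow> 'a poly_tower) \<Rightarrow> 'a poly_tower \<Rightarrow> 'a poly_tower" where
  "op_map g (Op n s) = Op n (g s)"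
| "op_map g x = x"

fun op_eval :: "(nat \<Rightarrow> 'a poly_tower \<Rightarrow> 'b) \<Rightarrow> 'a poly_tower \<Rightarrow> 'b" where
  "op_eval h (Op n s) = h n s"
| "op_eval h x = undefined"

definition free_psi_ring :: "'a poly_tower set \<Rightarrow> 'a poly_tower psi_ring" where
  "free_psi_ring S = ring.extend (free_cring {Op n s | n s. 1 \<le> n \<and> s \<in> S})
     \<lparr>psi = (\<lambda>m. free_map (op_mult m))\<rparr>"


section \<open>The comonads \<open>FU\<close> and their resolutions\<close>

text \<open>\<open>base_ring R\<close> is the copy of \<open>R\<close> inside the tower type; \<open>cr_tower R n\<close> and \<open>psi_tower R n\<close> are
  \<open>G\<^sup>n(R)\<close> for the comonad \<open>G = FU\<close> on commutative rings and on Psi-rings.\<close>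

definition base_ring :: "('a, 'x) ring_scheme \<Rightarrow> 'a poly_tower ring" where
  "base_ring R =
    \<lparr>carrier = Base ` carrier R,
     monoid.mult = (\<lambda>x y. Base (un_Base x \<otimes>\<^bsub>R\<^esub> un_Base y)),
     one = Base \<one>\<^bsub>R\<^esub>,
     zero = Base \<zero>\<^bsub>R\<^esub>,
     add = (\<lambda>x y. Base (un_Base x \<oplus>\<^bsub>R\<^esub> un_Base y))\<rparr>"

definition base_psi_ring :: "('a, 'x) psi_ring_scheme \<Rightarrow> 'a poly_tower psi_ring" where
  "base_psi_ring R = ring.extend (base_ring R) \<lparr>psi = (\<lambda>n x. Base (psi R n (un_Base x)))\<rparr>"

primrec cr_tower :: "('a, 'x) ring_scheme \<Rightarrow> nat \<Rightarrow> 'a poly_tower ring" where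
  "cr_tower R 0 = base_ring R"
| "cr_tower R (Suc n) = free_cring (carrier (cr_tower R n))"

primrec psi_tower :: "('a, 'x) psi_ring_scheme \<Rightarrow> nat \<Rightarrow> 'a poly_tower psi_ring" where
  "psi_tower R 0 = base_psi_ring R"
| "psi_tower R (Suc n) = free_psi_ring (carrier (psi_tower R n))"

text \<open>The counits \<open>\<epsilon>\<^sub>X : G(X) \<rightarrow> X\<close>, the faces \<open>G\<^sup>k \<epsilon> G\<^sup>n\<^sup>-\<^sup>k : G\<^sup>n\<^sup>+\<^sup>1(R) \<rightarrow> G\<^sup>n(R)\<close> and the
  augmentations \<open>G\<^sup>n(R) \<rightarrow> R\<close>.\<close>

definition cr_counit :: "('a poly_tower, 'x) ring_scheme \<Rightarrow> 'a poly_tower \<Rightarrow> 'a poly_tower" where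
  "cr_counit X = free_lift X (\<lambda>v. v)"

definition psi_counit :: "('a poly_tower, 'x) psi_ring_scheme \<Rightarrow> 'a poly_tower \<Rightarrow> 'a poly_tower" where
  "psi_counit X = free_lift X (op_eval (psi X))"

definition cr_face :: "('a, 'x) ring_scheme \<Rightarrow> nat \<Rightarrow> nat \<Rightarrow> 'a poly_tower \<Rightarrow> 'a poly_tower" where
  "cr_face R n k = (free_map ^^ k) (cr_counit (cr_tower R (n - k)))"

definition psi_face :: "('a, 'x) psi_ring_scheme \<Rightarrow> nat \<Rightarrow> nat \<Rightarrow> 'a poly_tower \<Rightarrow> 'a poly_tower" where
  "psi_face R n k = ((\<lambda>g. free_map (op_map g)) ^^ k) (psi_counit (psi_tower R (n - k)))"

primrec cr_aug :: "('a, 'x) ring_scheme \<Rightarrow> nat \<Rightarrow> 'a poly_tower \<Rightarrow> 'a" where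
  "cr_aug R 0 = un_Base"
| "cr_aug R (Suc n) = cr_aug R n \<circ> cr_counit (cr_tower R n)"

primrec psi_aug :: "('a, 'x) psi_ring_scheme \<Rightarrow> nat \<Rightarrow> 'a poly_tower \<Rightarrow> 'a" where
  "psi_aug R 0 = un_Base"
| "psi_aug R (Suc n) = psi_aug R n \<circ> psi_counit (psi_tower R n)"

text \<open>The endomorphism \<open>G\<^sup>n(\<phi>)\<close> of \<open>G\<^sup>n(R)\<close>, for an endomorphism \<open>\<phi>\<close> of the commutative ring \<open>R\<close>.\<close>

primrec cr_tower_map :: "('a \<Rightarrow> 'a) \<Rightarrow> nat \<Rightarrow> 'a poly_tower \<Rightarrow> 'a poly_tower" where
  "cr_tower_map \<phi> 0 = (\<lambda>x. Base (\<phi> (un_Base x)))"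
| "cr_tower_map \<phi> (Suc n) = free_map (cr_tower_map \<phi> n)"


section \<open>Cohomology of a cochain complex\<close>

text \<open>Abelian groups are written multiplicatively, as in the library.\<close>

definition homology_at :: "('c, 'x) monoid_scheme \<Rightarrow> ('c \<Rightarrow> 'd) \<Rightarrow> ('d, 'y) monoid_scheme \<Rightarrow>
    ('d \<Rightarrow> 'e) \<Rightarrow> ('e, 'z) monoid_scheme \<Rightarrow> 'd set monoid" where
  "homology_at A f B g C = (B\<lparr>carrier := kernel B C g\<rparr>) Mod (f ` carrier A)"

definition coboundaries :: "(nat \<Rightarrow> 'c monoid) \<Rightarrow> (nat \<Rightarrow> 'c \<Rightarrow> 'c) \<Rightarrow> nat \<Rightarrow> 'c set" where
  "coboundaries C d n = (case n of 0 \<Rightarrow> {\<one>\<^bsub>C 0\<^esub>} | Suc m \<Rightarrow> d m ` carrier (C m))"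

definition cohomology :: "(nat \<Rightarrow> 'c monoid) \<Rightarrow> (nat \<Rightarrow> 'c \<Rightarrow> 'c) \<Rightarrow> nat \<Rightarrow> 'c set monoid" where
  "cohomology C d n =
    ((C n)\<lparr>carrier := kernel (C n) (C (Suc n)) (d n)\<rparr>) Mod (coboundaries C d n)"

text \<open>The map on degree-\<open>n\<close> cohomology induced by a cochain map \<open>g\<close> into the complex \<open>(C, d)\<close>: the
  class of \<open>z\<close> goes to the class of \<open>g z\<close>.\<close>

definition cohomology_map :: "(nat \<Rightarrow> 'c monoid) \<Rightarrow> (nat \<Rightarrow> 'c \<Rightarrow> 'c) \<Rightarrow> nat \<Rightarrow>
    ('b \<Rightarrow> 'c) \<Rightarrow> 'b set \<Rightarrow> 'c set" where
  "cohomology_map C d n g X = (\<Union>z\<in>X. coboundaries C d n #>\<^bsub>C n\<^esub> g z)"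


section \<open>Comonad cohomology\<close>

definition pullback_ring :: "('a, 'x) ring_scheme \<Rightarrow> ('b, 'y) ring_scheme \<Rightarrow>
    ('a \<Rightarrow> 'c) \<Rightarrow> ('b \<Rightarrow> 'c) \<Rightarrow> ('a \<times> 'b) ring" where
  "pullback_ring A B f g =
    (RDirProd A B)\<lparr>carrier := {(x, y). x \<in> carrier A \<and> y \<in> carrier B \<and> f x = g y}\<rparr>"

definition pullback_psi_ring :: "('a, 'x) psi_ring_scheme \<Rightarrow> ('b, 'y) psi_ring_scheme \<Rightarrow>
    ('a \<Rightarrow> 'c) \<Rightarrow> ('b \<Rightarrow> 'c) \<Rightarrow> ('a \<times> 'b) psi_ring" where
  "pullback_psi_ring A B f g = ring.extend (pullback_ring A B f g)
     \<lparr>psi = (\<lambda>n (x, y). (psi A n x, psi B n y))\<rparr>"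

text \<open>Sections of the first projection of a pullback. Functions are made unique by extensionality
  on the carrier.\<close>

definition ring_sections :: "('a, 'x) ring_scheme \<Rightarrow> ('a \<times> 'b, 'y) ring_scheme \<Rightarrow>
    ('a \<Rightarrow> 'a \<times> 'b) set" where
  "ring_sections A P =
    {s \<in> extensional (carrier A). s \<in> ring_hom A P \<and> (\<forall>x\<in>carrier A. fst (s x) = x)}"

definition psi_ring_sections :: "('a, 'x) psi_ring_scheme \<Rightarrow> ('a \<times> 'b, 'y) psi_ring_scheme \<Rightarrow>
    ('a \<Rightarrow> 'a \<times> 'b) set" where
  "psi_ring_sections A P =
    {s \<in> ring_sections A P. \<forall>n\<ge>1. \<forall>x\<in>carrier A. s (psi A n x) = psi P n (s x)}"

text \<open>The group structure on a set \<open>S\<close> of sections of the pullback of \<open>R \<rtimes> M\<close> along \<open>f : A \<rightarrow> R\<close>,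
  inherited from the group object \<open>R \<rtimes> M\<close> over \<open>R\<close>.\<close>

definition section_group :: "('c, 'x) ring_scheme \<Rightarrow> ('c \<Rightarrow> 'a) \<Rightarrow> ('a, 'b, 'y) module_scheme \<Rightarrow>
    ('c \<Rightarrow> 'c \<times> 'a \<times> 'b) set \<Rightarrow> ('c \<Rightarrow> 'c \<times> 'a \<times> 'b) monoid" where
  "section_group A f M S =
    \<lparr>carrier = S,
     monoid.mult = (\<lambda>s t. \<lambda>x\<in>carrier A. (x, fibre_add M (snd (s x)) (snd (t x)))),
     one = (\<lambda>x\<in>carrier A. (x, f x, \<zero>\<^bsub>M\<^esub>))\<rparr>"

text \<open>The map on sections induced by \<open>h : A \<rightarrow> B\<close> over \<open>R\<close>.\<close>

definition section_pullback :: "('c, 'x) ring_scheme \<Rightarrow> ('c \<Rightarrow> 'c) \<Rightarrow>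
    ('c \<Rightarrow> 'c \<times> 'd) \<Rightarrow> ('c \<Rightarrow> 'c \<times> 'd)" where
  "section_pullback A h s = (\<lambda>x\<in>carrier A. (x, snd (s (h x))))"

definition alternating_sum :: "('c, 'x) monoid_scheme \<Rightarrow> nat \<Rightarrow> (nat \<Rightarrow> 'c) \<Rightarrow> 'c" where
  "alternating_sum C n a = (\<Otimes>\<^bsub>C\<^esub>k\<in>{..n}. a k [^]\<^bsub>C\<^esub> ((- 1) ^ k :: int))"

definition aq_cochains :: "('a, 'x) ring_scheme \<Rightarrow> ('a, 'b, 'y) module_scheme \<Rightarrow> nat \<Rightarrow>
    ('a poly_tower \<Rightarrow> 'a poly_tower \<times> 'a \<times> 'b) monoid" where
  "aq_cochains R N n =
    (let A = cr_tower R (Suc n); f = cr_aug R (Suc n)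
     in section_group A f N (ring_sections A (pullback_ring A (semidirect R N) f fst)))"

definition aq_diff :: "('a, 'x) ring_scheme \<Rightarrow> ('a, 'b, 'y) module_scheme \<Rightarrow> nat \<Rightarrow>
    ('a poly_tower \<Rightarrow> 'a poly_tower \<times> 'a \<times> 'b) \<Rightarrow>
    ('a poly_tower \<Rightarrow> 'a poly_tower \<times> 'a \<times> 'b)" where
  "aq_diff R N n s =
    alternating_sum (aq_cochains R N (Suc n)) (Suc n)
      (\<lambda>k. section_pullback (cr_tower R (Suc (Suc n))) (cr_face R (Suc n) k) s)"

definition aq_cohomology :: "('a, 'x) ring_scheme \<Rightarrow> ('a, 'b, 'y) module_scheme \<Rightarrow> nat \<Rightarrow>
    ('a poly_tower \<Rightarrow> 'a poly_tower \<times> 'a \<times> 'b) set monoid" where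
  "aq_cohomology R N = cohomology (aq_cochains R N) (aq_diff R N)"

definition psi_cochains :: "('a, 'x) psi_ring_scheme \<Rightarrow> ('a, 'b, 'y) psi_module_scheme \<Rightarrow> nat \<Rightarrow>
    ('a poly_tower \<Rightarrow> 'a poly_tower \<times> 'a \<times> 'b) monoid" where
  "psi_cochains R M n =
    (let A = psi_tower R (Suc n); f = psi_aug R (Suc n)
     in section_group A f M (psi_ring_sections A (pullback_psi_ring A (psi_semidirect R M) f fst)))"

definition psi_diff :: "('a, 'x) psi_ring_scheme \<Rightarrow> ('a, 'b, 'y) psi_module_scheme \<Rightarrow> nat \<Rightarrow>
    ('a poly_tower \<Rightarrow> 'a poly_tower \<times> 'a \<times> 'b) \<Rightarrow>
    ('a poly_tower \<Rightarrow> 'a poly_tower \<times> 'a \<times> 'b)" where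
  "psi_diff R M n s =
    alternating_sum (psi_cochains R M (Suc n)) (Suc n)
      (\<lambda>k. section_pullback (psi_tower R (Suc (Suc n))) (psi_face R (Suc n) k) s)"

definition psi_cohomology :: "('a, 'x) psi_ring_scheme \<Rightarrow> ('a, 'b, 'y) psi_module_scheme \<Rightarrow> nat \<Rightarrow>
    ('a poly_tower \<Rightarrow> 'a poly_tower \<times> 'a \<times> 'b) set monoid" where
  "psi_cohomology R M = cohomology (psi_cochains R M) (psi_diff R M)"


section \<open>Natural systems and Baues--Wirsching cohomology\<close>

record ('o, 'm) category =
  Obj :: "'o set"
  Arr :: "'m set"
  Dom :: "'m \<Rightarrow> 'o"
  Cod :: "'m \<Rightarrow> 'o"
  Id :: "'o \<Rightarrow> 'm"
  Comp :: "'m \<Rightarrow> 'm \<Rightarrow> 'm"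

locale small_category =
  fixes I :: "('o, 'm) category"
  assumes Dom_Obj: "f \<in> Arr I \<Longrightarrow> Dom I f \<in> Obj I"
    and Cod_Obj: "f \<in> Arr I \<Longrightarrow> Cod I f \<in> Obj I"
    and Id_Arr: "i \<in> Obj I \<Longrightarrow> Id I i \<in> Arr I \<and> Dom I (Id I i) = i \<and> Cod I (Id I i) = i"
    and Comp_Arr: "\<lbrakk>f \<in> Arr I; g \<in> Arr I; Dom I f = Cod I g\<rbrakk> \<Longrightarrow>
          Comp I f g \<in> Arr I \<and> Dom I (Comp I f g) = Dom I g \<and> Cod I (Comp I f g) = Cod I f"
    and Comp_Id: "f \<in> Arr I \<Longrightarrow> Comp I f (Id I (Dom I f)) = f \<and> Comp I (Id I (Cod I f)) f = f"
    and Comp_assoc: "\<lbrakk>f \<in> Arr I; g \<in> Arr I; h \<in> Arr I; Dom I f = Cod I g; Dom I g = Cod I h\<rbrakk> \<Longrightarrow>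
          Comp I (Comp I f g) h = Comp I f (Comp I g h)"

text \<open>\<open>push D \<alpha> f\<close> is \<open>\<alpha>\<^sub>* : D(f) \<rightarrow> D(\<alpha>f)\<close> and \<open>pull D \<beta> f\<close> is \<open>\<beta>\<^sup>* : D(f) \<rightarrow> D(f\<beta>)\<close>; the morphism
  \<open>(\<alpha>, \<beta>)\<close> of the category of factorizations acts as \<open>\<alpha>\<^sub>*\<beta>\<^sup>* = \<beta>\<^sup>*\<alpha>\<^sub>*\<close>.\<close>

record ('m, 'c) nat_sys =
  grp :: "'m \<Rightarrow> 'c monoid"
  push :: "'m \<Rightarrow> 'm \<Rightarrow> 'c \<Rightarrow> 'c"
  pull :: "'m \<Rightarrow> 'm \<Rightarrow> 'c \<Rightarrow> 'c"

locale natural_system = small_category I for I :: "('o, 'm) category" +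
  fixes D :: "('m, 'c) nat_sys"
  assumes grp_comm: "f \<in> Arr I \<Longrightarrow> comm_group (grp D f)"
    and push_hom: "\<lbrakk>a \<in> Arr I; f \<in> Arr I; Dom I a = Cod I f\<rbrakk> \<Longrightarrow>
          push D a f \<in> hom (grp D f) (grp D (Comp I a f))"
    and pull_hom: "\<lbrakk>b \<in> Arr I; f \<in> Arr I; Dom I f = Cod I b\<rbrakk> \<Longrightarrow>
          pull D b f \<in> hom (grp D f) (grp D (Comp I f b))"
    and push_id: "\<lbrakk>f \<in> Arr I; x \<in> carrier (grp D f)\<rbrakk> \<Longrightarrow> push D (Id I (Cod I f)) f x = x"
    and pull_id: "\<lbrakk>f \<in> Arr I; x \<in> carrier (grp D f)\<rbrakk> \<Longrightarrow> pull D (Id I (Dom I f)) f x = x"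
    and push_comp: "\<lbrakk>a \<in> Arr I; b \<in> Arr I; f \<in> Arr I; Dom I a = Cod I b; Dom I b = Cod I f;
          x \<in> carrier (grp D f)\<rbrakk> \<Longrightarrow>
          push D a (Comp I b f) (push D b f x) = push D (Comp I a b) f x"
    and pull_comp: "\<lbrakk>a \<in> Arr I; b \<in> Arr I; f \<in> Arr I; Dom I f = Cod I a; Dom I a = Cod I b;
          x \<in> carrier (grp D f)\<rbrakk> \<Longrightarrow>
          pull D b (Comp I f a) (pull D a f x) = pull D (Comp I a b) f x"
    and push_pull: "\<lbrakk>a \<in> Arr I; b \<in> Arr I; f \<in> Arr I; Dom I a = Cod I f; Dom I f = Cod I b;
          x \<in> carrier (grp D f)\<rbrakk> \<Longrightarrow>
          push D a (Comp I f b) (pull D b f x) = pull D b (Comp I a f) (push D a f x)"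

text \<open>A chain \<open>i\<^sub>n \<rightarrow> \<dots> \<rightarrow> i\<^sub>0\<close> is given by its end \<open>i\<^sub>0\<close> (needed when \<open>n = 0\<close>) and the list
  \<open>[\<alpha>\<^sub>1, \<dots>, \<alpha>\<^sub>n]\<close>.\<close>

fun is_chain :: "('o, 'm) category \<Rightarrow> 'o \<Rightarrow> 'm list \<Rightarrow> bool" where
  "is_chain I i [] \<longleftrightarrow> i \<in> Obj I"
| "is_chain I i (a # as) \<longleftrightarrow> a \<in> Arr I \<and> Cod I a = i \<and> is_chain I (Dom I a) as"

fun chain_comp :: "('o, 'm) category \<Rightarrow> 'o \<Rightarrow> 'm list \<Rightarrow> 'm" where
  "chain_comp I i [] = Id I i"
| "chain_comp I i (a # as) = Comp I a (chain_comp I (Dom I a) as)"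

definition chains :: "('o, 'm) category \<Rightarrow> nat \<Rightarrow> ('o \<times> 'm list) set" where
  "chains I n = {(i, as). is_chain I i as \<and> length as = n}"

definition bw_cochains :: "('o, 'm) category \<Rightarrow> ('m, 'c) nat_sys \<Rightarrow> nat \<Rightarrow>
    ('o \<times> 'm list \<Rightarrow> 'c) monoid" where
  "bw_cochains I D n = product_group (chains I n) (\<lambda>(i, as). grp D (chain_comp I i as))"

text \<open>\<open>compose_at I j [\<alpha>\<^sub>1, \<dots>, \<alpha>\<^sub>n\<^sub>+\<^sub>1] = [\<alpha>\<^sub>1, \<dots>, \<alpha>\<^sub>j\<alpha>\<^sub>j\<^sub>+\<^sub>1, \<dots>, \<alpha>\<^sub>n\<^sub>+\<^sub>1]\<close> (list positions count from 0).\<close>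

definition compose_at :: "('o, 'm) category \<Rightarrow> nat \<Rightarrow> 'm list \<Rightarrow> 'm list" where
  "compose_at I j as = take (j - 1) as @ Comp I (as ! (j - 1)) (as ! j) # drop (j + 1) as"

definition bw_face :: "('o, 'm) category \<Rightarrow> ('m, 'c) nat_sys \<Rightarrow> nat \<Rightarrow> nat \<Rightarrow>
    ('o \<times> 'm list \<Rightarrow> 'c) \<Rightarrow> 'o \<times> 'm list \<Rightarrow> 'c" where
  "bw_face I D n j f = (\<lambda>(i, as).
     if j = 0 then
       push D (hd as) (chain_comp I (Dom I (hd as)) (tl as)) (f (Dom I (hd as), tl as))
     else if j \<le> n then f (i, compose_at I j as)
     else pull D (last as) (chain_comp I i (butlast as)) (f (i, butlast as)))"

definition bw_diff :: "('o, 'm) category \<Rightarrow> ('m, 'c) nat_sys \<Rightarrow> nat \<Rightarrow>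
    ('o \<times> 'm list \<Rightarrow> 'c) \<Rightarrow> ('o \<times> 'm list \<Rightarrow> 'c)" where
  "bw_diff I D n f = (\<lambda>(i, as)\<in>chains I (Suc n).
     alternating_sum (grp D (chain_comp I i as)) (Suc n) (\<lambda>j. bw_face I D n j f (i, as)))"

definition bw_cohomology :: "('o, 'm) category \<Rightarrow> ('m, 'c) nat_sys \<Rightarrow> nat \<Rightarrow>
    ('o \<times> 'm list \<Rightarrow> 'c) set monoid" where
  "bw_cohomology I D = cohomology (bw_cochains I D) (bw_diff I D)"

definition Nmult :: "(unit, nat) category" where
  "Nmult = \<lparr>Obj = {()}, Arr = {n. 1 \<le> n}, Dom = (\<lambda>_. ()), Cod = (\<lambda>_. ()), Id = (\<lambda>_. 1), Comp = (*)\<rparr>"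

lemma small_category_Nmult: "small_category Nmult"
  by unfold_locales (auto simp: Nmult_def)

text \<open>The maps on degree-\<open>q\<close> cochains induced by a coefficient homomorphism \<open>\<mu> : N \<rightarrow> N'\<close>, and by a ring
  endomorphism \<open>\<phi>\<close> of \<open>R\<close> (from coefficients \<open>N\<close> to \<open>N\<close> with the action restricted along \<open>\<phi>\<close>).\<close>

definition aq_coeff_map :: "('a, 'x) ring_scheme \<Rightarrow> nat \<Rightarrow> ('b \<Rightarrow> 'b) \<Rightarrow>
    ('a poly_tower \<Rightarrow> 'a poly_tower \<times> 'a \<times> 'b) \<Rightarrow>
    ('a poly_tower \<Rightarrow> 'a poly_tower \<times> 'a \<times> 'b)" where
  "aq_coeff_map R q \<mu> s =
    (\<lambda>x\<in>carrier (cr_tower R (Suc q)). (x, cr_aug R (Suc q) x, \<mu> (snd (snd (s x)))))"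

definition aq_ring_map :: "('a, 'x) ring_scheme \<Rightarrow> nat \<Rightarrow> ('a \<Rightarrow> 'a) \<Rightarrow>
    ('a poly_tower \<Rightarrow> 'a poly_tower \<times> 'a \<times> 'b) \<Rightarrow>
    ('a poly_tower \<Rightarrow> 'a poly_tower \<times> 'a \<times> 'b)" where
  "aq_ring_map R q \<phi> s =
    (\<lambda>x\<in>carrier (cr_tower R (Suc q)).
       (x, cr_aug R (Suc q) x, snd (snd (s (cr_tower_map \<phi> (Suc q) x)))))"

definition aq_nat_sys :: "('a, 'x) psi_ring_scheme \<Rightarrow> ('a, 'b, 'y) psi_module_scheme \<Rightarrow> nat \<Rightarrow>
    (nat, ('a poly_tower \<Rightarrow> 'a poly_tower \<times> 'a \<times> 'b) set) nat_sys" where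
  "aq_nat_sys R M q =
    \<lparr>grp = (\<lambda>f. aq_cohomology R (twist R M f) q),
     push = (\<lambda>u f. cohomology_map (aq_cochains R (twist R M (u * f))) (aq_diff R (twist R M (u * f))) q
                     (aq_coeff_map R q (mpsi M u))),
     pull = (\<lambda>v f. cohomology_map (aq_cochains R (twist R M (f * v))) (aq_diff R (twist R M (f * v))) q
                     (aq_ring_map R q (psi R v)))\<rparr>"


section \<open>Spectral sequences\<close>

text \<open>Cohomological spectral sequences starting at the second page:
  \<open>d\<^sub>r : E\<^sub>r\<^sup>p\<^sup>,\<^sup>q \<rightarrow> E\<^sub>r\<^sup>p\<^sup>+\<^sup>r\<^sup>,\<^sup>q\<^sup>-\<^sup>r\<^sup>+\<^sup>1\<close>.\<close>

definition spectral_sequence :: "(nat \<Rightarrow> int \<Rightarrow> int \<Rightarrow> 'e monoid) \<Rightarrow>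
    (nat \<Rightarrow> int \<Rightarrow> int \<Rightarrow> 'e \<Rightarrow> 'e) \<Rightarrow> bool" where
  "spectral_sequence E d \<longleftrightarrow> (\<forall>r\<ge>2. \<forall>p q.
     comm_group (E r p q) \<and>
     d r p q \<in> hom (E r p q) (E r (p + int r) (q - int r + 1)) \<and>
     (\<forall>x\<in>carrier (E r p q). d r (p + int r) (q - int r + 1) (d r p q x)
        = \<one>\<^bsub>E r (p + 2 * int r) (q - 2 * int r + 2)\<^esub>) \<and>
     E (Suc r) p q \<cong>
       homology_at (E r (p - int r) (q + int r - 1)) (d r (p - int r) (q + int r - 1))
         (E r p q) (d r p q) (E r (p + int r) (q - int r + 1)))"

text \<open>The second page is the first-quadrant family \<open>A\<close>. (All later pages are subquotients of the
  second one, hence representable in the same element type \<open>'e\<close>.)\<close>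

definition second_page :: "(nat \<Rightarrow> int \<Rightarrow> int \<Rightarrow> 'e monoid) \<Rightarrow> (nat \<Rightarrow> nat \<Rightarrow> 'e monoid) \<Rightarrow> bool" where
  "second_page E A \<longleftrightarrow>
     (\<forall>p q. E 2 (int p) (int q) \<cong> A p q) \<and>
     (\<forall>p q. p < 0 \<or> q < 0 \<longrightarrow> carrier (E 2 p q) = {\<one>\<^bsub>E 2 p q\<^esub>})"

text \<open>Convergence of a first-quadrant spectral sequence to \<open>H\<close>: a finite decreasing filtration
  \<open>H\<^sup>n = F\<^sup>0 \<supseteq> \<dots> \<supseteq> F\<^sup>n\<^sup>+\<^sup>1 = 0\<close> with \<open>F\<^sup>p / F\<^sup>p\<^sup>+\<^sup>1\<close> isomorphic to the stable value of \<open>E\<^sub>r\<^sup>p\<^sup>,\<^sup>n\<^sup>-\<^sup>p\<close>.\<close>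

definition converges_to :: "(nat \<Rightarrow> int \<Rightarrow> int \<Rightarrow> 'e monoid) \<Rightarrow> (nat \<Rightarrow> int \<Rightarrow> int \<Rightarrow> 'e \<Rightarrow> 'e) \<Rightarrow>
    (nat \<Rightarrow> 'h monoid) \<Rightarrow> bool" where
  "converges_to E d H \<longleftrightarrow> (\<forall>n. comm_group (H n) \<and>
     (\<exists>F :: nat \<Rightarrow> 'h set.
        F 0 = carrier (H n) \<and> F (Suc n) = {\<one>\<^bsub>H n\<^esub>} \<and>
        (\<forall>p\<le>Suc n. subgroup (F p) (H n)) \<and>
        (\<forall>p\<le>n. F (Suc p) \<subseteq> F p) \<and>
        (\<forall>p\<le>n. let P = int p; Q = int n - int p in
           \<exists>r0\<ge>2. \<forall>r\<ge>r0.
             (\<forall>x\<in>carrier (E r P Q). d r P Q x = \<one>\<^bsub>E r (P + int r) (Q - int r + 1)\<^esub>) \<and>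
             (\<forall>x\<in>carrier (E r (P - int r) (Q + int r - 1)).
                d r (P - int r) (Q + int r - 1) x = \<one>\<^bsub>E r P Q\<^esub>) \<and>
             E r P Q \<cong> ((H n)\<lparr>carrier := F p\<rparr>) Mod F (Suc p))))"

end

theory Submission
  imports Defs "HOL.Modules" "HOL-Library.Function_Algebras" "HOL-Algebra.Free_Abelian_Groups"
begin

text \<open>Both sides of the spectral sequence are read off one double complex. A section of the
  pullback of \<open>R \<rtimes> M\<^sup>f\<close> along \<open>A \<rightarrow> R\<close> is a
  derivation \<open>A \<rightarrow> M\<close> over the composite of the augmentation with
  \<open>\<Psi>\<^sup>f\<close>, and a derivation \<open>\<phi>\<close> out of a Psi-ring is a
  Psi-derivation when \<open>\<Psi>\<^sup>n \<phi> = \<phi> \<Psi>\<^sup>n\<close> for all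
  \<open>n\<close>, that is, when it is a Baues--Wirsching \<open>0\<close>-cocycle of the natural
  system \<open>f \<mapsto> Der(A, M\<^sup>f)\<close>. If \<open>A\<close> is a free Psi-ring,
  this natural system has no higher cohomology: a derivation out of the polynomial ring on the
  symbols \<open>\<Psi>\<^sup>n s\<close> may take arbitrary values on these symbols, so that
  \<open>y(\<alpha>\<^sub>1, \<dots>, \<alpha>\<^sub>p)(\<Psi>\<^sup>n s) = c(\<alpha>\<^sub>1,
  \<dots>, \<alpha>\<^sub>p, n)(s)\<close> defines, up to sign, a cochain bounding a given cocycle
  \<open>c\<close> (lemma \<open>W_exact\<close>).

  Let \<open>G\<close> be the free Psi-ring comonad and let \<open>K\<^sup>p\<^sup>,\<^sup>q =
  C\<^sup>p\<^sub>B\<^sub>W(f \<mapsto> Der(G\<^sup>q\<^sup>+\<^sup>1(R), M\<^sup>f))\<close>. By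
  the preceding remark the total cohomology of \<open>K\<close> is the cohomology of the complex
  of Psi-derivations out of \<open>G\<^sup>q\<^sup>+\<^sup>1(R)\<close>, which is the
  Psi-cohomology of \<open>R\<close> with coefficients in \<open>M\<close>. In the other
  direction, cochains are a product over chains, so the cohomology of a column \<open>p\<close>
  consists of the cochains with values in the cohomology of the complexes
  \<open>Der(G\<^sup>q\<^sup>+\<^sup>1(R), M\<^sup>f)\<close>, and the second page is the
  Baues--Wirsching cohomology of these groups
  (\<open>natural_complexes.presents_second_page_bw\<close>).

  It remains to identify the cohomology of \<open>Der(G\<^sup>q\<^sup>+\<^sup>1(R),
  M\<^sup>f)\<close> with Andre-Quillen cohomology, naturally in \<open>f\<close> (theorem
  \<open>kappa\<close>). A free Psi-ring is in particular a free commutative ring. With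
  \<open>F\<close> the free commutative ring comonad, the double complex
  \<open>Der(F\<^sup>a(G\<^sup>b(R)), M\<^sup>f)\<close> is exact in the direction of
  \<open>a\<close> for \<open>b \<ge> 1\<close> because \<open>G\<^sup>b(R)\<close> is then free
  (\<open>diffA_exact\<close>), and exact in the direction of \<open>b\<close> for \<open>a \<ge>
  1\<close> because \<open>x \<mapsto> \<Psi>\<^sup>1 x\<close> is a set-theoretic contraction of
  the resolution (\<open>diffB_exact\<close>). Its two edges therefore have the same cohomology.

  Two devices keep the bookkeeping additive. Every group that occurs is written as a subgroup of a
  type of functions modulo another one (\<open>presents\<close>), so that a page of the spectral
  sequence is a pair of sets of cochains; and cochains take their values not in \<open>M\<close>
  but in the free abelian group on its elements, which is evaluated by \<open>ev\<close>. All
  identities then hold modulo the cochains that evaluate to zero.\<close>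

section \<open>Subquotients of additive groups\<close>

definition subgrp :: "'c::ab_group_add set \<Rightarrow> bool" where
  "subgrp S \<longleftrightarrow> 0 \<in> S \<and> (\<forall>x\<in>S. \<forall>y\<in>S. x - y \<in> S)"

lemma subgrp_0 [simp]: "subgrp S \<Longrightarrow> 0 \<in> S"
  and subgrp_diff: "subgrp S \<Longrightarrow> x \<in> S \<Longrightarrow> y \<in> S \<Longrightarrow> x - y \<in> S"
  by (auto simp: subgrp_def)

lemma subgrp_minus: "subgrp S \<Longrightarrow> x \<in> S \<Longrightarrow> - x \<in> S"
  using subgrp_diff[of S 0 x] by simp

lemma subgrp_add: "subgrp S \<Longrightarrow> x \<in> S \<Longrightarrow> y \<in> S \<Longrightarrow> x + y \<in> S"
  using subgrp_diff[of S x "- y"] subgrp_minus[of S y] by simp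

lemma subgrp_sum: "subgrp S \<Longrightarrow> (\<And>i. i \<in> I \<Longrightarrow> f i \<in> S) \<Longrightarrow> sum f I \<in> S"
  by (induction I rule: infinite_finite_induct) (auto simp: subgrp_add)

lemma subgrp_cong:
  assumes "subgrp S" "x - y \<in> S"
  shows "x \<in> S \<longleftrightarrow> y \<in> S"
  using subgrp_add[OF assms(1), of "x - y" y] subgrp_diff[OF assms(1), of x "x - y"] assms(2)
  by auto

lemma subgrp_image: "additive f \<Longrightarrow> subgrp S \<Longrightarrow> subgrp (f ` S)"
  unfolding subgrp_def
  by (auto simp: additive.diff[symmetric] intro!: image_eqI[of 0 f 0] additive.zero[symmetric])

lemma subgrp_kernel:
  assumes "additive f" "subgrp S" "subgrp N"
  shows "subgrp {x \<in> S. f x \<in> N}"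
  using assms by (auto simp: subgrp_def additive.diff additive.zero)

lemma subgrp_extend:
  assumes "subgrp W" "subgrp N"
  shows "subgrp {x. \<exists>w\<in>W. x - w \<in> N}"
  unfolding subgrp_def
proof (intro conjI ballI CollectI)
  show "\<exists>w\<in>W. 0 - w \<in> N" using assms by (intro bexI[of _ 0]) auto
  fix x y assume "x \<in> {x. \<exists>w\<in>W. x - w \<in> N}" "y \<in> {x. \<exists>w\<in>W. x - w \<in> N}"
  then obtain v w where "v \<in> W" "x - v \<in> N" "w \<in> W" "y - w \<in> N" by auto
  then show "\<exists>w\<in>W. x - y - w \<in> N"
    using subgrp_diff[OF assms(2), of "x - v" "y - w"] subgrp_diff[OF assms(1), of v w]
    by (intro bexI[of _ "v - w"]) (auto simp: algebra_simps)
qed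

text \<open>\<open>h\<close> identifies the multiplicatively written group \<open>G\<close> with
  \<open>Z\<close> modulo \<open>N\<close>. Its kernel is \<open>Z \<inter> N\<close>, so that one
  modulus can serve for several groups of cochains.\<close>

definition presents ::
    "'c::ab_group_add set \<Rightarrow> 'c set \<Rightarrow> ('g, 'x) monoid_scheme \<Rightarrow> ('c \<Rightarrow> 'g) \<Rightarrow> bool" where
  "presents Z N G h \<longleftrightarrow> subgrp Z \<and> subgrp N \<and>
     (\<forall>x\<in>Z. \<forall>y\<in>Z. h (x + y) = h x \<otimes>\<^bsub>G\<^esub> h y) \<and> h ` Z = carrier G \<and>
     (\<forall>x\<in>Z. h x = \<one>\<^bsub>G\<^esub> \<longleftrightarrow> x \<in> N)"

lemma presentsD:
  assumes "presents Z N G h"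
  shows "subgrp Z" "subgrp N"
    "x \<in> Z \<Longrightarrow> y \<in> Z \<Longrightarrow> h (x + y) = h x \<otimes>\<^bsub>G\<^esub> h y"
    "x \<in> Z \<Longrightarrow> h x \<in> carrier G"
    "g \<in> carrier G \<Longrightarrow> \<exists>x\<in>Z. g = h x"
    "x \<in> Z \<Longrightarrow> h x = \<one>\<^bsub>G\<^esub> \<longleftrightarrow> x \<in> N"
  using assms by (auto simp: presents_def)

lemma presents_zero: "presents Z N G h \<Longrightarrow> h 0 = \<one>\<^bsub>G\<^esub>"
  by (meson presentsD subgrp_0)

lemma presents_comm_group:
  assumes P: "presents Z N G h"
  shows "comm_group G"
proof (rule comm_groupI)
  note D = presentsD[OF P]
  show "\<one>\<^bsub>G\<^esub> \<in> carrier G" using D(4)[of 0] D(1) presents_zero[OF P] by simp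
  fix x y assume "x \<in> carrier G" "y \<in> carrier G"
  then obtain a b where a: "a \<in> Z" "x = h a" and b: "b \<in> Z" "y = h b" using D(5) by metis
  show "x \<otimes>\<^bsub>G\<^esub> y \<in> carrier G"
    using a b D(3,4) subgrp_add[OF D(1)] by metis
  show "x \<otimes>\<^bsub>G\<^esub> y = y \<otimes>\<^bsub>G\<^esub> x" using a b D(3) by (metis add.commute)
  show "\<one>\<^bsub>G\<^esub> \<otimes>\<^bsub>G\<^esub> x = x"
    using D(3)[of 0 a] a D(1) presents_zero[OF P] by simp
  show "\<exists>y\<in>carrier G. y \<otimes>\<^bsub>G\<^esub> x = \<one>\<^bsub>G\<^esub>"
    using D(3)[of "- a" a] a D(4)[of "- a"] subgrp_minus[OF D(1), of a] presents_zero[OF P]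
    by auto
  fix z assume "z \<in> carrier G"
  then obtain c where c: "c \<in> Z" "z = h c" using D(5) by metis
  show "x \<otimes>\<^bsub>G\<^esub> y \<otimes>\<^bsub>G\<^esub> z = x \<otimes>\<^bsub>G\<^esub> (y \<otimes>\<^bsub>G\<^esub> z)"
    using a b c D(3)[of a b] D(3)[of "a + b" c] D(3)[of b c] D(3)[of a "b + c"]
      subgrp_add[OF D(1)] by (metis add.assoc)
qed

lemma presents_minus:
  assumes P: "presents Z N G h" and x: "x \<in> Z"
  shows "h (- x) = inv\<^bsub>G\<^esub> h x"
proof -
  note D = presentsD[OF P]
  interpret comm_group G by (rule presents_comm_group[OF P])
  show ?thesis
    using D(3)[of "- x" x] x D(4) subgrp_minus[OF D(1), of x] presents_zero[OF P]
    by (metis add.left_inverse inv_equality)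
qed

lemma presents_eq:
  assumes P: "presents Z N G h" and x: "x \<in> Z" "y \<in> Z"
  shows "h x = h y \<longleftrightarrow> x - y \<in> N"
proof -
  note D = presentsD[OF P]
  interpret comm_group G by (rule presents_comm_group[OF P])
  have "h (x - y) = h x \<otimes>\<^bsub>G\<^esub> inv\<^bsub>G\<^esub> h y"
    using D(3)[of x "- y"] x subgrp_minus[OF D(1), of y] presents_minus[OF P, of y] by simp
  moreover have "h (x - y) = \<one>\<^bsub>G\<^esub> \<longleftrightarrow> x - y \<in> N"
    using D(6) subgrp_diff[OF D(1)] x by metis
  ultimately show ?thesis
    by (metis D(4) inv_closed inv_equality inv_inv r_inv x)
qed

text \<open>Multiplication by \<open>(-1)\<^sup>k\<close>, stated without a ring structure on the
  values.\<close>

definition alt :: "nat \<Rightarrow> 'c::ab_group_add \<Rightarrow> 'c" where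
  "alt k x = (if even k then x else - x)"

lemma alt_simps [simp]: "alt 0 x = x" "alt k 0 = 0"
  and alt_Suc: "alt (Suc k) x = - alt k x"
  by (auto simp: alt_def)

lemma alt_mem: "subgrp S \<Longrightarrow> x \<in> S \<Longrightarrow> alt k x \<in> S"
  by (auto simp: alt_def subgrp_minus)

lemma alt_mem_iff: "subgrp S \<Longrightarrow> alt k x \<in> S \<longleftrightarrow> x \<in> S"
  using subgrp_minus[of S "- x"] subgrp_minus[of S x] by (auto simp: alt_def)

lemma additive_alt: "additive (alt k)"
  by (simp add: additive_def alt_def)

lemma alt_add: "alt k (x + y) = alt k x + alt k y"
  and alt_diff: "alt k (x - y) = alt k x - alt k y"
  and alt_minus: "alt k (- x) = - alt k x"
  by (simp_all add: alt_def)

lemma alt_sum: "alt k (sum f I) = (\<Sum>i\<in>I. alt k (f i))"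
  by (simp add: additive.sum[OF additive_alt])

lemma additive_alt_apply: "additive f \<Longrightarrow> f (alt k x) = alt k (f x)"
  by (simp add: alt_def additive.minus)

lemma alt_fun: "alt k f x = alt k (f x)"
  by (simp add: alt_def)

lemma fun_sum_apply: "sum f I x = (\<Sum>i\<in>I. f i x)"
  by (induction I rule: infinite_finite_induct) auto

lemma presents_alternating_sum:
  assumes P: "presents Z N G h" and a: "\<And>k. k \<le> n \<Longrightarrow> a k \<in> Z"
    and g: "\<And>k. k \<le> n \<Longrightarrow> g k = h (a k)"
  shows "alternating_sum G n g = h (\<Sum>k\<le>n. alt k (a k))"
proof -
  note D = presentsD[OF P]
  interpret comm_group G by (rule presents_comm_group[OF P])
  have e: "g k [^]\<^bsub>G\<^esub> ((- 1) ^ k :: int) = h (alt k (a k))" if "k \<le> n" for k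
    using D(4)[OF a[OF that]] presents_minus[OF P a[OF that]] g[OF that]
    by (cases "even k") (auto simp: alt_def int_pow_neg)
  have "finprod G (\<lambda>k. h (alt k (a k))) {..m} = h (\<Sum>k\<le>m. alt k (a k))" if "m \<le> n" for m
    using that
  proof (induction m)
    case 0
    show ?case using D(4)[OF a[of 0]] by simp
  next
    case (Suc m)
    have S: "(\<Sum>k\<le>m. alt k (a k)) \<in> Z" "alt (Suc m) (a (Suc m)) \<in> Z"
      using Suc.prems by (auto intro!: subgrp_sum[OF D(1)] alt_mem[OF D(1)] a)
    have "finprod G (\<lambda>k. h (alt k (a k))) (insert (Suc m) {..m}) =
        h (alt (Suc m) (a (Suc m))) \<otimes>\<^bsub>G\<^esub> finprod G (\<lambda>k. h (alt k (a k))) {..m}"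
      using Suc.prems
      by (intro finprod_insert)
        (auto intro!: D(4) alt_mem[OF D(1)] a)
    also have "\<dots> = h (alt (Suc m) (a (Suc m)) + (\<Sum>k\<le>m. alt k (a k)))"
      using Suc S D(3) by simp
    finally show ?case by (simp add: atMost_Suc add.commute)
  qed
  moreover have "alternating_sum G n g = finprod G (\<lambda>k. h (alt k (a k))) {..n}"
    unfolding alternating_sum_def
    by (rule finprod_cong') (auto simp: e intro!: D(4) alt_mem[OF D(1)] a)
  ultimately show ?thesis by simp
qed

lemma presents_pullback:
  assumes P: "presents Z N G h" and S: "subgrp Z1" "subgrp N1" and f: "additive f"
    and fZ: "\<And>x. x \<in> Z1 \<Longrightarrow> f x \<in> Z" and fN: "\<And>x. x \<in> Z1 \<Longrightarrow> f x \<in> N \<longleftrightarrow> x \<in> N1"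
    and sur: "\<And>z. z \<in> Z \<Longrightarrow> \<exists>x\<in>Z1. z - f x \<in> N"
  shows "presents Z1 N1 G (\<lambda>x. h (f x))"
  unfolding presents_def
proof (intro conjI ballI S)
  note D = presentsD[OF P]
  show "h (f (x + y)) = h (f x) \<otimes>\<^bsub>G\<^esub> h (f y)" if "x \<in> Z1" "y \<in> Z1" for x y
    using that D(3) fZ additive.add[OF f] by simp
  show "h (f x) = \<one>\<^bsub>G\<^esub> \<longleftrightarrow> x \<in> N1" if "x \<in> Z1" for x
    using that D(6) fZ fN by simp
  have "\<exists>x\<in>Z1. h z = h (f x)" if "z \<in> Z" for z
    using sur[OF that] presents_eq[OF P that] fZ by blast
  then show "(\<lambda>x. h (f x)) ` Z1 = carrier G"
    using D(4,5) fZ by (fastforce simp: image_iff)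
qed

lemma additive_id: "additive (\<lambda>x. x)"
  by (simp add: additive_def)

lemma presents_restrict:
  assumes "presents Z N G h" "subgrp Z1" "subgrp N1" "Z1 \<subseteq> Z"
    and "\<And>x. x \<in> Z1 \<Longrightarrow> x \<in> N \<longleftrightarrow> x \<in> N1" "\<And>z. z \<in> Z \<Longrightarrow> \<exists>x\<in>Z1. z - x \<in> N"
  shows "presents Z1 N1 G h"
  by (rule presents_pullback[OF assms(1-3) additive_id]) (use assms(4-) in auto)

text \<open>A comparison map \<open>i\<close> inducing a bijection of subquotients carries a
  presentation forwards. The new epimorphism is characterized by its values on representatives
  that come from \<open>Z\<close>, which is the form in which naturality is checked later.\<close>

lemma presents_pushforward:
  assumes P: "presents Z N G h" and S: "subgrp Z1" "subgrp N1" and i: "additive i"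
    and iZ: "\<And>x. x \<in> Z \<Longrightarrow> i x \<in> Z1" and iN: "\<And>x. x \<in> Z \<Longrightarrow> i x \<in> N1 \<longleftrightarrow> x \<in> N"
    and sur: "\<And>z. z \<in> Z1 \<Longrightarrow> \<exists>x\<in>Z. z - i x \<in> N1"
  shows "\<exists>h1. presents Z1 N1 G h1 \<and> (\<forall>x\<in>Z. \<forall>z\<in>Z1. z - i x \<in> N1 \<longrightarrow> h1 z = h x)"
proof -
  note D = presentsD[OF P]
  define s where "s z = (SOME x. x \<in> Z \<and> z - i x \<in> N1)" for z
  have s: "s z \<in> Z \<and> z - i (s z) \<in> N1" if "z \<in> Z1" for z
    unfolding s_def by (rule someI_ex) (use sur[OF that] in blast)
  have u: "h (s z) = h x" if "x \<in> Z" "z \<in> Z1" "z - i x \<in> N1" for x z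
  proof -
    have "i (s z - x) \<in> N1"
      using subgrp_diff[OF S(2) that(3) s[OF that(2), THEN conjunct2]]
      by (simp add: additive.diff[OF i])
    then show ?thesis
      using iN[of "s z - x"] subgrp_diff[OF D(1)] s[OF that(2)] that presents_eq[OF P] by metis
  qed
  have "presents Z1 N1 G (\<lambda>z. h (s z))"
    unfolding presents_def
  proof (intro conjI ballI S)
    show "h (s (x + y)) = h (s x) \<otimes>\<^bsub>G\<^esub> h (s y)" if "x \<in> Z1" "y \<in> Z1" for x y
    proof -
      have "h (s (x + y)) = h (s x + s y)"
      proof (rule u)
        show "s x + s y \<in> Z" "x + y \<in> Z1" using s that S D subgrp_add by metis+
        show "x + y - i (s x + s y) \<in> N1"
          using subgrp_add[OF S(2), of "x - i (s x)" "y - i (s y)"] s that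
          by (simp add: additive.add[OF i] algebra_simps)
      qed
      then show ?thesis using s that D(3) by simp
    qed
    show "h (s z) = \<one>\<^bsub>G\<^esub> \<longleftrightarrow> z \<in> N1" if "z \<in> Z1" for z
      using s[OF that] iN[of "s z"] D(6) subgrp_cong[OF S(2), of z "i (s z)"] by blast
    show "(\<lambda>z. h (s z)) ` Z1 = carrier G"
    proof
      show "(\<lambda>z. h (s z)) ` Z1 \<subseteq> carrier G" using s D(4) by blast
      show "carrier G \<subseteq> (\<lambda>z. h (s z)) ` Z1"
      proof
        fix g assume "g \<in> carrier G"
        then obtain x where x: "x \<in> Z" "g = h x" using D(5) by blast
        then have "h (s (i x)) = g" using u[of x "i x"] iZ S by simp
        then show "g \<in> (\<lambda>z. h (s z)) ` Z1" using iZ x by blast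
      qed
    qed
  qed
  then show ?thesis using u by blast
qed

lemma presents_subgroup:
  assumes P: "presents Z N G h" and S: "subgrp S" "S \<subseteq> Z"
  shows "subgroup (h ` S) G"
proof -
  interpret comm_group G by (rule presents_comm_group[OF P])
  note D = presentsD[OF P]
  show ?thesis
  proof (rule subgroup.intro)
    show "h ` S \<subseteq> carrier G" using D(4) S by blast
    show "x \<otimes>\<^bsub>G\<^esub> y \<in> h ` S" if xy: "x \<in> h ` S" "y \<in> h ` S" for x y
    proof -
      obtain u v where "u \<in> S" "v \<in> S" "x = h u" "y = h v" using xy by blast
      then show ?thesis using subsetD[OF S(2)] D(3)[of u v] subgrp_add[OF S(1), of u v]
        by (intro image_eqI[of _ h "u + v"]) auto
    qed
    show "\<one>\<^bsub>G\<^esub> \<in> h ` S" using presents_zero[OF P] S by (intro image_eqI[of _ h 0]) auto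
    show "inv\<^bsub>G\<^esub> x \<in> h ` S" if x: "x \<in> h ` S" for x
    proof -
      obtain u where "u \<in> S" "x = h u" using x by blast
      then show ?thesis using subsetD[OF S(2)] presents_minus[OF P, of u] subgrp_minus[OF S(1), of u]
        by (intro image_eqI[of _ h "- u"]) auto
    qed
  qed
qed

lemma presents_Mod:
  assumes P: "presents Z N G h" and Z': "subgrp Z'" "Z' \<subseteq> Z" and W: "subgrp W" "W \<subseteq> Z'"
  shows "presents Z' {x. \<exists>w\<in>W. x - w \<in> N} ((G\<lparr>carrier := h ` Z'\<rparr>) Mod (h ` W))
    (\<lambda>x. h ` W #>\<^bsub>G\<^esub> h x)"
proof -
  note D = presentsD[OF P]
  interpret comm_group G by (rule presents_comm_group[OF P])
  have sW: "subgroup (h ` W) G" using presents_subgroup[OF P W(1)] W Z' by blast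
  interpret nW: normal "h ` W" G using sW by (simp add: normal_iff_subgroup)
  show ?thesis
    unfolding presents_def
  proof (intro conjI ballI Z' subgrp_extend W D(2))
    fix x y assume x: "x \<in> Z'" and y: "y \<in> Z'"
    have "h x \<in> carrier G" "h y \<in> carrier G" using x y Z' D by auto
    then show "h ` W #>\<^bsub>G\<^esub> h (x + y) = (h ` W #>\<^bsub>G\<^esub> h x) \<otimes>\<^bsub>G\<lparr>carrier := h ` Z'\<rparr> Mod h ` W\<^esub> (h ` W #>\<^bsub>G\<^esub> h y)"
      using nW.rcos_sum[of "h x" "h y"] D(3)[OF subsetD[OF Z'(2) x] subsetD[OF Z'(2) y]]
      by (simp add: FactGroup_def set_mult_def)
  next
    show "(\<lambda>x. h ` W #>\<^bsub>G\<^esub> h x) ` Z' = carrier (G\<lparr>carrier := h ` Z'\<rparr> Mod h ` W)"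
      by (auto simp: FactGroup_def RCOSETS_def r_coset_def)
  next
    fix x assume x: "x \<in> Z'"
    then have hx: "h x \<in> carrier G" using Z' D by auto
    have "h ` W #>\<^bsub>G\<^esub> h x = h ` W \<longleftrightarrow> h x \<in> h ` W"
      using coset_join1[OF _ hx sW] coset_join2[OF hx sW] subgroup.subset[OF sW] by blast
    also have "\<dots> \<longleftrightarrow> (\<exists>w\<in>W. x - w \<in> N)"
      using presents_eq[OF P] x W Z' by (auto simp: image_iff subset_iff)
    finally show "h ` W #>\<^bsub>G\<^esub> h x = \<one>\<^bsub>G\<lparr>carrier := h ` Z'\<rparr> Mod h ` W\<^esub>
        \<longleftrightarrow> x \<in> {x. \<exists>w\<in>W. x - w \<in> N}"
      by (simp add: FactGroup_def)
  qed
qed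

lemma presents_iso:
  assumes P: "presents Z N G h" and Q: "presents Z N' G' h'"
    and e: "\<And>x. x \<in> Z \<Longrightarrow> x \<in> N \<longleftrightarrow> x \<in> N'"
  shows "G \<cong> G'"
proof -
  note D = presentsD[OF P] and D' = presentsD[OF Q]
  define s where "s g = (SOME x. x \<in> Z \<and> g = h x)" for g
  have s: "s g \<in> Z \<and> g = h (s g)" if "g \<in> carrier G" for g
    unfolding s_def by (rule someI_ex) (use D(5) that in blast)
  have k: "h x = h y \<longleftrightarrow> h' x = h' y" if "x \<in> Z" "y \<in> Z" for x y
    using presents_eq[OF P that] presents_eq[OF Q that] e subgrp_diff[OF D(1) that] by simp
  have u: "h' (s (h x)) = h' x" if "x \<in> Z" for x
    using k[of "s (h x)" x] s[of "h x"] that D(4) by metis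
  have "(\<lambda>g. h' (s g)) \<in> iso G G'"
    unfolding iso_def
  proof (intro CollectI conjI homI)
    show "h' (s x) \<in> carrier G'" if "x \<in> carrier G" for x using s[OF that] D' by simp
    show "h' (s (x \<otimes>\<^bsub>G\<^esub> y)) = h' (s x) \<otimes>\<^bsub>G'\<^esub> h' (s y)"
      if "x \<in> carrier G" "y \<in> carrier G" for x y
    proof -
      have "x \<otimes>\<^bsub>G\<^esub> y = h (s x + s y)" using D(3) s that by metis
      then show ?thesis using u[of "s x + s y"] s that D'(3) subgrp_add[OF D(1)] by simp
    qed
    show "bij_betw (\<lambda>g. h' (s g)) (carrier G) (carrier G')"
      unfolding bij_betw_def inj_on_def
    proof (intro conjI ballI impI Set.set_eqI iffI)
      fix x y assume "x \<in> carrier G" "y \<in> carrier G" "h' (s x) = h' (s y)"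
      then show "x = y" using k s by metis
    next
      fix y assume "y \<in> (\<lambda>g. h' (s g)) ` carrier G" then show "y \<in> carrier G'" using s D'(4) by auto
    next
      fix y assume "y \<in> carrier G'"
      then obtain x where "x \<in> Z" "y = h' x" using D'(5) by blast
      then show "y \<in> (\<lambda>g. h' (s g)) ` carrier G"
        using u D(4) by (intro image_eqI[of _ _ "h x"]) auto
    qed
  qed
  then show ?thesis by (auto simp: is_iso_def)
qed

text \<open>Every page of a spectral sequence must live on the same element type as the second
  one. A map \<open>k\<close> into that type which separates the classes is enough to put a
  subquotient there: the group operation is transported through representatives.\<close>

lemma presents_exists:
  fixes Z :: "'c::ab_group_add set" and k :: "'c \<Rightarrow> 'e"
  assumes Z: "subgrp Z" and B: "subgrp B"
    and k: "\<And>x y. x \<in> Z \<Longrightarrow> y \<in> Z \<Longrightarrow> k x = k y \<Longrightarrow> x - y \<in> B"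
  shows "\<exists>(G :: 'e monoid) h. presents Z B G h"
proof -
  define r where "r x = (SOME y. y \<in> Z \<and> x - y \<in> B)" for x
  have r: "r x \<in> Z \<and> x - r x \<in> B" if "x \<in> Z" for x
    unfolding r_def by (rule someI[of _ x]) (use that B in simp)
  define h where "h x = k (r x)" for x
  have h: "h x = h y \<longleftrightarrow> x - y \<in> B" if "x \<in> Z" "y \<in> Z" for x y
  proof (rule iffI)
    assume "h x = h y"
    then have "r x - r y \<in> B" using k r that by (simp add: h_def)
    then show "x - y \<in> B"
      using subgrp_add[OF B subgrp_diff[OF B], of "x - r x" "y - r y" "r x - r y"] r that
      by (simp add: algebra_simps)
  next
    assume xy: "x - y \<in> B"
    have "x - z \<in> B \<longleftrightarrow> y - z \<in> B" for z
      using subgrp_cong[OF B, of "x - z" "y - z"] xy by simp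
    then show "h x = h y" by (simp add: h_def r_def)
  qed
  define s where "s a = (SOME x. x \<in> Z \<and> h x = a)" for a
  have s: "s (h x) \<in> Z \<and> h (s (h x)) = h x" if "x \<in> Z" for x
    unfolding s_def by (rule someI[of _ x]) (use that in simp)
  have "presents Z B \<lparr>carrier = h ` Z, monoid.mult = (\<lambda>a b. h (s a + s b)), one = h 0\<rparr> h"
    unfolding presents_def
  proof (intro conjI ballI Z B)
    fix x y assume "x \<in> Z" "y \<in> Z"
    then have "x - s (h x) \<in> B" "y - s (h y) \<in> B" using s h by metis+
    then have "x + y - (s (h x) + s (h y)) \<in> B"
      using subgrp_add[OF B, of "x - s (h x)" "y - s (h y)"] by (simp add: algebra_simps)
    then have "h (x + y) = h (s (h x) + s (h y))"
      using h s \<open>x \<in> Z\<close> \<open>y \<in> Z\<close> subgrp_add[OF Z] by simp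
    then show "h (x + y) = h x \<otimes>\<^bsub>\<lparr>carrier = h ` Z, monoid.mult = (\<lambda>a b. h (s a + s b)), one = h 0\<rparr>\<^esub> h y"
      by simp
  next
    fix x assume "x \<in> Z"
    then show "h x = \<one>\<^bsub>\<lparr>carrier = h ` Z, monoid.mult = (\<lambda>a b. h (s a + s b)), one = h 0\<rparr>\<^esub> \<longleftrightarrow> x \<in> B"
      using h[of x 0] Z by simp
  qed simp
  then show ?thesis by blast
qed


section \<open>The spectral sequence of a filtered complex\<close>

lemma spectral_homology_at:
  assumes P1: "presents Z1 N1 A hA" and P2: "presents Z2 N2 G hG" and P3: "presents Z3 N3 C hC"
    and D: "additive D" and DZ: "\<And>x. x \<in> Z1 \<Longrightarrow> D x \<in> Z2" "\<And>x. x \<in> Z2 \<Longrightarrow> D x \<in> Z3"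
    and DD: "\<And>x. x \<in> Z1 \<Longrightarrow> D (D x) \<in> N3"
    and f: "\<And>x. x \<in> Z1 \<Longrightarrow> f (hA x) = hG (D x)" and g: "\<And>x. x \<in> Z2 \<Longrightarrow> g (hG x) = hC (D x)"
  shows "presents {x \<in> Z2. D x \<in> N3} {x. \<exists>w\<in>Z1. x - D w \<in> N2}
           (homology_at A f G g C) (\<lambda>x. f ` carrier A #>\<^bsub>G\<^esub> hG x)"
proof -
  note E1 = presentsD[OF P1] and E2 = presentsD[OF P2] and E3 = presentsD[OF P3]
  let ?Z = "{x \<in> Z2. D x \<in> N3}"
  have "presents ?Z {x. \<exists>w\<in>D ` Z1. x - w \<in> N2} ((G\<lparr>carrier := hG ` ?Z\<rparr>) Mod (hG ` D ` Z1))
    (\<lambda>x. hG ` D ` Z1 #>\<^bsub>G\<^esub> hG x)"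
    using DZ DD by (intro presents_Mod[OF P2] subgrp_kernel subgrp_image D E1 E2 E3) auto
  moreover have "hG ` ?Z = kernel G C g"
  proof -
    have "g (hG x) = \<one>\<^bsub>C\<^esub> \<longleftrightarrow> D x \<in> N3" if "x \<in> Z2" for x
      using g[OF that] E3(6)[OF DZ(2)[OF that]] by simp
    then have "hG ` ?Z = {g' \<in> hG ` Z2. g g' = \<one>\<^bsub>C\<^esub>}" by blast
    then show ?thesis using P2 by (simp add: kernel_def presents_def)
  qed
  moreover have "hG ` D ` Z1 = f ` carrier A"
  proof -
    have "f ` carrier A = f ` hA ` Z1" using P1 by (simp add: presents_def)
    then show ?thesis using f by (auto simp: image_image)
  qed
  ultimately show ?thesis by (simp add: homology_at_def)
qed

text \<open>A first-quadrant filtration \<open>F n p\<close> of the cochains of degree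
  \<open>n\<close>. The step \<open>F n (n + 1)\<close> plays the role of zero: it consists of the
  cochains to be ignored, and \<open>D\<close> squares to zero only up to it (\<open>DD_F\<close>
  with large \<open>p'\<close>).\<close>

locale filtered_complex =
  fixes F :: "int \<Rightarrow> int \<Rightarrow> 'c::ab_group_add set" and D :: "'c \<Rightarrow> 'c"
  assumes additive_D: "additive D"
    and subgrp_F: "subgrp (F n p)"
    and F_mono: "p \<le> p' \<Longrightarrow> F n p' \<subseteq> F n p"
    and F_bot: "p \<le> 0 \<Longrightarrow> F n p = F n 0"
    and F_top: "p > n \<Longrightarrow> F n p = F n (n + 1)"
    and D_F: "x \<in> F n p \<Longrightarrow> D x \<in> F (n + 1) p"
    and DD_F: "x \<in> F n p \<Longrightarrow> D (D x) \<in> F (n + 2) p'"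
begin

text \<open>The approximate cycles and boundaries in filtration degree \<open>p\<close>:
  \<open>E\<^sub>r = Z\<^sub>r / B\<^sub>r\<close> with \<open>B\<^sub>r\<^sup>p = D
  Z\<^sub>r\<^sub>-\<^sub>1\<^sup>p\<^sup>-\<^sup>r\<^sup>+\<^sup>1 +
  Z\<^sub>r\<^sub>-\<^sub>1\<^sup>p\<^sup>+\<^sup>1\<close>.\<close>

definition Zr :: "int \<Rightarrow> int \<Rightarrow> int \<Rightarrow> 'c set" where
  "Zr r n p = {x \<in> F n p. D x \<in> F (n + 1) (p + r)}"

definition Br :: "int \<Rightarrow> int \<Rightarrow> int \<Rightarrow> 'c set" where
  "Br r n p = {x. \<exists>w \<in> D ` Zr (r - 1) (n - 1) (p - r + 1). x - w \<in> Zr (r - 1) n (p + 1)}"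

lemma subgrp_Zr: "subgrp (Zr r n p)"
  unfolding Zr_def by (intro subgrp_kernel additive_D subgrp_F)

lemma subgrp_Br: "subgrp (Br r n p)"
  unfolding Br_def by (intro subgrp_extend subgrp_image additive_D subgrp_Zr)

lemma Zr_mono: "r' \<le> r \<Longrightarrow> Zr r n p \<subseteq> Zr r' n p"
  unfolding Zr_def using F_mono[of "p + r'" "p + r" "n + 1"] by auto

lemma D_Zr: "x \<in> Zr r n p \<Longrightarrow> D x \<in> Zr r' (n + 1) (p + r)"
  unfolding Zr_def using DD_F[of x n p] by (auto simp: algebra_simps)

lemma D_Br:
  assumes "x \<in> Br r n p"
  shows "D x \<in> Br r (n + 1) (p + r)"
proof -
  obtain w where w: "w \<in> Zr (r - 1) (n - 1) (p - r + 1)" and xw: "x - D w \<in> Zr (r - 1) n (p + 1)"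
    using assms by (auto simp: Br_def)
  have "D x - D (x - D w) = D (D w)"
    by (simp add: additive.diff[OF additive_D])
  moreover have "D (D w) \<in> Zr (r - 1) (n + 1) (p + r + 1)"
    using w DD_F[of w "n - 1" "p - r + 1"] DD_F[of "D w" n "p - r + 1"] D_F[of w "n - 1" "p - r + 1"]
      D_F[of "D (D w)" "n + 1" "p + r + 1 + (r - 1)"]
    by (auto simp: Zr_def algebra_simps)
  ultimately show ?thesis
    using xw by (auto simp: Br_def intro!: bexI[of _ "x - D w"])
qed

lemma Zr_in_Br: "x \<in> Zr (r - 1) n (p + 1) \<Longrightarrow> x \<in> Br r n p"
  unfolding Br_def using subgrp_Zr[of "r - 1" "n - 1" "p - r + 1"]
  by (auto intro!: bexI[of _ 0] simp: additive.zero[OF additive_D])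

lemma DD_Br: "x \<in> Zr r n p \<Longrightarrow> D (D x) \<in> Br r' (n + 2) p'"
  using DD_F[of x n p "p' + 1"] DD_F[of "D x" "n + 1" p] D_F[of x n p]
  by (intro Zr_in_Br) (auto simp: Zr_def)

definition Zinf :: "int \<Rightarrow> 'c set" where
  "Zinf n = {x \<in> F n 0. D x \<in> F (n + 1) (n + 2)}"

definition Binf :: "int \<Rightarrow> 'c set" where
  "Binf n = {x. \<exists>w\<in>D ` F (n - 1) 0. x - w \<in> F n (n + 1)}"

lemma subgrp_Zinf: "subgrp (Zinf n)" and subgrp_Binf: "subgrp (Binf n)"
  unfolding Zinf_def Binf_def by (intro subgrp_kernel subgrp_extend subgrp_image additive_D subgrp_F)+

end

locale presented_pages = filtered_complex F D
  for F :: "int \<Rightarrow> int \<Rightarrow> 'c::ab_group_add set" and D :: "'c \<Rightarrow> 'c" +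
  fixes page :: "int \<Rightarrow> int \<Rightarrow> int \<Rightarrow> 'g monoid" and cls :: "int \<Rightarrow> int \<Rightarrow> int \<Rightarrow> 'c \<Rightarrow> 'g"
  assumes presents_page: "2 \<le> r \<Longrightarrow> presents (Zr r n p) (Br r n p) (page r n p) (cls r n p)"
begin

definition dr :: "int \<Rightarrow> int \<Rightarrow> int \<Rightarrow> 'g \<Rightarrow> 'g" where
  "dr r n p X = cls r (n + 1) (p + r) (D (SOME x. x \<in> Zr r n p \<and> X = cls r n p x))"

lemma dr_cls:
  assumes "x \<in> Zr r n p" and r: "2 \<le> r"
  shows "dr r n p (cls r n p x) = cls r (n + 1) (p + r) (D x)"
proof -
  define y where "y = (SOME y. y \<in> Zr r n p \<and> cls r n p x = cls r n p y)"
  have y: "y \<in> Zr r n p \<and> cls r n p x = cls r n p y"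
    unfolding y_def by (rule someI[of _ x]) (use assms in simp)
  then have "y - x \<in> Br r n p"
    using presents_eq[OF presents_page[OF r]] assms by metis
  then have "D y - D x \<in> Br r (n + 1) (p + r)"
    using D_Br by (metis additive.diff[OF additive_D])
  then have "cls r (n + 1) (p + r) (D y) = cls r (n + 1) (p + r) (D x)"
    using presents_eq[OF presents_page[OF r]] D_Zr y assms by metis
  then show ?thesis by (simp add: dr_def y_def)
qed

text \<open>If \<open>D z\<close> vanishes on the page \<open>r\<close>, then \<open>D z - D
  w\<close> lies one filtration step deeper for some \<open>w\<close> that is zero on that page,
  and \<open>z - w\<close> is a cycle for the next page representing the same class. The position
  of the neighbouring groups is given by equations because the indices of the spectral sequence
  arrive in several arithmetical forms.\<close>

lemma presents_next_page:
  assumes r: "2 \<le> r" and n: "n1 = n - 1" "p1 = p - r" "n2 = n + 1" "p2 = p + r"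
  shows "presents (Zr (r + 1) n p) (Br (r + 1) n p)
    (homology_at (page r n1 p1) (dr r n1 p1) (page r n p) (dr r n p) (page r n2 p2))
    (\<lambda>x. dr r n1 p1 ` carrier (page r n1 p1) #>\<^bsub>page r n p\<^esub> cls r n p x)"
proof -
  have "presents {x \<in> Zr r n p. D x \<in> Br r n2 p2} {x. \<exists>w\<in>Zr r n1 p1. x - D w \<in> Br r n p}
    (homology_at (page r n1 p1) (dr r n1 p1) (page r n p) (dr r n p) (page r n2 p2))
    (\<lambda>x. dr r n1 p1 ` carrier (page r n1 p1) #>\<^bsub>page r n p\<^esub> cls r n p x)"
  proof -
    have n': "n1 + 1 = n" "p1 + r = p" "n + 1 = n2" "p + r = p2" "n1 + 2 = n2" using n by auto
    have 1: "D x \<in> Zr r n p" "dr r n1 p1 (cls r n1 p1 x) = cls r n p (D x)" "D (D x) \<in> Br r n2 p2"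
      if "x \<in> Zr r n1 p1" for x
      using D_Zr[OF that, of r] dr_cls[OF that r] DD_Br[OF that, of r p2] unfolding n' by auto
    have 2: "D x \<in> Zr r n2 p2" "dr r n p (cls r n p x) = cls r n2 p2 (D x)" if "x \<in> Zr r n p" for x
      using D_Zr[OF that, of r] dr_cls[OF that r] unfolding n' by auto
    show "presents {x \<in> Zr r n p. D x \<in> Br r n2 p2} {x. \<exists>w\<in>Zr r n1 p1. x - D w \<in> Br r n p}
      (homology_at (page r n1 p1) (dr r n1 p1) (page r n p) (dr r n p) (page r n2 p2))
      (\<lambda>x. dr r n1 p1 ` carrier (page r n1 p1) #>\<^bsub>page r n p\<^esub> cls r n p x)"
      by (rule spectral_homology_at[where f = "dr r n1 p1" and g = "dr r n p",
          OF presents_page[OF r, of n1 p1] presents_page[OF r, of n p] presents_page[OF r, of n2 p2] additive_D 1(1) 2(1) 1(3) 1(2) 2(2)])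
  qed
  then show ?thesis
  proof (rule presents_restrict[OF _ subgrp_Zr subgrp_Br])
    show "Zr (r + 1) n p \<subseteq> {x \<in> Zr r n p. D x \<in> Br r n2 p2}"
    proof
      fix x assume x: "x \<in> Zr (r + 1) n p"
      then have "D x \<in> Zr (r - 1) n2 (p2 + 1)" using D_Zr[of x "r + 1" n p] n by (simp add: add.assoc)
      then have "D x \<in> Br r n2 p2" by (rule Zr_in_Br)
      then show "x \<in> {x \<in> Zr r n p. D x \<in> Br r n2 p2}" using x Zr_mono[of r "r + 1" n p] by auto
    qed
  next
    fix z assume z: "z \<in> {x \<in> Zr r n p. D x \<in> Br r n2 p2}"
    then obtain w where w: "w \<in> Zr (r - 1) n (p + 1)" and zw: "D z - D w \<in> Zr (r - 1) n2 (p2 + 1)"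
      using n by (auto simp: Br_def)
    have "z - w \<in> F n p"
      using z w F_mono[of p "p + 1" n] subgrp_diff[OF subgrp_F] by (auto simp: Zr_def)
    moreover have "D (z - w) \<in> F (n + 1) (p + (r + 1))"
      using zw n by (simp add: Zr_def additive.diff[OF additive_D] add.assoc)
    ultimately have "z - w \<in> Zr (r + 1) n p" by (simp add: Zr_def)
    moreover have "z - (z - w) - D 0 \<in> Br r n p"
      using Zr_in_Br[OF w] by (simp add: additive.zero[OF additive_D])
    ultimately show "\<exists>x\<in>Zr (r + 1) n p. z - x \<in> {x. \<exists>w\<in>Zr r n1 p1. x - D w \<in> Br r n p}"
      using subgrp_0[OF subgrp_Zr] by blast
  next
    fix x assume x: "x \<in> Zr (r + 1) n p"
    show "x \<in> {x. \<exists>w\<in>Zr r n1 p1. x - D w \<in> Br r n p} \<longleftrightarrow> x \<in> Br (r + 1) n p"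
    proof (rule iffI)
      assume "x \<in> {x. \<exists>w\<in>Zr r n1 p1. x - D w \<in> Br r n p}"
      then obtain u where u: "u \<in> Zr r n1 p1" and "x - D u \<in> Br r n p" by blast
      then obtain w where w: "w \<in> Zr (r - 1) (n - 1) (p - r + 1)"
        and xuw: "x - D u - D w \<in> Zr (r - 1) n (p + 1)" by (auto simp: Br_def)
      have "w \<in> Zr r n1 p1"
        using w n F_mono[of "p - r" "p - r + 1" "n - 1"] by (auto simp: Zr_def)
      then have uw: "u + w \<in> Zr r n1 p1" using u subgrp_add[OF subgrp_Zr] by blast
      have n1: "n1 + 2 = n + 1" using n by simp
      have "D (D (u + w)) \<in> F (n + 1) (p + 1 + r)"
        using uw DD_F[of "u + w" n1 p1 "p + 1 + r"] unfolding n1 by (simp add: Zr_def)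
      moreover have "D x \<in> F (n + 1) (p + 1 + r)"
        using x by (simp add: Zr_def add.assoc add.commute[of r 1])
      ultimately have "D (x - D (u + w)) \<in> F (n + 1) (p + 1 + r)"
        by (simp add: additive.diff[OF additive_D] subgrp_diff[OF subgrp_F])
      moreover have "x - D (u + w) \<in> F n (p + 1)"
        using xuw by (simp add: Zr_def additive.add[OF additive_D] diff_diff_add)
      ultimately have "x - D (u + w) \<in> Zr r n (p + 1)" by (simp add: Zr_def)
      then show "x \<in> Br (r + 1) n p" using uw n by (auto simp: Br_def)
    next
      assume "x \<in> Br (r + 1) n p"
      then obtain u where u: "u \<in> Zr r n1 p1" and "x - D u \<in> Zr r n (p + 1)" using n by (auto simp: Br_def)
      then have "x - D u \<in> Zr (r - 1) n (p + 1)" using Zr_mono[of "r - 1" r n "p + 1"] by auto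
      then show "x \<in> {x. \<exists>w\<in>Zr r n1 p1. x - D w \<in> Br r n p}" using u Zr_in_Br by blast
    qed
  qed
qed

definition spage :: "nat \<Rightarrow> int \<Rightarrow> int \<Rightarrow> 'g monoid" where
  "spage r p q = page (int r) (p + q) p"

definition sdiff :: "nat \<Rightarrow> int \<Rightarrow> int \<Rightarrow> 'g \<Rightarrow> 'g" where
  "sdiff r p q = dr (int r) (p + q) p"

lemma page_elem: "2 \<le> r \<Longrightarrow> X \<in> carrier (page r n p) \<Longrightarrow> \<exists>x\<in>Zr r n p. X = cls r n p x"
  using presentsD(5)[OF presents_page] .

theorem spectral_sequence_spage: "spectral_sequence spage sdiff"
  unfolding spectral_sequence_def
proof (intro allI impI conjI ballI)
  fix r :: nat and p q :: int assume "2 \<le> r"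
  then have r: "2 \<le> int r" and r1: "2 \<le> int r + 1" by simp_all
  show "comm_group (spage r p q)"
    unfolding spage_def by (rule presents_comm_group[OF presents_page[OF r]])
  have n: "p + int r + (q - int r + 1) = p + q + 1" "p - int r + (q + int r - 1) = p + q - 1"
    "p + 2 * int r + (q - 2 * int r + 2) = p + q + 2" by auto
  show "sdiff r p q \<in> hom (spage r p q) (spage r (p + int r) (q - int r + 1))"
    unfolding sdiff_def spage_def n
  proof (rule homI)
    fix X Y assume "X \<in> carrier (page (int r) (p + q) p)" "Y \<in> carrier (page (int r) (p + q) p)"
    then obtain x y where x: "x \<in> Zr (int r) (p + q) p" "X = cls (int r) (p + q) p x"
      and y: "y \<in> Zr (int r) (p + q) p" "Y = cls (int r) (p + q) p y"
      using page_elem[OF r] by blast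
    note M = presentsD(3)[OF presents_page[OF r], symmetric]
    show "dr (int r) (p + q) p X \<in> carrier (page (int r) (p + q + 1) (p + int r))"
      using x by (simp add: dr_cls[OF _ r] presentsD(4)[OF presents_page[OF r]] D_Zr)
    show "dr (int r) (p + q) p (X \<otimes>\<^bsub>page (int r) (p + q) p\<^esub> Y) =
      dr (int r) (p + q) p X \<otimes>\<^bsub>page (int r) (p + q + 1) (p + int r)\<^esub> dr (int r) (p + q) p Y"
      using x y subgrp_add[OF subgrp_Zr x(1) y(1)]
      by (simp add: dr_cls[OF _ r] M D_Zr additive.add[OF additive_D])
  qed
  show "sdiff r (p + int r) (q - int r + 1) (sdiff r p q X)
        = \<one>\<^bsub>spage r (p + 2 * int r) (q - 2 * int r + 2)\<^esub>" if X: "X \<in> carrier (spage r p q)" for X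
  proof -
    obtain x where x: "x \<in> Zr (int r) (p + q) p" "X = cls (int r) (p + q) p x"
      using page_elem[OF r] X unfolding spage_def by blast
    have "D (D x) \<in> Zr (int r) (p + q + 1 + 1) (p + int r + int r)"
      by (intro D_Zr x)
    then have "cls (int r) (p + q + 2) (p + 2 * int r) (D (D x)) = \<one>\<^bsub>page (int r) (p + q + 2) (p + 2 * int r)\<^esub>"
      using presentsD(6)[OF presents_page[OF r], of "D (D x)" "p + q + 2" "p + 2 * int r"]
        DD_Br[OF x(1)] by (simp add: algebra_simps)
    moreover have "dr (int r) (p + q + 1) (p + int r) (dr (int r) (p + q) p X) =
        cls (int r) (p + q + 1 + 1) (p + int r + int r) (D (D x))"
      unfolding x(2) dr_cls[OF x(1) r] by (rule dr_cls[OF _ r]) (rule D_Zr[OF x(1)])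
    ultimately show ?thesis
      unfolding sdiff_def spage_def n by (simp add: algebra_simps)
  qed
  show "spage (Suc r) p q \<cong> homology_at (spage r (p - int r) (q + int r - 1))
      (sdiff r (p - int r) (q + int r - 1)) (spage r p q) (sdiff r p q)
      (spage r (p + int r) (q - int r + 1))"
    unfolding sdiff_def spage_def n of_nat_Suc add.commute[of 1]
    by (rule presents_iso[OF presents_page[OF r1] presents_next_page[OF r]]) auto
qed

text \<open>For \<open>r > n + 1\<close> both the source and the target of the differentials at
  total degree \<open>n\<close> lie outside of the quadrant, so the page is stable there; its
  groups are the graded pieces of the total cohomology, filtered by the images of \<open>F n
  p\<close>.\<close>

theorem converges_spage:
  assumes H: "\<And>n. presents (Zinf (int n)) (Binf (int n)) (H n) (h n)"
  shows "converges_to spage sdiff H"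
  unfolding converges_to_def
proof (intro allI conjI)
  fix n :: nat
  note P = H[of n]
  show "comm_group (H n)" by (rule presents_comm_group[OF P])
  interpret H: comm_group "H n" by (rule presents_comm_group[OF P])
  let ?S = "\<lambda>p :: nat. Zinf (int n) \<inter> F (int n) (int p)"
  have S: "subgrp (?S p)" for p
    using subgrp_Zinf subgrp_F by (auto simp: subgrp_def)
  let ?F = "\<lambda>p. h n ` ?S p"
  show "\<exists>F. F 0 = carrier (H n) \<and> F (Suc n) = {\<one>\<^bsub>H n\<^esub>} \<and> (\<forall>p\<le>Suc n. subgroup (F p) (H n)) \<and>
      (\<forall>p\<le>n. F (Suc p) \<subseteq> F p) \<and>
      (\<forall>p\<le>n. let P = int p; Q = int n - int p in
           \<exists>r0\<ge>2. \<forall>r\<ge>r0.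
             (\<forall>x\<in>carrier (spage r P Q). sdiff r P Q x = \<one>\<^bsub>spage r (P + int r) (Q - int r + 1)\<^esub>) \<and>
             (\<forall>x\<in>carrier (spage r (P - int r) (Q + int r - 1)).
                sdiff r (P - int r) (Q + int r - 1) x = \<one>\<^bsub>spage r P Q\<^esub>) \<and>
             spage r P Q \<cong> ((H n)\<lparr>carrier := F p\<rparr>) Mod F (Suc p))"
  proof (intro exI[of _ ?F] conjI allI impI)
    show "h n ` ?S 0 = carrier (H n)"
      using presentsD(4,5)[OF P] by (auto simp: Zinf_def)
    show "h n ` ?S (Suc n) = {\<one>\<^bsub>H n\<^esub>}"
    proof -
      have *: "h n x = \<one>\<^bsub>H n\<^esub>" if "x \<in> ?S (Suc n)" for x
        using that presentsD(6)[OF P, of x] subgrp_F[of "int n - 1" 0]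
        by (auto simp: Binf_def add.commute additive.zero[OF additive_D] intro!: bexI[of _ 0])
      have "0 \<in> ?S (Suc n)" using S subgrp_0 by blast
      then have "\<one>\<^bsub>H n\<^esub> \<in> h n ` ?S (Suc n)" using presents_zero[OF P] by (metis image_eqI)
      with * show ?thesis by blast
    qed
    show "subgroup (?F p) (H n)" for p by (rule presents_subgroup[OF P S]) auto
    show "?F (Suc p) \<subseteq> ?F p" for p using F_mono[of "int p" "int (Suc p)" "int n"] by auto
    fix p assume p: "p \<le> n"
    let ?P = "int p" and ?Q = "int n - int p"
    show "let P = int p; Q = int n - int p in
           \<exists>r0\<ge>2. \<forall>r\<ge>r0.
             (\<forall>x\<in>carrier (spage r P Q). sdiff r P Q x = \<one>\<^bsub>spage r (P + int r) (Q - int r + 1)\<^esub>) \<and>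
             (\<forall>x\<in>carrier (spage r (P - int r) (Q + int r - 1)).
                sdiff r (P - int r) (Q + int r - 1) x = \<one>\<^bsub>spage r P Q\<^esub>) \<and>
             spage r P Q \<cong> ((H n)\<lparr>carrier := ?F p\<rparr>) Mod ?F (Suc p)"
      unfolding Let_def
    proof (intro exI[of _ "n + 2"] conjI allI impI ballI)
      fix r assume r: "n + 2 \<le> r"
      then have r2: "2 \<le> int r" by simp
      have n: "?P + int r + (?Q - int r + 1) = int n + 1" "?P - int r + (?Q + int r - 1) = int n - 1"
        "?P + ?Q = int n" by auto
      show "sdiff r ?P ?Q X = \<one>\<^bsub>spage r (?P + int r) (?Q - int r + 1)\<^esub>" if X: "X \<in> carrier (spage r ?P ?Q)" for X
      proof -
        obtain x where x: "x \<in> Zr (int r) (int n) ?P" "X = cls (int r) (int n) ?P x"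
          using page_elem[OF r2] X[unfolded spage_def n] by blast
        have "D x \<in> F (int n + 1) (?P + int r + 1)"
          using x r F_top[of "int n + 1" "?P + int r"] F_top[of "int n + 1" "?P + int r + 1"] by (simp add: Zr_def)
        moreover have "D (D x) \<in> F (int n + 1 + 1) (?P + int r + 1 + (int r - 1))"
          using DD_F[of x "int n" ?P] x by (simp add: Zr_def add.assoc)
        ultimately have "D x \<in> Br (int r) (int n + 1) (?P + int r)"
          by (intro Zr_in_Br) (simp add: Zr_def)
        then show ?thesis
          unfolding spage_def sdiff_def n x(2) dr_cls[OF x(1) r2]
          using presentsD(6)[OF presents_page[OF r2]] D_Zr[OF x(1)] by blast
      qed
      show "sdiff r (?P - int r) (?Q + int r - 1) X = \<one>\<^bsub>spage r ?P ?Q\<^esub>"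
        if X: "X \<in> carrier (spage r (?P - int r) (?Q + int r - 1))" for X
      proof -
        obtain x where x: "x \<in> Zr (int r) (int n - 1) (?P - int r)"
            "X = cls (int r) (int n - 1) (?P - int r) x"
          using page_elem[OF r2] X[unfolded spage_def n] by blast
        have "x \<in> Zr (int r - 1) (int n - 1) (?P - int r + 1)"
          using x r p F_bot[of "?P - int r + 1" "int n - 1"] F_bot[of "?P - int r" "int n - 1"] by (simp add: Zr_def)
        then have "D x \<in> Br (int r) (int n) ?P"
          unfolding Br_def using subgrp_Zr[of "int r - 1" "int n" "int p + 1"] by (auto intro!: bexI[of _ x])
        then show ?thesis
          unfolding spage_def sdiff_def n x(2) dr_cls[OF x(1) r2]
          using presentsD(6)[OF presents_page[OF r2]] D_Zr[OF x(1), of "int r"] by simp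
      qed
      have T2: "F (int n + 1) k = F (int n + 1) (int n + 2)" if "k > int n + 1" for k
        using F_top[of "int n + 1" k] that by (simp add: add.commute)
      have ZS: "Zr (int r) (int n) ?P = ?S p"
        unfolding Zr_def Zinf_def
        using F_mono[of 0 ?P "int n"] T2[of "?P + int r"] r by auto
      have "presents (?S p) {x. \<exists>w\<in>?S (Suc p). x - w \<in> Binf (int n)}
           ((H n)\<lparr>carrier := ?F p\<rparr> Mod ?F (Suc p)) (\<lambda>x. h n ` ?S (Suc p) #>\<^bsub>H n\<^esub> h n x)"
        using F_mono[of "int p" "int (Suc p)" "int n"] by (intro presents_Mod[OF P] S) auto
      then have Q: "presents (Zr (int r) (int n) ?P) {x. \<exists>w\<in>?S (Suc p). x - w \<in> Binf (int n)}
           ((H n)\<lparr>carrier := ?F p\<rparr> Mod ?F (Suc p)) (\<lambda>x. h n ` ?S (Suc p) #>\<^bsub>H n\<^esub> h n x)"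
        by (simp only: ZS)
      show "spage r ?P ?Q \<cong> ((H n)\<lparr>carrier := ?F p\<rparr>) Mod ?F (Suc p)"
        unfolding spage_def n
      proof (rule presents_iso[OF presents_page[OF r2] Q])
        have B1: "F (int n - 1) (?P - int r + 1) = F (int n - 1) 0" by (rule F_bot) (use r p in simp)
        have B2: "F (int n + 1) (?P + 1 + (int r - 1)) = F (int n + 1) (int n + 2)"
          by (rule T2) (use r in simp)
        fix x assume x: "x \<in> Zr (int r) (int n) ?P"
        show "x \<in> Br (int r) (int n) ?P \<longleftrightarrow> x \<in> {x. \<exists>w\<in>?S (Suc p). x - w \<in> Binf (int n)}"
        proof (rule iffI)
          assume "x \<in> Br (int r) (int n) ?P"
          then obtain w where w: "w \<in> F (int n - 1) 0"
            and xw: "x - D w \<in> F (int n) (?P + 1)" "D (x - D w) \<in> F (int n + 1) (int n + 2)"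
            using B1 B2 by (auto simp: Br_def Zr_def)
          have "x - D w \<in> ?S (Suc p)"
            using xw F_mono[of 0 "?P + 1" "int n"] by (auto simp: Zinf_def add.commute)
          moreover have "x - (x - D w) \<in> Binf (int n)"
            unfolding Binf_def using w subgrp_F[of "int n" "int n + 1"] by (auto intro!: bexI[of _ w])
          ultimately show "x \<in> {x. \<exists>w\<in>?S (Suc p). x - w \<in> Binf (int n)}" by blast
        next
          assume "x \<in> {x. \<exists>w\<in>?S (Suc p). x - w \<in> Binf (int n)}"
          then obtain z w where z: "z \<in> ?S (Suc p)" and w: "w \<in> F (int n - 1) 0"
            and y: "x - z - D w \<in> F (int n) (int n + 1)" by (auto simp: Binf_def)
          have y': "x - z - D w \<in> F (int n) (?P + 1)" using y F_mono[of "?P + 1" "int n + 1" "int n"] p by auto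
          have z': "z \<in> F (int n) (?P + 1)" using z by (simp add: add.commute)
          have e: "x - D w \<in> F (int n) (?P + 1)"
            using subgrp_add[OF subgrp_F y' z'] by (simp add: algebra_simps)
          have "D w \<in> F (int n) ?P"
            using e x subgrp_diff[OF subgrp_F, of x "int n" ?P "x - D w"] F_mono[of ?P "?P + 1" "int n"]
            by (auto simp: Zr_def)
          then have wZ: "w \<in> Zr (int r - 1) (int n - 1) (?P - int r + 1)"
            using w B1 by (simp add: Zr_def)
          have "D (x - D w) \<in> F (int n + 1) (int n + 2)"
            using subgrp_diff[OF subgrp_F, of "D x" "int n + 1" "int n + 2" "D (D w)"]
              DD_F[OF w, of "int n + 2"] x ZS
            by (auto simp: additive.diff[OF additive_D] Zinf_def add.commute)
          then have "x - D w \<in> Zr (int r - 1) (int n) (?P + 1)" using e B2 by (simp add: Zr_def)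
          then show "x \<in> Br (int r) (int n) ?P" unfolding Br_def using wZ by auto
        qed
      qed
    qed simp
  qed
qed

end


section \<open>Bicomplexes\<close>

definition tot_diff :: "(int \<Rightarrow> int \<Rightarrow> 'y \<Rightarrow> 'y) \<Rightarrow> (int \<Rightarrow> int \<Rightarrow> 'y \<Rightarrow> 'y) \<Rightarrow>
    (int \<Rightarrow> int \<Rightarrow> 'y) \<Rightarrow> int \<Rightarrow> int \<Rightarrow> 'y::ab_group_add" where
  "tot_diff d1 d2 x = (\<lambda>p q. d1 (p - 1) q (x (p - 1) q) + d2 p (q - 1) (x p (q - 1)))"

definition tot :: "(int \<Rightarrow> int \<Rightarrow> 'y set) \<Rightarrow> int \<Rightarrow> (int \<Rightarrow> int \<Rightarrow> 'y) set" where
  "tot C n = {x. \<forall>p q. p + q = n \<longrightarrow> x p q \<in> C p q}"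

text \<open>Cocycles and coboundaries of the total complex, modulo \<open>N\<close>. An element of
  degree \<open>n\<close> is a family indexed by all pairs of integers of which only the entries
  with \<open>p + q = n\<close> count.\<close>

definition Ztot where
  "Ztot C N d1 d2 n = {x \<in> tot C n. tot_diff d1 d2 x \<in> tot N (n + 1)}"

definition Btot where
  "Btot C N d1 d2 n = {x. \<exists>w\<in>tot_diff d1 d2 ` tot C (n - 1). x - w \<in> tot N n}"

definition single :: "int \<Rightarrow> int \<Rightarrow> 'y \<Rightarrow> int \<Rightarrow> int \<Rightarrow> 'y::zero" where
  "single p q v = (\<lambda>i j. if i = p \<and> j = q then v else 0)"

lemma additive_single: "additive (single p q)"
  by (auto simp: additive_def single_def fun_eq_iff)

text \<open>A double complex of subquotients \<open>C p q / N p q\<close> with anticommuting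
  differentials. Indices are integers, as for the pages of a spectral sequence; outside of the
  first quadrant the quotients vanish.\<close>

locale bicomplex =
  fixes C N :: "int \<Rightarrow> int \<Rightarrow> 'y::ab_group_add set" and d1 d2 :: "int \<Rightarrow> int \<Rightarrow> 'y \<Rightarrow> 'y"
  assumes subgrp_C: "subgrp (C p q)" and subgrp_N: "subgrp (N p q)" and N_C: "N p q \<subseteq> C p q"
    and additive1: "additive (d1 p q)" and additive2: "additive (d2 p q)"
    and C1: "x \<in> C p q \<Longrightarrow> d1 p q x \<in> C (p + 1) q" and C2: "x \<in> C p q \<Longrightarrow> d2 p q x \<in> C p (q + 1)"
    and N1: "x \<in> N p q \<Longrightarrow> d1 p q x \<in> N (p + 1) q" and N2: "x \<in> N p q \<Longrightarrow> d2 p q x \<in> N p (q + 1)"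
    and dd1: "x \<in> C p q \<Longrightarrow> d1 (p + 1) q (d1 p q x) \<in> N (p + 2) q"
    and dd2: "x \<in> C p q \<Longrightarrow> d2 p (q + 1) (d2 p q x) \<in> N p (q + 2)"
    and anti: "x \<in> C p q \<Longrightarrow> d1 p (q + 1) (d2 p q x) + d2 (p + 1) q (d1 p q x) \<in> N (p + 1) (q + 1)"
    and outside: "p < 0 \<or> q < 0 \<Longrightarrow> N p q = C p q"
begin

abbreviation "D \<equiv> tot_diff d1 d2"

lemma additive_D: "additive D"
  by (auto simp: additive_def tot_diff_def fun_eq_iff additive.add[OF additive1] additive.add[OF additive2])

lemma subgrp_tot: "(\<And>p q. subgrp (A p q)) \<Longrightarrow> subgrp (tot A n)"
  by (auto simp: subgrp_def tot_def)

lemma subgrp_tot_C: "subgrp (tot C n)" and subgrp_tot_N: "subgrp (tot N n)"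
  by (rule subgrp_tot, rule subgrp_C, rule subgrp_tot, rule subgrp_N)

text \<open>Columns to the left of \<open>s\<close> are required to vanish modulo
  \<open>N\<close>.\<close>

definition fil :: "int \<Rightarrow> int \<Rightarrow> (int \<Rightarrow> int \<Rightarrow> 'y) set" where
  "fil n s = tot (\<lambda>p q. if p < s then N p q else C p q) n"

lemma filI: "(\<And>p q. p + q = n \<Longrightarrow> x p q \<in> (if p < s then N p q else C p q)) \<Longrightarrow> x \<in> fil n s"
  by (simp add: fil_def tot_def)

lemma filD: "x \<in> fil n s \<Longrightarrow> p + q = n \<Longrightarrow> x p q \<in> (if p < s then N p q else C p q)"
  by (auto simp: fil_def tot_def)

lemma fil_bot: "s \<le> 0 \<Longrightarrow> fil n s = tot C n"
  using outside by (simp add: fil_def tot_def)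

lemma fil_0: "fil n 0 = tot C n"
  by (simp add: fil_bot)

lemma fil_top: "n < s \<Longrightarrow> fil n s = tot N n"
  using outside by (force simp: fil_def tot_def)

lemma N2': "x \<in> N p q \<Longrightarrow> q' = q + 1 \<Longrightarrow> d2 p q x \<in> N p q'"
  using N2 by simp

lemma D_comp:
  assumes "x \<in> tot C n" "p + q = n + 2"
  shows "D (D x) p q \<in> N p q"
proof -
  have "x (p - 2) q \<in> C (p - 2) q" "x (p - 1) (q - 1) \<in> C (p - 1) (q - 1)" "x p (q - 2) \<in> C p (q - 2)"
    using assms by (auto simp: tot_def)
  then have "d1 (p - 1) q (d1 (p - 2) q (x (p - 2) q)) \<in> N p q"
    "d1 (p - 1) q (d2 (p - 1) (q - 1) (x (p - 1) (q - 1))) + d2 p (q - 1) (d1 (p - 1) (q - 1) (x (p - 1) (q - 1))) \<in> N p q"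
    "d2 p (q - 1) (d2 p (q - 2) (x p (q - 2))) \<in> N p q"
    using dd1[of "x (p - 2) q" "p - 2" q] anti[of "x (p - 1) (q - 1)" "p - 1" "q - 1"]
      dd2[of "x p (q - 2)" p "q - 2"] by simp_all
  from subgrp_add[OF subgrp_N subgrp_add[OF subgrp_N this(1,2)] this(3)]
  have "d1 (p - 1) q (d1 (p - 2) q (x (p - 2) q)) +
     (d1 (p - 1) q (d2 (p - 1) (q - 1) (x (p - 1) (q - 1))) + d2 p (q - 1) (d1 (p - 1) (q - 1) (x (p - 1) (q - 1)))) +
      d2 p (q - 1) (d2 p (q - 2) (x p (q - 2))) \<in> N p q" .
  then show ?thesis
    by (simp add: tot_diff_def additive.add[OF additive1] additive.add[OF additive2] add.assoc)
qed

sublocale filtered_complex fil D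
proof
  show "D (x + y) = D x + D y" for x y by (rule additive.add[OF additive_D])
  show "subgrp (fil n p)" for n p
    unfolding fil_def by (rule subgrp_tot) (simp add: subgrp_N subgrp_C)
  show "fil n p' \<subseteq> fil n p" if "p \<le> p'" for p p' n
    using that N_C by (fastforce simp: fil_def tot_def split: if_splits)
  show "fil n p = fil n 0" if "p \<le> 0" for p n
    using that by (simp add: fil_bot)
  show "fil n p = fil n (n + 1)" if "p > n" for p n using that by (simp add: fil_top)
  show "D x \<in> fil (n + 1) p" if "x \<in> fil n p" for x n p
  proof (rule filI)
    fix i j assume ij: "i + j = n + 1"
    have "x (i - 1) j \<in> (if i - 1 < p then N (i - 1) j else C (i - 1) j)"
      "x i (j - 1) \<in> (if i < p then N i (j - 1) else C i (j - 1))"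
      using filD[OF that, of "i - 1" j] filD[OF that, of i "j - 1"] ij by (simp_all split del: if_split)
    then show "D x i j \<in> (if i < p then N i j else C i j)"
      using C1[of "x (i - 1) j" "i - 1" j] N1[of "x (i - 1) j" "i - 1" j]
        C2[of "x i (j - 1)" i "j - 1"] N2[of "x i (j - 1)" i "j - 1"] N_C
      by (auto simp: tot_diff_def subset_iff intro!: subgrp_add[OF subgrp_N] subgrp_add[OF subgrp_C]
          split: if_splits)
  qed
  show "D (D x) \<in> fil (n + 2) p'" if "x \<in> fil n p" for x n p p'
  proof (rule filI)
    fix i j assume "i + j = n + 2"
    moreover have "x \<in> tot C n"
      using that N_C by (fastforce simp: fil_def tot_def split: if_splits)
    ultimately show "D (D x) i j \<in> (if i < p' then N i j else C i j)"
      using D_comp[of x n i j] subsetD[OF N_C] by auto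
  qed
qed

lemma D_tot_N: "x \<in> tot N n \<Longrightarrow> D x \<in> tot N (n + 1)"
  using D_F[of x n "n + 2"] by (simp add: fil_top)

lemma Zinf_tot: "Zinf n = Ztot C N d1 d2 n"
  by (simp add: Zinf_def Ztot_def fil_0 fil_top)

lemma Binf_tot: "Binf n = Btot C N d1 d2 n"
  by (simp add: Binf_def Btot_def fil_0 fil_top)

text \<open>Horizontal cohomology of the vertical cohomology, spelled out on
  representatives.\<close>

definition Z2 :: "int \<Rightarrow> int \<Rightarrow> 'y set" where
  "Z2 p q = {x \<in> C p q. d2 p q x \<in> N p (q + 1) \<and>
     (\<exists>y\<in>C (p + 1) (q - 1). d1 p q x + d2 (p + 1) (q - 1) y \<in> N (p + 1) q)}"

definition B2 :: "int \<Rightarrow> int \<Rightarrow> 'y set" where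
  "B2 p q = {x. \<exists>w\<in>C p (q - 1). \<exists>v\<in>C (p - 1) q. d2 (p - 1) q v \<in> N (p - 1) (q + 1) \<and>
     x - d2 p (q - 1) w - d1 (p - 1) q v \<in> N p q}"

text \<open>A class on the second page of the total complex is determined by its entry at
  \<open>(p, q)\<close>: the entries further to the right only witness that this entry is a cycle
  for the induced horizontal differential.\<close>

lemma presents_second_page:
  assumes P: "presents (Z2 p q) (B2 p q) A h"
  shows "presents (Zr 2 (p + q) p) (Br 2 (p + q) p) A (\<lambda>X. h (X p q))"
proof (rule presents_pullback[OF P subgrp_Zr subgrp_Br])
  show "additive (\<lambda>X. X p q)" by (simp add: additive_def)
next
  fix X assume X: "X \<in> Zr 2 (p + q) p"
  then have X1: "X \<in> fil (p + q) p" and X2: "D X \<in> fil (p + q + 1) (p + 2)" by (auto simp: Zr_def)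
  show "X p q \<in> Z2 p q"
    unfolding Z2_def
  proof (intro CollectI conjI bexI)
    show "X p q \<in> C p q" using filD[OF X1, of p q] by simp
    have "X (p - 1) (q + 1) \<in> N (p - 1) (q + 1)" using filD[OF X1, of "p - 1" "q + 1"] by simp
    then have "d1 (p - 1) (q + 1) (X (p - 1) (q + 1)) \<in> N p (q + 1)" using N1 by fastforce
    moreover have "d1 (p - 1) (q + 1) (X (p - 1) (q + 1)) + d2 p q (X p q) \<in> N p (q + 1)"
      using filD[OF X2, of p "q + 1"] by (simp add: tot_diff_def)
    ultimately show "d2 p q (X p q) \<in> N p (q + 1)"
      using subgrp_diff[OF subgrp_N] by fastforce
    show "X (p + 1) (q - 1) \<in> C (p + 1) (q - 1)" using filD[OF X1, of "p + 1" "q - 1"] by simp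
    show "d1 p q (X p q) + d2 (p + 1) (q - 1) (X (p + 1) (q - 1)) \<in> N (p + 1) q"
      using filD[OF X2, of "p + 1" q] by (simp add: tot_diff_def)
  qed
  show "X p q \<in> B2 p q \<longleftrightarrow> X \<in> Br 2 (p + q) p"
  proof (rule iffI)
    assume "X p q \<in> B2 p q"
    then obtain w v where w: "w \<in> C p (q - 1)" and v: "v \<in> C (p - 1) q"
      and dv: "d2 (p - 1) q v \<in> N (p - 1) (q + 1)"
      and e: "X p q - d2 p (q - 1) w - d1 (p - 1) q v \<in> N p q" by (auto simp: B2_def)
    define W where "W = single p (q - 1) w + single (p - 1) q v"
    have W: "W p (q - 1) = w" "W (p - 1) q = v" "i \<noteq> p - 1 \<Longrightarrow> i \<noteq> p \<Longrightarrow> W i j = 0"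
      "W (p - 1) j \<noteq> 0 \<Longrightarrow> j = q" "W p j \<noteq> 0 \<Longrightarrow> j = q - 1" for i j
      by (auto simp: W_def single_def split: if_splits)
    have WF: "W \<in> fil (p + q - 1) (p - 1)"
    proof (rule filI)
      fix i j assume "i + j = p + q - 1"
      then show "W i j \<in> (if i < p - 1 then N i j else C i j)"
        using W(1,2) W(3)[of i j] w v subgrp_0[OF subgrp_N, of i j] subgrp_0[OF subgrp_C, of i j]
        by (cases "i = p"; cases "i = p - 1") (auto simp: eq_diff_eq)
    qed
    have DW: "D W \<in> fil (p + q) p"
    proof (rule filI)
      fix i j assume ij: "i + j = p + q"
      show "D W i j \<in> (if i < p then N i j else C i j)"
      proof (cases "i = p - 1")
        case True
        then have "j = q + 1" using ij by simp
        then show ?thesis using True W(2) W(3)[of "p - 2" "q + 1"] dv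
          by (simp add: tot_diff_def additive.zero[OF additive1])
      next
        case False
        have "D W \<in> fil (p + q) (p - 1)" using D_F[OF WF] by simp
        from filD[OF this ij] False show ?thesis by (auto split: if_splits)
      qed
    qed
    have WZ: "W \<in> Zr 1 (p + q - 1) (p - 1)" using WF DW by (simp add: Zr_def)
    have "X - D W \<in> fil (p + q) (p + 1)"
    proof (rule filI)
      fix i j assume ij: "i + j = p + q"
      show "(X - D W) i j \<in> (if i < p + 1 then N i j else C i j)"
      proof (cases "i = p")
        case True
        then have "j = q" using ij by simp
        then show ?thesis using True W e by (simp add: tot_diff_def diff_diff_add add.commute)
      next
        case False
        have "X - D W \<in> fil (p + q) p" using X1 DW subgrp_diff[OF subgrp_F] by blast
        from filD[OF this ij] False show ?thesis by (auto split: if_splits)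
      qed
    qed
    moreover have "D (X - D W) \<in> fil (p + q + 1) (p + 1 + 1)"
    proof -
      have "D (D W) \<in> fil (p + q + 1) (p + 2)"
        using DD_F[OF WF, of "p + 2"] by (simp add: add.commute)
      then show ?thesis
        using X2 subgrp_diff[OF subgrp_F] by (simp add: additive.diff[OF additive_D] add.commute)
    qed
    ultimately show "X \<in> Br 2 (p + q) p" using WZ by (auto simp: Br_def Zr_def)
  next
    assume "X \<in> Br 2 (p + q) p"
    then obtain W where W: "W \<in> fil (p + q - 1) (p - 1)" "D W \<in> fil (p + q) p"
      and XW: "X - D W \<in> fil (p + q) (p + 1)" by (auto simp: Br_def Zr_def)
    show "X p q \<in> B2 p q"
      unfolding B2_def
    proof (intro CollectI bexI conjI)
      show "W p (q - 1) \<in> C p (q - 1)" using filD[OF W(1), of p "q - 1"] by simp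
      show "W (p - 1) q \<in> C (p - 1) q" using filD[OF W(1), of "p - 1" q] by simp
      have "W (p - 2) (q + 1) \<in> N (p - 2) (q + 1)" using filD[OF W(1), of "p - 2" "q + 1"] by simp
      then have "d1 (p - 2) (q + 1) (W (p - 2) (q + 1)) \<in> N (p - 1) (q + 1)" using N1 by fastforce
      moreover have "d1 (p - 2) (q + 1) (W (p - 2) (q + 1)) + d2 (p - 1) q (W (p - 1) q) \<in> N (p - 1) (q + 1)"
        using filD[OF W(2), of "p - 1" "q + 1"] by (simp add: tot_diff_def)
      ultimately show "d2 (p - 1) q (W (p - 1) q) \<in> N (p - 1) (q + 1)"
        using subgrp_diff[OF subgrp_N] by fastforce
      show "X p q - d2 p (q - 1) (W p (q - 1)) - d1 (p - 1) q (W (p - 1) q) \<in> N p q"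
        using filD[OF XW, of p q] by (simp add: tot_diff_def diff_diff_add add.commute)
    qed
  qed
next
  fix z assume z: "z \<in> Z2 p q"
  then obtain y where y: "y \<in> C (p + 1) (q - 1)" "d1 p q z + d2 (p + 1) (q - 1) y \<in> N (p + 1) q"
    and zC: "z \<in> C p q" "d2 p q z \<in> N p (q + 1)" by (auto simp: Z2_def)
  define X where "X = single p q z + single (p + 1) (q - 1) y"
  have X: "X p q = z" "X (p + 1) (q - 1) = y" "i \<noteq> p \<Longrightarrow> i \<noteq> p + 1 \<Longrightarrow> X i j = 0" for i j
    by (auto simp: X_def single_def)
  have XF: "X \<in> fil (p + q) p"
  proof (rule filI)
    fix i j assume "i + j = p + q"
    then show "X i j \<in> (if i < p then N i j else C i j)"
      using X(1,2) X(3)[of i j] zC(1) y(1) subgrp_0[OF subgrp_N, of i j] subgrp_0[OF subgrp_C, of i j]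
      by (cases "i = p"; cases "i = p + 1") (auto simp: algebra_simps)
  qed
  have "D X \<in> fil (p + q + 1) (p + 2)"
  proof (rule filI)
    fix i j assume ij: "i + j = p + q + 1"
    consider "i = p" "j = q + 1" | "i = p + 1" "j = q" | "i \<noteq> p" "i \<noteq> p + 1" using ij by fastforce
    then show "D X i j \<in> (if i < p + 2 then N i j else C i j)"
    proof cases
      case 1
      then show ?thesis using zC X(1) X(3)[of "p - 1" "q + 1"] by (simp add: tot_diff_def additive.zero[OF additive1])
    next
      case 2
      then show ?thesis using y X by (simp add: tot_diff_def)
    next
      case 3
      from filD[OF D_F[OF XF] ij] 3 show ?thesis by (auto split: if_splits)
    qed
  qed
  then have "X \<in> Zr 2 (p + q) p" using XF by (simp add: Zr_def)
  then show "\<exists>X\<in>Zr 2 (p + q) p. z - X p q \<in> B2 p q"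
    using X(1) presentsD(2)[OF P] by (auto intro!: bexI[of _ X])
qed

text \<open>The pages beyond the second one have to be realized on the element type of
  \<open>A\<close>. Two elements of \<open>Z\<^sub>r\<close> whose difference dies in
  \<open>E\<^sub>2\<close> also agree in \<open>E\<^sub>r\<close> (\<open>Z2B\<close>), so the map
  to \<open>E\<^sub>2\<close> separates the classes of every later page, as
  \<open>presents_exists\<close> requires.\<close>

theorem spectral_sequence_exists:
  assumes A: "\<And>p q. presents (Z2 (int p) (int q)) (B2 (int p) (int q)) (A p q) (a p q)"
    and H: "\<And>n. presents (Ztot C N d1 d2 (int n)) (Btot C N d1 d2 (int n)) (H n) (h n)"
  shows "\<exists>(E :: nat \<Rightarrow> int \<Rightarrow> int \<Rightarrow> 'e monoid) d. spectral_sequence E d \<and> second_page E A \<and> converges_to E d H"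
proof -
  have triv: "x \<in> Br r n p" if "p < 0 \<or> n - p < 0" "x \<in> Zr r n p" for x r n p
  proof (rule Zr_in_Br)
    have "x \<in> fil n (p + 1)"
    proof (rule filI)
      fix i j assume "i + j = n"
      with filD[of x n p i j] that outside[of i j]
      show "x i j \<in> (if i < p + 1 then N i j else C i j)"
        by (cases "i = p") (auto simp: Zr_def split: if_splits)
    qed
    then show "x \<in> Zr (r - 1) n (p + 1)" using that by (simp add: Zr_def)
  qed
  have Z2B: "x \<in> Br r n p" if x: "x \<in> Zr r n p" "x \<in> Br 2 n p" and r: "2 \<le> r" for x r n p
  proof -
    obtain w where w: "w \<in> Zr 1 (n - 1) (p - 1)" "x - D w \<in> Zr 1 n (p + 1)"
      using x(2) by (auto simp: Br_def algebra_simps)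
    have "D (D w) \<in> fil (n + 1) (p + 1 + (r - 1))" using DD_F[of w "n - 1" "p - 1"] w by (simp add: Zr_def add.commute)
    then have "D (x - D w) \<in> fil (n + 1) (p + 1 + (r - 1))"
      using x(1) subgrp_diff[OF subgrp_F] by (simp add: Zr_def additive.diff[OF additive_D])
    then have "x - D w \<in> Zr (r - 1) n (p + 1)" using w by (simp add: Zr_def)
    moreover have "w \<in> Zr (r - 1) (n - 1) (p - r + 1)"
      using w F_mono[of "p - r + 1" "p - 1" "n - 1"] r by (auto simp: Zr_def)
    ultimately show ?thesis by (auto simp: Br_def)
  qed
  \<comment> \<open>\<open>k\<close> reads off the class on the second page; outside of the quadrant a single value is enough, the groups being trivial\<close>
  define k :: "int \<Rightarrow> int \<Rightarrow> (int \<Rightarrow> int \<Rightarrow> 'y) \<Rightarrow> 'e" where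
    "k n p x = (if p < 0 \<or> n - p < 0 then undefined else a (nat p) (nat (n - p)) (x p (n - p)))" for n p x
  have kB: "x - y \<in> Br r n p" if r: "2 \<le> r" and x: "x \<in> Zr r n p" and y: "y \<in> Zr r n p" and e: "k n p x = k n p y"
    for r n p x y
  proof (cases "p < 0 \<or> n - p < 0")
    case True
    then show ?thesis using triv x y subgrp_diff[OF subgrp_Zr] by blast
  next
    case False
    then have "int (nat p) = p" "int (nat (n - p)) = n - p" by auto
    then have P: "presents (Zr 2 n p) (Br 2 n p) (A (nat p) (nat (n - p))) (\<lambda>x. a (nat p) (nat (n - p)) (x p (n - p)))"
      using presents_second_page[OF A[of "nat p" "nat (n - p)"]] by simp
    have "x \<in> Zr 2 n p" "y \<in> Zr 2 n p" using x y Zr_mono[OF r] by auto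
    then have "x - y \<in> Br 2 n p" using presents_eq[OF P] e False by (simp add: k_def)
    then show ?thesis using Z2B r x y subgrp_diff[OF subgrp_Zr] by blast
  qed
  have "\<exists>G h. presents (Zr r n p) (Br r n p) (G :: 'e monoid) h" if "2 \<le> r" for r n p
    by (rule presents_exists[OF subgrp_Zr subgrp_Br, of r n p "k n p"]) (use kB that in blast)
  then obtain page cls where pc: "\<And>r n p. 2 \<le> r \<Longrightarrow> presents (Zr r n p) (Br r n p) (page r n p :: 'e monoid) (cls r n p)"
    by metis
  interpret presented_pages fil D page cls
    by unfold_locales (rule pc)
  have "second_page spage A"
    unfolding second_page_def
  proof (intro conjI allI impI)
    fix p q :: nat
    show "spage 2 (int p) (int q) \<cong> A p q"
      unfolding spage_def using presents_page[of 2] presents_second_page[OF A[of p q]]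
      by (auto intro: presents_iso)
  next
    fix p q :: int assume pq: "p < 0 \<or> q < 0"
    have P: "presents (Zr 2 (p + q) p) (Br 2 (p + q) p) (spage 2 p q) (cls 2 (p + q) p)"
      using presents_page[of 2] by (simp add: spage_def)
    have "x = \<one>\<^bsub>spage 2 p q\<^esub>" if "x \<in> carrier (spage 2 p q)" for x
      using presentsD(5)[OF P that] presentsD(6)[OF P] triv[of p "p + q"] pq by auto
    moreover have "\<one>\<^bsub>spage 2 p q\<^esub> \<in> carrier (spage 2 p q)"
      using presentsD(4)[OF P subgrp_0[OF subgrp_Zr]] presents_zero[OF P] by simp
    ultimately show "carrier (spage 2 p q) = {\<one>\<^bsub>spage 2 p q\<^esub>}" by blast
  qed
  moreover have "converges_to spage sdiff H"
    by (rule converges_spage[where h = h]) (simp add: Zinf_tot Binf_tot H)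
  ultimately show ?thesis using spectral_sequence_spage by blast
qed

end

text \<open>Rows exact in positive degrees and resolving the complex \<open>BC /
  BN\<close>.\<close>

locale augmented_bicomplex = bicomplex C N d1 d2
  for C N :: "int \<Rightarrow> int \<Rightarrow> 'y::ab_group_add set" and d1 d2 :: "int \<Rightarrow> int \<Rightarrow> 'y \<Rightarrow> 'y" +
  fixes BC BN :: "int \<Rightarrow> 'z::ab_group_add set" and diffB :: "int \<Rightarrow> 'z \<Rightarrow> 'z" and i :: "int \<Rightarrow> 'z \<Rightarrow> 'y"
  assumes subgrp_BC: "subgrp (BC n)" and subgrp_BN: "subgrp (BN n)"
    and additive_diffB: "additive (diffB n)" and additive_i: "additive (i n)"
    and BC_diffB: "b \<in> BC n \<Longrightarrow> diffB n b \<in> BC (n + 1)"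
    and C_i: "b \<in> BC n \<Longrightarrow> i n b \<in> C 0 n"
    and i_diffB: "b \<in> BC n \<Longrightarrow> i (n + 1) (diffB n b) - d2 0 n (i n b) \<in> N 0 (n + 1)"
    and d1_i: "b \<in> BC n \<Longrightarrow> d1 0 n (i n b) \<in> N 1 n"
    and N_i: "b \<in> BC n \<Longrightarrow> i n b \<in> N 0 n \<longleftrightarrow> b \<in> BN n"
    and exact_0: "x \<in> C 0 n \<Longrightarrow> d1 0 n x \<in> N 1 n \<Longrightarrow> \<exists>b\<in>BC n. x - i n b \<in> N 0 n"
    and exact: "1 \<le> p \<Longrightarrow> x \<in> C p q \<Longrightarrow> d1 p q x \<in> N (p + 1) q \<Longrightarrow> \<exists>y\<in>C (p - 1) q. x - d1 (p - 1) q y \<in> N p q"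
begin

definition inc :: "int \<Rightarrow> 'z \<Rightarrow> int \<Rightarrow> int \<Rightarrow> 'y" where
  "inc n b = single 0 n (i n b)"

lemma additive_inc: "additive (inc n)"
  unfolding inc_def additive_def
  by (simp add: additive.add[OF additive_i] additive.add[OF additive_single])

lemma inc_tot: "b \<in> BC n \<Longrightarrow> inc n b \<in> tot C n"
  using C_i subgrp_0[OF subgrp_C] by (auto simp: inc_def tot_def single_def)

lemma D_inc:
  assumes b: "b \<in> BC n"
  shows "D (inc n b) - inc (n + 1) (diffB n b) \<in> tot N (n + 1)"
  unfolding tot_def
proof (intro CollectI allI impI)
  fix p q assume pq: "p + q = n + 1"
  consider "p = 0" "q = n + 1" | "p = 1" "q = n" | "p \<noteq> 0" "p \<noteq> 1" using pq by fastforce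
  then show "(D (inc n b) - inc (n + 1) (diffB n b)) p q \<in> N p q"
  proof cases
    case 1
    then show ?thesis using subgrp_minus[OF subgrp_N i_diffB[OF b]]
      by (simp add: tot_diff_def inc_def single_def additive.zero[OF additive1])
  next
    case 2
    then show ?thesis using d1_i[OF b]
      by (simp add: tot_diff_def inc_def single_def additive.zero[OF additive2])
  next
    case 3
    then show ?thesis
      by (simp add: tot_diff_def inc_def single_def additive.zero[OF additive1] additive.zero[OF additive2]
          subgrp_0[OF subgrp_N])
  qed
qed

text \<open>Exactness of the rows removes, one column at a time and starting with the rightmost
  one, all entries of a cochain whose total differential vanishes away from column
  \<open>0\<close>; what is left in column \<open>0\<close> comes from the augmentation.\<close>

lemma push_left:
  assumes x: "x \<in> tot C n" and Dx: "\<And>p q. 1 \<le> p \<Longrightarrow> p + q = n + 1 \<Longrightarrow> D x p q \<in> N p q"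
  shows "\<exists>w\<in>tot C (n - 1). \<exists>b\<in>BC n. x - D w - inc n b \<in> tot N n"
proof -
  have *: "\<exists>w\<in>tot C (n - 1). \<exists>b\<in>BC n. x - D w - inc n b \<in> tot N n"
    if "x \<in> tot C n" "\<And>p q. 1 \<le> p \<Longrightarrow> p + q = n + 1 \<Longrightarrow> D x p q \<in> N p q"
      "\<And>p q. int k < p \<Longrightarrow> p + q = n \<Longrightarrow> x p q \<in> N p q" for k x
    using that
  proof (induction k arbitrary: x)
    case (0 x)
    have x0: "x 0 n \<in> C 0 n" using 0(1) by (auto simp: tot_def)
    have "d2 1 (n - 1) (x 1 (n - 1)) \<in> N 1 n" using 0(3)[of 1 "n - 1"] N2[of _ 1 "n - 1"] by simp
    moreover have "d1 0 n (x 0 n) + d2 1 (n - 1) (x 1 (n - 1)) \<in> N 1 n"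
      using 0(2)[of 1 n] by (simp add: tot_diff_def)
    ultimately have "d1 0 n (x 0 n) \<in> N 1 n" using subgrp_diff[OF subgrp_N] by fastforce
    from exact_0[OF x0 this] obtain b where b: "b \<in> BC n" "x 0 n - i n b \<in> N 0 n" by blast
    have "x - D 0 - inc n b \<in> tot N n"
      unfolding tot_def
    proof (intro CollectI allI impI)
      fix p q assume pq: "p + q = n"
      consider "p = 0" "q = n" | "0 < p" | "p < 0" using pq by fastforce
      then show "(x - D 0 - inc n b) p q \<in> N p q"
      proof cases
        case 1 then show ?thesis using b by (simp add: additive.zero[OF additive_D] inc_def single_def)
      next
        case 2 then show ?thesis using 0(3)[OF _ pq] by (simp add: additive.zero[OF additive_D] inc_def single_def)
      next
        case 3 then show ?thesis using 0(1) pq outside[of p q]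
          by (auto simp: additive.zero[OF additive_D] inc_def single_def tot_def)
      qed
    qed
    moreover have "0 \<in> tot C (n - 1)" using subgrp_0[OF subgrp_C] by (simp add: tot_def)
    ultimately show ?case using b by blast
  next
    case (Suc k x)
    let ?p = "int (Suc k)" and ?q = "n - int (Suc k)"
    have xp: "x ?p ?q \<in> C ?p ?q" using Suc.prems(1) by (auto simp: tot_def)
    have "x (?p + 1) (?q - 1) \<in> N (?p + 1) (?q - 1)" using Suc.prems(3)[of "?p + 1" "?q - 1"] by simp
    then have "d2 (?p + 1) (?q - 1) (x (?p + 1) (?q - 1)) \<in> N (?p + 1) ?q"
      by (rule N2') simp
    moreover have "d1 ?p ?q (x ?p ?q) + d2 (?p + 1) (?q - 1) (x (?p + 1) (?q - 1)) \<in> N (?p + 1) ?q"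
      using Suc.prems(2)[of "?p + 1" ?q] by (simp add: tot_diff_def)
    ultimately have "d1 ?p ?q (x ?p ?q) \<in> N (?p + 1) ?q" using subgrp_diff[OF subgrp_N] by fastforce
    from exact[OF _ xp this] obtain y where y: "y \<in> C (?p - 1) ?q" "x ?p ?q - d1 (?p - 1) ?q y \<in> N ?p ?q" by auto
    define w where "w = single (?p - 1) ?q y"
    have w: "w \<in> tot C (n - 1)" using y subgrp_0[OF subgrp_C] by (auto simp: w_def tot_def single_def)
    have Dw: "D w \<in> tot C n" using D_F[of w "n - 1" 0] w by (simp add: fil_0)
    have "\<exists>v\<in>tot C (n - 1). \<exists>b\<in>BC n. x - D w - D v - inc n b \<in> tot N n"
    proof (rule Suc.IH)
      show "x - D w \<in> tot C n" using Suc.prems(1) Dw subgrp_diff[OF subgrp_tot_C] by blast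
      fix p q
      show "D (x - D w) p q \<in> N p q" if "1 \<le> p" "p + q = n + 1"
        using Suc.prems(2)[OF that] D_comp[OF w, of p q] that subgrp_diff[OF subgrp_N]
        by (simp add: additive.diff[OF additive_D])
      show "(x - D w) p q \<in> N p q" if p: "int k < p" and pq: "p + q = n"
      proof (cases "p = ?p")
        case True
        then have "q = ?q" using pq by simp
        then show ?thesis
          using y True by (simp add: tot_diff_def w_def single_def additive.zero[OF additive2])
      next
        case False
        then have "?p < p" using p by simp
        then show ?thesis using Suc.prems(3)[OF _ pq]
          by (simp add: tot_diff_def w_def single_def additive.zero[OF additive1] additive.zero[OF additive2])
      qed
    qed
    then obtain v b where v: "v \<in> tot C (n - 1)" and b: "b \<in> BC n"
      and e: "x - D w - D v - inc n b \<in> tot N n" by blast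
    have "w + v \<in> tot C (n - 1)" using w v subgrp_add[OF subgrp_tot_C] by blast
    moreover have "x - D (w + v) - inc n b \<in> tot N n"
      using e unfolding additive.add[OF additive_D] diff_diff_add .
    ultimately show ?case using b by blast
  qed
  show ?thesis
  proof (rule *[OF x Dx])
    fix p q :: int assume "int (nat n) < p" "p + q = n"
    then have "q < 0" by linarith
    moreover have "x p q \<in> C p q" using x \<open>p + q = n\<close> by (auto simp: tot_def)
    ultimately show "x p q \<in> N p q" using outside by simp
  qed auto
qed

definition ZB :: "int \<Rightarrow> 'z set" where "ZB n = {b \<in> BC n. diffB n b \<in> BN (n + 1)}"
definition BB :: "int \<Rightarrow> 'z set" where "BB n = {b. \<exists>c\<in>diffB (n - 1) ` BC (n - 1). b - c \<in> BN n}"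

lemma inc_N: "b \<in> BC n \<Longrightarrow> inc n b \<in> tot N n \<longleftrightarrow> b \<in> BN n"
  using N_i[of b n] subgrp_0[OF subgrp_N] by (auto simp: inc_def tot_def single_def)

lemma inc_Ztot:
  assumes b: "b \<in> ZB n"
  shows "inc n b \<in> Ztot C N d1 d2 n"
proof -
  have bC: "b \<in> BC n" and diffB: "diffB n b \<in> BN (n + 1)" using b by (auto simp: ZB_def)
  have "inc (n + 1) (diffB n b) \<in> tot N (n + 1)" using inc_N[OF BC_diffB[OF bC]] diffB by simp
  then have "D (inc n b) \<in> tot N (n + 1)" using D_inc[OF bC] subgrp_cong[OF subgrp_tot_N] by blast
  then show "inc n b \<in> Ztot C N d1 d2 n" using inc_tot[OF bC] by (simp add: Ztot_def)
qed

lemma inc_Btot_iff: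
  assumes b: "b \<in> ZB n"
  shows "inc n b \<in> Btot C N d1 d2 n \<longleftrightarrow> b \<in> BB n"
proof -
  note sN = subgrp_tot_N
  have bC: "b \<in> BC n" using b by (simp add: ZB_def)
  show ?thesis
  proof (rule iffI)
    assume "inc n b \<in> Btot C N d1 d2 n"
    then obtain w where w: "w \<in> tot C (n - 1)" "inc n b - D w \<in> tot N n" by (auto simp: Btot_def)
    have "D w p q \<in> N p q" if "1 \<le> p" "p + q = (n - 1) + 1" for p q
    proof -
      have "(inc n b - D w) p q \<in> N p q" using w(2) that by (auto simp: tot_def)
      then show ?thesis using that subgrp_minus[OF subgrp_N, of "- D w p q"] by (auto simp: inc_def single_def)
    qed
    from push_left[OF w(1) this] obtain v c where v: "v \<in> tot C (n - 1 - 1)" and c: "c \<in> BC (n - 1)"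
      and e: "w - D v - inc (n - 1) c \<in> tot N (n - 1)" by blast
    have a1: "D (w - D v - inc (n - 1) c) \<in> tot N n" using D_tot_N[OF e] by simp
    have a2: "D (D v) \<in> tot N n" using D_comp[OF v] by (simp add: tot_def)
    have a3: "D (inc (n - 1) c) - inc n (diffB (n - 1) c) \<in> tot N n" using D_inc[OF c] by simp
    from subgrp_add[OF sN w(2) subgrp_add[OF sN subgrp_add[OF sN a1 a2] a3]]
    have "inc n (b - diffB (n - 1) c) \<in> tot N n"
      by (simp add: additive.diff[OF additive_D] additive.add[OF additive_D] additive.diff[OF additive_inc] algebra_simps)
    moreover have "b - diffB (n - 1) c \<in> BC n"
      using bC BC_diffB[OF c] subgrp_diff[OF subgrp_BC] by simp
    ultimately have "b - diffB (n - 1) c \<in> BN n" using inc_N by blast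
    then show "b \<in> BB n" using c by (auto simp: BB_def)
  next
    assume "b \<in> BB n"
    then obtain c where c: "c \<in> BC (n - 1)" "b - diffB (n - 1) c \<in> BN n" by (auto simp: BB_def)
    have "b - diffB (n - 1) c \<in> BC n"
      using bC BC_diffB[OF c(1)] subgrp_diff[OF subgrp_BC] by simp
    then have "inc n (b - diffB (n - 1) c) \<in> tot N n" using inc_N c by blast
    moreover have "D (inc (n - 1) c) - inc n (diffB (n - 1) c) \<in> tot N n" using D_inc[OF c(1)] by simp
    ultimately have "inc n (b - diffB (n - 1) c) - (D (inc (n - 1) c) - inc n (diffB (n - 1) c)) \<in> tot N n"
      by (rule subgrp_diff[OF sN])
    then have "inc n b - D (inc (n - 1) c) \<in> tot N n"
      by (simp add: additive.diff[OF additive_inc])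
    then show "inc n b \<in> Btot C N d1 d2 n"
      unfolding Btot_def using inc_tot[OF c(1)] by blast
  qed
qed

lemma Ztot_inc:
  assumes z: "z \<in> Ztot C N d1 d2 n"
  shows "\<exists>b\<in>ZB n. z - inc n b \<in> Btot C N d1 d2 n"
proof -
  note sN = subgrp_tot_N
  have zC: "z \<in> tot C n" and Dz: "D z \<in> tot N (n + 1)" using z by (auto simp: Ztot_def)
  have "D z p q \<in> N p q" if "p + q = n + 1" for p q using Dz that by (auto simp: tot_def)
  then obtain w b where w: "w \<in> tot C (n - 1)" and b: "b \<in> BC n" and e: "z - D w - inc n b \<in> tot N n"
    using push_left[OF zC] by blast
  have a1: "D (z - D w - inc n b) \<in> tot N (n + 1)" by (rule D_tot_N[OF e])
  have a2: "D (D w) \<in> tot N (n + 1)" using D_comp[OF w] by (simp add: tot_def)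
  have a3: "D (inc n b) - inc (n + 1) (diffB n b) \<in> tot N (n + 1)" using D_inc[OF b] by simp
  from subgrp_diff[OF sN Dz subgrp_add[OF sN subgrp_add[OF sN a1 a2] a3]]
  have "inc (n + 1) (diffB n b) \<in> tot N (n + 1)"
    by (simp add: additive.diff[OF additive_D] additive.add[OF additive_D] algebra_simps)
  then have "b \<in> ZB n" using inc_N[OF BC_diffB[OF b]] b by (simp add: ZB_def)
  moreover have "z - inc n b \<in> Btot C N d1 d2 n"
  proof -
    have "z - inc n b - D w \<in> tot N n" using e by (simp add: diff_diff_add add.commute)
    then show "z - inc n b \<in> Btot C N d1 d2 n" unfolding Btot_def using w by blast
  qed
  ultimately show "\<exists>b\<in>ZB n. z - inc n b \<in> Btot C N d1 d2 n" by blast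
qed

lemma subgrp_Ztot: "subgrp (Ztot C N d1 d2 n)" and subgrp_Btot: "subgrp (Btot C N d1 d2 n)"
  using subgrp_Zinf[of n] subgrp_Binf[of n] by (simp_all add: Zinf_tot Binf_tot)

lemma subgrp_ZB: "subgrp (ZB n)" and subgrp_BB: "subgrp (BB n)"
  unfolding ZB_def BB_def
  by (intro subgrp_kernel subgrp_extend subgrp_image additive_diffB subgrp_BC subgrp_BN)+

lemma presents_total:
  assumes P: "presents (ZB n) (BB n) G h"
  shows "\<exists>h1. presents (Ztot C N d1 d2 n) (Btot C N d1 d2 n) G h1 \<and>
     (\<forall>b\<in>ZB n. \<forall>z\<in>Ztot C N d1 d2 n. z - inc n b \<in> Btot C N d1 d2 n \<longrightarrow> h1 z = h b)"
  by (rule presents_pushforward[OF P subgrp_Ztot subgrp_Btot additive_inc inc_Ztot inc_Btot_iff Ztot_inc])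

lemma presents_augmentation:
  assumes P: "presents (Ztot C N d1 d2 n) (Btot C N d1 d2 n) G h"
  shows "presents (ZB n) (BB n) G (\<lambda>b. h (inc n b))"
  by (rule presents_pullback[OF P subgrp_ZB subgrp_BB additive_inc inc_Ztot inc_Btot_iff Ztot_inc])

end

text \<open>Interchanging the two directions turns statements about rows into statements about
  columns.\<close>

definition swap2 :: "('i \<Rightarrow> 'j \<Rightarrow> 'y) \<Rightarrow> 'j \<Rightarrow> 'i \<Rightarrow> 'y" where "swap2 x = (\<lambda>p q. x q p)"

lemma swap2_swap2 [simp]: "swap2 (swap2 x) = x"
  by (simp add: swap2_def)

lemma tot_swap: "swap2 x \<in> tot (swap2 C) n \<longleftrightarrow> x \<in> tot C n"
  by (auto simp: tot_def swap2_def add.commute)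

lemma tot_diff_swap: "tot_diff (swap2 d2) (swap2 d1) (swap2 x) = swap2 (tot_diff d1 d2 x)"
  by (simp add: tot_diff_def swap2_def fun_eq_iff add.commute)

lemma Ztot_swap: "swap2 x \<in> Ztot (swap2 C) (swap2 N) (swap2 d2) (swap2 d1) n \<longleftrightarrow> x \<in> Ztot C N d1 d2 n"
  by (simp add: Ztot_def tot_swap tot_diff_swap)

lemma Btot_swap: "swap2 x \<in> Btot (swap2 C) (swap2 N) (swap2 d2) (swap2 d1) n \<longleftrightarrow> x \<in> Btot C N d1 d2 n"
proof -
  have d: "swap2 x - swap2 y = swap2 (x - y)" for x y :: "int \<Rightarrow> int \<Rightarrow> 'a"
    by (simp add: swap2_def fun_eq_iff)
  have "swap2 x \<in> Btot (swap2 C) (swap2 N) (swap2 d2) (swap2 d1) n \<longleftrightarrow>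
      (\<exists>w. swap2 w \<in> tot (swap2 C) (n - 1) \<and> swap2 x - tot_diff (swap2 d2) (swap2 d1) (swap2 w) \<in> tot (swap2 N) n)"
    by (auto simp: Btot_def) (metis swap2_swap2)
  then show ?thesis by (auto simp: tot_diff_swap d tot_swap Btot_def)
qed


section \<open>Free commutative rings\<close>

text \<open>The polynomials with variables in \<open>S\<close>, before they are encoded in the
  tower type. As an additive group they are free on the monomials, which is the basis of their
  induction rule.\<close>

definition mpolys :: "'v set \<Rightarrow> ('v multiset \<Rightarrow>\<^sub>0 int) set" where
  "mpolys S = {p. \<forall>m\<in>Poly_Mapping.keys p. set_mset m \<subseteq> S}"

lemma mpolys_altdef: "mpolys S = {p. Poly_Mapping.keys p \<subseteq> {m. set_mset m \<subseteq> S}}"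
  by (auto simp: mpolys_def)

lemma mpolys_closed:
  shows "0 \<in> mpolys S" "1 \<in> mpolys S" "p \<in> mpolys S \<Longrightarrow> - p \<in> mpolys S"
    "p \<in> mpolys S \<Longrightarrow> q \<in> mpolys S \<Longrightarrow> p + q \<in> mpolys S"
    "p \<in> mpolys S \<Longrightarrow> q \<in> mpolys S \<Longrightarrow> p * q \<in> mpolys S"
    "v \<in> S \<Longrightarrow> frag_of {#v#} \<in> mpolys S"
proof -
  show "p \<in> mpolys S \<Longrightarrow> q \<in> mpolys S \<Longrightarrow> p + q \<in> mpolys S"
    using keys_add[of p q] by (auto simp: mpolys_def)
  show "p \<in> mpolys S \<Longrightarrow> q \<in> mpolys S \<Longrightarrow> p * q \<in> mpolys S"
    using keys_mult[of p q] by (fastforce simp: mpolys_def)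
qed (auto simp: mpolys_def)

lemma mpolys_induct [consumes 1, case_names one var diff mult]:
  assumes p: "p \<in> mpolys S" and 1: "Q 1" and var: "\<And>v. v \<in> S \<Longrightarrow> Q (frag_of {#v#})"
    and diff: "\<And>p q. p \<in> mpolys S \<Longrightarrow> q \<in> mpolys S \<Longrightarrow> Q p \<Longrightarrow> Q q \<Longrightarrow> Q (p - q)"
    and mult: "\<And>p q. p \<in> mpolys S \<Longrightarrow> q \<in> mpolys S \<Longrightarrow> Q p \<Longrightarrow> Q q \<Longrightarrow> Q (p * q)"
  shows "Q p"
proof -
  have m: "Q (frag_of m) \<and> frag_of m \<in> mpolys S" if "set_mset m \<subseteq> S" for m
    using that
  proof (induction m)
    case empty
    then show ?case using 1 mpolys_closed(2) by simp
  next
    case (add v m)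
    have e: "frag_of (add_mset v m) = frag_of {#v#} * frag_of m" by (simp add: mult_single)
    have m: "Q (frag_of m)" "frag_of m \<in> mpolys S" and v: "v \<in> S" using add by auto
    show ?case unfolding e
      by (intro conjI mult mpolys_closed(5,6) var m v)
  qed
  have 0: "Q 0" using diff[OF mpolys_closed(2,2) 1 1] by simp
  show ?thesis
    by (rule free_Abelian_group_induct[where S = "{m. set_mset m \<subseteq> S}"])
      (use p 0 diff m in \<open>auto simp: mpolys_altdef\<close>)
qed

lemma free_cring_simps:
  "carrier (free_cring S) = poly_enc ` mpolys S"
  "poly_enc p \<otimes>\<^bsub>free_cring S\<^esub> poly_enc q = poly_enc (p * q)"
  "poly_enc p \<oplus>\<^bsub>free_cring S\<^esub> poly_enc q = poly_enc (p + q)"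
  "\<one>\<^bsub>free_cring S\<^esub> = poly_enc 1" "\<zero>\<^bsub>free_cring S\<^esub> = poly_enc 0"
  by (simp_all add: free_cring_def mpolys_def)

lemma cring_free_cring: "cring (free_cring S)"
proof (rule cringI)
  show "abelian_group (free_cring S)"
  proof (rule abelian_groupI)
    fix x assume "x \<in> carrier (free_cring S)"
    then obtain p where "p \<in> mpolys S" "x = poly_enc p" by (auto simp: free_cring_simps)
    then show "\<exists>y\<in>carrier (free_cring S). y \<oplus>\<^bsub>free_cring S\<^esub> x = \<zero>\<^bsub>free_cring S\<^esub>"
      by (intro bexI[of _ "poly_enc (- p)"]) (auto simp: free_cring_simps mpolys_closed)
  qed (auto simp: free_cring_simps mpolys_closed ac_simps)
  show "comm_monoid (free_cring S)"
    by (rule comm_monoidI) (auto simp: free_cring_simps mpolys_closed ac_simps)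
qed (auto simp: free_cring_simps algebra_simps)

lemma free_cring_minus:
  "p \<in> mpolys S \<Longrightarrow> q \<in> mpolys S \<Longrightarrow> poly_enc p \<ominus>\<^bsub>free_cring S\<^esub> poly_enc q = poly_enc (p - q)"
proof -
  interpret cring "free_cring S" by (rule cring_free_cring)
  assume pq: "p \<in> mpolys S" "q \<in> mpolys S"
  have "\<ominus>\<^bsub>free_cring S\<^esub> poly_enc q = poly_enc (- q)"
    by (rule minus_equality) (use pq in \<open>auto simp: free_cring_simps mpolys_closed\<close>)
  then show ?thesis by (simp add: a_minus_def free_cring_simps)
qed

definition var :: "'a poly_tower \<Rightarrow> 'a poly_tower" where
  "var v = poly_enc (frag_of {#v#})"

lemma var_carrier [intro]: "v \<in> S \<Longrightarrow> var v \<in> carrier (free_cring S)"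
  by (auto simp: var_def free_cring_simps mpolys_closed)

text \<open>One induction rule for everything determined by its values on variables: homomorphisms
  and derivations. Subtraction is chosen because \<open>0\<close> and sums are obtained from
  it.\<close>

lemma free_cring_induct [consumes 1, case_names one var diff mult]:
  assumes x: "x \<in> carrier (free_cring S)" and 1: "Q \<one>\<^bsub>free_cring S\<^esub>"
    and var: "\<And>v. v \<in> S \<Longrightarrow> Q (var v)"
    and diff: "\<And>x y. x \<in> carrier (free_cring S) \<Longrightarrow> y \<in> carrier (free_cring S) \<Longrightarrow>
        Q x \<Longrightarrow> Q y \<Longrightarrow> Q (x \<ominus>\<^bsub>free_cring S\<^esub> y)"
    and mult: "\<And>x y. x \<in> carrier (free_cring S) \<Longrightarrow> y \<in> carrier (free_cring S) \<Longrightarrow>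
        Q x \<Longrightarrow> Q y \<Longrightarrow> Q (x \<otimes>\<^bsub>free_cring S\<^esub> y)"
  shows "Q x"
proof -
  obtain p where p: "p \<in> mpolys S" "x = poly_enc p" using x by (auto simp: free_cring_simps)
  from p(1) have "Q (poly_enc p)"
  proof (induction rule: mpolys_induct)
    case one then show ?case using 1 by (simp add: free_cring_simps)
  next
    case (var v) then show ?case using assms(3) by (simp add: var_def)
  next
    case (diff p q) then show ?case using assms(4) by (simp add: free_cring_minus[symmetric] free_cring_simps)
  next
    case (mult p q)
    then show ?case using assms(5)[of "poly_enc p" "poly_enc q"] by (simp add: free_cring_simps)
  qed
  then show ?thesis using p by simp
qed

lemma ring_hom_minus:
  assumes "h \<in> ring_hom A B" "cring A" "cring B" "x \<in> carrier A" "y \<in> carrier A"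
  shows "h (x \<ominus>\<^bsub>A\<^esub> y) = h x \<ominus>\<^bsub>B\<^esub> h y"
proof -
  interpret ring_hom_cring A B h
    using assms by (simp add: ring_hom_cring_def ring_hom_cring_axioms_def)
  show ?thesis using assms by (simp add: a_minus_def)
qed

lemma free_cring_hom_eq:
  assumes h: "h \<in> ring_hom (free_cring S) B" and k: "k \<in> ring_hom (free_cring S) B" and B: "cring B"
    and v: "\<And>v. v \<in> S \<Longrightarrow> h (var v) = k (var v)" and x: "x \<in> carrier (free_cring S)"
  shows "h x = k x"
  using x
proof (induction rule: free_cring_induct)
  case one then show ?case using ring_hom_one[OF h] ring_hom_one[OF k] by simp
next
  case (var w) then show ?case by (rule v)
next
  case (diff x y)
  then show ?case using ring_hom_minus[OF h cring_free_cring B] ring_hom_minus[OF k cring_free_cring B] by simp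
next
  case (mult x y) then show ?case using ring_hom_mult[OF h] ring_hom_mult[OF k] by simp
qed

lemma free_lift_hom:
  fixes X :: "('b, 'x) ring_scheme" and S :: "'a poly_tower set"
  assumes X: "cring X" and g: "\<And>v. v \<in> S \<Longrightarrow> g v \<in> carrier X"
  shows "free_lift X g \<in> ring_hom (free_cring S) X"
    and free_lift_var: "v \<in> S \<Longrightarrow> free_lift X g (var v) = g v"
proof -
  interpret X: cring X by (rule X)
  define mon where "mon m = (\<Otimes>\<^bsub>X\<^esub>v\<in>set_mset m. g v [^]\<^bsub>X\<^esub> count m v)" for m
  define ev where "ev p = (\<Oplus>\<^bsub>X\<^esub>m\<in>Poly_Mapping.keys p. [Poly_Mapping.lookup p m] \<cdot>\<^bsub>X\<^esub> mon m)"
    for p :: "'a poly_tower multiset \<Rightarrow>\<^sub>0 int"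
  let ?M = "{m. set_mset m \<subseteq> S}"
  have mon_superset: "mon m = (\<Otimes>\<^bsub>X\<^esub>v\<in>A. g v [^]\<^bsub>X\<^esub> count m v)"
    if "finite A" "set_mset m \<subseteq> A" "A \<subseteq> S" for m A
    unfolding mon_def using that g
    by (intro X.finprod_mono_neutral_cong_left) (auto simp: not_in_iff)
  have mon: "mon m \<in> carrier X" if "m \<in> ?M" for m
    unfolding mon_def using that g by (intro X.finprod_closed) auto
  have mon_add: "mon (m + m') = mon m \<otimes>\<^bsub>X\<^esub> mon m'" if "m \<in> ?M" "m' \<in> ?M" for m m'
  proof -
    let ?A = "set_mset m \<union> set_mset m'"
    have "mon (m + m') = (\<Otimes>\<^bsub>X\<^esub>v\<in>?A. g v [^]\<^bsub>X\<^esub> count m v \<otimes>\<^bsub>X\<^esub> g v [^]\<^bsub>X\<^esub> count m' v)"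
      using that g by (subst mon_superset[of ?A]) (auto intro!: X.finprod_cong' simp: X.nat_pow_mult)
    also have "\<dots> = (\<Otimes>\<^bsub>X\<^esub>v\<in>?A. g v [^]\<^bsub>X\<^esub> count m v) \<otimes>\<^bsub>X\<^esub> (\<Otimes>\<^bsub>X\<^esub>v\<in>?A. g v [^]\<^bsub>X\<^esub> count m' v)"
      using that g by (intro X.finprod_multf) auto
    also have "\<dots> = mon m \<otimes>\<^bsub>X\<^esub> mon m'"
      using that by (subst (1 2) mon_superset[of ?A]) auto
    finally show ?thesis .
  qed
  have zero_pow: "[(0 :: int)] \<cdot>\<^bsub>X\<^esub> x = \<zero>\<^bsub>X\<^esub>" for x by (simp add: add_pow_def)
  have ev_superset: "ev p = (\<Oplus>\<^bsub>X\<^esub>m\<in>A. [Poly_Mapping.lookup p m] \<cdot>\<^bsub>X\<^esub> mon m)"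
    if "finite A" "Poly_Mapping.keys p \<subseteq> A" "A \<subseteq> ?M" for p A
    unfolding ev_def using that mon
    by (intro X.add.finprod_mono_neutral_cong_left) (auto simp: in_keys_iff subset_iff zero_pow)
  have ev: "ev p \<in> carrier X" if "p \<in> mpolys S" for p
    unfolding ev_def using that mon by (intro X.finsum_closed) (auto simp: mpolys_altdef subset_iff)
  have ev_add: "ev (p + q) = ev p \<oplus>\<^bsub>X\<^esub> ev q" if "p \<in> mpolys S" "q \<in> mpolys S" for p q
  proof -
    let ?A = "Poly_Mapping.keys p \<union> Poly_Mapping.keys q"
    have A: "finite ?A" "?A \<subseteq> ?M" using that by (auto simp: mpolys_altdef)
    have "ev (p + q) = (\<Oplus>\<^bsub>X\<^esub>m\<in>?A. [Poly_Mapping.lookup (p + q) m] \<cdot>\<^bsub>X\<^esub> mon m)"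
      using A keys_add[of p q] by (intro ev_superset)
    also have "\<dots> = (\<Oplus>\<^bsub>X\<^esub>m\<in>?A. [Poly_Mapping.lookup p m] \<cdot>\<^bsub>X\<^esub> mon m \<oplus>\<^bsub>X\<^esub> [Poly_Mapping.lookup q m] \<cdot>\<^bsub>X\<^esub> mon m)"
      by (rule X.finsum_cong') (use A mon in \<open>auto simp: lookup_add X.add.int_pow_mult\<close>)
    also have "\<dots> = (\<Oplus>\<^bsub>X\<^esub>m\<in>?A. [Poly_Mapping.lookup p m] \<cdot>\<^bsub>X\<^esub> mon m) \<oplus>\<^bsub>X\<^esub> (\<Oplus>\<^bsub>X\<^esub>m\<in>?A. [Poly_Mapping.lookup q m] \<cdot>\<^bsub>X\<^esub> mon m)"
      using A mon by (intro X.finsum_addf) (auto simp: subset_iff)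
    also have "\<dots> = ev p \<oplus>\<^bsub>X\<^esub> ev q"
      using A by (subst (1 2) ev_superset[of ?A]) auto
    finally show ?thesis .
  qed
  have ev_diff: "ev (p - q) = ev p \<ominus>\<^bsub>X\<^esub> ev q" if "p \<in> mpolys S" "q \<in> mpolys S" for p q
  proof -
    have pq: "p - q \<in> mpolys S" using that mpolys_closed(3,4)[of _ S] by (metis diff_conv_add_uminus)
    have "ev (p - q) \<oplus>\<^bsub>X\<^esub> ev q = ev p" using ev_add[OF pq that(2)] by simp
    then show ?thesis using ev pq that by (metis X.add.inv_solve_right' X.minus_eq)
  qed
  have ev_frag: "ev (frag_of m) = mon m" if "m \<in> ?M" for m
    using mon[OF that] by (simp add: ev_def)
  have frag: "frag_of m \<in> mpolys S" if "m \<in> ?M" for m using that by (simp add: mpolys_altdef)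
  have diff: "p - q \<in> mpolys S" if "p \<in> mpolys S" "q \<in> mpolys S" for p q
    using that mpolys_closed(3,4)[of _ S] by (metis diff_conv_add_uminus)
  have ev_mult1: "ev (frag_of m * q) = mon m \<otimes>\<^bsub>X\<^esub> ev q" if m: "m \<in> ?M" and q: "q \<in> mpolys S" for m q
  proof (rule free_Abelian_group_induct[where S = ?M and x = q and
        P = "\<lambda>q. ev (frag_of m * q) = mon m \<otimes>\<^bsub>X\<^esub> ev q"])
    show "Poly_Mapping.keys q \<subseteq> ?M" using q by (simp add: mpolys_altdef)
    show "ev (frag_of m * 0) = mon m \<otimes>\<^bsub>X\<^esub> ev 0" using mon[OF m] by (simp add: ev_def)
    show "ev (frag_of m * frag_of m') = mon m \<otimes>\<^bsub>X\<^esub> ev (frag_of m')" if "m' \<in> ?M" for m'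
    proof -
      have "frag_of m * frag_of m' = frag_of (m + m')" by (simp add: mult_single)
      then show ?thesis using m that mon_add ev_frag by simp
    qed
    fix x y
    assume "Poly_Mapping.keys x \<subseteq> ?M" "Poly_Mapping.keys y \<subseteq> ?M" and IH: "ev (frag_of m * x) = mon m \<otimes>\<^bsub>X\<^esub> ev x"
      "ev (frag_of m * y) = mon m \<otimes>\<^bsub>X\<^esub> ev y"
    then have xy: "x \<in> mpolys S" "y \<in> mpolys S" by (auto simp: mpolys_altdef)
    show "ev (frag_of m * (x - y)) = mon m \<otimes>\<^bsub>X\<^esub> ev (x - y)"
      using xy frag[OF m] ev[OF xy(1)] ev[OF xy(2)] mon[OF m] IH
      by (simp add: right_diff_distrib ev_diff mpolys_closed(5) X.minus_eq X.r_distr X.r_minus)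
  qed
  have ev_mult: "ev (p * q) = ev p \<otimes>\<^bsub>X\<^esub> ev q" if p: "p \<in> mpolys S" and q: "q \<in> mpolys S" for p q
  proof (rule free_Abelian_group_induct[where S = ?M and x = p and
        P = "\<lambda>p. ev (p * q) = ev p \<otimes>\<^bsub>X\<^esub> ev q"])
    show "Poly_Mapping.keys p \<subseteq> ?M" using p by (simp add: mpolys_altdef)
    show "ev (0 * q) = ev 0 \<otimes>\<^bsub>X\<^esub> ev q" using ev[OF q] by (simp add: ev_def)
    show "ev (frag_of m * q) = ev (frag_of m) \<otimes>\<^bsub>X\<^esub> ev q" if "m \<in> ?M" for m
      using ev_mult1[OF that q] ev_frag[OF that] by simp
    fix x y
    assume "Poly_Mapping.keys x \<subseteq> ?M" "Poly_Mapping.keys y \<subseteq> ?M" and IH: "ev (x * q) = ev x \<otimes>\<^bsub>X\<^esub> ev q"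
      "ev (y * q) = ev y \<otimes>\<^bsub>X\<^esub> ev q"
    then have xy: "x \<in> mpolys S" "y \<in> mpolys S" by (auto simp: mpolys_altdef)
    show "ev ((x - y) * q) = ev (x - y) \<otimes>\<^bsub>X\<^esub> ev q"
      using xy ev[OF xy(1)] ev[OF xy(2)] ev[OF q] q IH
      by (simp add: left_diff_distrib ev_diff mpolys_closed(5) X.minus_eq X.l_distr X.l_minus)
  qed
  have lift: "free_lift X g (poly_enc p) = ev p" for p
    by (simp add: free_lift_def ev_def mon_def)
  have mon0: "ev 1 = \<one>\<^bsub>X\<^esub>" using ev_frag[of "{#}"] by (simp add: mon_def)
  show "free_lift X g \<in> ring_hom (free_cring S) X"
    by (rule ring_hom_memI) (auto simp: free_cring_simps lift ev ev_mult ev_add mon0)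
  show "free_lift X g (var v) = g v" if "v \<in> S"
    using that g by (simp add: var_def lift ev_frag) (simp add: mon_def)
qed

text \<open>\<open>free_map\<close> below the encoding.\<close>

definition push_vars :: "('v \<Rightarrow> 'w) \<Rightarrow> ('v multiset \<Rightarrow>\<^sub>0 int) \<Rightarrow> ('w multiset \<Rightarrow>\<^sub>0 int)" where
  "push_vars g = frag_extend (frag_of \<circ> image_mset g)"

lemma free_map_enc:
  "free_map g (poly_enc p) = poly_enc (push_vars g p)"
proof -
  have "frag_cmul c (frag_of m) = Poly_Mapping.single m c" for m :: "'a poly_tower multiset" and c
    by (rule poly_mapping_eqI) (simp add: lookup_single when_def)
  then show ?thesis by (simp add: free_map_def push_vars_def frag_extend_def)
qed

lemma push_vars_simps:
  "push_vars g 0 = 0" "push_vars g (p + q) = push_vars g p + push_vars g q"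
  "push_vars g (p - q) = push_vars g p - push_vars g q"
  "push_vars g (frag_of m) = frag_of (image_mset g m)"
  by (simp_all add: push_vars_def frag_extend_add frag_extend_diff)

lemma push_vars_one: "push_vars g 1 = 1"
  using push_vars_simps(4)[of g "{#}"] by simp

lemma push_vars_mult: "push_vars g (p * q) = push_vars g p * push_vars g q"
proof -
  have 1: "push_vars g (frag_of m * q) = push_vars g (frag_of m) * push_vars g q" for m
  proof (rule free_Abelian_group_induct[where S = UNIV and x = q and
        P = "\<lambda>q. push_vars g (frag_of m * q) = push_vars g (frag_of m) * push_vars g q"])
    fix m'
    have "frag_of m * frag_of m' = frag_of (m + m')"
      "frag_of (image_mset g m) * frag_of (image_mset g m') = frag_of (image_mset g (m + m'))"
      by (simp_all add: mult_single)
    then show "push_vars g (frag_of m * frag_of m') = push_vars g (frag_of m) * push_vars g (frag_of m')"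
      by (simp only: push_vars_simps)
  qed (simp_all only: push_vars_simps right_diff_distrib mult_zero_right subset_UNIV)
  show ?thesis
    by (rule free_Abelian_group_induct[where S = UNIV and x = p and
        P = "\<lambda>p. push_vars g (p * q) = push_vars g p * push_vars g q"])
      (simp_all only: push_vars_simps(1,2,3) left_diff_distrib mult_zero_left subset_UNIV 1)
qed

lemma push_vars_mpolys:
  assumes p: "p \<in> mpolys S" and g: "\<And>v. v \<in> S \<Longrightarrow> g v \<in> T"
  shows "push_vars g p \<in> mpolys T"
  unfolding mpolys_def
proof (intro CollectI ballI)
  fix m assume "m \<in> Poly_Mapping.keys (push_vars g p)"
  then obtain m' where "m' \<in> Poly_Mapping.keys p" "m = image_mset g m'"
    using keys_frag_extend[of "frag_of \<circ> image_mset g" p] by (auto simp: push_vars_def)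
  then show "set_mset m \<subseteq> T" using p g by (auto simp: mpolys_def)
qed

lemma free_map_hom:
  assumes g: "\<And>v. v \<in> S \<Longrightarrow> g v \<in> T"
  shows "free_map g \<in> ring_hom (free_cring S) (free_cring T)"
  by (intro ring_hom_memI)
    (auto simp: free_cring_simps free_map_enc push_vars_mult push_vars_simps(2) push_vars_one
      intro!: push_vars_mpolys g)

lemma free_map_var: "free_map g (var v) = var (g v)"
  by (simp add: var_def free_map_enc push_vars_simps)

lemma free_map_comp:
  assumes "x \<in> carrier (free_cring S)"
  shows "free_map g (free_map h x) = free_map (\<lambda>v. g (h v)) x"
proof -
  have "push_vars g (push_vars h p) = push_vars (\<lambda>v. g (h v)) p" for p
  proof -
    have e: "(frag_of \<circ> image_mset g) \<circ> image_mset h = frag_of \<circ> image_mset (\<lambda>v. g (h v))"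
      by (rule ext) (simp add: image_mset.compositionality comp_def)
    show ?thesis
      using frag_extend_compose[of "frag_of \<circ> image_mset g" "image_mset h" p]
      unfolding push_vars_def e .
  qed
  then show ?thesis using assms by (auto simp: free_cring_simps free_map_enc)
qed

lemma free_map_cong:
  assumes "x \<in> carrier (free_cring S)" "\<And>v. v \<in> S \<Longrightarrow> g v = h v"
  shows "free_map g x = free_map h x"
proof -
  obtain p where p: "p \<in> mpolys S" "x = poly_enc p" using assms by (auto simp: free_cring_simps)
  have "push_vars g p = push_vars h p"
    unfolding push_vars_def using p assms(2)
    by (intro frag_extend_eq) (auto simp: mpolys_def subset_iff intro!: arg_cong[of _ _ frag_of] image_mset_cong)
  then show ?thesis using p by (simp add: free_map_enc)
qed

lemma free_map_id:
  assumes "x \<in> carrier (free_cring S)" "\<And>v. v \<in> S \<Longrightarrow> g v = v"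
  shows "free_map g x = x"
  by (rule free_cring_hom_eq[where k = "\<lambda>x. x", OF free_map_hom _ cring_free_cring])
    (use assms in \<open>auto simp: free_map_var ring_hom_def\<close>)


section \<open>The towers of the two comonads\<close>

text \<open>What the simplicial identities of a comonad resolution need: functoriality of
  \<open>Fm\<close> on commutative squares and naturality of the counit, both only for the
  distinguished maps \<open>mor\<close> between the stages \<open>X n\<close>. It is used for the
  commutative and for the Psi-ring comonad.\<close>

locale comonad_tower =
  fixes X :: "nat \<Rightarrow> 't set" and Fm :: "('t \<Rightarrow> 't) \<Rightarrow> 't \<Rightarrow> 't"
    and eps :: "nat \<Rightarrow> 't \<Rightarrow> 't" and mor :: "nat \<Rightarrow> nat \<Rightarrow> ('t \<Rightarrow> 't) \<Rightarrow> bool"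
  assumes mor_eps: "mor (Suc n) n (eps n)"
    and mor_F: "mor m n g \<Longrightarrow> mor (Suc m) (Suc n) (Fm g)"
    and mor_in: "mor m n g \<Longrightarrow> x \<in> X m \<Longrightarrow> g x \<in> X n"
    and eps_natural: "mor m n g \<Longrightarrow> x \<in> X (Suc m) \<Longrightarrow> eps n (Fm g x) = g (eps m x)"
    and F_square: "\<lbrakk>mor m n g; mor n l h; mor m n' g'; mor n' l h'; \<And>x. x \<in> X m \<Longrightarrow> h (g x) = h' (g' x);
        x \<in> X (Suc m)\<rbrakk> \<Longrightarrow> Fm h (Fm g x) = Fm h' (Fm g' x)"
begin

definition face :: "nat \<Rightarrow> nat \<Rightarrow> 't \<Rightarrow> 't" where
  "face n k = (Fm ^^ k) (eps (n - k))"

lemma face_simps: "face n 0 = eps n" "face (Suc n) (Suc k) = Fm (face n k)"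
  by (simp_all add: face_def)

lemma mor_face: "k \<le> n \<Longrightarrow> mor (Suc n) n (face n k)"
proof (induction k arbitrary: n)
  case 0 then show ?case by (simp add: face_simps mor_eps)
next
  case (Suc k n) then show ?case by (cases n) (auto simp: face_simps mor_F)
qed

lemma face_face:
  assumes "i < j" "j \<le> Suc n" "x \<in> X (Suc (Suc n))"
  shows "face n i (face (Suc n) j x) = face n (j - 1) (face (Suc n) i x)"
  using assms
proof (induction i arbitrary: j n x)
  case 0
  then obtain j' where j: "j = Suc j'" by (cases j) auto
  then show ?case
    using eps_natural[OF mor_face, of j' n x] 0 by (simp add: face_simps)
next
  case (Suc i j n x)
  then obtain j' n' where jn: "j = Suc j'" "n = Suc n'" by (cases j; cases n) auto
  then obtain j'' where j'': "j' = Suc j''" using Suc.prems by (cases j') auto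
  have "Fm (face n' i) (Fm (face (Suc n') j') x) = Fm (face n' (j' - 1)) (Fm (face (Suc n') i) x)"
    by (rule F_square[OF mor_face mor_face mor_face mor_face Suc.IH]) (use Suc.prems jn in auto)
  then show ?case by (simp add: jn j'' face_simps)
qed

lemma aug_face:
  assumes a: "\<And>n. aug (Suc n) = aug n \<circ> eps n" and "k \<le> n" "x \<in> X (Suc n)"
  shows "aug n (face n k x) = aug (Suc n) x"
  using assms(2-)
proof (induction k arbitrary: n x)
  case 0 then show ?case by (simp add: face_simps a)
next
  case (Suc k n x)
  then obtain n' where n: "n = Suc n'" by (cases n) auto
  have "aug n (face n (Suc k) x) = aug n' (face n' k (eps (Suc n') x))"
    using Suc.prems eps_natural[OF mor_face, of k n' x] by (simp add: n face_simps a)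
  also have "\<dots> = aug (Suc n') (eps (Suc n') x)"
    using Suc mor_in[OF mor_eps] n by (intro Suc.IH) auto
  finally show ?case by (simp add: n a)
qed

end

text \<open>\<open>F\<^sup>n(Y)\<close> for the comonad \<open>F\<close> of free commutative rings
  and an arbitrary ring \<open>Y\<close> inside of the tower type. For \<open>Y = base_ring
  R\<close> this is the resolution of the Andre-Quillen theory; the other instances have a stage
  of the Psi-ring tower for \<open>Y\<close>.\<close>

primrec ctower :: "'a poly_tower ring \<Rightarrow> nat \<Rightarrow> 'a poly_tower ring" where
  "ctower Y 0 = Y"
| "ctower Y (Suc n) = free_cring (carrier (ctower Y n))"

definition cface :: "'a poly_tower ring \<Rightarrow> nat \<Rightarrow> nat \<Rightarrow> 'a poly_tower \<Rightarrow> 'a poly_tower" where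
  "cface Y n k = (free_map ^^ k) (cr_counit (ctower Y (n - k)))"

primrec caug :: "'a poly_tower ring \<Rightarrow> ('a poly_tower \<Rightarrow> 'r) \<Rightarrow> nat \<Rightarrow> 'a poly_tower \<Rightarrow> 'r" where
  "caug Y \<alpha> 0 = \<alpha>"
| "caug Y \<alpha> (Suc n) = caug Y \<alpha> n \<circ> cr_counit (ctower Y n)"

text \<open>\<open>F\<^sup>a(g)\<close>, with the rings of variables left implicit.\<close>

abbreviation gmap :: "nat \<Rightarrow> ('a poly_tower \<Rightarrow> 'a poly_tower) \<Rightarrow> 'a poly_tower \<Rightarrow> 'a poly_tower" where
  "gmap a g \<equiv> (free_map ^^ a) g"

lemma cr_tower_ctower: "cr_tower R n = ctower (base_ring R) n"
  by (induction n) auto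

lemma cr_face_cface: "cr_face R n k = cface (base_ring R) n k"
  by (simp add: cr_face_def cface_def cr_tower_ctower)

lemma cr_aug_caug: "cr_aug R n = caug (base_ring R) un_Base n"
  by (induction n) (auto simp: cr_tower_ctower)

lemma cr_tower_map_gmap: "cr_tower_map \<phi> n = gmap n (\<lambda>x. Base (\<phi> (un_Base x)))"
  by (induction n) auto

lemma ring_hom_comp: "g \<in> ring_hom A B \<Longrightarrow> h \<in> ring_hom B C \<Longrightarrow> (\<lambda>x. h (g x)) \<in> ring_hom A C"
  by (auto simp: ring_hom_def Pi_iff)

lemma cring_ctower: "cring Y \<Longrightarrow> cring (ctower Y n)"
  by (cases n) (auto simp: cring_free_cring)

lemma counit_hom:
  assumes "cring X"
  shows "cr_counit X \<in> ring_hom (free_cring (carrier X)) X"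
    and "v \<in> carrier X \<Longrightarrow> cr_counit X (var v) = v"
  using free_lift_hom[OF assms, of "carrier X" "\<lambda>v. v"] free_lift_var[OF assms, of "carrier X" "\<lambda>v. v"]
  by (auto simp: cr_counit_def)

lemma counit_natural:
  assumes A: "cring A" and B: "cring B" and g: "g \<in> ring_hom A B" and x: "x \<in> carrier (free_cring (carrier A))"
  shows "cr_counit B (free_map g x) = g (cr_counit A x)"
proof (rule free_cring_hom_eq[OF _ _ B _ x])
  have gA: "g v \<in> carrier B" if "v \<in> carrier A" for v using ring_hom_closed[OF g that] .
  show "(\<lambda>x. cr_counit B (free_map g x)) \<in> ring_hom (free_cring (carrier A)) B"
    by (rule ring_hom_comp[OF free_map_hom counit_hom(1)[OF B]]) (rule gA)
  show "(\<lambda>x. g (cr_counit A x)) \<in> ring_hom (free_cring (carrier A)) B"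
    by (rule ring_hom_comp[OF counit_hom(1)[OF A] g])
  show "cr_counit B (free_map g (var v)) = g (cr_counit A (var v))" if "v \<in> carrier A" for v
    using that gA by (simp add: free_map_var counit_hom A B)
qed

lemma free_map_square:
  assumes "\<And>v. v \<in> S \<Longrightarrow> h (g v) = h' (g' v)" "x \<in> carrier (free_cring S)"
  shows "free_map h (free_map g x) = free_map h' (free_map g' x)"
  unfolding free_map_comp[OF assms(2)] by (rule free_map_cong[OF assms(2,1)])

lemma comonad_tower_ctower:
  fixes Y :: "'a poly_tower ring"
  assumes Y: "cring Y"
  shows "comonad_tower (\<lambda>n. carrier (ctower Y n)) free_map (\<lambda>n. cr_counit (ctower Y n))
    (\<lambda>m n g. g \<in> ring_hom (ctower Y m) (ctower Y n))"
proof
  fix m n g x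
  show "cr_counit (ctower Y n) \<in> ring_hom (ctower Y (Suc n)) (ctower Y n)" for n
    using counit_hom(1)[OF cring_ctower[OF Y]] by simp
  assume g: "g \<in> ring_hom (ctower Y m) (ctower Y n)"
  then have gc: "g v \<in> carrier (ctower Y n)" if "v \<in> carrier (ctower Y m)" for v
    using that by (rule ring_hom_closed)
  show "free_map g \<in> ring_hom (ctower Y (Suc m)) (ctower Y (Suc n))"
    using free_map_hom[OF gc] by simp
  show "x \<in> carrier (ctower Y m) \<Longrightarrow> g x \<in> carrier (ctower Y n)" by (rule gc)
  show "x \<in> carrier (ctower Y (Suc m)) \<Longrightarrow> cr_counit (ctower Y n) (free_map g x) = g (cr_counit (ctower Y m) x)"
    using counit_natural[OF cring_ctower[OF Y] cring_ctower[OF Y] g] by simp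
next
  fix m x and g h g' h' :: "'a poly_tower \<Rightarrow> 'a poly_tower"
  assume e: "\<And>x. x \<in> carrier (ctower Y m) \<Longrightarrow> h (g x) = h' (g' x)"
    and x: "x \<in> carrier (ctower Y (Suc m))"
  show "free_map h (free_map g x) = free_map h' (free_map g' x)"
    by (rule free_map_square[where S = "carrier (ctower Y m)"]) (use e x in auto)
qed

lemma ctower_face:
  assumes Y: "cring Y"
  shows "comonad_tower.face free_map (\<lambda>n. cr_counit (ctower Y n)) n k = cface Y n k"
  by (simp add: comonad_tower.face_def[OF comonad_tower_ctower[OF Y]] cface_def)

lemma cface_hom:
  "cring Y \<Longrightarrow> k \<le> n \<Longrightarrow> cface Y n k \<in> ring_hom (ctower Y (Suc n)) (ctower Y n)"
  using comonad_tower.mor_face[OF comonad_tower_ctower, of Y k n] by (simp only: ctower_face)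

lemma cface_cface:
  "cring Y \<Longrightarrow> i < j \<Longrightarrow> j \<le> Suc n \<Longrightarrow> x \<in> carrier (ctower Y (Suc (Suc n))) \<Longrightarrow>
     cface Y n i (cface Y (Suc n) j x) = cface Y n (j - 1) (cface Y (Suc n) i x)"
  using comonad_tower.face_face[OF comonad_tower_ctower, of Y i j n x] by (simp only: ctower_face)

lemma caug_cface:
  "cring Y \<Longrightarrow> k \<le> n \<Longrightarrow> x \<in> carrier (ctower Y (Suc n)) \<Longrightarrow>
     caug Y \<alpha> n (cface Y n k x) = caug Y \<alpha> (Suc n) x"
  using comonad_tower.aug_face[OF comonad_tower_ctower[of Y], where aug = "caug Y \<alpha>" and n = n and k = k and x = x]
  by (simp only: ctower_face caug.simps)

lemma cface_simps: "cface Y n 0 = cr_counit (ctower Y n)" "cface Y (Suc n) (Suc k) = free_map (cface Y n k)"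
  by (simp_all add: cface_def)

lemma caug_hom:
  assumes Y: "cring Y" and a: "\<alpha> \<in> ring_hom Y R"
  shows "caug Y \<alpha> n \<in> ring_hom (ctower Y n) R"
proof (induction n)
  case (Suc n)
  have "(\<lambda>x. caug Y \<alpha> n (cr_counit (ctower Y n) x)) \<in> ring_hom (ctower Y (Suc n)) R"
    using ring_hom_comp[OF counit_hom(1)[OF cring_ctower[OF Y]] Suc] by simp
  then show ?case by (simp add: comp_def)
qed (simp add: a)

lemma caug_comp: "caug Y (\<lambda>x. \<tau> (\<alpha> x)) n x = \<tau> (caug Y \<alpha> n x)"
  by (induction n arbitrary: x) auto

lemma gmap_in:
  assumes "\<And>y. y \<in> carrier Y \<Longrightarrow> g y \<in> carrier Y'"
  shows "x \<in> carrier (ctower Y n) \<Longrightarrow> gmap n g x \<in> carrier (ctower Y' n)"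
proof (induction n arbitrary: x)
  case (Suc n)
  then show ?case using ring_hom_closed[OF free_map_hom[of "carrier (ctower Y n)"]] by simp
qed (simp add: assms)

lemma gmap_hom_Suc:
  assumes "\<And>y. y \<in> carrier Y \<Longrightarrow> g y \<in> carrier Y'"
  shows "gmap (Suc n) g \<in> ring_hom (ctower Y (Suc n)) (ctower Y' (Suc n))"
  using free_map_hom[of "carrier (ctower Y n)" "gmap n g", OF gmap_in[OF assms]] by simp

lemma gmap_hom:
  assumes "g \<in> ring_hom Y Y'"
  shows "gmap n g \<in> ring_hom (ctower Y n) (ctower Y' n)"
  using assms gmap_hom_Suc[OF ring_hom_closed[OF assms]] by (cases n) auto

lemma gmap_square:
  assumes gh: "\<And>y. y \<in> carrier Y \<Longrightarrow> h (g y) = h' (g' y)"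
  shows "x \<in> carrier (ctower Y n) \<Longrightarrow> gmap n h (gmap n g x) = gmap n h' (gmap n g' x)"
proof (induction n arbitrary: x)
  case (Suc n)
  then show ?case
    using free_map_square[of "carrier (ctower Y n)" "gmap n h" "gmap n g" "gmap n h'" "gmap n g'" x] by simp
qed (simp add: gh)

lemma gmap_id:
  assumes gh: "\<And>y. y \<in> carrier Y \<Longrightarrow> g y = y"
  shows "x \<in> carrier (ctower Y n) \<Longrightarrow> gmap n g x = x"
proof (induction n arbitrary: x)
  case (Suc n) then show ?case using free_map_id[of x "carrier (ctower Y n)" "gmap n g"] by simp
qed (simp add: gh)

lemma gmap_comp: "x \<in> carrier (ctower Y n) \<Longrightarrow> gmap n h (gmap n g x) = gmap n (\<lambda>y. h (g y)) x"
proof (induction n arbitrary: x)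
  case (Suc n)
  have x: "x \<in> carrier (free_cring (carrier (ctower Y n)))" using Suc.prems by simp
  have "free_map (gmap n h) (free_map (gmap n g) x) = free_map (\<lambda>v. gmap n h (gmap n g v)) x"
    by (rule free_map_comp[OF x])
  also have "\<dots> = free_map (gmap n (\<lambda>y. h (g y))) x"
    by (rule free_map_cong[OF x Suc.IH])
  finally show ?case by simp
qed simp

lemma gmap_cface:
  assumes Y: "cring Y" and Y': "cring Y'" and g: "g \<in> ring_hom Y Y'" and "k \<le> n" "x \<in> carrier (ctower Y (Suc n))"
  shows "cface Y' n k (gmap (Suc n) g x) = gmap n g (cface Y n k x)"
  using assms(4-)
proof (induction k arbitrary: n x)
  case 0
  then show ?case
    using counit_natural[OF cring_ctower[OF Y] cring_ctower[OF Y'] gmap_hom[OF g]] by (simp add: cface_simps)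
next
  case (Suc k n x)
  then obtain n' where n: "n = Suc n'" by (cases n) auto
  show ?case
    using Suc free_map_square[of "carrier (ctower Y (Suc n'))" "cface Y' n' k" "gmap (Suc n') g"
        "gmap n' g" "cface Y n' k" x]
    by (simp add: n cface_simps)
qed

text \<open>The map \<open>g\<close> may be any map of sets over \<open>R\<close>, not necessarily
  a ring homomorphism, because above stage \<open>0\<close> the augmentations are determined by
  their values on variables. The contraction \<open>x \<mapsto> \<Psi>\<^sup>1 x\<close> of the
  Psi-ring tower is such a map.\<close>

lemma caug_gmap:
  assumes Y: "cring Y" and Y': "cring Y'" and R: "cring R" and a: "\<alpha> \<in> ring_hom Y R" and a': "\<alpha>' \<in> ring_hom Y' R"
    and g: "\<And>y. y \<in> carrier Y \<Longrightarrow> g y \<in> carrier Y'" and ga: "\<And>y. y \<in> carrier Y \<Longrightarrow> \<alpha>' (g y) = \<alpha> y"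
    and x: "x \<in> carrier (ctower Y n)"
  shows "caug Y' \<alpha>' n (gmap n g x) = caug Y \<alpha> n x"
proof (cases n)
  case 0 then show ?thesis using x ga by simp
next
  case (Suc n')
  have "x \<in> carrier (ctower Y (Suc n')) \<Longrightarrow> caug Y' \<alpha>' (Suc n') (gmap (Suc n') g x) = caug Y \<alpha> (Suc n') x" for x
  proof (induction n' arbitrary: x)
    case 0
    show ?case
    proof (rule free_cring_hom_eq[OF _ _ R])
      show "x \<in> carrier (free_cring (carrier Y))" using 0 by simp
      show "(\<lambda>x. caug Y' \<alpha>' (Suc 0) (gmap (Suc 0) g x)) \<in> ring_hom (free_cring (carrier Y)) R"
        using ring_hom_comp[OF gmap_hom_Suc[OF g, where n = 0] caug_hom[OF Y' a', of "Suc 0"]] by simp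
      show "caug Y \<alpha> (Suc 0) \<in> ring_hom (free_cring (carrier Y)) R"
        using caug_hom[OF Y a, of "Suc 0"] by simp
      show "caug Y' \<alpha>' (Suc 0) (gmap (Suc 0) g (var v)) = caug Y \<alpha> (Suc 0) (var v)" if "v \<in> carrier Y" for v
        using that g ga by (simp add: free_map_var counit_hom Y Y')
    qed
  next
    case (Suc n' x)
    have "cr_counit (ctower Y' (Suc n')) (free_map (gmap (Suc n') g) x) =
        gmap (Suc n') g (cr_counit (ctower Y (Suc n')) x)"
      using counit_natural[OF cring_ctower[OF Y] cring_ctower[OF Y'] gmap_hom_Suc[OF g]] Suc.prems by simp
    moreover have "cr_counit (ctower Y (Suc n')) x \<in> carrier (ctower Y (Suc n'))"
      using ring_hom_closed[OF counit_hom(1)[OF cring_ctower[OF Y]], of x "Suc n'"] Suc.prems by simp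
    ultimately show ?case using Suc.IH by simp
  qed
  then show ?thesis using x Suc by simp
qed

text \<open>The variables \<open>\<Psi>\<^sup>n s\<close> of the free Psi-ring on
  \<open>S\<close>.\<close>

definition ops :: "'a poly_tower set \<Rightarrow> 'a poly_tower set" where
  "ops S = {Op n s | n s. 1 \<le> n \<and> s \<in> S}"

text \<open>The commutative ring underlying \<open>psi_tower R n\<close>, as a plain ring record,
  so that it can be fed into \<open>ctower\<close>.\<close>

definition ytower :: "('a, 'x) psi_ring_scheme \<Rightarrow> nat \<Rightarrow> 'a poly_tower ring" where
  "ytower R n = (case n of 0 \<Rightarrow> base_ring R | Suc m \<Rightarrow> free_cring (ops (carrier (psi_tower R m))))"

lemma ytower_simps:
  "ytower R 0 = base_ring R" "ytower R (Suc n) = free_cring (ops (carrier (psi_tower R n)))"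
  by (simp_all add: ytower_def)

lemma psi_tower_truncate:
  shows carrier_psi_tower: "carrier (psi_tower R n) = carrier (ytower R n)"
    and ring_hom_psi_tower1: "ring_hom (psi_tower R n) B = ring_hom (ytower R n) B"
    and ring_hom_psi_tower2: "ring_hom A (psi_tower R n) = ring_hom A (ytower R n)"
  by (cases n; auto simp: ytower_def base_psi_ring_def free_psi_ring_def ring.defs ring_hom_def ops_def)+

lemma psi_psi_tower:
  "psi (psi_tower R 0) k = (\<lambda>x. Base (psi R k (un_Base x)))"
  "psi (psi_tower R (Suc n)) k = free_map (op_mult k)"
  "psi (base_psi_ring R) k = (\<lambda>x. Base (psi R k (un_Base x)))"
  "psi (free_psi_ring S) k = free_map (op_mult k)"
  "carrier (base_psi_ring R) = Base ` carrier R"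
  by (simp_all add: base_ring_def base_psi_ring_def free_psi_ring_def ring.defs)

lemma cring_base_ring:
  assumes "cring R"
  shows "cring (base_ring R)" "un_Base \<in> ring_hom (base_ring R) R"
proof -
  interpret cring R by fact
  show "cring (base_ring R)"
  proof (rule cringI)
    show "abelian_group (base_ring R)"
    proof (rule abelian_groupI)
      fix x assume "x \<in> carrier (base_ring R)"
      then obtain y where "y \<in> carrier R" "x = Base y" by (auto simp: base_ring_def)
      then show "\<exists>y\<in>carrier (base_ring R). y \<oplus>\<^bsub>base_ring R\<^esub> x = \<zero>\<^bsub>base_ring R\<^esub>"
        by (intro bexI[of _ "Base (\<ominus>\<^bsub>R\<^esub> y)"]) (auto simp: base_ring_def l_neg)
    qed (auto simp: base_ring_def a_ac)
    show "comm_monoid (base_ring R)"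
      by (rule comm_monoidI) (auto simp: base_ring_def m_ac)
  qed (auto simp: base_ring_def l_distr)
  show "un_Base \<in> ring_hom (base_ring R) R"
    by (rule ring_hom_memI) (auto simp: base_ring_def)
qed

lemma cring_transfer:
  assumes "cring A" "carrier B = carrier A" "\<And>x y. x \<otimes>\<^bsub>B\<^esub> y = x \<otimes>\<^bsub>A\<^esub> y" "\<one>\<^bsub>B\<^esub> = \<one>\<^bsub>A\<^esub>"
    "\<zero>\<^bsub>B\<^esub> = \<zero>\<^bsub>A\<^esub>" "\<And>x y. x \<oplus>\<^bsub>B\<^esub> y = x \<oplus>\<^bsub>A\<^esub> y"
  shows "cring B"
proof -
  interpret A: cring A by fact
  show ?thesis
  proof (rule cringI)
    show "abelian_group B"
      by (rule abelian_groupI) (auto simp: assms(2-) A.a_ac intro: A.a_closed bexI[of _ "\<ominus>\<^bsub>A\<^esub> _"] A.l_neg)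
    show "comm_monoid B"
      by (rule comm_monoidI) (auto simp: assms(2-) A.m_ac)
  qed (auto simp: assms(2-) A.l_distr)
qed

lemma cring_psi_tower:
  assumes "cring R"
  shows "cring (ytower R n)" "cring (psi_tower R n)"
proof -
  show Y: "cring (ytower R n)"
    using cring_base_ring[OF assms] cring_free_cring by (cases n) (auto simp: ytower_def)
  show "cring (psi_tower R n)"
    by (rule cring_transfer[OF Y])
      (cases n; simp add: ytower_def base_psi_ring_def free_psi_ring_def ring.defs ops_def)+
qed

lemma op_mult_ops: "1 \<le> k \<Longrightarrow> v \<in> ops S \<Longrightarrow> op_mult k v \<in> ops S"
  by (auto simp: ops_def)

lemma op_map_ops: "(\<And>s. s \<in> S \<Longrightarrow> g s \<in> T) \<Longrightarrow> v \<in> ops S \<Longrightarrow> op_map g v \<in> ops T"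
  by (auto simp: ops_def)

lemma psi_ring_psi_tower:
  assumes "psi_ring R"
  shows "psi_ring (psi_tower R n)"
proof -
  interpret R: psi_ring R by fact
  interpret T: cring "psi_tower R n" by (rule cring_psi_tower(2)[OF R.is_cring])
  show ?thesis
  proof (cases n)
    case 0
    show ?thesis
    proof
      show "psi (psi_tower R n) k \<in> ring_hom (psi_tower R n) (psi_tower R n)" if "1 \<le> k" for k
        unfolding ring_hom_psi_tower1 ring_hom_psi_tower2
        using R.psi_hom[OF that] by (auto simp: 0 ytower_def psi_psi_tower base_ring_def ring_hom_def Pi_iff)
    qed (auto simp: 0 carrier_psi_tower ytower_def psi_psi_tower base_ring_def R.psi_one[simplified] R.psi_comp)
  next
    case (Suc m)
    let ?S = "ops (carrier (psi_tower R m))"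
    show ?thesis
    proof
      show "psi (psi_tower R n) k \<in> ring_hom (psi_tower R n) (psi_tower R n)" if "1 \<le> k" for k
        unfolding ring_hom_psi_tower1 ring_hom_psi_tower2
        using free_map_hom[of ?S "op_mult k" ?S, OF op_mult_ops[OF that]] by (simp add: Suc ytower_def psi_psi_tower)
    next
      fix x assume "x \<in> carrier (psi_tower R n)"
      then have x: "x \<in> carrier (free_cring ?S)"
        unfolding Suc carrier_psi_tower[of R "Suc m"] ytower_simps .
      show "psi (psi_tower R n) 1 x = x"
        unfolding Suc psi_psi_tower by (rule free_map_id[OF x]) (auto simp: ops_def)
      fix k l :: nat
      have "free_map (op_mult k) (free_map (op_mult l) x) = free_map (op_mult (k * l)) x"
        unfolding free_map_comp[OF x] by (rule free_map_cong[OF x]) (auto simp: ops_def)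
      then show "psi (psi_tower R n) k (psi (psi_tower R n) l x) = psi (psi_tower R n) (k * l) x"
        unfolding Suc psi_psi_tower .
    qed
  qed
qed

text \<open>Homomorphisms of Psi-rings between two stages.\<close>

definition psi_mor :: "('a, 'x) psi_ring_scheme \<Rightarrow> nat \<Rightarrow> nat \<Rightarrow> ('a poly_tower \<Rightarrow> 'a poly_tower) \<Rightarrow> bool" where
  "psi_mor R m n g \<longleftrightarrow> g \<in> ring_hom (ytower R m) (ytower R n) \<and>
     (\<forall>k\<ge>1. \<forall>x\<in>carrier (ytower R m). g (psi (psi_tower R m) k x) = psi (psi_tower R n) k (g x))"

lemma psi_counit_hom:
  assumes R: "psi_ring R"
  shows "psi_counit (psi_tower R n) \<in> ring_hom (ytower R (Suc n)) (ytower R n)"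
    and psi_counit_var: "1 \<le> k \<Longrightarrow> s \<in> carrier (ytower R n) \<Longrightarrow>
      psi_counit (psi_tower R n) (var (Op k s)) = psi (psi_tower R n) k s"
proof -
  interpret T: psi_ring "psi_tower R n" by (rule psi_ring_psi_tower[OF R])
  let ?S = "ops (carrier (psi_tower R n))"
  have c: "op_eval (psi (psi_tower R n)) v \<in> carrier (psi_tower R n)" if "v \<in> ?S" for v
    using that ring_hom_closed[OF T.psi_hom] by (auto simp: ops_def)
  show "psi_counit (psi_tower R n) \<in> ring_hom (ytower R (Suc n)) (ytower R n)"
    using free_lift_hom[OF T.is_cring c] by (simp add: psi_counit_def ytower_simps ring_hom_psi_tower2)
  show "psi_counit (psi_tower R n) (var (Op k s)) = psi (psi_tower R n) k s"
    if "1 \<le> k" "s \<in> carrier (ytower R n)"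
    using free_lift_var[OF T.is_cring, of ?S "op_eval (psi (psi_tower R n))" "Op k s"] c that
    by (auto simp: psi_counit_def ops_def carrier_psi_tower)
qed

text \<open>Ring homomorphisms out of a free Psi-ring are compared on the symbols
  \<open>\<Psi>\<^sup>l s\<close>.\<close>

lemma psi_hom_eq:
  assumes R: "cring B" and h: "h \<in> ring_hom (ytower R (Suc n)) B" and k: "k \<in> ring_hom (ytower R (Suc n)) B"
    and v: "\<And>l s. 1 \<le> l \<Longrightarrow> s \<in> carrier (ytower R n) \<Longrightarrow> h (var (Op l s)) = k (var (Op l s))"
    and x: "x \<in> carrier (ytower R (Suc n))"
  shows "h x = k x"
  using free_cring_hom_eq[of h "ops (carrier (psi_tower R n))" B k x] assms
  by (auto simp: ytower_simps ops_def carrier_psi_tower)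

lemma psi_tower_psi_hom:
  assumes "psi_ring R" "1 \<le> k"
  shows "psi (psi_tower R n) k \<in> ring_hom (ytower R n) (ytower R n)"
  using psi_ring.psi_hom[OF psi_ring_psi_tower[OF assms(1)] assms(2), of n]
  by (simp add: ring_hom_psi_tower1 ring_hom_psi_tower2)

lemma comonad_tower_psi:
  assumes R: "psi_ring R"
  shows "comonad_tower (\<lambda>n. carrier (ytower R n)) (\<lambda>g. free_map (op_map g))
    (\<lambda>n. psi_counit (psi_tower R n)) (psi_mor R)"
proof
  interpret R: psi_ring R by fact
  note Y = cring_psi_tower(1)[OF R.is_cring]
  fix n
  interpret T: psi_ring "psi_tower R n" by (rule psi_ring_psi_tower[OF R])
  show "psi_mor R (Suc n) n (psi_counit (psi_tower R n))"
    unfolding psi_mor_def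
  proof (intro conjI allI impI ballI psi_counit_hom R)
    fix k :: nat and x assume k: "1 \<le> k" and x: "x \<in> carrier (ytower R (Suc n))"
    show "psi_counit (psi_tower R n) (psi (psi_tower R (Suc n)) k x) =
        psi (psi_tower R n) k (psi_counit (psi_tower R n) x)"
    proof (rule psi_hom_eq[OF Y _ _ _ x])
      show "(\<lambda>x. psi_counit (psi_tower R n) (psi (psi_tower R (Suc n)) k x)) \<in> ring_hom (ytower R (Suc n)) (ytower R n)"
        by (rule ring_hom_comp[OF psi_tower_psi_hom[OF R k] psi_counit_hom(1)[OF R]])
      show "(\<lambda>x. psi (psi_tower R n) k (psi_counit (psi_tower R n) x)) \<in> ring_hom (ytower R (Suc n)) (ytower R n)"
        by (rule ring_hom_comp[OF psi_counit_hom(1)[OF R] psi_tower_psi_hom[OF R k]])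
      show "psi_counit (psi_tower R n) (psi (psi_tower R (Suc n)) k (var (Op l s))) =
          psi (psi_tower R n) k (psi_counit (psi_tower R n) (var (Op l s)))"
        if "1 \<le> l" "s \<in> carrier (ytower R n)" for l s
        using that k T.psi_comp[of k l s]
        by (simp add: psi_psi_tower free_map_var psi_counit_var[OF R] carrier_psi_tower)
    qed
  qed
next
  interpret R: psi_ring R by fact
  note Y = cring_psi_tower(1)[OF R.is_cring]
  fix m n g x assume g: "psi_mor R m n g"
  then have gh: "g \<in> ring_hom (ytower R m) (ytower R n)" by (simp add: psi_mor_def)
  have gc: "g v \<in> carrier (ytower R n)" if "v \<in> carrier (ytower R m)" for v
    using ring_hom_closed[OF gh that] .
  then show "x \<in> carrier (ytower R m) \<Longrightarrow> g x \<in> carrier (ytower R n)" .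
  have Fg: "free_map (op_map g) \<in> ring_hom (ytower R (Suc m)) (ytower R (Suc n))"
    unfolding ytower_simps carrier_psi_tower by (rule free_map_hom, rule op_map_ops[OF gc])
  moreover have "free_map (op_map g) (free_map (op_mult k) x) = free_map (op_mult k) (free_map (op_map g) x)"
    if "x \<in> carrier (ytower R (Suc m))" for k x
    by (rule free_map_square[where S = "ops (carrier (psi_tower R m))"])
      (use that in \<open>auto simp: ops_def ytower_simps\<close>)
  ultimately show "psi_mor R (Suc m) (Suc n) (free_map (op_map g))"
    by (simp add: psi_mor_def psi_psi_tower)
  show "psi_counit (psi_tower R n) (free_map (op_map g) x) = g (psi_counit (psi_tower R m) x)"
    if x: "x \<in> carrier (ytower R (Suc m))"
  proof (rule psi_hom_eq[OF Y _ _ _ x])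
    show "(\<lambda>x. psi_counit (psi_tower R n) (free_map (op_map g) x)) \<in> ring_hom (ytower R (Suc m)) (ytower R n)"
      by (rule ring_hom_comp[OF Fg psi_counit_hom(1)[OF R]])
    show "(\<lambda>x. g (psi_counit (psi_tower R m) x)) \<in> ring_hom (ytower R (Suc m)) (ytower R n)"
      by (rule ring_hom_comp[OF psi_counit_hom(1)[OF R] gh])
    show "psi_counit (psi_tower R n) (free_map (op_map g) (var (Op l s))) =
          g (psi_counit (psi_tower R m) (var (Op l s)))"
      if "1 \<le> l" "s \<in> carrier (ytower R m)" for l s
      using that g gc[of s] by (simp add: free_map_var psi_counit_var[OF R] psi_mor_def)
  qed
next
  fix m x and g h g' h' :: "'a poly_tower \<Rightarrow> 'a poly_tower"
  assume e: "\<And>x. x \<in> carrier (ytower R m) \<Longrightarrow> h (g x) = h' (g' x)"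
    and x: "x \<in> carrier (ytower R (Suc m))"
  show "free_map (op_map h) (free_map (op_map g) x) = free_map (op_map h') (free_map (op_map g') x)"
    by (rule free_map_square[where S = "ops (carrier (psi_tower R m))"])
      (use e x in \<open>auto simp: ops_def ytower_simps carrier_psi_tower\<close>)
qed

lemma psi_face_simps:
  "psi_face R n 0 = psi_counit (psi_tower R n)"
  "psi_face R (Suc n) (Suc k) = free_map (op_map (psi_face R n k))"
  by (simp_all add: psi_face_def)

lemma psi_face_face:
  assumes R: "psi_ring R"
  shows "comonad_tower.face (\<lambda>g. free_map (op_map g)) (\<lambda>n. psi_counit (psi_tower R n)) n k = psi_face R n k"
  by (simp add: comonad_tower.face_def[OF comonad_tower_psi[OF R]] psi_face_def)

lemma psi_face_mor: "psi_ring R \<Longrightarrow> k \<le> n \<Longrightarrow> psi_mor R (Suc n) n (psi_face R n k)"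
  using comonad_tower.mor_face[OF comonad_tower_psi, of R k n] by (simp only: psi_face_face)

lemma psi_face_psi_face:
  "psi_ring R \<Longrightarrow> i < j \<Longrightarrow> j \<le> Suc n \<Longrightarrow> x \<in> carrier (ytower R (Suc (Suc n))) \<Longrightarrow>
     psi_face R n i (psi_face R (Suc n) j x) = psi_face R n (j - 1) (psi_face R (Suc n) i x)"
  using comonad_tower.face_face[OF comonad_tower_psi, of R i j n x] by (simp only: psi_face_face)

lemma psi_aug_face:
  "psi_ring R \<Longrightarrow> k \<le> n \<Longrightarrow> x \<in> carrier (ytower R (Suc n)) \<Longrightarrow>
     psi_aug R n (psi_face R n k x) = psi_aug R (Suc n) x"
  using comonad_tower.aug_face[OF comonad_tower_psi[of R], where aug = "psi_aug R" and n = n and k = k and x = x]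
  by (simp only: psi_face_face psi_aug.simps)

lemma psi_aug_hom:
  assumes R: "psi_ring R"
  shows "psi_aug R n \<in> ring_hom (ytower R n) R"
    and psi_aug_psi: "1 \<le> k \<Longrightarrow> x \<in> carrier (ytower R n) \<Longrightarrow>
        psi_aug R n (psi (psi_tower R n) k x) = psi R k (psi_aug R n x)"
proof -
  interpret R: psi_ring R by fact
  have "psi_aug R n \<in> ring_hom (ytower R n) R \<and> (\<forall>k\<ge>1. \<forall>x\<in>carrier (ytower R n).
      psi_aug R n (psi (psi_tower R n) k x) = psi R k (psi_aug R n x))"
  proof (induction n)
    case 0
    then show ?case
      using cring_base_ring(2)[OF R.is_cring] by (simp add: ytower_simps psi_psi_tower)
  next
    case (Suc n)
    have "psi_mor R (Suc n) n (psi_counit (psi_tower R n))"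
      using psi_face_mor[OF R, of 0 n] by (simp add: psi_face_simps)
    moreover have "(\<lambda>x. psi_aug R n (psi_counit (psi_tower R n) x)) \<in> ring_hom (ytower R (Suc n)) R"
      by (rule ring_hom_comp[OF psi_counit_hom(1)[OF R]]) (use Suc in simp)
    ultimately show ?case
      using Suc ring_hom_closed[OF psi_counit_hom(1)[OF R]] by (simp add: psi_mor_def comp_def)
  qed
  then show "psi_aug R n \<in> ring_hom (ytower R n) R"
    "1 \<le> k \<Longrightarrow> x \<in> carrier (ytower R n) \<Longrightarrow> psi_aug R n (psi (psi_tower R n) k x) = psi R k (psi_aug R n x)"
    by auto
qed


section \<open>Sections as derivations\<close>

lemma cring_semidirect:
  fixes R (structure)
  assumes "Module.module R M"
  shows "cring (semidirect R M)"
proof -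
  interpret Module.module R M by fact
  show ?thesis
  proof (rule cringI)
    show "abelian_group (semidirect R M)"
    proof (rule abelian_groupI)
      fix x assume "x \<in> carrier (semidirect R M)"
      then obtain r m where "r \<in> carrier R" "m \<in> carrier M" "x = (r, m)" by (auto simp: semidirect_def)
      then show "\<exists>y\<in>carrier (semidirect R M). y \<oplus>\<^bsub>semidirect R M\<^esub> x = \<zero>\<^bsub>semidirect R M\<^esub>"
        by (intro bexI[of _ "(\<ominus> r, \<ominus>\<^bsub>M\<^esub> m)"]) (auto simp: semidirect_def R.l_neg M.l_neg)
    qed (auto simp: semidirect_def R.a_ac M.a_ac)
    show "comm_monoid (semidirect R M)"
    proof (rule comm_monoidI)
      fix x y z assume "x \<in> carrier (semidirect R M)" "y \<in> carrier (semidirect R M)" "z \<in> carrier (semidirect R M)"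
      then obtain a k b l c m where "a \<in> carrier R" "k \<in> carrier M" "x = (a, k)"
          "b \<in> carrier R" "l \<in> carrier M" "y = (b, l)" "c \<in> carrier R" "m \<in> carrier M" "z = (c, m)"
        by (auto simp: semidirect_def)
      moreover have "c \<odot>\<^bsub>M\<^esub> (a \<odot>\<^bsub>M\<^esub> l) = a \<odot>\<^bsub>M\<^esub> (c \<odot>\<^bsub>M\<^esub> l)"
          "c \<odot>\<^bsub>M\<^esub> (b \<odot>\<^bsub>M\<^esub> k) = b \<odot>\<^bsub>M\<^esub> (c \<odot>\<^bsub>M\<^esub> k)"
        using calculation by (simp_all add: smult_assoc1[symmetric] m_comm[of c])
      ultimately show "x \<otimes>\<^bsub>semidirect R M\<^esub> y \<otimes>\<^bsub>semidirect R M\<^esub> z = x \<otimes>\<^bsub>semidirect R M\<^esub> (y \<otimes>\<^bsub>semidirect R M\<^esub> z)"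
        by (simp add: semidirect_def m_assoc smult_r_distr smult_assoc1 M.a_assoc)
    next
      fix x y assume "x \<in> carrier (semidirect R M)" "y \<in> carrier (semidirect R M)"
      then obtain a k b l where "a \<in> carrier R" "k \<in> carrier M" "x = (a, k)"
          "b \<in> carrier R" "l \<in> carrier M" "y = (b, l)"
        by (auto simp: semidirect_def)
      then show "x \<otimes>\<^bsub>semidirect R M\<^esub> y \<in> carrier (semidirect R M)"
          "x \<otimes>\<^bsub>semidirect R M\<^esub> y = y \<otimes>\<^bsub>semidirect R M\<^esub> x"
        by (simp_all add: semidirect_def m_comm[of a b] M.a_comm[of "a \<odot>\<^bsub>M\<^esub> l"])
    qed (auto simp: semidirect_def)
    fix x y z assume "x \<in> carrier (semidirect R M)" "y \<in> carrier (semidirect R M)" "z \<in> carrier (semidirect R M)"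
    then obtain a k b l c m where "a \<in> carrier R" "k \<in> carrier M" "x = (a, k)"
          "b \<in> carrier R" "l \<in> carrier M" "y = (b, l)" "c \<in> carrier R" "m \<in> carrier M" "z = (c, m)"
        by (auto simp: semidirect_def)
    then show "(x \<oplus>\<^bsub>semidirect R M\<^esub> y) \<otimes>\<^bsub>semidirect R M\<^esub> z =
        x \<otimes>\<^bsub>semidirect R M\<^esub> z \<oplus>\<^bsub>semidirect R M\<^esub> y \<otimes>\<^bsub>semidirect R M\<^esub> z"
      by (simp add: semidirect_def l_distr smult_l_distr smult_r_distr M.a_ac)
  qed
qed

context psi_module
begin

lemma is_cring_R: "cring R" ..

lemma psi_ring_R: "psi_ring R" ..

text \<open>The carrier of \<open>M\<close> is a set without type class structure. Its elements
  are represented in the free abelian group on the type \<open>'b\<close>, and \<open>ev\<close>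
  is the surjection back to \<open>M\<close>. Generators outside of the carrier are sent to zero,
  so that \<open>ev\<close> is a total homomorphism.\<close>

definition ev :: "('b \<Rightarrow>\<^sub>0 int) \<Rightarrow> 'b" where
  "ev = (SOME h. h \<in> hom (free_Abelian_group UNIV) (add_monoid M) \<and>
     (\<forall>x. h (frag_of x) = (if x \<in> carrier M then x else \<zero>\<^bsub>M\<^esub>)))"

lemma ev_props: "ev \<in> hom (free_Abelian_group UNIV) (add_monoid M)"
  "ev (frag_of x) = (if x \<in> carrier M then x else \<zero>\<^bsub>M\<^esub>)"
proof -
  let ?f = "\<lambda>x. if x \<in> carrier M then x else \<zero>\<^bsub>M\<^esub>"
  have f: "?f ` UNIV \<subseteq> carrier (add_monoid M)" by auto
  have "\<exists>h. h \<in> hom (free_Abelian_group UNIV) (add_monoid M) \<and> (\<forall>x. h (frag_of x) = ?f x)"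
  proof (rule comm_group.free_Abelian_group_universal[OF M.a_comm_group f])
    fix h assume h: "h \<in> hom (free_Abelian_group UNIV) (add_monoid M)" "\<And>x. x \<in> UNIV \<Longrightarrow> h (frag_of x) = ?f x"
    then show "\<exists>h. h \<in> hom (free_Abelian_group UNIV) (add_monoid M) \<and> (\<forall>x. h (frag_of x) = ?f x)"
      by (intro exI[of _ h] conjI allI h UNIV_I)
  qed
  then have "ev \<in> hom (free_Abelian_group UNIV) (add_monoid M) \<and> (\<forall>x. ev (frag_of x) = ?f x)"
    unfolding ev_def by (rule someI_ex)
  then show "ev \<in> hom (free_Abelian_group UNIV) (add_monoid M)"
    "ev (frag_of x) = (if x \<in> carrier M then x else \<zero>\<^bsub>M\<^esub>)" by auto
qed

lemma ev_closed [simp]: "ev c \<in> carrier M"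
  using hom_in_carrier[OF ev_props(1), of c] by simp

lemma ev_add: "ev (c + d) = ev c \<oplus>\<^bsub>M\<^esub> ev d"
  using hom_mult[OF ev_props(1), of c d] by simp

lemma ev_0 [simp]: "ev 0 = \<zero>\<^bsub>M\<^esub>"
  using ev_add[of 0 0] by (metis M.add.l_cancel_one' ev_closed add_0)

lemma ev_minus: "ev (- c) = \<ominus>\<^bsub>M\<^esub> ev c"
  using ev_add[of "- c" c] by (simp add: M.minus_equality)

lemma ev_diff: "ev (c - d) = ev c \<oplus>\<^bsub>M\<^esub> \<ominus>\<^bsub>M\<^esub> ev d"
  using ev_add[of c "- d"] ev_minus by simp

lemma ev_frag [simp]: "x \<in> carrier M \<Longrightarrow> ev (frag_of x) = x"
  by (simp add: ev_props)

lemma ev_eq_iff: "ev c = ev d \<longleftrightarrow> ev (c - d) = \<zero>\<^bsub>M\<^esub>"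
  unfolding ev_diff using M.minus_equality[of "ev c" "\<ominus>\<^bsub>M\<^esub> ev d"] by (auto simp: M.r_neg)

text \<open>An additive endomorphism of \<open>M\<close> lifts to formal sums through
  \<open>ev\<close>; the lift is additive on the nose.\<close>

definition lift_end :: "('b \<Rightarrow> 'b) \<Rightarrow> ('b \<Rightarrow>\<^sub>0 int) \<Rightarrow> ('b \<Rightarrow>\<^sub>0 int)" where
  "lift_end g = frag_extend (\<lambda>x. if x \<in> carrier M then frag_of (g x) else 0)"

lemma lift_end_add: "lift_end g (c + d) = lift_end g c + lift_end g d"
  by (simp add: lift_end_def frag_extend_add)

lemma ev_lift_end:
  assumes "g \<in> hom (add_monoid M) (add_monoid M)"
  shows "ev (lift_end g c) = g (ev c)"
proof -
  interpret g: group_hom "add_monoid M" "add_monoid M" g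
    using assms M.a_comm_group by (simp add: group_hom_def group_hom_axioms_def comm_group.axioms)
  have g: "x \<in> carrier M \<Longrightarrow> y \<in> carrier M \<Longrightarrow> g (x \<oplus>\<^bsub>M\<^esub> y) = g x \<oplus>\<^bsub>M\<^esub> g y"
      "x \<in> carrier M \<Longrightarrow> g (\<ominus>\<^bsub>M\<^esub> x) = \<ominus>\<^bsub>M\<^esub> g x" "x \<in> carrier M \<Longrightarrow> g x \<in> carrier M" for x y
    using g.hom_mult[of x y] g.hom_inv[of x] g.hom_closed[of x] by (auto simp: a_inv_def)
  have g0: "g \<zero>\<^bsub>M\<^esub> = \<zero>\<^bsub>M\<^esub>" using g.hom_one by simp
  show ?thesis
  proof (rule free_Abelian_group_induct[where S = UNIV and x = c and P = "\<lambda>c. ev (lift_end g c) = g (ev c)"])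
    fix a show "ev (lift_end g (frag_of a)) = g (ev (frag_of a))"
      by (simp add: lift_end_def ev_props g g0)
  next
    fix x y assume "ev (lift_end g x) = g (ev x)" "ev (lift_end g y) = g (ev y)"
    moreover have "lift_end g (x - y) = lift_end g x - lift_end g y"
      by (simp add: lift_end_def frag_extend_diff)
    ultimately show "ev (lift_end g (x - y)) = g (ev (x - y))"
      by (simp add: ev_diff g)
  qed (simp_all add: lift_end_def g0)
qed

text \<open>Maps into formal sums that become derivations over \<open>\<sigma>\<close> after
  evaluation. The map itself is not additive, and its values outside of the carrier are arbitrary;
  both defects disappear modulo \<open>Nul A\<close>.\<close>

definition Der :: "('t, 'z) ring_scheme \<Rightarrow> ('t \<Rightarrow> 'a) \<Rightarrow> ('t \<Rightarrow> ('b \<Rightarrow>\<^sub>0 int)) set" where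
  "Der A \<sigma> = {\<phi>. \<forall>x\<in>carrier A. \<forall>y\<in>carrier A.
     ev (\<phi> (x \<oplus>\<^bsub>A\<^esub> y)) = ev (\<phi> x) \<oplus>\<^bsub>M\<^esub> ev (\<phi> y) \<and>
     ev (\<phi> (x \<otimes>\<^bsub>A\<^esub> y)) = \<sigma> x \<odot>\<^bsub>M\<^esub> ev (\<phi> y) \<oplus>\<^bsub>M\<^esub> \<sigma> y \<odot>\<^bsub>M\<^esub> ev (\<phi> x)}"

definition Nul :: "('t, 'z) ring_scheme \<Rightarrow> ('t \<Rightarrow> ('b \<Rightarrow>\<^sub>0 int)) set" where
  "Nul A = {\<phi>. \<forall>x\<in>carrier A. ev (\<phi> x) = \<zero>\<^bsub>M\<^esub>}"

lemma subgrp_Nul: "subgrp (Nul A)"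
  by (auto simp: subgrp_def Nul_def ev_diff)

lemma Nul_diff_iff: "\<phi> - \<psi> \<in> Nul A \<longleftrightarrow> (\<forall>x\<in>carrier A. ev (\<phi> x) = ev (\<psi> x))"
  by (simp add: Nul_def ev_eq_iff[of "\<phi> _" "\<psi> _"])

lemma DerD:
  assumes "\<phi> \<in> Der A \<sigma>" "x \<in> carrier A" "y \<in> carrier A"
  shows "ev (\<phi> (x \<oplus>\<^bsub>A\<^esub> y)) = ev (\<phi> x) \<oplus>\<^bsub>M\<^esub> ev (\<phi> y)"
    "ev (\<phi> (x \<otimes>\<^bsub>A\<^esub> y)) = \<sigma> x \<odot>\<^bsub>M\<^esub> ev (\<phi> y) \<oplus>\<^bsub>M\<^esub> \<sigma> y \<odot>\<^bsub>M\<^esub> ev (\<phi> x)"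
  using assms by (auto simp: Der_def)

lemma subgrp_Der:
  assumes s: "\<And>x. x \<in> carrier A \<Longrightarrow> \<sigma> x \<in> carrier R"
  shows "subgrp (Der A \<sigma>)"
  unfolding subgrp_def
proof (intro conjI ballI)
  show "0 \<in> Der A \<sigma>" using s by (auto simp: Der_def smult_r_null)
  fix \<phi> \<psi> assume *: "\<phi> \<in> Der A \<sigma>" "\<psi> \<in> Der A \<sigma>"
  show "\<phi> - \<psi> \<in> Der A \<sigma>"
    unfolding Der_def
  proof (intro CollectI ballI conjI)
    fix x y assume x: "x \<in> carrier A" and y: "y \<in> carrier A"
    show "ev ((\<phi> - \<psi>) (x \<oplus>\<^bsub>A\<^esub> y)) = ev ((\<phi> - \<psi>) x) \<oplus>\<^bsub>M\<^esub> ev ((\<phi> - \<psi>) y)"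
      by (simp add: ev_diff DerD(1)[OF *(1) x y] DerD(1)[OF *(2) x y] M.minus_add M.a_ac)
    show "ev ((\<phi> - \<psi>) (x \<otimes>\<^bsub>A\<^esub> y)) =
        \<sigma> x \<odot>\<^bsub>M\<^esub> ev ((\<phi> - \<psi>) y) \<oplus>\<^bsub>M\<^esub> \<sigma> y \<odot>\<^bsub>M\<^esub> ev ((\<phi> - \<psi>) x)"
      using s[OF x] s[OF y]
      by (simp add: ev_diff DerD(2)[OF *(1) x y] DerD(2)[OF *(2) x y] M.minus_add M.a_ac
          smult_r_distr smult_r_minus)
  qed
qed

lemma Nul_subset_Der:
  assumes "cring A" "\<And>x. x \<in> carrier A \<Longrightarrow> \<sigma> x \<in> carrier R"
  shows "Nul A \<subseteq> Der A \<sigma>"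
proof -
  interpret A: cring A by fact
  show ?thesis using assms(2) by (auto simp: Nul_def Der_def smult_r_null)
qed

lemma Der_comp:
  assumes "h \<in> ring_hom A B" "\<phi> \<in> Der B \<tau>" "\<And>x. x \<in> carrier A \<Longrightarrow> \<tau> (h x) = \<sigma> x"
  shows "(\<lambda>x. \<phi> (h x)) \<in> Der A \<sigma>"
  using assms ring_hom_closed[OF assms(1)]
  by (auto simp: Der_def ring_hom_mult ring_hom_add)

lemma Nul_comp: "(\<And>x. x \<in> carrier A \<Longrightarrow> h x \<in> carrier B) \<Longrightarrow> \<phi> \<in> Nul B \<Longrightarrow> (\<lambda>x. \<phi> (h x)) \<in> Nul A"
  by (auto simp: Nul_def)

definition pushf :: "nat \<Rightarrow> ('t \<Rightarrow> ('b \<Rightarrow>\<^sub>0 int)) \<Rightarrow> 't \<Rightarrow> ('b \<Rightarrow>\<^sub>0 int)" where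
  "pushf u \<phi> = (\<lambda>x. lift_end (mpsi M u) (\<phi> x))"

lemma ev_pushf: "1 \<le> u \<Longrightarrow> ev (pushf u \<phi> x) = mpsi M u (ev (\<phi> x))"
  unfolding pushf_def by (rule ev_lift_end[OF mpsi_hom])

lemma additive_pushf: "additive (pushf u)"
  by (simp add: additive_def pushf_def lift_end_add fun_eq_iff)

lemma mpsi_props:
  assumes "1 \<le> u"
  shows "m \<in> carrier M \<Longrightarrow> mpsi M u m \<in> carrier M"
    "m \<in> carrier M \<Longrightarrow> m' \<in> carrier M \<Longrightarrow> mpsi M u (m \<oplus>\<^bsub>M\<^esub> m') = mpsi M u m \<oplus>\<^bsub>M\<^esub> mpsi M u m'"
    "mpsi M u \<zero>\<^bsub>M\<^esub> = \<zero>\<^bsub>M\<^esub>"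
proof -
  show 1: "m \<in> carrier M \<Longrightarrow> mpsi M u m \<in> carrier M"
    and 2: "m \<in> carrier M \<Longrightarrow> m' \<in> carrier M \<Longrightarrow> mpsi M u (m \<oplus>\<^bsub>M\<^esub> m') = mpsi M u m \<oplus>\<^bsub>M\<^esub> mpsi M u m'" for m m'
    using hom_in_carrier[OF mpsi_hom[OF assms], of m] hom_mult[OF mpsi_hom[OF assms], of m m'] by auto
  show "mpsi M u \<zero>\<^bsub>M\<^esub> = \<zero>\<^bsub>M\<^esub>"
    using ev_lift_end[OF mpsi_hom[OF assms], of 0] by (simp add: lift_end_def)
qed

lemma Der_pushf:
  assumes u: "1 \<le> u" and p: "\<phi> \<in> Der A \<sigma>" and s: "\<And>x. x \<in> carrier A \<Longrightarrow> \<sigma> x \<in> carrier R"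
  shows "pushf u \<phi> \<in> Der A (\<lambda>x. psi R u (\<sigma> x))"
  unfolding Der_def
proof (intro CollectI ballI conjI)
  fix x y assume xy: "x \<in> carrier A" "y \<in> carrier A"
  note D = DerD[OF p xy]
  show "ev (pushf u \<phi> (x \<oplus>\<^bsub>A\<^esub> y)) = ev (pushf u \<phi> x) \<oplus>\<^bsub>M\<^esub> ev (pushf u \<phi> y)"
    using u by (simp add: ev_pushf D mpsi_props)
  show "ev (pushf u \<phi> (x \<otimes>\<^bsub>A\<^esub> y)) =
     psi R u (\<sigma> x) \<odot>\<^bsub>M\<^esub> ev (pushf u \<phi> y) \<oplus>\<^bsub>M\<^esub> psi R u (\<sigma> y) \<odot>\<^bsub>M\<^esub> ev (pushf u \<phi> x)"
    using u s xy by (simp add: ev_pushf D mpsi_props mpsi_smult)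
qed

lemma Nul_pushf: "1 \<le> u \<Longrightarrow> \<phi> \<in> Nul A \<Longrightarrow> pushf u \<phi> \<in> Nul A"
  by (simp add: Nul_def ev_pushf mpsi_props)

lemma Der_diff_zero:
  assumes A: "cring A" and p: "\<phi> \<in> Der A \<sigma>" and s: "\<sigma> \<in> ring_hom A R"
  shows "ev (\<phi> \<one>\<^bsub>A\<^esub>) = \<zero>\<^bsub>M\<^esub>"
    and "\<lbrakk>x \<in> carrier A; y \<in> carrier A; ev (\<phi> x) = \<zero>\<^bsub>M\<^esub>; ev (\<phi> y) = \<zero>\<^bsub>M\<^esub>\<rbrakk> \<Longrightarrow> ev (\<phi> (x \<ominus>\<^bsub>A\<^esub> y)) = \<zero>\<^bsub>M\<^esub>"
proof -
  interpret A: cring A by fact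
  have "ev (\<phi> \<one>\<^bsub>A\<^esub>) = ev (\<phi> \<one>\<^bsub>A\<^esub>) \<oplus>\<^bsub>M\<^esub> ev (\<phi> \<one>\<^bsub>A\<^esub>)"
    using DerD(2)[OF p A.one_closed A.one_closed] ring_hom_one[OF s] by simp
  then show "ev (\<phi> \<one>\<^bsub>A\<^esub>) = \<zero>\<^bsub>M\<^esub>" by (metis M.add.l_cancel_one' ev_closed)
  assume xy: "x \<in> carrier A" "y \<in> carrier A" and z: "ev (\<phi> x) = \<zero>\<^bsub>M\<^esub>" "ev (\<phi> y) = \<zero>\<^bsub>M\<^esub>"
  have "(x \<ominus>\<^bsub>A\<^esub> y) \<oplus>\<^bsub>A\<^esub> y = x" using xy by (simp add: A.minus_eq A.a_assoc A.l_neg)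
  then show "ev (\<phi> (x \<ominus>\<^bsub>A\<^esub> y)) = \<zero>\<^bsub>M\<^esub>"
    using DerD(1)[OF p A.minus_closed[OF xy] xy(2)] z by simp
qed

lemma Der_free_zero:
  assumes p: "\<phi> \<in> Der (free_cring S) \<sigma>" and s: "\<sigma> \<in> ring_hom (free_cring S) R"
    and v: "\<And>v. v \<in> S \<Longrightarrow> ev (\<phi> (var v)) = \<zero>\<^bsub>M\<^esub>"
  shows "\<phi> \<in> Nul (free_cring S)"
  unfolding Nul_def
proof (intro CollectI ballI)
  fix x assume "x \<in> carrier (free_cring S)"
  then show "ev (\<phi> x) = \<zero>\<^bsub>M\<^esub>"
  proof (induction rule: free_cring_induct)
    case one show ?case by (rule Der_diff_zero(1)[OF cring_free_cring p s])
  next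
    case (var w) then show ?case by (rule v)
  next
    case (diff x y) then show ?case by (intro Der_diff_zero(2)[OF cring_free_cring p s])
  next
    case (mult x y)
    then show ?case using DerD(2)[OF p mult(1,2)] ring_hom_closed[OF s] by (simp add: smult_r_null)
  qed
qed

lemma Der_free_eq:
  assumes "\<phi> \<in> Der (free_cring S) \<sigma>" "\<psi> \<in> Der (free_cring S) \<sigma>" "\<sigma> \<in> ring_hom (free_cring S) R"
    and "\<And>v. v \<in> S \<Longrightarrow> ev (\<phi> (var v)) = ev (\<psi> (var v))"
  shows "\<phi> - \<psi> \<in> Nul (free_cring S)"
proof (rule Der_free_zero[OF _ assms(3)])
  show "\<phi> - \<psi> \<in> Der (free_cring S) \<sigma>"
    by (rule subgrp_diff[OF subgrp_Der assms(1,2)]) (rule ring_hom_closed[OF assms(3)])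
  show "ev ((\<phi> - \<psi>) (var v)) = \<zero>\<^bsub>M\<^esub>" if "v \<in> S" for v
    using assms(4)[OF that] ev_eq_iff[of "\<phi> (var v)" "\<psi> (var v)"] by simp
qed

text \<open>A derivation over \<open>\<sigma>\<close> is the second component of a ring
  homomorphism to the square-zero extension lifting \<open>\<sigma>\<close>, and such
  homomorphisms are determined freely on the variables.\<close>

lemma Der_free_extend:
  fixes S :: "'v poly_tower set"
  assumes s: "\<sigma> \<in> ring_hom (free_cring S) R" and g: "\<And>v. v \<in> S \<Longrightarrow> g v \<in> carrier M"
  shows "\<exists>\<phi>\<in>Der (free_cring S) \<sigma>. \<forall>v\<in>S. ev (\<phi> (var v)) = g v"
proof -
  let ?X = "semidirect R M"
  have X: "cring ?X" by (rule cring_semidirect[OF module_axioms])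
  have gX: "(\<sigma> (var v), g v) \<in> carrier ?X" if "v \<in> S" for v
    using ring_hom_closed[OF s var_carrier[OF that]] g[OF that] by (simp add: semidirect_def)
  define L where "L = free_lift ?X (\<lambda>v. (\<sigma> (var v), g v))"
  have L: "L \<in> ring_hom (free_cring S) ?X" unfolding L_def by (rule free_lift_hom[OF X]) (rule gX)
  have Lv: "L (var v) = (\<sigma> (var v), g v)" if "v \<in> S" for v
    unfolding L_def by (rule free_lift_var[OF X _ that]) (rule gX)
  have fst: "fst \<in> ring_hom ?X R" by (rule ring_hom_memI) (auto simp: semidirect_def)
  have Ls: "fst (L x) = \<sigma> x" if x: "x \<in> carrier (free_cring S)" for x
  proof (rule free_cring_hom_eq[OF _ s is_cring_R _ x, where h = "\<lambda>x. fst (L x)"])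
    show "(\<lambda>x. fst (L x)) \<in> ring_hom (free_cring S) R" by (rule ring_hom_comp[OF L fst])
    show "fst (L (var v)) = \<sigma> (var v)" if "v \<in> S" for v using Lv[OF that] by simp
  qed
  have LM: "snd (L x) \<in> carrier M" if "x \<in> carrier (free_cring S)" for x
    using ring_hom_closed[OF L that] by (auto simp: semidirect_def)
  interpret F: cring "free_cring S" by (rule cring_free_cring)
  have "(\<lambda>x. frag_of (snd (L x))) \<in> Der (free_cring S) \<sigma>"
    unfolding Der_def
  proof (intro CollectI ballI conjI)
    fix x y assume x: "x \<in> carrier (free_cring S)" and y: "y \<in> carrier (free_cring S)"
    define m n where "m = snd (L x)" and "n = snd (L y)"
    then have Lxy: "L x = (\<sigma> x, m)" "L y = (\<sigma> y, n)" and mn: "m \<in> carrier M" "n \<in> carrier M"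
      using Ls[OF x] Ls[OF y] LM[OF x] LM[OF y] by (simp_all add: prod_eq_iff)
    have "L (x \<oplus>\<^bsub>free_cring S\<^esub> y) = (\<sigma> x \<oplus> \<sigma> y, m \<oplus>\<^bsub>M\<^esub> n)"
      "L (x \<otimes>\<^bsub>free_cring S\<^esub> y) = (\<sigma> x \<otimes> \<sigma> y, \<sigma> x \<odot>\<^bsub>M\<^esub> n \<oplus>\<^bsub>M\<^esub> \<sigma> y \<odot>\<^bsub>M\<^esub> m)"
      using ring_hom_add[OF L x y] ring_hom_mult[OF L x y] Lxy by (simp_all add: semidirect_def)
    then show "ev (frag_of (snd (L (x \<oplus>\<^bsub>free_cring S\<^esub> y)))) = ev (frag_of (snd (L x))) \<oplus>\<^bsub>M\<^esub> ev (frag_of (snd (L y)))"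
      "ev (frag_of (snd (L (x \<otimes>\<^bsub>free_cring S\<^esub> y)))) =
        \<sigma> x \<odot>\<^bsub>M\<^esub> ev (frag_of (snd (L y))) \<oplus>\<^bsub>M\<^esub> \<sigma> y \<odot>\<^bsub>M\<^esub> ev (frag_of (snd (L x)))"
      using Lxy mn ring_hom_closed[OF s x] ring_hom_closed[OF s y] by simp_all
  qed
  moreover have "\<forall>v\<in>S. ev (frag_of (snd (L (var v)))) = g v"
    using Lv g by simp
  ultimately show ?thesis by (intro bexI[of _ "\<lambda>x. frag_of (snd (L x))"])
qed

definition sec :: "('t, 'z) ring_scheme \<Rightarrow> ('t \<Rightarrow> 'a) \<Rightarrow> ('t \<Rightarrow> ('b \<Rightarrow>\<^sub>0 int)) \<Rightarrow> 't \<Rightarrow> 't \<times> 'a \<times> 'b" where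
  "sec A \<alpha> \<phi> = (\<lambda>x\<in>carrier A. (x, \<alpha> x, ev (\<phi> x)))"

lemma twist_simps:
  "carrier (twist R M f) = carrier M" "x \<oplus>\<^bsub>twist R M f\<^esub> y = x \<oplus>\<^bsub>M\<^esub> y" "\<zero>\<^bsub>twist R M f\<^esub> = \<zero>\<^bsub>M\<^esub>"
  "r \<odot>\<^bsub>twist R M f\<^esub> a = psi R f r \<odot>\<^bsub>M\<^esub> a"
  by (simp_all add: twist_def)

text \<open>The fibre product has the element \<open>(x, r, m)\<close> over \<open>x\<close> only
  for \<open>r = \<alpha> x\<close>, so a section is determined by its third component.
  Multiplicativity in \<open>R \<rtimes> M\<^sup>f\<close> is the Leibniz rule for the action
  twisted by \<open>\<Psi>\<^sup>f\<close>.\<close>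

lemma presents_ring_sections:
  assumes A: "cring A" and a: "\<alpha> \<in> ring_hom A R" and f: "1 \<le> f"
  shows "presents (Der A (\<lambda>x. psi R f (\<alpha> x))) (Nul A)
    (section_group A \<alpha> (twist R M f) (ring_sections A (pullback_ring A (semidirect R (twist R M f)) \<alpha> fst)))
    (sec A \<alpha>)"
proof -
  interpret A: cring A by fact
  let ?s = "\<lambda>x. psi R f (\<alpha> x)"
  have s: "?s x \<in> carrier R" if "x \<in> carrier A" for x
    using ring_hom_closed[OF psi_hom[OF f]] ring_hom_closed[OF a that] by blast
  have sh: "?s \<in> ring_hom A R" by (rule ring_hom_comp[OF a psi_hom[OF f]])
  let ?P = "pullback_ring A (semidirect R (twist R M f)) \<alpha> fst"
  have "sec A \<alpha> ` Der A ?s = ring_sections A ?P"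
  proof (rule equalityI; rule subsetI)
    fix t assume "t \<in> sec A \<alpha> ` Der A ?s"
    then obtain \<phi> where p: "\<phi> \<in> Der A ?s" and t: "t = sec A \<alpha> \<phi>" by blast
    show "t \<in> ring_sections A ?P"
      unfolding ring_sections_def t
    proof (intro CollectI conjI ballI ring_hom_memI)
      fix x y assume xy: "x \<in> carrier A" "y \<in> carrier A"
      show "sec A \<alpha> \<phi> (x \<otimes>\<^bsub>A\<^esub> y) = sec A \<alpha> \<phi> x \<otimes>\<^bsub>?P\<^esub> sec A \<alpha> \<phi> y"
        "sec A \<alpha> \<phi> (x \<oplus>\<^bsub>A\<^esub> y) = sec A \<alpha> \<phi> x \<oplus>\<^bsub>?P\<^esub> sec A \<alpha> \<phi> y"
        using xy DerD[OF p xy] ring_hom_mult[OF a xy] ring_hom_add[OF a xy]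
        by (simp_all add: sec_def pullback_ring_def RDirProd_def DirProd_def monoid.defs semidirect_def twist_simps ring.defs)
    qed (use a Der_diff_zero(1)[OF A p sh] ring_hom_closed[OF a] ring_hom_one[OF a] in
        \<open>auto simp: sec_def pullback_ring_def RDirProd_def DirProd_def monoid.defs semidirect_def twist_simps ring.defs\<close>)
  next
    fix t assume t: "t \<in> ring_sections A ?P"
    then have tE: "t \<in> extensional (carrier A)" and th: "t \<in> ring_hom A ?P"
      and tf: "\<And>x. x \<in> carrier A \<Longrightarrow> fst (t x) = x" by (auto simp: ring_sections_def)
    have tx: "t x = (x, \<alpha> x, snd (snd (t x)))" "snd (snd (t x)) \<in> carrier M" if "x \<in> carrier A" for x
      using tf[OF that] ring_hom_closed[OF th that]
      by (auto simp: pullback_ring_def RDirProd_def DirProd_def monoid.defs semidirect_def twist_simps ring.defs prod_eq_iff)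
    let ?\<phi> = "\<lambda>x. frag_of (snd (snd (t x)))"
    have "?\<phi> \<in> Der A ?s"
      unfolding Der_def
    proof (intro CollectI ballI conjI)
      fix x y assume xy: "x \<in> carrier A" "y \<in> carrier A"
      obtain m n where m: "t x = (x, \<alpha> x, m)" "m \<in> carrier M" and n: "t y = (y, \<alpha> y, n)" "n \<in> carrier M"
        using tx xy by metis
      show "ev (?\<phi> (x \<oplus>\<^bsub>A\<^esub> y)) = ev (?\<phi> x) \<oplus>\<^bsub>M\<^esub> ev (?\<phi> y)"
        "ev (?\<phi> (x \<otimes>\<^bsub>A\<^esub> y)) = psi R f (\<alpha> x) \<odot>\<^bsub>M\<^esub> ev (?\<phi> y) \<oplus>\<^bsub>M\<^esub> psi R f (\<alpha> y) \<odot>\<^bsub>M\<^esub> ev (?\<phi> x)"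
        using ring_hom_add[OF th xy] ring_hom_mult[OF th xy] m n s xy
        by (auto simp: pullback_ring_def RDirProd_def DirProd_def monoid.defs semidirect_def twist_simps ring.defs)
    qed
    moreover have "t = sec A \<alpha> ?\<phi>"
    proof (rule extensionalityI[OF tE])
      show "sec A \<alpha> ?\<phi> \<in> extensional (carrier A)" by (simp add: sec_def)
      show "t x = sec A \<alpha> ?\<phi> x" if "x \<in> carrier A" for x
        using tx[OF that] that by (simp add: sec_def)
    qed
    ultimately show "t \<in> sec A \<alpha> ` Der A ?s" by blast
  qed
  then show ?thesis
    unfolding presents_def
  proof (intro conjI ballI subgrp_Der[OF s] subgrp_Nul)
    fix \<phi> assume "\<phi> \<in> Der A ?s"
    show "sec A \<alpha> \<phi> = \<one>\<^bsub>section_group A \<alpha> (twist R M f) (ring_sections A ?P)\<^esub> \<longleftrightarrow> \<phi> \<in> Nul A"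
      by (auto simp: section_group_def sec_def Nul_def twist_simps fun_eq_iff restrict_def)
  qed (auto simp: section_group_def sec_def fibre_add_def twist_simps ev_add fun_eq_iff restrict_def)
qed

definition PsiDer :: "('t, 'z) psi_ring_scheme \<Rightarrow> ('t \<Rightarrow> 'a) \<Rightarrow> ('t \<Rightarrow> ('b \<Rightarrow>\<^sub>0 int)) set" where
  "PsiDer A \<alpha> = {\<phi> \<in> Der A \<alpha>. \<forall>n\<ge>1. \<forall>x\<in>carrier A. ev (\<phi> (psi A n x)) = mpsi M n (ev (\<phi> x))}"

lemma subgrp_PsiDer:
  assumes "\<alpha> \<in> ring_hom A R"
  shows "subgrp (PsiDer A \<alpha>)"
proof -
  have m: "mpsi M n (\<ominus>\<^bsub>M\<^esub> m) = \<ominus>\<^bsub>M\<^esub> mpsi M n m" if "1 \<le> n" "m \<in> carrier M" for n m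
    using mpsi_props(2)[OF that(1), of "\<ominus>\<^bsub>M\<^esub> m" m] that mpsi_props(1,3)[OF that(1)]
    by (simp add: M.l_neg M.minus_equality)
  have S: "subgrp (Der A \<alpha>)" by (rule subgrp_Der) (rule ring_hom_closed[OF assms])
  then show ?thesis
    unfolding subgrp_def PsiDer_def by (auto simp: ev_diff mpsi_props m)
qed

text \<open>The untwisted case \<open>f = 1\<close> of \<open>presents_ring_sections\<close>,
  restricted to the sections that commute with the operations.\<close>

lemma presents_psi_ring_sections:
  assumes A: "psi_ring A" and a: "\<alpha> \<in> ring_hom A R"
    and ap: "\<And>n x. 1 \<le> n \<Longrightarrow> x \<in> carrier A \<Longrightarrow> \<alpha> (psi A n x) = psi R n (\<alpha> x)"
  shows "presents (PsiDer A \<alpha>) (Nul A)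
    (section_group A \<alpha> M (psi_ring_sections A (pullback_psi_ring A (psi_semidirect R M) \<alpha> fst)))
    (sec A \<alpha>)"
proof -
  interpret A: psi_ring A by fact
  let ?P = "pullback_psi_ring A (psi_semidirect R M) \<alpha> fst"
  let ?P' = "pullback_ring A (semidirect R (twist R M 1)) \<alpha> fst"
  have R1: "psi R 1 r = r" if "r \<in> carrier R" for r by (rule psi_one[OF that])
  have Deq: "Der A (\<lambda>x. psi R 1 (\<alpha> x)) = Der A \<alpha>"
    using R1 ring_hom_closed[OF a] unfolding Der_def by (auto simp: A.a_closed)
  have Q: "presents (Der A \<alpha>) (Nul A) (section_group A \<alpha> (twist R M 1) (ring_sections A ?P')) (sec A \<alpha>)"
    using presents_ring_sections[OF A.is_cring a, of 1] unfolding Deq by simp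
  have "ring_hom A ?P = ring_hom A ?P'"
  proof -
    have c: "carrier ?P = carrier ?P'" "\<one>\<^bsub>?P\<^esub> = \<one>\<^bsub>?P'\<^esub>" "\<And>x y. x \<oplus>\<^bsub>?P\<^esub> y = x \<oplus>\<^bsub>?P'\<^esub> y"
      by (simp_all add: pullback_psi_ring_def psi_semidirect_def pullback_ring_def RDirProd_def DirProd_def
          monoid.defs semidirect_def twist_simps ring.defs)
    have m: "x \<otimes>\<^bsub>?P\<^esub> y = x \<otimes>\<^bsub>?P'\<^esub> y" if "x \<in> carrier ?P'" "y \<in> carrier ?P'" for x y
      using that R1 by (auto simp: pullback_psi_ring_def psi_semidirect_def pullback_ring_def RDirProd_def DirProd_def
          monoid.defs semidirect_def twist_simps ring.defs)
    show ?thesis unfolding ring_hom_def c by (auto simp: Pi_iff m)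
  qed
  then have rs: "ring_sections A ?P = ring_sections A ?P'" by (simp add: ring_sections_def)
  have im: "sec A \<alpha> ` Der A \<alpha> = ring_sections A ?P'" using Q by (simp add: presents_def section_group_def)
  have psiP: "psi ?P n (x, r, m) = (psi A n x, psi R n r, mpsi M n m)" for n x r m
    by (simp add: pullback_psi_ring_def psi_semidirect_def ring.defs)
  have *: "(\<forall>n\<ge>1. \<forall>x\<in>carrier A. sec A \<alpha> \<phi> (psi A n x) = psi ?P n (sec A \<alpha> \<phi> x)) \<longleftrightarrow>
      (\<forall>n\<ge>1. \<forall>x\<in>carrier A. ev (\<phi> (psi A n x)) = mpsi M n (ev (\<phi> x)))" for \<phi>
    using ring_hom_closed[OF A.psi_hom] ap by (auto simp: sec_def psiP)
  have "sec A \<alpha> ` PsiDer A \<alpha> = psi_ring_sections A ?P"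
    unfolding psi_ring_sections_def rs im[symmetric] PsiDer_def using * by auto
  then show ?thesis
    using Q subgrp_PsiDer[OF a]
    by (simp add: presents_def section_group_def PsiDer_def fibre_add_def twist_simps)
qed

end


section \<open>Alternating sums and cohomology of presented complexes\<close>

text \<open>The cancellation behind \<open>d \<circ> d = 0\<close>, with the cosimplicial identity
  \<open>d\<^sub>j d\<^sub>i = d\<^sub>i d\<^sub>j\<^sub>-\<^sub>1\<close> holding modulo
  \<open>N\<close>: the terms with \<open>i < j\<close> are matched with those with \<open>j \<le>
  i\<close>.\<close>

lemma alternating_square:
  fixes a :: "nat \<Rightarrow> nat \<Rightarrow> 'y::ab_group_add"
  assumes N: "subgrp N" and a: "\<And>i j. i < j \<Longrightarrow> j \<le> Suc n \<Longrightarrow> a j i - a i (j - 1) \<in> N"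
  shows "(\<Sum>j\<le>Suc n. \<Sum>i\<le>n. alt j (alt i (a j i))) \<in> N"
proof -
  let ?g = "\<lambda>(j, i). alt j (alt i (a j i))"
  let ?P = "{..Suc n} \<times> {..n}" and ?U = "{(j, i). j \<le> Suc n \<and> i < j}" and ?V = "{(j, i). i \<le> n \<and> j \<le> i}"
  have fin: "finite ?U" "finite ?V"
    by (rule finite_subset[of _ "{..Suc n} \<times> {..Suc n}"]; auto)+
  have "(\<Sum>j\<le>Suc n. \<Sum>i\<le>n. alt j (alt i (a j i))) = sum ?g ?P"
    by (simp add: sum.cartesian_product)
  also have "?P = ?U \<union> ?V" by auto
  also have "sum ?g (?U \<union> ?V) = sum ?g ?U + sum ?g ?V"
    by (rule sum.union_disjoint[OF fin]) auto
  also have "sum ?g ?V = sum (\<lambda>(j, i). - alt j (alt i (a i (j - 1)))) ?U"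
  proof (rule sum.reindex_cong[where l = "\<lambda>(j, i). (i, j - 1)"])
    show "inj_on (\<lambda>(j, i). (i, j - 1)) ?U" by (auto simp: inj_on_def)
    show "?V = (\<lambda>(j, i). (i, j - 1)) ` ?U"
    proof (rule equalityI; rule subsetI)
      fix p assume p: "p \<in> ?V"
      then show "p \<in> (\<lambda>(j, i). (i, j - 1)) ` ?U"
        by (intro image_eqI[of _ _ "(Suc (snd p), fst p)"]) (auto split: prod.splits)
    qed auto
    fix p assume "p \<in> ?U"
    then obtain j i where p: "p = (Suc j, i)" by (cases p; cases "fst p") auto
    show "?g (case p of (j, i) \<Rightarrow> (i, j - 1)) = (case p of (j, i) \<Rightarrow> - alt j (alt i (a i (j - 1))))"
      unfolding p by (simp add: alt_def)
  qed
  also have "sum ?g ?U + \<dots> = sum (\<lambda>(j, i). alt j (alt i (a j i - a i (j - 1)))) ?U"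
    unfolding sum.distrib[symmetric] by (rule sum.cong) (auto simp: alt_diff)
  also have "\<dots> \<in> N"
    by (rule subgrp_sum[OF N]) (auto intro!: alt_mem[OF N] a[unfolded One_nat_def])
  finally show ?thesis .
qed

lemma mem_sum_diff:
  assumes "subgrp N" "\<And>k. k \<in> K \<Longrightarrow> f k - g k \<in> N"
  shows "sum f K - sum g K \<in> N"
  using subgrp_sum[OF assms] by (simp add: sum_subtractf)

definition altsum :: "(nat \<Rightarrow> 'x \<Rightarrow> 'y::ab_group_add) \<Rightarrow> nat \<Rightarrow> 'x \<Rightarrow> 'y" where
  "altsum F n x = (\<Sum>k\<le>n. alt k (F k x))"

lemma additive_altsum:
  assumes "\<And>k. additive (F k)"
  shows "additive (altsum F n)"
  by (simp add: additive_def altsum_def additive.add[OF assms] alt_add sum.distrib)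

lemma altsum_mem: "subgrp S \<Longrightarrow> (\<And>k. k \<le> n \<Longrightarrow> F k x \<in> S) \<Longrightarrow> altsum F n x \<in> S"
  unfolding altsum_def by (intro subgrp_sum alt_mem) auto

lemma altsum_map:
  assumes H: "additive H"
  shows "H (altsum F n x) = (\<Sum>k\<le>n. alt k (H (F k x)))"
  by (simp add: altsum_def additive.sum[OF H] additive_alt_apply[OF H])

lemma altsum_commute:
  assumes N: "subgrp N" and H: "additive H"
    and c: "\<And>k. k \<le> n \<Longrightarrow> H (F k x) - F' k (H' x) \<in> N"
  shows "H (altsum F n x) - altsum F' n (H' x) \<in> N"
proof -
  have "(\<Sum>k\<le>n. alt k (H (F k x))) - (\<Sum>k\<le>n. alt k (F' k (H' x))) \<in> N"
    by (rule mem_sum_diff[OF N]) (auto simp: alt_diff[symmetric] intro!: alt_mem[OF N] c)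
  then show ?thesis unfolding altsum_map[OF H] unfolding altsum_def .
qed

lemma altsum_square:
  assumes N: "subgrp N" and F': "\<And>k. additive (F' k)"
    and s: "\<And>i j. i < j \<Longrightarrow> j \<le> Suc n \<Longrightarrow> F' j (F i x) - F' i (F (j - 1) x) \<in> N"
  shows "altsum F' (Suc n) (altsum F n x) \<in> N"
proof -
  have "altsum F' (Suc n) (altsum F n x) = (\<Sum>j\<le>Suc n. \<Sum>i\<le>n. alt j (alt i (F' j (F i x))))"
    unfolding altsum_def[of F' "Suc n"] altsum_map[OF F'] alt_sum ..
  then show ?thesis using alternating_square[OF N, of n "\<lambda>j i. F' j (F i x)"] s by simp
qed

text \<open>An extra degeneracy \<open>H\<close> splitting the last face contracts the complex:
  \<open>H d x = \<plusminus> x + d' (H x)\<close>. In degree \<open>0\<close> it shows that the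
  differential is injective.\<close>

lemma altsum_last_degeneracy:
  assumes N: "subgrp N" and H: "additive H"
    and c: "\<And>k. k < n \<Longrightarrow> H (F k x) - F' k z \<in> N" and l: "H (F n x) - x \<in> N"
    and d: "H (altsum F n x) \<in> N"
  shows "n = 0 \<Longrightarrow> x \<in> N"
    and "n = Suc m \<Longrightarrow> x - alt n (- altsum F' m z) \<in> N"
proof -
  show "n = 0 \<Longrightarrow> x \<in> N"
    using d l subgrp_diff[OF N d l] by (simp add: altsum_def)
  assume n: "n = Suc m"
  have A: "(\<Sum>k\<le>m. alt k (H (F k x))) - altsum F' m z \<in> N"
    unfolding altsum_def using n
    by (intro mem_sum_diff[OF N]) (auto simp: alt_diff[symmetric] intro!: alt_mem[OF N] c)
  have B: "alt n (H (F n x) - x) \<in> N" by (intro alt_mem[OF N] l)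
  have e: "altsum F' m z + alt n x = H (altsum F n x) -
      (((\<Sum>k\<le>m. alt k (H (F k x))) - altsum F' m z) + alt n (H (F n x) - x))"
    by (simp add: altsum_map[OF H] n alt_diff)
  have "altsum F' m z + alt n x \<in> N"
    unfolding e by (rule subgrp_diff[OF N d subgrp_add[OF N A B]])
  then have "alt n (altsum F' m z + alt n x) \<in> N" by (rule alt_mem[OF N])
  moreover have "alt n (alt n x) = x" by (simp add: alt_def)
  ultimately show "x - alt n (- altsum F' m z) \<in> N" by (simp add: alt_add alt_minus add.commute)
qed

text \<open>The mirror image, with \<open>H\<close> splitting the face of index
  \<open>0\<close>.\<close>

lemma altsum_first_degeneracy:
  assumes N: "subgrp N" and H: "additive H"
    and c: "\<And>k. k < n \<Longrightarrow> H (F (Suc k) x) - F' k z \<in> N" and l: "H (F 0 x) - x \<in> N"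
    and d: "H (altsum F n x) \<in> N"
  shows "n = 0 \<Longrightarrow> x \<in> N"
    and "n = Suc m \<Longrightarrow> x - altsum F' m z \<in> N"
proof -
  show "n = 0 \<Longrightarrow> x \<in> N"
    using subgrp_diff[OF N d l] by (simp add: altsum_def)
  assume n: "n = Suc m"
  have A: "(\<Sum>k\<le>m. alt k (H (F (Suc k) x))) - altsum F' m z \<in> N"
    unfolding altsum_def using n
    by (intro mem_sum_diff[OF N]) (auto simp: alt_diff[symmetric] intro!: alt_mem[OF N] c)
  have h: "H (altsum F n x) = H (F 0 x) - (\<Sum>k\<le>m. alt k (H (F (Suc k) x)))"
    unfolding altsum_map[OF H] n sum.atMost_Suc_shift by (simp add: alt_Suc sum_negf)
  have "x - altsum F' m z = (H (altsum F n x) - (H (F 0 x) - x)) +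
      ((\<Sum>k\<le>m. alt k (H (F (Suc k) x))) - altsum F' m z)"
    unfolding h by simp
  then show "x - altsum F' m z \<in> N"
    using subgrp_add[OF N subgrp_diff[OF N d l] A] by metis
qed

text \<open>In degree \<open>0\<close> the only coboundaries are the elements of \<open>N
  0\<close>, in accordance with the trivial subgroup used by \<open>coboundaries\<close>.\<close>

definition coboundary_set :: "(nat \<Rightarrow> 'c set) \<Rightarrow> (nat \<Rightarrow> 'c set) \<Rightarrow> (nat \<Rightarrow> 'c \<Rightarrow> 'c) \<Rightarrow> nat \<Rightarrow> 'c::ab_group_add set" where
  "coboundary_set C N d n = {x. \<exists>w\<in>(case n of 0 \<Rightarrow> {0} | Suc m \<Rightarrow> d m ` C m). x - w \<in> N n}"

definition cocycle_set :: "(nat \<Rightarrow> 'c set) \<Rightarrow> (nat \<Rightarrow> 'c set) \<Rightarrow> (nat \<Rightarrow> 'c \<Rightarrow> 'c) \<Rightarrow> nat \<Rightarrow> 'c::ab_group_add set" where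
  "cocycle_set C N d n = {x \<in> C n. d n x \<in> N (Suc n)}"

text \<open>Once the cochain groups and the differential are written on representatives, so is the
  cohomology.\<close>

lemma presents_cohomology:
  assumes P: "\<And>n. presents (C n) (N n) (G n) (h n)"
    and \<delta>: "\<And>n. additive (\<delta> n)" and C: "\<And>n x. x \<in> C n \<Longrightarrow> \<delta> n x \<in> C (Suc n)"
    and dd: "\<And>n x. x \<in> C n \<Longrightarrow> \<delta> (Suc n) (\<delta> n x) \<in> N (Suc (Suc n))"
    and d: "\<And>n x. x \<in> C n \<Longrightarrow> d n (h n x) = h (Suc n) (\<delta> n x)"
  shows "presents (cocycle_set C N \<delta> n) (coboundary_set C N \<delta> n) (cohomology G d n)
    (\<lambda>x. coboundaries G d n #>\<^bsub>G n\<^esub> h n x)"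
proof -
  note E = presentsD[OF P]
  let ?W = "case n of 0 \<Rightarrow> {0} | Suc m \<Rightarrow> \<delta> m ` C m"
  have Z: "subgrp (cocycle_set C N \<delta> n)"
    unfolding cocycle_set_def by (intro subgrp_kernel \<delta> E(1) E(2))
  have W: "subgrp ?W"
    using subgrp_image[OF \<delta> E(1)] by (cases n) (auto simp: subgrp_def)
  have WZ: "?W \<subseteq> cocycle_set C N \<delta> n"
    using C dd subgrp_0[OF E(1)] subgrp_0[OF E(2)] additive.zero[OF \<delta>]
    by (cases n) (auto simp: cocycle_set_def)
  have "h n ` cocycle_set C N \<delta> n = kernel (G n) (G (Suc n)) (d n)"
  proof -
    have "d n (h n x) = \<one>\<^bsub>G (Suc n)\<^esub> \<longleftrightarrow> \<delta> n x \<in> N (Suc n)" if "x \<in> C n" for x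
      using d[OF that] E(6)[OF C[OF that]] by simp
    then have "h n ` cocycle_set C N \<delta> n = {g \<in> h n ` C n. d n g = \<one>\<^bsub>G (Suc n)\<^esub>}"
      unfolding cocycle_set_def by blast
    then show ?thesis using P[of n] by (simp add: kernel_def presents_def)
  qed
  moreover have "h n ` ?W = coboundaries G d n"
  proof (cases n)
    case 0 then show ?thesis using presents_zero[OF P] by (simp add: coboundaries_def)
  next
    case (Suc m)
    have "d m ` carrier (G m) = d m ` h m ` C m" using P[of m] by (simp add: presents_def)
    then show ?thesis using d Suc by (auto simp: coboundaries_def image_image)
  qed
  ultimately show ?thesis
    using presents_Mod[OF P[of n] Z _ W WZ]
    by (simp add: cohomology_def coboundary_set_def) (simp add: cocycle_set_def)
qed


text \<open>\<open>cohomology_map\<close> computes on representatives.\<close>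

lemma cohomology_map_presented:
  assumes P: "\<And>n. presents (C n) (N n) (G n) (h n)" and P': "\<And>n. presents (C' n) (N' n) (G' n) (h' n)"
    and C: "\<And>n x. x \<in> C n \<Longrightarrow> \<delta> n x \<in> C (Suc n)" and C': "\<And>n x. x \<in> C' n \<Longrightarrow> \<delta>' n x \<in> C' (Suc n)"
    and \<delta>: "\<And>n. additive (\<delta> n)" and \<delta>': "\<And>n. additive (\<delta>' n)"
    and d: "\<And>n x. x \<in> C n \<Longrightarrow> d n (h n x) = h (Suc n) (\<delta> n x)"
    and d': "\<And>n x. x \<in> C' n \<Longrightarrow> d' n (h' n x) = h' (Suc n) (\<delta>' n x)"
    and \<gamma>: "\<And>n. additive (\<gamma> n)" and \<gamma>C: "\<And>n x. x \<in> C n \<Longrightarrow> \<gamma> n x \<in> C' n"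
    and \<gamma>d: "\<And>n x. x \<in> C n \<Longrightarrow> \<gamma> (Suc n) (\<delta> n x) - \<delta>' n (\<gamma> n x) \<in> N' (Suc n)"
    and g: "\<And>x. x \<in> C n \<Longrightarrow> g (h n x) = h' n (\<gamma> n x)"
    and x: "x \<in> C n"
  shows "cohomology_map G' d' n g (coboundaries G d n #>\<^bsub>G n\<^esub> h n x) = coboundaries G' d' n #>\<^bsub>G' n\<^esub> h' n (\<gamma> n x)"
proof -
  note E = presentsD[OF P] and E' = presentsD[OF P']
  interpret G': comm_group "G' n" by (rule presents_comm_group[OF P'])
  let ?W = "case n of 0 \<Rightarrow> {0} | Suc m \<Rightarrow> \<delta> m ` C m"
  let ?W' = "case n of 0 \<Rightarrow> {0} | Suc m \<Rightarrow> \<delta>' m ` C' m"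
  have W: "?W \<subseteq> C n" using C subgrp_0[OF E(1)] by (cases n) auto
  have W': "?W' \<subseteq> C' n" "subgrp ?W'"
    using C' subgrp_0[OF E'(1)] subgrp_image[OF \<delta>' E'(1)] by (cases n; auto simp: subgrp_def)+
  have cob: "coboundaries G d n = h n ` ?W"
  proof (cases n)
    case 0 then show ?thesis using presents_zero[OF P] by (simp add: coboundaries_def)
  next
    case (Suc m)
    have "d m ` carrier (G m) = d m ` h m ` C m" using P[of m] by (simp add: presents_def)
    then show ?thesis using d Suc by (auto simp: coboundaries_def image_image)
  qed
  have cob': "coboundaries G' d' n = h' n ` ?W'"
  proof (cases n)
    case 0 then show ?thesis using presents_zero[OF P'] by (simp add: coboundaries_def)
  next
    case (Suc m)
    have "d' m ` carrier (G' m) = d' m ` h' m ` C' m" using P'[of m] by (simp add: presents_def)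
    then show ?thesis using d' Suc by (auto simp: coboundaries_def image_image)
  qed
  let ?B = "coboundaries G' d' n"
  have sB: "subgroup ?B (G' n)" unfolding cob' by (rule presents_subgroup[OF P' W'(2,1)])
  have \<gamma>W: "h' n (\<gamma> n w) \<in> ?B" if w: "w \<in> ?W" for w
  proof (cases n)
    case 0
    then show ?thesis using w cob' additive.zero[OF \<gamma>] by auto
  next
    case (Suc m)
    then obtain c where c: "c \<in> C m" "w = \<delta> m c" using w by auto
    have "h' n (\<gamma> n w) = h' n (\<delta>' m (\<gamma> m c))"
      using presents_eq[OF P'[of n], of "\<gamma> n w" "\<delta>' m (\<gamma> m c)"] \<gamma>d[OF c(1)] C[OF c(1)] C'[OF \<gamma>C[OF c(1)]] \<gamma>C Suc c
      by auto
    then show ?thesis using cob' Suc \<gamma>C[OF c(1)] by auto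
  qed
  have "?B #>\<^bsub>G' n\<^esub> g z = ?B #>\<^bsub>G' n\<^esub> h' n (\<gamma> n x)" if z: "z \<in> coboundaries G d n #>\<^bsub>G n\<^esub> h n x" for z
  proof -
    obtain w where w: "w \<in> ?W" "z = h n w \<otimes>\<^bsub>G n\<^esub> h n x"
      using z unfolding cob r_coset_def by auto
    then have "g z = h' n (\<gamma> n (w + x))"
      using E(3)[of w n x] W x g[of "w + x"] subgrp_add[OF E(1)] by auto
    also have "\<dots> = h' n (\<gamma> n w) \<otimes>\<^bsub>G' n\<^esub> h' n (\<gamma> n x)"
      using E'(3) \<gamma>C w W x additive.add[OF \<gamma>] by auto
    finally show ?thesis
      using G'.coset_mult_assoc[of ?B "h' n (\<gamma> n w)" "h' n (\<gamma> n x)"] G'.coset_join2[OF _ sB \<gamma>W[OF w(1)]]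
        subgroup.subset[OF sB] \<gamma>W[OF w(1)] E'(4)[OF \<gamma>C[OF x]] by auto
  qed
  moreover have "\<exists>z. z \<in> coboundaries G d n #>\<^bsub>G n\<^esub> h n x"
  proof -
    have "0 \<in> ?W"
    proof (cases n)
      case (Suc m)
      have "0 \<in> \<delta> m ` C m"
        using additive.zero[OF \<delta>[of m]] subgrp_0[OF E(1)[of m]] by (metis image_eqI)
      then show ?thesis using Suc by simp
    qed simp
    then show ?thesis unfolding cob r_coset_def by auto
  qed
  ultimately show ?thesis unfolding cohomology_map_def by blast
qed


section \<open>Comparing the two edges of a bicomplex\<close>

text \<open>Complexes are indexed by natural numbers, the spectral sequence by integers;
  everything is extended by zero.\<close>

definition ext1 :: "(nat \<Rightarrow> 'y set) \<Rightarrow> int \<Rightarrow> 'y::zero set" where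
  "ext1 A n = (if n < 0 then {0} else A (nat n))"

definition extf1 :: "(nat \<Rightarrow> 'x \<Rightarrow> 'y) \<Rightarrow> int \<Rightarrow> 'x \<Rightarrow> 'y::zero" where
  "extf1 d n = (if n < 0 then (\<lambda>_. 0) else d (nat n))"

definition ext2 :: "(nat \<Rightarrow> nat \<Rightarrow> 'y set) \<Rightarrow> int \<Rightarrow> int \<Rightarrow> 'y::zero set" where
  "ext2 A p q = (if p < 0 \<or> q < 0 then {0} else A (nat p) (nat q))"

definition extf2 :: "(nat \<Rightarrow> nat \<Rightarrow> 'x \<Rightarrow> 'y) \<Rightarrow> int \<Rightarrow> int \<Rightarrow> 'x \<Rightarrow> 'y::zero" where
  "extf2 d p q = (if p < 0 \<or> q < 0 then (\<lambda>_. 0) else d (nat p) (nat q))"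

lemma nat_int_plus [simp]: "nat (int m + 1) = Suc m" "nat (int m + 2) = Suc (Suc m)"
  by simp_all

lemma ext_int [simp]:
  "ext1 A (int n) = A n" "ext1 A (int n + 1) = A (Suc n)"
  "extf1 d (int n) = d n"
  "ext2 B (int m) (int n) = B m n" "ext2 B (int m + 1) (int n) = B (Suc m) n"
  "ext2 B (int m) (int n + 1) = B m (Suc n)" "ext2 B (int m + 1) (int n + 1) = B (Suc m) (Suc n)"
  "ext2 B (int m + 2) (int n) = B (Suc (Suc m)) n" "ext2 B (int m) (int n + 2) = B m (Suc (Suc n))"
  "extf2 e (int m) (int n) = e m n" "extf2 e (int m + 1) (int n) = e (Suc m) n"
  "extf2 e (int m) (int n + 1) = e m (Suc n)"
  "ext2 B 0 (int n) = B 0 n" "ext2 B 0 (int n + 1) = B 0 (Suc n)" "ext2 B 1 (int n) = B (Suc 0) n"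
  "ext2 B (int n) 0 = B n 0" "ext2 B (int n + 1) 0 = B (Suc n) 0" "ext2 B (int n) 1 = B n (Suc 0)"
  "extf2 e 0 (int n) = e 0 n" "extf2 e (int n) 0 = e n 0"
  by (simp_all add: ext1_def extf1_def ext2_def extf2_def nat_1)

lemma ext_outside:
  "n < 0 \<Longrightarrow> ext1 A n = {0}" "n < 0 \<Longrightarrow> extf1 d n = (\<lambda>_. 0)"
  "p < 0 \<or> q < 0 \<Longrightarrow> ext2 B p q = {0}" "p < 0 \<or> q < 0 \<Longrightarrow> extf2 e p q = (\<lambda>_. 0)"
  by (auto simp: ext1_def extf1_def ext2_def extf2_def)

lemma subgrp_ext: "(\<And>n. subgrp (A n)) \<Longrightarrow> subgrp (ext1 A k)" "(\<And>m n. subgrp (B m n)) \<Longrightarrow> subgrp (ext2 B p q)"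
  by (auto simp: ext1_def ext2_def subgrp_def)

lemma additive_zero_fun: "additive (\<lambda>_. 0)" by (simp add: additive_def)

lemma additive_ext: "(\<And>n. additive (d n)) \<Longrightarrow> additive (extf1 d k)"
  "(\<And>m n. additive (e m n)) \<Longrightarrow> additive (extf2 e p q)"
  by (auto simp: extf1_def extf2_def additive_zero_fun)

lemma int2_cases:
  fixes p q :: int
  obtains "p < 0 \<or> q < 0" | m n where "p = int m" "q = int n"
  by (metis nonneg_int_cases not_less)

lemma int1_cases:
  fixes p :: int
  obtains "p < 0" | m where "p = int m"
  by (metis nonneg_int_cases not_less)

lemma ext_coboundary:
  "{b. \<exists>c\<in>extf1 d (int n - 1) ` ext1 A (int n - 1). b - c \<in> ext1 A' (int n)} = coboundary_set A A' d n"
proof (cases n)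
  case 0
  then show ?thesis by (simp add: coboundary_set_def ext_outside) (simp add: ext1_def)
next
  case (Suc m)
  then have m: "int n - 1 = int m" by simp
  show ?thesis unfolding m ext_int(1,3) using Suc by (simp add: coboundary_set_def)
qed

text \<open>Here the differentials commute; a sign \<open>(-1)\<^sup>p\<close> in the second one
  makes them anticommute.\<close>

locale nat_bicomplex =
  fixes C N :: "nat \<Rightarrow> nat \<Rightarrow> 'y::ab_group_add set" and \<delta>1 \<delta>2 :: "nat \<Rightarrow> nat \<Rightarrow> 'y \<Rightarrow> 'y"
  assumes subgrp_C: "subgrp (C p q)" and subgrp_N: "subgrp (N p q)" and N_C: "N p q \<subseteq> C p q"
    and additive1: "additive (\<delta>1 p q)" and additive2: "additive (\<delta>2 p q)"
    and C1: "x \<in> C p q \<Longrightarrow> \<delta>1 p q x \<in> C (Suc p) q" and C2: "x \<in> C p q \<Longrightarrow> \<delta>2 p q x \<in> C p (Suc q)"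
    and N1: "x \<in> N p q \<Longrightarrow> \<delta>1 p q x \<in> N (Suc p) q" and N2: "x \<in> N p q \<Longrightarrow> \<delta>2 p q x \<in> N p (Suc q)"
    and dd1: "x \<in> C p q \<Longrightarrow> \<delta>1 (Suc p) q (\<delta>1 p q x) \<in> N (Suc (Suc p)) q"
    and dd2: "x \<in> C p q \<Longrightarrow> \<delta>2 p (Suc q) (\<delta>2 p q x) \<in> N p (Suc (Suc q))"
    and comm: "x \<in> C p q \<Longrightarrow> \<delta>1 p (Suc q) (\<delta>2 p q x) - \<delta>2 (Suc p) q (\<delta>1 p q x) \<in> N (Suc p) (Suc q)"
begin

abbreviation "IC \<equiv> ext2 C"
abbreviation "IN \<equiv> ext2 N"
abbreviation "I1 \<equiv> extf2 \<delta>1"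
abbreviation "I2 \<equiv> extf2 (\<lambda>p q x. alt p (\<delta>2 p q x))"

lemma additive_alt_d2: "additive (\<lambda>x. alt p (\<delta>2 p q x))"
  by (simp add: additive_def additive.add[OF additive2] alt_add)

lemma zero_IC [simp]: "0 \<in> IC p q" and zero_IN [simp]: "0 \<in> IN p q"
  using subgrp_ext(2)[of C p q] subgrp_ext(2)[of N p q] subgrp_C subgrp_N by (auto intro: subgrp_0)

lemma additive_I: "additive (I1 p q)" "additive (I2 p q)"
  by (rule additive_ext(2), rule additive1, rule additive_ext(2), rule additive_alt_d2)

sublocale bicomplex IC IN I1 I2
proof
  fix p q :: int and x y
  show "subgrp (IC p q)" "subgrp (IN p q)" by (rule subgrp_ext(2), rule subgrp_C, rule subgrp_ext(2), rule subgrp_N)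
  show "IN p q \<subseteq> IC p q" using N_C by (simp add: ext2_def)
  show "I1 p q (x + y) = I1 p q x + I1 p q y" "I2 p q (x + y) = I2 p q x + I2 p q y"
    by (rule additive.add[OF additive_I(1)], rule additive.add[OF additive_I(2)])
  show "p < 0 \<or> q < 0 \<Longrightarrow> IN p q = IC p q" by (simp add: ext_outside)
  show "I1 p q x \<in> IC (p + 1) q" if "x \<in> IC p q"
    by (cases p q rule: int2_cases) (use that in \<open>auto simp: ext_outside C1\<close>)
  show "I1 p q x \<in> IN (p + 1) q" if "x \<in> IN p q"
    by (cases p q rule: int2_cases) (use that in \<open>auto simp: ext_outside N1\<close>)
  show "I2 p q x \<in> IC p (q + 1)" if "x \<in> IC p q"
    by (cases p q rule: int2_cases) (use that in \<open>auto simp: ext_outside C2 alt_mem[OF subgrp_C]\<close>)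
  show "I2 p q x \<in> IN p (q + 1)" if "x \<in> IN p q"
    by (cases p q rule: int2_cases) (use that in \<open>auto simp: ext_outside N2 alt_mem[OF subgrp_N]\<close>)
  show "I1 (p + 1) q (I1 p q x) \<in> IN (p + 2) q" if "x \<in> IC p q"
    by (cases p q rule: int2_cases) (use that in \<open>auto simp: ext_outside(4) additive.zero[OF additive_I(1)] dd1\<close>)
  show "I2 p (q + 1) (I2 p q x) \<in> IN p (q + 2)" if "x \<in> IC p q"
    by (cases p q rule: int2_cases)
      (use that in \<open>auto simp: ext_outside(4) additive.zero[OF additive_I(2)] additive_alt_apply[OF additive2]
        dd2 alt_mem[OF subgrp_N]\<close>)
  show "I1 p (q + 1) (I2 p q x) + I2 (p + 1) q (I1 p q x) \<in> IN (p + 1) (q + 1)" if x: "x \<in> IC p q"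
  proof (cases p q rule: int2_cases)
    case 1
    then show ?thesis by (simp add: ext_outside(4) additive.zero[OF additive_I(1)] additive.zero[OF additive_I(2)])
  next
    case (2 m n)
    have "alt m (\<delta>1 m (Suc n) (\<delta>2 m n x) - \<delta>2 (Suc m) n (\<delta>1 m n x)) \<in> N (Suc m) (Suc n)"
      using x 2 by (intro alt_mem[OF subgrp_N] comm) simp
    then show ?thesis using 2 by (simp add: additive_alt_apply[OF additive1] alt_Suc alt_diff)
  qed
qed

end

lemma bicomplex_swap:
  assumes "bicomplex C N d1 d2"
  shows "bicomplex (swap2 C) (swap2 N) (swap2 d2) (swap2 d1)"
proof -
  interpret bicomplex C N d1 d2 by fact
  show ?thesis
  proof
    fix p q x y
    show "subgrp (swap2 C p q)" "subgrp (swap2 N p q)" "swap2 N p q \<subseteq> swap2 C p q"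
      by (simp_all add: swap2_def subgrp_C subgrp_N N_C)
    show "swap2 d2 p q (x + y) = swap2 d2 p q x + swap2 d2 p q y"
      "swap2 d1 p q (x + y) = swap2 d1 p q x + swap2 d1 p q y"
      by (simp_all add: swap2_def additive.add[OF additive1] additive.add[OF additive2])
    show "p < 0 \<or> q < 0 \<Longrightarrow> swap2 N p q = swap2 C p q" using outside[of q p] by (auto simp: swap2_def)
    show "swap2 d2 p q x \<in> swap2 C (p + 1) q" "swap2 d1 p q x \<in> swap2 C p (q + 1)"
      "swap2 d2 (p + 1) q (swap2 d2 p q x) \<in> swap2 N (p + 2) q"
      "swap2 d1 p (q + 1) (swap2 d1 p q x) \<in> swap2 N p (q + 2)"
      "swap2 d2 p (q + 1) (swap2 d1 p q x) + swap2 d1 (p + 1) q (swap2 d2 p q x) \<in> swap2 N (p + 1) (q + 1)"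
      if "x \<in> swap2 C p q"
      using C2[of x q p] C1[of x q p] dd2[of x q p] dd1[of x q p] anti[of x q p] that
      by (simp_all add: swap2_def add.commute)
    show "swap2 d2 p q x \<in> swap2 N (p + 1) q" "swap2 d1 p q x \<in> swap2 N p (q + 1)" if "x \<in> swap2 N p q"
      using N2[of x q p] N1[of x q p] that by (simp_all add: swap2_def)
  qed
qed

locale nat_row_augmented = nat_bicomplex C N \<delta>1 \<delta>2
  for C N :: "nat \<Rightarrow> nat \<Rightarrow> 'y::ab_group_add set" and \<delta>1 \<delta>2 :: "nat \<Rightarrow> nat \<Rightarrow> 'y \<Rightarrow> 'y" +
  fixes BC BN :: "nat \<Rightarrow> 'z::ab_group_add set" and \<delta>B :: "nat \<Rightarrow> 'z \<Rightarrow> 'z" and i :: "nat \<Rightarrow> 'z \<Rightarrow> 'y"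
  assumes subgrp_BC: "subgrp (BC n)" and subgrp_BN: "subgrp (BN n)"
    and additive_diffB: "additive (\<delta>B n)" and additive_i: "additive (i n)"
    and BC_diffB: "b \<in> BC n \<Longrightarrow> \<delta>B n b \<in> BC (Suc n)"
    and C_i: "b \<in> BC n \<Longrightarrow> i n b \<in> C 0 n"
    and i_diffB: "b \<in> BC n \<Longrightarrow> i (Suc n) (\<delta>B n b) - \<delta>2 0 n (i n b) \<in> N 0 (Suc n)"
    and d1_i: "b \<in> BC n \<Longrightarrow> \<delta>1 0 n (i n b) \<in> N (Suc 0) n"
    and N_i: "b \<in> BC n \<Longrightarrow> i n b \<in> N 0 n \<longleftrightarrow> b \<in> BN n"
    and exact_0: "x \<in> C 0 n \<Longrightarrow> \<delta>1 0 n x \<in> N (Suc 0) n \<Longrightarrow> \<exists>b\<in>BC n. x - i n b \<in> N 0 n"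
    and exact: "x \<in> C (Suc p) q \<Longrightarrow> \<delta>1 (Suc p) q x \<in> N (Suc (Suc p)) q \<Longrightarrow> \<exists>y\<in>C p q. x - \<delta>1 p q y \<in> N (Suc p) q"
begin

sublocale row: augmented_bicomplex IC IN I1 I2 "ext1 BC" "ext1 BN" "extf1 \<delta>B" "extf1 i"
proof
  fix n :: int and x y b
  show "subgrp (ext1 BC n)" "subgrp (ext1 BN n)"
    by (rule subgrp_ext(1), rule subgrp_BC, rule subgrp_ext(1), rule subgrp_BN)
  show "extf1 \<delta>B n (x + y) = extf1 \<delta>B n x + extf1 \<delta>B n y"
    by (rule additive.add[OF additive_ext(1)[OF additive_diffB]])
  show "extf1 i n (x + y) = extf1 i n x + extf1 i n y" for x y :: 'z
    by (rule additive.add[OF additive_ext(1)[OF additive_i]])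
  have z: "0 \<in> ext1 BC (k::int)" for k using subgrp_0[OF subgrp_ext(1)[OF subgrp_BC]] .
  show "extf1 \<delta>B n b \<in> ext1 BC (n + 1)" if "b \<in> ext1 BC n"
    by (cases n rule: int1_cases) (use that z in \<open>auto simp: ext_outside BC_diffB\<close>)
  show "extf1 i n b \<in> IC 0 n" if "b \<in> ext1 BC n"
    by (cases n rule: int1_cases) (use that in \<open>auto simp: ext_outside C_i\<close>)
  show "extf1 i (n + 1) (extf1 \<delta>B n b) - I2 0 n (extf1 i n b) \<in> IN 0 (n + 1)" if "b \<in> ext1 BC n"
  proof (cases n rule: int1_cases)
    case 1
    then show ?thesis by (simp add: ext_outside additive.zero[OF additive_ext(1)[OF additive_i]])
  next
    case (2 m)
    have "extf1 i (int m + 1) = i (Suc m)" by (simp add: extf1_def)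
    then show ?thesis using that i_diffB[of b m] 2 by simp
  qed
  show "I1 0 n (extf1 i n b) \<in> IN 1 n" if "b \<in> ext1 BC n"
    by (cases n rule: int1_cases) (use that in \<open>auto simp: ext_outside d1_i\<close>)
  show "extf1 i n b \<in> IN 0 n \<longleftrightarrow> b \<in> ext1 BN n" if "b \<in> ext1 BC n"
    by (cases n rule: int1_cases) (use that in \<open>auto simp: ext_outside N_i\<close>)
next
  fix n :: int and x assume x: "x \<in> IC 0 n" "I1 0 n x \<in> IN 1 n"
  show "\<exists>b\<in>ext1 BC n. x - extf1 i n b \<in> IN 0 n"
  proof (cases n rule: int1_cases)
    case 1 then show ?thesis using x by (simp add: ext_outside)
  next
    case (2 m) then show ?thesis using x exact_0[of x m] by simp
  qed
next
  fix p q :: int and x assume p: "1 \<le> p" and x: "x \<in> IC p q" "I1 p q x \<in> IN (p + 1) q"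
  obtain k where k: "p = int (Suc k)" using p by (metis Suc_pred' int_one_le_iff_zero_less nonneg_int_cases of_nat_0_less_iff zero_le_one order_trans)
  show "\<exists>y\<in>IC (p - 1) q. x - I1 (p - 1) q y \<in> IN p q"
  proof (cases q rule: int1_cases)
    case 1 then show ?thesis using x by (simp add: ext_outside)
  next
    case (2 m)
    have k1: "p - 1 = int k" using k by simp
    have "x \<in> C (Suc k) m" "\<delta>1 (Suc k) m x \<in> N (Suc (Suc k)) m"
      using x 2 k ext_int(5)[of N "Suc k" m] by (simp_all del: of_nat_Suc)
    then show ?thesis unfolding k1 using exact[of x k m] 2 k by (simp del: of_nat_Suc)
  qed
qed

lemma row_ZB: "row.ZB (int n) = cocycle_set BC BN \<delta>B n" and row_BB: "row.BB (int n) = coboundary_set BC BN \<delta>B n"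
  unfolding row.ZB_def row.BB_def ext_coboundary cocycle_set_def by simp_all

end

locale nat_col_augmented = nat_bicomplex C N \<delta>1 \<delta>2
  for C N :: "nat \<Rightarrow> nat \<Rightarrow> 'y::ab_group_add set" and \<delta>1 \<delta>2 :: "nat \<Rightarrow> nat \<Rightarrow> 'y \<Rightarrow> 'y" +
  fixes AC AN :: "nat \<Rightarrow> 'z::ab_group_add set" and \<delta>A :: "nat \<Rightarrow> 'z \<Rightarrow> 'z" and j :: "nat \<Rightarrow> 'z \<Rightarrow> 'y"
  assumes subgrp_AC: "subgrp (AC n)" and subgrp_AN: "subgrp (AN n)"
    and additive_diffA: "additive (\<delta>A n)" and additive_j: "additive (j n)"
    and AC_diffA: "b \<in> AC n \<Longrightarrow> \<delta>A n b \<in> AC (Suc n)"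
    and C_j: "b \<in> AC n \<Longrightarrow> j n b \<in> C n 0"
    and j_diffA: "b \<in> AC n \<Longrightarrow> j (Suc n) (\<delta>A n b) - \<delta>1 n 0 (j n b) \<in> N (Suc n) 0"
    and d2_j: "b \<in> AC n \<Longrightarrow> \<delta>2 n 0 (j n b) \<in> N n (Suc 0)"
    and N_j: "b \<in> AC n \<Longrightarrow> j n b \<in> N n 0 \<longleftrightarrow> b \<in> AN n"
    and coexact_0: "x \<in> C n 0 \<Longrightarrow> \<delta>2 n 0 x \<in> N n (Suc 0) \<Longrightarrow> \<exists>b\<in>AC n. x - j n b \<in> N n 0"
    and coexact: "x \<in> C p (Suc q) \<Longrightarrow> \<delta>2 p (Suc q) x \<in> N p (Suc (Suc q)) \<Longrightarrow> \<exists>y\<in>C p q. x - \<delta>2 p q y \<in> N p (Suc q)"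
begin

lemma augmented_swap:
  "augmented_bicomplex (swap2 IC) (swap2 IN) (swap2 I2) (swap2 I1) (ext1 AC) (ext1 AN) (extf1 \<delta>A) (extf1 j)"
  unfolding augmented_bicomplex_def augmented_bicomplex_axioms_def
proof (intro conjI allI impI bicomplex_swap[OF bicomplex_axioms])
  fix n :: int and b
  show "subgrp (ext1 AC n)" "subgrp (ext1 AN n)"
    by (rule subgrp_ext(1), rule subgrp_AC, rule subgrp_ext(1), rule subgrp_AN)
  show "additive (extf1 \<delta>A n)" by (rule additive_ext(1)[OF additive_diffA])
  show "additive (extf1 j n)" by (rule additive_ext(1)[OF additive_j])
  have z: "0 \<in> ext1 AC (k::int)" for k using subgrp_0[OF subgrp_ext(1)[OF subgrp_AC]] .
  assume b: "b \<in> ext1 AC n"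
  show "extf1 \<delta>A n b \<in> ext1 AC (n + 1)"
    by (cases n rule: int1_cases) (use b z in \<open>auto simp: ext_outside AC_diffA\<close>)
  show "extf1 j n b \<in> swap2 IC 0 n"
    by (cases n rule: int1_cases) (use b in \<open>auto simp: swap2_def ext_outside C_j\<close>)
  show "extf1 j (n + 1) (extf1 \<delta>A n b) - swap2 I1 0 n (extf1 j n b) \<in> swap2 IN 0 (n + 1)"
  proof (cases n rule: int1_cases)
    case 1
    then show ?thesis by (simp add: swap2_def ext_outside additive.zero[OF additive_ext(1)[OF additive_j]])
  next
    case (2 m)
    have "extf1 j (int m + 1) = j (Suc m)" by (simp add: extf1_def)
    then show ?thesis using b j_diffA[of b m] 2 by (simp add: swap2_def)
  qed
  show "swap2 I2 0 n (extf1 j n b) \<in> swap2 IN 1 n"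
    by (cases n rule: int1_cases)
      (use b in \<open>auto simp: swap2_def ext_outside d2_j alt_mem[OF subgrp_N]\<close>)
  show "extf1 j n b \<in> swap2 IN 0 n \<longleftrightarrow> b \<in> ext1 AN n"
    by (cases n rule: int1_cases) (use b in \<open>auto simp: swap2_def ext_outside N_j\<close>)
next
  fix n :: int and x assume x: "x \<in> swap2 IC 0 n" "swap2 I2 0 n x \<in> swap2 IN 1 n"
  show "\<exists>b\<in>ext1 AC n. x - extf1 j n b \<in> swap2 IN 0 n"
  proof (cases n rule: int1_cases)
    case 1 then show ?thesis using x by (simp add: swap2_def ext_outside)
  next
    case (2 m)
    then show ?thesis using x coexact_0[of x m] by (simp add: swap2_def alt_mem_iff[OF subgrp_N])
  qed
next
  fix p q :: int and x assume p: "1 \<le> p" and x: "x \<in> swap2 IC p q" "swap2 I2 p q x \<in> swap2 IN (p + 1) q"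
  obtain k where k: "p = int (Suc k)" using p by (metis Suc_pred' int_one_le_iff_zero_less nonneg_int_cases of_nat_0_less_iff zero_le_one order_trans)
  show "\<exists>y\<in>swap2 IC (p - 1) q. x - swap2 I2 (p - 1) q y \<in> swap2 IN p q"
  proof (cases q rule: int1_cases)
    case 1 then show ?thesis using x by (simp add: swap2_def ext_outside)
  next
    case (2 m)
    have k1: "p - 1 = int k" using k by simp
    have "x \<in> C m (Suc k)" "\<delta>2 m (Suc k) x \<in> N m (Suc (Suc k))"
      using x 2 k ext_int(6)[of N m "Suc k"] by (simp_all add: swap2_def alt_mem_iff[OF subgrp_N] del: of_nat_Suc)
    then obtain y where y: "y \<in> C m k" "x - \<delta>2 m k y \<in> N m (Suc k)" using coexact by blast
    have "alt m (\<delta>2 m k (alt m y)) = \<delta>2 m k y"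
      by (simp add: additive_alt_apply[OF additive2]) (simp add: alt_def)
    then have "x - swap2 I2 (p - 1) q (alt m y) \<in> swap2 IN p q"
      unfolding k1 using y 2 k by (simp add: swap2_def del: of_nat_Suc)
    moreover have "alt m y \<in> swap2 IC (p - 1) q"
      unfolding k1 using y 2 by (simp add: swap2_def alt_mem[OF subgrp_C])
    ultimately show ?thesis by blast
  qed
qed

end

lemma Btot_map:
  assumes B: "bicomplex C N d1 d2" and B': "bicomplex C' N' d1' d2'"
    and \<Gamma>: "\<And>p q. additive (\<Gamma> p q)" and \<Gamma>C: "\<And>p q x. x \<in> C p q \<Longrightarrow> \<Gamma> p q x \<in> C' p q"
    and \<Gamma>N: "\<And>p q x. x \<in> N p q \<Longrightarrow> \<Gamma> p q x \<in> N' p q"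
    and c1: "\<And>p q x. x \<in> C p q \<Longrightarrow> \<Gamma> (p + 1) q (d1 p q x) - d1' p q (\<Gamma> p q x) \<in> N' (p + 1) q"
    and c2: "\<And>p q x. x \<in> C p q \<Longrightarrow> \<Gamma> p (q + 1) (d2 p q x) - d2' p q (\<Gamma> p q x) \<in> N' p (q + 1)"
    and z: "z \<in> Btot C N d1 d2 n"
  shows "(\<lambda>p q. \<Gamma> p q (z p q)) \<in> Btot C' N' d1' d2' n"
proof -
  interpret B': bicomplex C' N' d1' d2' by fact
  obtain w where w: "w \<in> tot C (n - 1)" and zw: "z - tot_diff d1 d2 w \<in> tot N n"
    using z by (auto simp: Btot_def)
  let ?w = "\<lambda>p q. \<Gamma> p q (w p q)"
  have "?w \<in> tot C' (n - 1)" using w \<Gamma>C by (auto simp: tot_def)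
  moreover have "(\<lambda>p q. \<Gamma> p q (z p q)) - tot_diff d1' d2' ?w \<in> tot N' n"
    unfolding tot_def
  proof (intro CollectI allI impI)
    fix p q assume pq: "p + q = n"
    have "z p q - tot_diff d1 d2 w p q \<in> N p q" using zw pq by (auto simp: tot_def)
    then have a: "\<Gamma> p q (z p q) - (\<Gamma> p q (d1 (p - 1) q (w (p - 1) q)) + \<Gamma> p q (d2 p (q - 1) (w p (q - 1)))) \<in> N' p q"
      using \<Gamma>N by (force simp: tot_diff_def additive.diff[OF \<Gamma>] additive.add[OF \<Gamma>])
    have "w (p - 1) q \<in> C (p - 1) q" "w p (q - 1) \<in> C p (q - 1)" using w pq by (auto simp: tot_def)
    from c1[OF this(1)] c2[OF this(2)]
    have b: "\<Gamma> p q (d1 (p - 1) q (w (p - 1) q)) - d1' (p - 1) q (?w (p - 1) q) \<in> N' p q"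
      and c: "\<Gamma> p q (d2 p (q - 1) (w p (q - 1))) - d2' p (q - 1) (?w p (q - 1)) \<in> N' p q" by simp_all
    from subgrp_add[OF B'.subgrp_N subgrp_add[OF B'.subgrp_N a b] c]
    show "((\<lambda>p q. \<Gamma> p q (z p q)) - tot_diff d1' d2' ?w) p q \<in> N' p q"
      by (simp add: tot_diff_def algebra_simps)
  qed
  ultimately show ?thesis by (auto simp: Btot_def)
qed

text \<open>A bicomplex resolving one complex along its rows and another one along its columns.
  Both are quasi-isomorphic to the total complex.\<close>

locale nat_double_augmented =
  nat_row_augmented C N \<delta>1 \<delta>2 BC BN \<delta>B i + nat_col_augmented C N \<delta>1 \<delta>2 AC AN \<delta>A j
  for C N :: "nat \<Rightarrow> nat \<Rightarrow> 'y::ab_group_add set" and \<delta>1 \<delta>2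
    and BC BN :: "nat \<Rightarrow> 'z::ab_group_add set" and \<delta>B i
    and AC AN :: "nat \<Rightarrow> 'w::ab_group_add set" and \<delta>A j
begin

sublocale col: augmented_bicomplex "swap2 IC" "swap2 IN" "swap2 I2" "swap2 I1" "ext1 AC" "ext1 AN" "extf1 \<delta>A" "extf1 j"
  by (rule augmented_swap)

text \<open>The classes of \<open>x\<close> and \<open>y\<close> agree in the total complex.
  Working with this relation instead of a choice of isomorphism makes the comparison visibly
  natural.\<close>

definition zigzag :: "nat \<Rightarrow> 'z \<Rightarrow> 'w \<Rightarrow> bool" where
  "zigzag n x y \<longleftrightarrow> single 0 (int n) (i n x) - single (int n) 0 (j n y) \<in> Btot IC IN I1 I2 (int n)"

lemma col_ZB: "col.ZB (int n) = cocycle_set AC AN \<delta>A n" and col_BB: "col.BB (int n) = coboundary_set AC AN \<delta>A n"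
  unfolding col.ZB_def col.BB_def ext_coboundary cocycle_set_def by simp_all

lemma single_swap: "swap2 (single p q v) = single q p v"
  by (auto simp: swap2_def single_def fun_eq_iff)

text \<open>The cohomology \<open>G\<close> of the complex that the columns resolve is also
  presented by the cocycles of the complex that the rows resolve, and the two presentations agree
  along \<open>zigzag\<close>.\<close>

theorem zigzag_presents:
  assumes P: "presents (cocycle_set AC AN \<delta>A n) (coboundary_set AC AN \<delta>A n) G h"
  shows "\<exists>\<kappa>. presents (cocycle_set BC BN \<delta>B n) (coboundary_set BC BN \<delta>B n) G \<kappa> \<and>
     (\<forall>x\<in>cocycle_set BC BN \<delta>B n. \<forall>y\<in>cocycle_set AC AN \<delta>A n. zigzag n x y \<longrightarrow> \<kappa> x = h y)"
proof -
  let ?Z = "Ztot IC IN I1 I2 (int n)" and ?B = "Btot IC IN I1 I2 (int n)"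
  let ?Z' = "Ztot (swap2 IC) (swap2 IN) (swap2 I2) (swap2 I1) (int n)"
    and ?B' = "Btot (swap2 IC) (swap2 IN) (swap2 I2) (swap2 I1) (int n)"
  obtain h1 where h1: "presents ?Z' ?B' G h1"
    and h1h: "\<And>y z. y \<in> cocycle_set AC AN \<delta>A n \<Longrightarrow> z \<in> ?Z' \<Longrightarrow> z - col.inc (int n) y \<in> ?B' \<Longrightarrow> h1 z = h y"
    using col.presents_total[of "int n" G h] P unfolding col_ZB col_BB by blast
  have "additive (\<lambda>z :: int \<Rightarrow> int \<Rightarrow> 'y. swap2 z)"
    by (simp add: additive_def swap2_def fun_eq_iff)
  then have h2: "presents ?Z ?B G (\<lambda>z. h1 (swap2 z))"
  proof (rule presents_pullback[OF h1 row.subgrp_Ztot row.subgrp_Btot])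
    show "x \<in> ?Z \<Longrightarrow> swap2 x \<in> ?Z'" for x by (simp only: Ztot_swap)
    show "swap2 x \<in> ?B' \<longleftrightarrow> x \<in> ?B" for x by (rule Btot_swap)
    fix z assume "z \<in> ?Z'"
    then have "swap2 z \<in> ?Z" using Ztot_swap[of "swap2 z" IC IN I2 I1 "int n"] by simp
    then show "\<exists>x\<in>?Z. z - swap2 x \<in> ?B'"
      by (rule bexI[rotated]) (simp add: subgrp_0[OF col.subgrp_Btot])
  qed
  have k: "presents (cocycle_set BC BN \<delta>B n) (coboundary_set BC BN \<delta>B n) G (\<lambda>x. h1 (swap2 (row.inc (int n) x)))"
    using row.presents_augmentation[OF h2] unfolding row_ZB row_BB .
  have "h1 (swap2 (row.inc (int n) x)) = h y"
    if x: "x \<in> cocycle_set BC BN \<delta>B n" and y: "y \<in> cocycle_set AC AN \<delta>A n" and xy: "zigzag n x y" for x y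
  proof (rule h1h[OF y])
    show "swap2 (row.inc (int n) x) \<in> ?Z'"
      unfolding Ztot_swap using row.inc_Ztot[of x "int n"] x unfolding row_ZB by simp
    have e: "swap2 (row.inc (int n) x) - col.inc (int n) y = swap2 (single 0 (int n) (i n x) - single (int n) 0 (j n y))"
      by (simp add: row.inc_def col.inc_def single_swap swap2_def single_def fun_eq_iff)
    show "swap2 (row.inc (int n) x) - col.inc (int n) y \<in> ?B'"
      unfolding e Btot_swap using xy unfolding zigzag_def .
  qed
  then show ?thesis using k by blast
qed

lemma zigzag_total:
  assumes x: "x \<in> cocycle_set BC BN \<delta>B n"
  shows "\<exists>y\<in>cocycle_set AC AN \<delta>A n. zigzag n x y"
proof -
  have "swap2 (row.inc (int n) x) \<in> Ztot (swap2 IC) (swap2 IN) (swap2 I2) (swap2 I1) (int n)"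
    unfolding Ztot_swap using row.inc_Ztot[of x "int n"] x unfolding row_ZB by simp
  from col.Ztot_inc[OF this] obtain y where y: "y \<in> cocycle_set AC AN \<delta>A n"
    and b: "swap2 (row.inc (int n) x) - col.inc (int n) y \<in> Btot (swap2 IC) (swap2 IN) (swap2 I2) (swap2 I1) (int n)"
    unfolding col_ZB by blast
  have e: "swap2 (row.inc (int n) x) - col.inc (int n) y = swap2 (single 0 (int n) (i n x) - single (int n) 0 (j n y))"
    by (simp add: row.inc_def col.inc_def single_swap swap2_def single_def fun_eq_iff)
  have "zigzag n x y" using b unfolding e Btot_swap zigzag_def .
  then show ?thesis using y by blast
qed

end

text \<open>Maps of bicomplexes that respect the augmentations up to the modulus preserve
  \<open>zigzag\<close>.\<close>

lemma zigzag_map: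
  assumes A: "nat_double_augmented C N \<delta>1 \<delta>2 BC BN \<delta>B i AC AN \<delta>A j"
    and A': "nat_double_augmented C' N' \<delta>1' \<delta>2' BC' BN' \<delta>B' i' AC' AN' \<delta>A' j'"
    and \<Gamma>: "\<And>p q. additive (\<Gamma> p q)" and \<Gamma>C: "\<And>p q x. x \<in> C p q \<Longrightarrow> \<Gamma> p q x \<in> C' p q"
    and \<Gamma>N: "\<And>p q x. x \<in> N p q \<Longrightarrow> \<Gamma> p q x \<in> N' p q"
    and c1: "\<And>p q x. x \<in> C p q \<Longrightarrow> \<Gamma> (Suc p) q (\<delta>1 p q x) - \<delta>1' p q (\<Gamma> p q x) \<in> N' (Suc p) q"
    and c2: "\<And>p q x. x \<in> C p q \<Longrightarrow> \<Gamma> p (Suc q) (\<delta>2 p q x) - \<delta>2' p q (\<Gamma> p q x) \<in> N' p (Suc q)"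
    and ci: "\<And>q x. x \<in> BC q \<Longrightarrow> \<Gamma> 0 q (i q x) - i' q (\<gamma>B q x) \<in> N' 0 q"
    and cj: "\<And>p x. x \<in> AC p \<Longrightarrow> \<Gamma> p 0 (j p x) - j' p (\<gamma>A p x) \<in> N' p 0"
    and x: "x \<in> BC n" and y: "y \<in> AC n"
    and xy: "nat_double_augmented.zigzag C N \<delta>1 \<delta>2 i j n x y"
  shows "nat_double_augmented.zigzag C' N' \<delta>1' \<delta>2' i' j' n (\<gamma>B n x) (\<gamma>A n y)"
proof -
  interpret A: nat_double_augmented C N \<delta>1 \<delta>2 BC BN \<delta>B i AC AN \<delta>A j by fact
  interpret A': nat_double_augmented C' N' \<delta>1' \<delta>2' BC' BN' \<delta>B' i' AC' AN' \<delta>A' j' by fact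
  let ?G = "extf2 \<Gamma>"
  have G: "additive (?G p q)" for p q by (rule additive_ext(2)[OF \<Gamma>])
  let ?z = "single 0 (int n) (i n x) - single (int n) 0 (j n y)"
  have z: "(\<lambda>p q. ?G p q (?z p q)) \<in> Btot A'.IC A'.IN A'.I1 A'.I2 (int n)"
  proof (rule Btot_map[OF A.bicomplex_axioms A'.bicomplex_axioms G])
    fix p q x
    show "?G p q x \<in> A'.IC p q" if "x \<in> A.IC p q"
      by (cases p q rule: int2_cases) (use that in \<open>auto simp: ext_outside \<Gamma>C\<close>)
    show "?G p q x \<in> A'.IN p q" if "x \<in> A.IN p q"
      by (cases p q rule: int2_cases) (use that in \<open>auto simp: ext_outside \<Gamma>N\<close>)
    show "?G (p + 1) q (A.I1 p q x) - A'.I1 p q (?G p q x) \<in> A'.IN (p + 1) q" if "x \<in> A.IC p q"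
      by (cases p q rule: int2_cases) (use that in \<open>auto simp: ext_outside(4) additive.zero[OF G] c1\<close>)
    show "?G p (q + 1) (A.I2 p q x) - A'.I2 p q (?G p q x) \<in> A'.IN p (q + 1)" if "x \<in> A.IC p q"
      by (cases p q rule: int2_cases)
        (use that in \<open>auto simp: ext_outside(4) additive.zero[OF G] c2 additive_alt_apply[OF \<Gamma>] alt_diff[symmetric]
          alt_mem[OF A'.subgrp_N]\<close>)
  next
    show "?z \<in> Btot A.IC A.IN A.I1 A.I2 (int n)" using xy by (simp add: A.zigzag_def)
  qed
  let ?z' = "single 0 (int n) (i' n (\<gamma>B n x)) - single (int n) 0 (j' n (\<gamma>A n y))"
  have "(\<lambda>p q. ?G p q (?z p q)) - ?z' \<in> tot A'.IN (int n)"
    unfolding tot_def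
  proof (intro CollectI allI impI)
    fix p q assume pq: "p + q = int n"
    have e: "((\<lambda>p q. ?G p q (?z p q)) - ?z') p q =
       (if p = 0 \<and> q = int n then \<Gamma> 0 n (i n x) - i' n (\<gamma>B n x) else 0) -
       (if p = int n \<and> q = 0 then \<Gamma> n 0 (j n y) - j' n (\<gamma>A n y) else 0)"
      by (auto simp: single_def additive.diff[OF G] additive.zero[OF G] additive.zero[OF \<Gamma>] additive.diff[OF \<Gamma>])
    show "((\<lambda>p q. ?G p q (?z p q)) - ?z') p q \<in> A'.IN p q"
      unfolding e
      by (rule subgrp_diff[OF subgrp_ext(2)[OF nat_bicomplex.subgrp_N[OF A'.nat_bicomplex_axioms]]]) (use ci[OF x] cj[OF y] in auto)
  qed
  then have "(\<lambda>p q. ?G p q (?z p q)) - ?z' \<in> Btot A'.IC A'.IN A'.I1 A'.I2 (int n)"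
    unfolding Btot_def using subgrp_0[OF subgrp_image[OF A'.additive_D A'.subgrp_tot_C]]
    by (intro CollectI bexI[of _ 0]) simp_all
  then have "?z' \<in> Btot A'.IC A'.IN A'.I1 A'.I2 (int n)"
    using z subgrp_cong[OF A'.row.subgrp_Btot] by blast
  then show ?thesis by (simp add: A'.zigzag_def)
qed


section \<open>The mixed resolution\<close>

lemma ctower_ctower: "ctower (ctower Y (Suc 0)) n = ctower Y (Suc n)"
  by (induction n) auto

lemma caug_ctower: "caug (ctower Y (Suc 0)) (caug Y \<alpha> (Suc 0)) n = caug Y \<alpha> (Suc n)"
proof (induction n)
  case (Suc n)
  have "caug (ctower Y (Suc 0)) (caug Y \<alpha> (Suc 0)) (Suc n) =
      caug Y \<alpha> (Suc n) \<circ> cr_counit (ctower Y (Suc n))"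
    unfolding caug.simps(2)[of "ctower Y (Suc 0)"] Suc ctower_ctower ..
  then show ?case by (simp only: caug.simps(2)[of Y \<alpha> "Suc n"])
qed simp

lemma cface_ctower:
  assumes "k \<le> n"
  shows "cface Y (Suc n) k = cface (ctower Y (Suc 0)) n k"
proof -
  have "Suc n - k = Suc (n - k)" using assms by simp
  then show ?thesis unfolding cface_def ctower_ctower by simp
qed

lemma cface_last: "cface Y n n = gmap n (cr_counit Y)"
  by (simp add: cface_def)

context psi_module
begin

text \<open>\<open>F\<^sup>a(G\<^sup>b(R))\<close>, with \<open>F\<close> the free commutative
  ring comonad and \<open>G\<close> the free Psi-ring comonad. The row \<open>b = 0\<close> is the
  Andre-Quillen resolution, the column \<open>a = 0\<close> the Psi-ring resolution.\<close>

definition bitower :: "nat \<Rightarrow> nat \<Rightarrow> 'a poly_tower ring" where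
  "bitower a b = ctower (ytower R b) a"

definition biaug :: "nat \<Rightarrow> nat \<Rightarrow> 'a poly_tower \<Rightarrow> 'a" where
  "biaug a b = caug (ytower R b) (psi_aug R b) a"

text \<open>\<open>Der(F\<^sup>a(G\<^sup>b(R)), M\<^sup>f)\<close>; the modulus
  \<open>biNul\<close> does not depend on \<open>f\<close>.\<close>

definition biDer :: "nat \<Rightarrow> nat \<Rightarrow> nat \<Rightarrow> ('a poly_tower \<Rightarrow> ('b \<Rightarrow>\<^sub>0 int)) set" where
  "biDer f a b = Der (bitower a b) (\<lambda>x. psi R f (biaug a b x))"

definition biNul :: "nat \<Rightarrow> nat \<Rightarrow> ('a poly_tower \<Rightarrow> ('b \<Rightarrow>\<^sub>0 int)) set" where
  "biNul a b = Nul (bitower a b)"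

definition faceA :: "nat \<Rightarrow> nat \<Rightarrow> nat \<Rightarrow> ('a poly_tower \<Rightarrow> ('b \<Rightarrow>\<^sub>0 int)) \<Rightarrow> 'a poly_tower \<Rightarrow> ('b \<Rightarrow>\<^sub>0 int)" where
  "faceA a b k \<phi> = (\<lambda>x. \<phi> (cface (ytower R b) a k x))"

definition faceB :: "nat \<Rightarrow> nat \<Rightarrow> nat \<Rightarrow> ('a poly_tower \<Rightarrow> ('b \<Rightarrow>\<^sub>0 int)) \<Rightarrow> 'a poly_tower \<Rightarrow> ('b \<Rightarrow>\<^sub>0 int)" where
  "faceB a b k \<phi> = (\<lambda>x. \<phi> (gmap a (psi_face R b k) x))"

definition diffA :: "nat \<Rightarrow> nat \<Rightarrow> ('a poly_tower \<Rightarrow> ('b \<Rightarrow>\<^sub>0 int)) \<Rightarrow> 'a poly_tower \<Rightarrow> ('b \<Rightarrow>\<^sub>0 int)" where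
  "diffA a b = altsum (faceA a b) a"

definition diffB :: "nat \<Rightarrow> nat \<Rightarrow> ('a poly_tower \<Rightarrow> ('b \<Rightarrow>\<^sub>0 int)) \<Rightarrow> 'a poly_tower \<Rightarrow> ('b \<Rightarrow>\<^sub>0 int)" where
  "diffB a b = altsum (faceB a b) b"

lemma additive_precomp: "additive (\<lambda>\<phi> x. \<phi> (h x) :: 'b \<Rightarrow>\<^sub>0 int)"
  by (simp add: additive_def fun_eq_iff)

lemma additive_faceA: "additive (faceA a b k)" and additive_faceB: "additive (faceB a b k)"
  unfolding faceA_def[abs_def] faceB_def[abs_def] by (rule additive_precomp)+

lemma additive_diffA: "additive (diffA a b)" and additive_diffB: "additive (diffB a b)"
  unfolding diffA_def diffB_def by (intro additive_altsum additive_faceA additive_faceB)+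

lemma cring_Y: "cring (ytower R b)"
  by (rule cring_psi_tower(1)[OF is_cring_R])

lemma cring_bitower: "cring (bitower a b)"
  unfolding bitower_def by (rule cring_ctower[OF cring_Y])

lemma psi_aug_ring_hom: "psi_aug R b \<in> ring_hom (ytower R b) R"
  by (rule psi_aug_hom[OF psi_ring_R])

lemma biaug_hom: "biaug a b \<in> ring_hom (bitower a b) R"
  unfolding biaug_def bitower_def by (rule caug_hom[OF cring_Y psi_aug_ring_hom])

lemma sigma_hom: "1 \<le> f \<Longrightarrow> (\<lambda>x. psi R f (biaug a b x)) \<in> ring_hom (bitower a b) R"
  by (rule ring_hom_comp[OF biaug_hom psi_hom])

lemma subgrp_biNul: "subgrp (biNul a b)"
  unfolding biNul_def by (rule subgrp_Nul)

lemma subgrp_biDer: "1 \<le> f \<Longrightarrow> subgrp (biDer f a b)"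
  unfolding biDer_def by (rule subgrp_Der) (rule ring_hom_closed[OF sigma_hom])

lemma biNul_biDer: "1 \<le> f \<Longrightarrow> biNul a b \<subseteq> biDer f a b"
  unfolding biDer_def biNul_def by (rule Nul_subset_Der[OF cring_bitower]) (rule ring_hom_closed[OF sigma_hom])

lemma biDer_comp:
  assumes "h \<in> ring_hom (bitower a b) (bitower a' b')" "\<And>x. x \<in> carrier (bitower a b) \<Longrightarrow> biaug a' b' (h x) = biaug a b x" "\<phi> \<in> biDer f a' b'"
  shows "(\<lambda>x. \<phi> (h x)) \<in> biDer f a b"
  using assms unfolding biDer_def by (intro Der_comp[OF assms(1)]) auto

lemma biNul_comp: "h \<in> ring_hom (bitower a b) (bitower a' b') \<Longrightarrow> \<phi> \<in> biNul a' b' \<Longrightarrow> (\<lambda>x. \<phi> (h x)) \<in> biNul a b"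
  unfolding biNul_def by (rule Nul_comp) (rule ring_hom_closed)

lemma biNul_eqI: "(\<And>x. x \<in> carrier (bitower a b) \<Longrightarrow> \<phi> x = \<psi> x) \<Longrightarrow> \<phi> - \<psi> \<in> biNul a b"
  by (simp add: biNul_def Nul_def)

lemma psi_face_hom: "k \<le> b \<Longrightarrow> psi_face R b k \<in> ring_hom (ytower R (Suc b)) (ytower R b)"
  using psi_face_mor[OF psi_ring_R] by (auto simp: psi_mor_def)

lemma face_A_hom: "k \<le> a \<Longrightarrow> cface (ytower R b) a k \<in> ring_hom (bitower (Suc a) b) (bitower a b)"
  unfolding bitower_def by (rule cface_hom[OF cring_Y])

lemma face_B_hom: "k \<le> b \<Longrightarrow> gmap a (psi_face R b k) \<in> ring_hom (bitower a (Suc b)) (bitower a b)"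
  unfolding bitower_def by (rule gmap_hom[OF psi_face_hom])

lemma biaug_face_A: "k \<le> a \<Longrightarrow> x \<in> carrier (bitower (Suc a) b) \<Longrightarrow> biaug a b (cface (ytower R b) a k x) = biaug (Suc a) b x"
  unfolding biaug_def bitower_def by (rule caug_cface[OF cring_Y])

lemma biaug_face_B: "k \<le> b \<Longrightarrow> x \<in> carrier (bitower a (Suc b)) \<Longrightarrow> biaug a b (gmap a (psi_face R b k) x) = biaug a (Suc b) x"
  unfolding biaug_def bitower_def
  by (rule caug_gmap[OF cring_Y cring_Y is_cring_R psi_aug_ring_hom psi_aug_ring_hom])
    (auto intro: ring_hom_closed[OF psi_face_hom] psi_aug_face[OF psi_ring_R] simp del: psi_aug.simps)

lemma faceA_biDer: "k \<le> a \<Longrightarrow> \<phi> \<in> biDer f a b \<Longrightarrow> faceA a b k \<phi> \<in> biDer f (Suc a) b"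
  unfolding faceA_def by (rule biDer_comp[OF face_A_hom biaug_face_A])

lemma faceB_biDer: "k \<le> b \<Longrightarrow> \<phi> \<in> biDer f a b \<Longrightarrow> faceB a b k \<phi> \<in> biDer f a (Suc b)"
  unfolding faceB_def by (rule biDer_comp[OF face_B_hom biaug_face_B])

lemma faceA_biNul: "k \<le> a \<Longrightarrow> \<phi> \<in> biNul a b \<Longrightarrow> faceA a b k \<phi> \<in> biNul (Suc a) b"
  unfolding faceA_def by (rule biNul_comp[OF face_A_hom])

lemma faceB_biNul: "k \<le> b \<Longrightarrow> \<phi> \<in> biNul a b \<Longrightarrow> faceB a b k \<phi> \<in> biNul a (Suc b)"
  unfolding faceB_def by (rule biNul_comp[OF face_B_hom])

lemma diffA_biDer: "1 \<le> f \<Longrightarrow> \<phi> \<in> biDer f a b \<Longrightarrow> diffA a b \<phi> \<in> biDer f (Suc a) b"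
  unfolding diffA_def by (intro altsum_mem[OF subgrp_biDer] faceA_biDer)

lemma diffB_biDer: "1 \<le> f \<Longrightarrow> \<phi> \<in> biDer f a b \<Longrightarrow> diffB a b \<phi> \<in> biDer f a (Suc b)"
  unfolding diffB_def by (intro altsum_mem[OF subgrp_biDer] faceB_biDer)

lemma diffA_biNul: "\<phi> \<in> biNul a b \<Longrightarrow> diffA a b \<phi> \<in> biNul (Suc a) b"
  unfolding diffA_def by (intro altsum_mem[OF subgrp_biNul] faceA_biNul)

lemma diffB_biNul: "\<phi> \<in> biNul a b \<Longrightarrow> diffB a b \<phi> \<in> biNul a (Suc b)"
  unfolding diffB_def by (intro altsum_mem[OF subgrp_biNul] faceB_biNul)

lemma diffA_diffA: "diffA (Suc a) b (diffA a b \<phi>) \<in> biNul (Suc (Suc a)) b"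
  unfolding diffA_def
proof (rule altsum_square[OF subgrp_biNul additive_faceA])
  fix i j assume ij: "i < j" "j \<le> Suc a"
  show "faceA (Suc a) b j (faceA a b i \<phi>) - faceA (Suc a) b i (faceA a b (j - 1) \<phi>) \<in> biNul (Suc (Suc a)) b"
  proof (rule biNul_eqI)
    fix x assume "x \<in> carrier (bitower (Suc (Suc a)) b)"
    then have "cface (ytower R b) a i (cface (ytower R b) (Suc a) j x) =
        cface (ytower R b) a (j - 1) (cface (ytower R b) (Suc a) i x)"
      unfolding bitower_def by (rule cface_cface[OF cring_Y ij])
    then show "faceA (Suc a) b j (faceA a b i \<phi>) x = faceA (Suc a) b i (faceA a b (j - 1) \<phi>) x"
      by (simp only: faceA_def)
  qed
qed

lemma diffB_diffB: "diffB a (Suc b) (diffB a b \<phi>) \<in> biNul a (Suc (Suc b))"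
  unfolding diffB_def
proof (rule altsum_square[OF subgrp_biNul additive_faceB])
  fix i j assume ij: "i < j" "j \<le> Suc b"
  show "faceB a (Suc b) j (faceB a b i \<phi>) - faceB a (Suc b) i (faceB a b (j - 1) \<phi>) \<in> biNul a (Suc (Suc b))"
  proof (rule biNul_eqI)
    fix x assume x: "x \<in> carrier (bitower a (Suc (Suc b)))"
    have "gmap a (psi_face R b i) (gmap a (psi_face R (Suc b) j) x) =
        gmap a (psi_face R b (j - 1)) (gmap a (psi_face R (Suc b) i) x)"
      by (rule gmap_square[where Y = "ytower R (Suc (Suc b))"])
        (use psi_face_psi_face[OF psi_ring_R ij] x in \<open>auto simp: bitower_def\<close>)
    then show "faceB a (Suc b) j (faceB a b i \<phi>) x = faceB a (Suc b) i (faceB a b (j - 1) \<phi>) x"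
      by (simp only: faceB_def)
  qed
qed

lemma diffA_diffB: "diffA a (Suc b) (diffB a b \<phi>) - diffB (Suc a) b (diffA a b \<phi>) \<in> biNul (Suc a) (Suc b)"
proof -
  have "faceA a (Suc b) k (diffB a b \<phi>) - diffB (Suc a) b (faceA a b k \<phi>) \<in> biNul (Suc a) (Suc b)" if k: "k \<le> a" for k
    unfolding diffB_def
  proof (rule altsum_commute[OF subgrp_biNul additive_faceA])
    fix l assume l: "l \<le> b"
    show "faceA a (Suc b) k (faceB a b l \<phi>) - faceB (Suc a) b l (faceA a b k \<phi>) \<in> biNul (Suc a) (Suc b)"
    proof (rule biNul_eqI)
      fix x assume x: "x \<in> carrier (bitower (Suc a) (Suc b))"
      have "cface (ytower R b) a k (gmap (Suc a) (psi_face R b l) x) =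
          gmap a (psi_face R b l) (cface (ytower R (Suc b)) a k x)"
        by (rule gmap_cface[OF cring_Y cring_Y psi_face_hom[OF l] k x[unfolded bitower_def]])
      then show "faceA a (Suc b) k (faceB a b l \<phi>) x = faceB (Suc a) b l (faceA a b k \<phi>) x"
        by (simp only: faceA_def faceB_def)
    qed
  qed
  then have "- (faceA a (Suc b) k (diffB a b \<phi>) - diffB (Suc a) b (faceA a b k \<phi>)) \<in> biNul (Suc a) (Suc b)" if "k \<le> a" for k
    using subgrp_minus[OF subgrp_biNul] that by blast
  then have "diffB (Suc a) b (diffA a b \<phi>) - diffA a (Suc b) (diffB a b \<phi>) \<in> biNul (Suc a) (Suc b)"
    unfolding diffA_def by (intro altsum_commute[OF subgrp_biNul additive_diffB]) simp
  from subgrp_minus[OF subgrp_biNul this] show ?thesis by simp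
qed

text \<open>The ring \<open>Y = G\<^sup>b\<^sup>+\<^sup>1(R)\<close> is free as a commutative
  ring, so its counit \<open>F(Y) \<rightarrow> Y\<close> has a section \<open>s\<close> that is a
  ring homomorphism over \<open>R\<close>. Applying \<open>F\<^sup>a\<close> to \<open>s\<close>
  splits the last face and commutes with the others.\<close>

lemma diffA_exact:
  assumes p: "\<phi> \<in> biDer f a (Suc b)" and d: "diffA a (Suc b) \<phi> \<in> biNul (Suc a) (Suc b)" and f: "1 \<le> f"
  shows "a = 0 \<Longrightarrow> \<phi> \<in> biNul a (Suc b)"
    and "a = Suc m \<Longrightarrow> \<exists>y\<in>biDer f m (Suc b). \<phi> - diffA m (Suc b) y \<in> biNul a (Suc b)"
proof -
  let ?Y = "ytower R (Suc b)" and ?V = "ops (carrier (psi_tower R b))"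
  let ?Y' = "ctower ?Y (Suc 0)"
  have Y: "?Y = free_cring ?V" by (rule ytower_simps)
  have Y'c: "cring ?Y'" by (rule cring_ctower[OF cring_Y])
  \<comment> \<open>the section of the counit, sending a variable \<open>v\<close> of \<open>Y\<close> to the variable of \<open>F(Y)\<close> named by the element \<open>v\<close> of \<open>Y\<close>\<close>
  define s where "s = free_map (var :: 'a poly_tower \<Rightarrow> _)"
  have s: "s \<in> ring_hom ?Y ?Y'"
    unfolding s_def Y ctower.simps by (rule free_map_hom) (rule var_carrier)
  have es: "cr_counit ?Y (s x) = x" if x: "x \<in> carrier ?Y" for x
  proof (rule free_cring_hom_eq[OF _ _ cring_Y[of "Suc b", unfolded Y] _ x[unfolded Y], folded Y])
    show "(\<lambda>x. cr_counit ?Y (s x)) \<in> ring_hom ?Y ?Y"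
      using ring_hom_comp[OF s, of "cr_counit ?Y" ?Y] counit_hom(1)[OF cring_Y] by simp
    show "(\<lambda>x. x) \<in> ring_hom ?Y ?Y" by (simp add: ring_hom_def)
    show "cr_counit ?Y (s (var v)) = var v" if "v \<in> ?V" for v
      unfolding s_def free_map_var by (rule counit_hom(2)[OF cring_Y]) (use that Y var_carrier in auto)
  qed
  have sg: "gmap n s \<in> ring_hom (bitower n (Suc b)) (bitower (Suc n) (Suc b))" for n
    using gmap_hom[OF s, of n] by (simp add: bitower_def ctower_ctower del: ctower.simps)
  have aug: "biaug (Suc n) (Suc b) (gmap n s x) = biaug n (Suc b) x" if x: "x \<in> carrier (bitower n (Suc b))" for n x
  proof -
    have "caug ?Y' (caug ?Y (psi_aug R (Suc b)) (Suc 0)) n (gmap n s x) = caug ?Y (psi_aug R (Suc b)) n x"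
    proof (rule caug_gmap[OF cring_Y Y'c is_cring_R psi_aug_ring_hom caug_hom[OF cring_Y psi_aug_ring_hom]
          ring_hom_closed[OF s] _ x[unfolded bitower_def]])
      show "caug ?Y (psi_aug R (Suc b)) (Suc 0) (s y) = psi_aug R (Suc b) y" if "y \<in> carrier ?Y" for y
        using es[OF that] by simp
    qed
    then show ?thesis by (simp only: biaug_def caug_ctower)
  qed
  define H where "H n \<psi> = (\<lambda>x. \<psi> (gmap n s x) :: 'b \<Rightarrow>\<^sub>0 int)" for n and \<psi> :: "'a poly_tower \<Rightarrow> ('b \<Rightarrow>\<^sub>0 int)"
  have H: "additive (H n)" for n unfolding H_def[abs_def] by (rule additive_precomp)
  have HN: "\<psi> \<in> biNul (Suc n) (Suc b) \<Longrightarrow> H n \<psi> \<in> biNul n (Suc b)" for n \<psi>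
    unfolding H_def by (rule biNul_comp[OF sg])
  have HL: "\<psi> \<in> biDer f (Suc n) (Suc b) \<Longrightarrow> H n \<psi> \<in> biDer f n (Suc b)" for n \<psi>
    unfolding H_def by (rule biDer_comp[OF sg aug])
  have c: "H a (faceA a (Suc b) k \<phi>) - faceA (a - 1) (Suc b) k (H (a - 1) \<phi>) \<in> biNul a (Suc b)" if k: "k < a" for k
  proof (rule biNul_eqI)
    fix x assume x: "x \<in> carrier (bitower a (Suc b))"
    obtain n where n: "a = Suc n" using k by (cases a) auto
    have "cface ?Y' n k (gmap (Suc n) s x) = gmap n s (cface ?Y n k x)"
      by (rule gmap_cface[OF cring_Y Y'c s]) (use k n x in \<open>auto simp: bitower_def\<close>)
    then show "H a (faceA a (Suc b) k \<phi>) x = faceA (a - 1) (Suc b) k (H (a - 1) \<phi>) x"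
      unfolding H_def faceA_def n using k n by (simp add: cface_ctower del: ctower.simps funpow.simps)
  qed
  have l: "H a (faceA a (Suc b) a \<phi>) - \<phi> \<in> biNul a (Suc b)"
  proof (rule biNul_eqI)
    fix x assume x: "x \<in> carrier (bitower a (Suc b))"
    have "gmap a (cr_counit ?Y) (gmap a s x) = gmap a (\<lambda>y. cr_counit ?Y (s y)) x"
      using gmap_comp[of x ?Y a] x by (simp add: bitower_def)
    also have "\<dots> = x" by (rule gmap_id[OF es x[unfolded bitower_def]])
    finally show "H a (faceA a (Suc b) a \<phi>) x = \<phi> x" by (simp only: H_def faceA_def cface_last)
  qed
  have dH: "H a (altsum (faceA a (Suc b)) a \<phi>) \<in> biNul a (Suc b)" using HN[OF d] by (simp only: diffA_def)
  note E = altsum_last_degeneracy[where N = "biNul a (Suc b)" and H = "H a" and F = "faceA a (Suc b)"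
      and F' = "faceA (a - 1) (Suc b)" and x = \<phi> and z = "H (a - 1) \<phi>", OF subgrp_biNul H c l dH]
  show "a = 0 \<Longrightarrow> \<phi> \<in> biNul a (Suc b)" by (rule E(1))
  assume a: "a = Suc m"
  have m: "a - 1 = m" using a by simp
  have "\<phi> - alt a (- altsum (faceA (a - 1) (Suc b)) m (H (a - 1) \<phi>)) \<in> biNul a (Suc b)" by (rule E(2)[OF _ a])
  then have "\<phi> - diffA m (Suc b) (alt a (- H m \<phi>)) \<in> biNul a (Suc b)"
    unfolding m diffA_def[symmetric] by (simp add: additive_alt_apply[OF additive_diffA] additive.minus[OF additive_diffA])
  moreover have "alt a (- H m \<phi>) \<in> biDer f m (Suc b)"
    using HL[of \<phi> m] p a by (intro alt_mem[OF subgrp_biDer[OF f]] subgrp_minus[OF subgrp_biDer[OF f]]) simp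
  ultimately show "\<exists>y\<in>biDer f m (Suc b). \<phi> - diffA m (Suc b) y \<in> biNul a (Suc b)" by blast
qed

text \<open>\<open>x \<mapsto> \<Psi>\<^sup>1 x\<close> splits the counit \<open>G(Z)
  \<rightarrow> Z\<close> as a map of sets only; after one application of \<open>F\<close> it
  induces ring homomorphisms, which is why the first index must be positive.\<close>

lemma diffB_exact:
  assumes p: "\<phi> \<in> biDer f (Suc a) b" and d: "diffB (Suc a) b \<phi> \<in> biNul (Suc a) (Suc b)" and f: "1 \<le> f"
  shows "b = 0 \<Longrightarrow> \<phi> \<in> biNul (Suc a) b"
    and "b = Suc m \<Longrightarrow> \<exists>y\<in>biDer f (Suc a) m. \<phi> - diffB (Suc a) m y \<in> biNul (Suc a) b"
proof -
  let ?e = "\<lambda>x :: 'a poly_tower. var (Op (Suc 0) x)"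
  have ec: "?e x \<in> carrier (ytower R (Suc n))" if "x \<in> carrier (ytower R n)" for x n
    using that by (auto simp: ytower_simps ops_def carrier_psi_tower)
  have face0: "psi_face R n 0 (?e x) = x" if "x \<in> carrier (ytower R n)" for x n
    using psi_counit_var[OF psi_ring_R, of "Suc 0" x n] that
      psi_ring.psi_one[OF psi_ring_psi_tower[OF psi_ring_R], of x n]
    by (simp add: psi_face_simps carrier_psi_tower)
  have faceS: "psi_face R (Suc n) (Suc k) (?e x) = ?e (psi_face R n k x)" for n k x
    by (simp add: psi_face_simps free_map_var)
  have eg: "gmap (Suc a) ?e \<in> ring_hom (bitower (Suc a) n) (bitower (Suc a) (Suc n))" for n
    unfolding bitower_def by (rule gmap_hom_Suc[OF ec])
  have aug: "biaug (Suc a) (Suc n) (gmap (Suc a) ?e x) = biaug (Suc a) n x" if x: "x \<in> carrier (bitower (Suc a) n)" for n x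
    unfolding biaug_def
  proof (rule caug_gmap[OF cring_Y cring_Y is_cring_R psi_aug_ring_hom psi_aug_ring_hom ec _ x[unfolded bitower_def]])
    fix y assume y: "y \<in> carrier (ytower R n)"
    show "psi_aug R (Suc n) (?e y) = psi_aug R n y"
      using psi_aug_face[OF psi_ring_R, of 0 n "?e y"] ec[OF y] face0[OF y] by (simp del: psi_aug.simps)
  qed
  define H where "H \<psi> = (\<lambda>x. \<psi> (gmap (Suc a) ?e x) :: 'b \<Rightarrow>\<^sub>0 int)" for \<psi> :: "'a poly_tower \<Rightarrow> ('b \<Rightarrow>\<^sub>0 int)"
  have H: "additive H" unfolding H_def[abs_def] by (rule additive_precomp)
  have HN: "\<psi> \<in> biNul (Suc a) (Suc n) \<Longrightarrow> H \<psi> \<in> biNul (Suc a) n" for n \<psi>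
    unfolding H_def by (rule biNul_comp[OF eg])
  have HL: "\<psi> \<in> biDer f (Suc a) (Suc n) \<Longrightarrow> H \<psi> \<in> biDer f (Suc a) n" for n \<psi>
    unfolding H_def by (rule biDer_comp[OF eg aug])
  have c: "H (faceB (Suc a) b (Suc k) \<phi>) - faceB (Suc a) (b - 1) k (H \<phi>) \<in> biNul (Suc a) b" if k: "k < b" for k
  proof (rule biNul_eqI)
    fix x assume x: "x \<in> carrier (bitower (Suc a) b)"
    obtain n where n: "b = Suc n" using k by (cases b) auto
    have "gmap (Suc a) (psi_face R b (Suc k)) (gmap (Suc a) ?e x) = gmap (Suc a) ?e (gmap (Suc a) (psi_face R n k) x)"
      by (rule gmap_square[OF _ x[unfolded bitower_def]]) (simp add: n faceS)
    then show "H (faceB (Suc a) b (Suc k) \<phi>) x = faceB (Suc a) (b - 1) k (H \<phi>) x"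
      unfolding H_def faceB_def n by (simp only: diff_Suc_1)
  qed
  have l: "H (faceB (Suc a) b 0 \<phi>) - \<phi> \<in> biNul (Suc a) b"
  proof (rule biNul_eqI)
    fix x assume x: "x \<in> carrier (bitower (Suc a) b)"
    have "gmap (Suc a) (psi_face R b 0) (gmap (Suc a) ?e x) = gmap (Suc a) (\<lambda>y. psi_face R b 0 (?e y)) x"
      by (rule gmap_comp[OF x[unfolded bitower_def]])
    also have "\<dots> = x" by (rule gmap_id[OF face0 x[unfolded bitower_def]])
    finally show "H (faceB (Suc a) b 0 \<phi>) x = \<phi> x" by (simp only: H_def faceB_def)
  qed
  have dH: "H (altsum (faceB (Suc a) b) b \<phi>) \<in> biNul (Suc a) b" using HN[OF d] by (simp only: diffB_def)
  note E = altsum_first_degeneracy[where N = "biNul (Suc a) b" and H = H and F = "faceB (Suc a) b"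
      and F' = "faceB (Suc a) (b - 1)" and x = \<phi> and z = "H \<phi>", OF subgrp_biNul H c l dH]
  show "b = 0 \<Longrightarrow> \<phi> \<in> biNul (Suc a) b" by (rule E(1))
  assume b: "b = Suc m"
  have m: "b - 1 = m" using b by simp
  have "\<phi> - altsum (faceB (Suc a) (b - 1)) m (H \<phi>) \<in> biNul (Suc a) b" by (rule E(2)[OF _ b])
  then have "\<phi> - diffB (Suc a) m (H \<phi>) \<in> biNul (Suc a) b" unfolding m diffB_def .
  moreover have "H \<phi> \<in> biDer f (Suc a) m" using HL[of \<phi> m] p b by simp
  ultimately show "\<exists>y\<in>biDer f (Suc a) m. \<phi> - diffB (Suc a) m y \<in> biNul (Suc a) b" by blast
qed

lemma double_biDer:
  assumes f: "1 \<le> f"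
  shows "nat_double_augmented (\<lambda>p q. biDer f (Suc p) (Suc q)) (\<lambda>p q. biNul (Suc p) (Suc q))
    (\<lambda>p q. diffA (Suc p) (Suc q)) (\<lambda>p q. diffB (Suc p) (Suc q))
    (\<lambda>q. biDer f 0 (Suc q)) (\<lambda>q. biNul 0 (Suc q)) (\<lambda>q. diffB 0 (Suc q)) (\<lambda>q. diffA 0 (Suc q))
    (\<lambda>p. biDer f (Suc p) 0) (\<lambda>p. biNul (Suc p) 0) (\<lambda>p. diffA (Suc p) 0) (\<lambda>p. diffB (Suc p) 0)"
proof
  have minus: "diffB (Suc a) b (diffA a b \<phi>) - diffA a (Suc b) (diffB a b \<phi>) \<in> biNul (Suc a) (Suc b)" for a b \<phi>
    using subgrp_minus[OF subgrp_biNul diffA_diffB[of a b \<phi>]] by simp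
  fix p q :: nat and x y
  show "biNul (Suc p) (Suc q) \<subseteq> biDer f (Suc p) (Suc q)" by (rule biNul_biDer[OF f])
  show "diffA (Suc p) (Suc q) (x + y) = diffA (Suc p) (Suc q) x + diffA (Suc p) (Suc q) y"
    by (rule additive.add[OF additive_diffA])
  show "diffB (Suc p) (Suc q) (x + y) = diffB (Suc p) (Suc q) x + diffB (Suc p) (Suc q) y"
    by (rule additive.add[OF additive_diffB])
  show "diffB 0 (Suc q) (x + y) = diffB 0 (Suc q) x + diffB 0 (Suc q) y" by (rule additive.add[OF additive_diffB])
  show "diffA 0 (Suc q) (x + y) = diffA 0 (Suc q) x + diffA 0 (Suc q) y" by (rule additive.add[OF additive_diffA])
  show "diffA (Suc p) 0 (x + y) = diffA (Suc p) 0 x + diffA (Suc p) 0 y" by (rule additive.add[OF additive_diffA])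
  show "diffB (Suc p) 0 (x + y) = diffB (Suc p) 0 x + diffB (Suc p) 0 y" by (rule additive.add[OF additive_diffB])
  show "diffA 0 (Suc q) x \<in> biNul (Suc 0) (Suc q) \<longleftrightarrow> x \<in> biNul 0 (Suc q)" if "x \<in> biDer f 0 (Suc q)"
    using diffA_exact(1)[OF that _ f refl] diffA_biNul by blast
  show "diffB (Suc p) 0 x \<in> biNul (Suc p) (Suc 0) \<longleftrightarrow> x \<in> biNul (Suc p) 0" if "x \<in> biDer f (Suc p) 0"
    using diffB_exact(1)[OF that _ f refl] diffB_biNul by blast
  show "diffB (Suc (Suc p)) 0 (diffA (Suc p) 0 x) - diffA (Suc p) (Suc 0) (diffB (Suc p) 0 x) \<in> biNul (Suc (Suc p)) (Suc 0)"
    by (rule minus)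
qed (use f in \<open>auto intro: subgrp_biDer subgrp_biNul diffA_biDer diffB_biDer diffA_biNul diffB_biNul diffA_diffA diffB_diffB diffA_diffB
    diffA_exact(2) diffB_exact(2)\<close>)

end


section \<open>Free Psi-ring resolutions compute Andre-Quillen cohomology\<close>

context psi_module
begin

lemma Der_cong: "(\<And>x. x \<in> carrier A \<Longrightarrow> \<sigma> x = \<tau> x) \<Longrightarrow> Der A \<sigma> = Der A \<tau>"
  by (auto simp: Der_def)

lemma psi_psi: "1 \<le> u \<Longrightarrow> 1 \<le> f \<Longrightarrow> x \<in> carrier (bitower a b) \<Longrightarrow>
    psi R u (psi R f (biaug a b x)) = psi R (u * f) (biaug a b x)"
  by (rule psi_comp) (auto intro: ring_hom_closed[OF biaug_hom])

lemma pushf_biDer: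
  assumes u: "1 \<le> u" and f: "1 \<le> f" and p: "\<phi> \<in> biDer f a b"
  shows "pushf u \<phi> \<in> biDer (u * f) a b"
proof -
  have "pushf u \<phi> \<in> Der (bitower a b) (\<lambda>x. psi R u (psi R f (biaug a b x)))"
    using p unfolding biDer_def by (intro Der_pushf[OF u]) (auto intro: ring_hom_closed[OF sigma_hom[OF f]])
  also have "Der (bitower a b) (\<lambda>x. psi R u (psi R f (biaug a b x))) = biDer (u * f) a b"
    unfolding biDer_def by (rule Der_cong) (rule psi_psi[OF u f])
  finally show ?thesis .
qed

lemma pushf_biNul: "1 \<le> u \<Longrightarrow> \<phi> \<in> biNul a b \<Longrightarrow> pushf u \<phi> \<in> biNul a b"
  unfolding biNul_def by (rule Nul_pushf)

lemma pushf_diffA: "pushf u (diffA a b \<phi>) = diffA a b (pushf u \<phi>)"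
proof -
  have e: "pushf u (faceA a b k \<phi>) = faceA a b k (pushf u \<phi>)" for k by (simp add: pushf_def faceA_def)
  show ?thesis unfolding diffA_def altsum_map[OF additive_pushf] e unfolding altsum_def ..
qed

lemma pushf_diffB: "pushf u (diffB a b \<phi>) = diffB a b (pushf u \<phi>)"
proof -
  have e: "pushf u (faceB a b k \<phi>) = faceB a b k (pushf u \<phi>)" for k by (simp add: pushf_def faceB_def)
  show ?thesis unfolding diffB_def altsum_map[OF additive_pushf] e unfolding altsum_def ..
qed

text \<open>The map induced by \<open>\<Psi>\<^sup>v\<close> on the source; at \<open>b =
  0\<close> it comes from the endomorphism \<open>\<Psi>\<^sup>v\<close> of \<open>R\<close>.
  Together with \<open>pushf\<close> it makes \<open>f \<mapsto> biDer f a b\<close> a natural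
  system.\<close>

definition pullf :: "nat \<Rightarrow> nat \<Rightarrow> nat \<Rightarrow> ('a poly_tower \<Rightarrow> ('b \<Rightarrow>\<^sub>0 int)) \<Rightarrow> 'a poly_tower \<Rightarrow> ('b \<Rightarrow>\<^sub>0 int)" where
  "pullf a b v \<phi> = (\<lambda>x. \<phi> (gmap a (psi (psi_tower R b) v) x))"

lemma additive_pullf: "additive (pullf a b v)"
  unfolding pullf_def[abs_def] by (rule additive_precomp)

lemma pullf_hom: "1 \<le> v \<Longrightarrow> gmap a (psi (psi_tower R b) v) \<in> ring_hom (bitower a b) (bitower a b)"
  unfolding bitower_def by (rule gmap_hom[OF psi_tower_psi_hom[OF psi_ring_R]])

lemma biaug_pullf:
  assumes v: "1 \<le> v" and x: "x \<in> carrier (bitower a b)"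
  shows "biaug a b (gmap a (psi (psi_tower R b) v) x) = psi R v (biaug a b x)"
proof -
  have "caug (ytower R b) (psi_aug R b) a (gmap a (psi (psi_tower R b) v) x) =
      caug (ytower R b) (\<lambda>x. psi R v (psi_aug R b x)) a x"
    by (rule caug_gmap[OF cring_Y cring_Y is_cring_R ring_hom_comp[OF psi_aug_ring_hom psi_hom[OF v]]
          psi_aug_ring_hom ring_hom_closed[OF psi_tower_psi_hom[OF psi_ring_R v]]
          psi_aug_psi[OF psi_ring_R v] x[unfolded bitower_def]])
  then show ?thesis by (simp add: biaug_def caug_comp)
qed

lemma pullf_biDer:
  assumes v: "1 \<le> v" and f: "1 \<le> f" and p: "\<phi> \<in> biDer f a b"
  shows "pullf a b v \<phi> \<in> biDer (f * v) a b"
  unfolding biDer_def pullf_def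
proof (rule Der_comp[OF pullf_hom[OF v] p[unfolded biDer_def]])
  fix x assume x: "x \<in> carrier (bitower a b)"
  show "psi R f (biaug a b (gmap a (psi (psi_tower R b) v) x)) = psi R (f * v) (biaug a b x)"
    using biaug_pullf[OF v x] psi_psi[OF f v x] by simp
qed

lemma pullf_biNul: "1 \<le> v \<Longrightarrow> \<phi> \<in> biNul a b \<Longrightarrow> pullf a b v \<phi> \<in> biNul a b"
  unfolding pullf_def by (rule biNul_comp[OF pullf_hom])

lemma pullf_diffA:
  assumes v: "1 \<le> v"
  shows "pullf (Suc a) b v (diffA a b \<phi>) - diffA a b (pullf a b v \<phi>) \<in> biNul (Suc a) b"
  unfolding diffA_def
proof (rule altsum_commute[OF subgrp_biNul additive_pullf])
  fix k assume k: "k \<le> a"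
  show "pullf (Suc a) b v (faceA a b k \<phi>) - faceA a b k (pullf a b v \<phi>) \<in> biNul (Suc a) b"
  proof (rule biNul_eqI)
    fix x assume x: "x \<in> carrier (bitower (Suc a) b)"
    have "cface (ytower R b) a k (gmap (Suc a) (psi (psi_tower R b) v) x) =
        gmap a (psi (psi_tower R b) v) (cface (ytower R b) a k x)"
      by (rule gmap_cface[OF cring_Y cring_Y psi_tower_psi_hom[OF psi_ring_R v] k x[unfolded bitower_def]])
    then show "pullf (Suc a) b v (faceA a b k \<phi>) x = faceA a b k (pullf a b v \<phi>) x"
      by (simp only: pullf_def faceA_def)
  qed
qed

lemma pullf_diffB:
  assumes v: "1 \<le> v"
  shows "pullf a (Suc b) v (diffB a b \<phi>) - diffB a b (pullf a b v \<phi>) \<in> biNul a (Suc b)"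
  unfolding diffB_def
proof (rule altsum_commute[OF subgrp_biNul additive_pullf])
  fix k assume k: "k \<le> b"
  show "pullf a (Suc b) v (faceB a b k \<phi>) - faceB a b k (pullf a b v \<phi>) \<in> biNul a (Suc b)"
  proof (rule biNul_eqI)
    fix x assume x: "x \<in> carrier (bitower a (Suc b))"
    have "gmap a (psi_face R b k) (gmap a (psi (psi_tower R (Suc b)) v) x) =
        gmap a (psi (psi_tower R b) v) (gmap a (psi_face R b k) x)"
      by (rule gmap_square[where Y = "ytower R (Suc b)"])
        (use psi_face_mor[OF psi_ring_R k] v x in \<open>auto simp: bitower_def psi_mor_def simp del: psi_tower.simps\<close>)
    then show "pullf a (Suc b) v (faceB a b k \<phi>) x = faceB a b k (pullf a b v \<phi>) x"
      by (simp only: pullf_def faceB_def)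
  qed
qed

definition aq_section :: "nat \<Rightarrow> ('a poly_tower \<Rightarrow> ('b \<Rightarrow>\<^sub>0 int)) \<Rightarrow> 'a poly_tower \<Rightarrow> 'a poly_tower \<times> 'a \<times> 'b" where
  "aq_section q = sec (bitower (Suc q) 0) (biaug (Suc q) 0)"

lemma bitower_cr_tower: "bitower a 0 = cr_tower R a" and biaug_cr_aug: "biaug a 0 = cr_aug R a"
  by (simp_all add: bitower_def biaug_def cr_tower_ctower cr_aug_caug ytower_simps)

lemma presents_aq_cochains:
  assumes f: "1 \<le> f"
  shows "presents (biDer f (Suc q) 0) (biNul (Suc q) 0) (aq_cochains R (twist R M f) q) (aq_section q)"
  using presents_ring_sections[OF cring_bitower biaug_hom f, of "Suc q" 0]
  by (simp add: biDer_def biNul_def aq_section_def aq_cochains_def Let_def bitower_cr_tower biaug_cr_aug del: cr_tower.simps cr_aug.simps)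

lemma section_pullback_sec:
  assumes "\<And>x. x \<in> carrier A \<Longrightarrow> h x \<in> carrier B \<and> \<beta> (h x) = \<alpha> x"
  shows "section_pullback A h (sec B \<beta> \<phi>) = sec A \<alpha> (\<lambda>x. \<phi> (h x))"
  using assms by (auto simp: section_pullback_def sec_def restrict_def fun_eq_iff)

lemma aq_diff_sec:
  assumes f: "1 \<le> f" and p: "\<phi> \<in> biDer f (Suc q) 0"
  shows "aq_diff R (twist R M f) q (aq_section q \<phi>) = aq_section (Suc q) (diffA (Suc q) 0 \<phi>)"
proof -
  have "section_pullback (cr_tower R (Suc (Suc q))) (cr_face R (Suc q) k) (aq_section q \<phi>) = aq_section (Suc q) (faceA (Suc q) 0 k \<phi>)"
    if "k \<le> Suc q" for k
    unfolding aq_section_def faceA_def bitower_cr_tower[symmetric] cr_face_cface ytower_simps(1)[of R, symmetric]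
    using ring_hom_closed[OF face_A_hom[OF that, of 0]] biaug_face_A[OF that, of _ 0]
    by (intro section_pullback_sec) simp
  then show ?thesis
    unfolding aq_diff_def diffA_def altsum_def
    by (intro presents_alternating_sum[OF presents_aq_cochains[OF f]] faceA_biDer[OF _ p])
qed

abbreviation "LA f \<equiv> (\<lambda>q. biDer f (Suc q) 0)"
abbreviation "NA \<equiv> (\<lambda>q. biNul (Suc q) 0)"
abbreviation "DA \<equiv> (\<lambda>q. diffA (Suc q) 0)"
abbreviation "LB f \<equiv> (\<lambda>q. biDer f 0 (Suc q))"
abbreviation "NB \<equiv> (\<lambda>q. biNul 0 (Suc q))"
abbreviation "DB \<equiv> (\<lambda>q. diffB 0 (Suc q))"

definition aq_class where
  "aq_class f q x = coboundaries (aq_cochains R (twist R M f)) (aq_diff R (twist R M f)) q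
     #>\<^bsub>aq_cochains R (twist R M f) q\<^esub> aq_section q x"

lemma presents_aq_cohomology:
  assumes f: "1 \<le> f"
  shows "presents (cocycle_set (LA f) NA DA q) (coboundary_set (LA f) NA DA q) (aq_cohomology R (twist R M f) q) (aq_class f q)"
  unfolding aq_cohomology_def aq_class_def[abs_def]
  by (rule presents_cohomology[where C = "LA f" and N = NA and G = "aq_cochains R (twist R M f)" and h = aq_section
        and \<delta> = DA and d = "aq_diff R (twist R M f)"])
    (rule presents_aq_cochains[OF f] additive_diffA diffA_diffA diffA_biDer[OF f] aq_diff_sec[OF f]; assumption)+

lemma push_aq_class:
  assumes u: "1 \<le> u" and f: "1 \<le> f" and y: "y \<in> LA f q"
  shows "push (aq_nat_sys R M q) u f (aq_class f q y) = aq_class (u * f) q (pushf u y)"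
proof -
  have uf: "1 \<le> u * f" using u f by simp
  have g: "aq_coeff_map R q (mpsi M u) (aq_section q x) = aq_section q (pushf u x)" if "x \<in> LA f q" for x
    using u by (auto simp: aq_coeff_map_def aq_section_def sec_def bitower_cr_tower biaug_cr_aug ev_pushf restrict_def fun_eq_iff
        simp del: cr_tower.simps cr_aug.simps)
  have N: "pushf u (DA k x) - DA k (pushf u x) \<in> NA (Suc k)" for k x
    unfolding pushf_diffA using subgrp_0[OF subgrp_biNul] by simp
  show ?thesis
    unfolding aq_nat_sys_def nat_sys.simps aq_class_def
    by (rule cohomology_map_presented[where n = q and g = "aq_coeff_map R q (mpsi M u)" and \<gamma> = "\<lambda>_. pushf u"
          and C = "LA f" and N = NA and C' = "LA (u * f)" and N' = NA and h = aq_section and h' = aq_section and \<delta> = DA and \<delta>' = DA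
          and G = "aq_cochains R (twist R M f)" and G' = "aq_cochains R (twist R M (u * f))"
          and d = "aq_diff R (twist R M f)" and d' = "aq_diff R (twist R M (u * f))"])
      (rule presents_aq_cochains[OF f] presents_aq_cochains[OF uf] diffA_biDer[OF f] diffA_biDer[OF uf] additive_diffA
         aq_diff_sec[OF f] aq_diff_sec[OF uf] additive_pushf pushf_biDer[OF u f] N g y; assumption)+
qed

lemma pull_aq_class:
  assumes v: "1 \<le> v" and f: "1 \<le> f" and y: "y \<in> LA f q"
  shows "pull (aq_nat_sys R M q) v f (aq_class f q y) = aq_class (f * v) q (pullf (Suc q) 0 v y)"
proof -
  have fv: "1 \<le> f * v" using v f by simp
  have m: "cr_tower_map (psi R v) (Suc q) = gmap (Suc q) (psi (psi_tower R 0) v)"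
    unfolding cr_tower_map_gmap psi_psi_tower(1) ..
  have g: "aq_ring_map R q (psi R v) (aq_section q x) = aq_section q (pullf (Suc q) 0 v x)" if "x \<in> LA f q" for x
    using ring_hom_closed[OF pullf_hom[OF v, of "Suc q" 0]]
    unfolding aq_ring_map_def m pullf_def aq_section_def bitower_cr_tower[symmetric] biaug_cr_aug[symmetric]
    by (auto simp: sec_def restrict_def fun_eq_iff simp del: psi_tower.simps funpow.simps)
  show ?thesis
    unfolding aq_nat_sys_def nat_sys.simps aq_class_def
    by (rule cohomology_map_presented[where n = q and g = "aq_ring_map R q (psi R v)" and \<gamma> = "\<lambda>q. pullf (Suc q) 0 v"
          and C = "LA f" and N = NA and C' = "LA (f * v)" and N' = NA and h = aq_section and h' = aq_section and \<delta> = DA and \<delta>' = DA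
          and G = "aq_cochains R (twist R M f)" and G' = "aq_cochains R (twist R M (f * v))"
          and d = "aq_diff R (twist R M f)" and d' = "aq_diff R (twist R M (f * v))"])
      (rule presents_aq_cochains[OF f] presents_aq_cochains[OF fv] diffA_biDer[OF f] diffA_biDer[OF fv] additive_diffA
         aq_diff_sec[OF f] aq_diff_sec[OF fv] additive_pullf pullf_biDer[OF v f] pullf_diffA[OF v] g y; assumption)+
qed

text \<open>The comparison of the edges \<open>b = 0\<close> and \<open>a = 0\<close>. The
  bicomplex itself starts at \<open>a = b = 1\<close>; the differentials out of the edges are its
  augmentations.\<close>

definition zigzag_at where
  "zigzag_at f = nat_double_augmented.zigzag (\<lambda>p q. biDer f (Suc p) (Suc q)) (\<lambda>p q. biNul (Suc p) (Suc q))
    (\<lambda>p q. diffA (Suc p) (Suc q)) (\<lambda>p q. diffB (Suc p) (Suc q)) (\<lambda>q. diffA 0 (Suc q)) (\<lambda>p. diffB (Suc p) 0)"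

abbreviation "ZX f q \<equiv> cocycle_set (LB f) NB DB q"
abbreviation "BX f q \<equiv> coboundary_set (LB f) NB DB q"
abbreviation "ZA f q \<equiv> cocycle_set (LA f) NA DA q"

lemma kappa_exists:
  "\<exists>\<kappa>. \<forall>f q. 1 \<le> f \<longrightarrow> presents (ZX f q) (BX f q) (aq_cohomology R (twist R M f) q) (\<kappa> f q) \<and>
     (\<forall>x\<in>ZX f q. \<forall>y\<in>ZA f q. zigzag_at f q x y \<longrightarrow> \<kappa> f q x = aq_class f q y)"
proof -
  have "\<exists>k. 1 \<le> f \<longrightarrow> presents (ZX f q) (BX f q) (aq_cohomology R (twist R M f) q) k \<and>
     (\<forall>x\<in>ZX f q. \<forall>y\<in>ZA f q. zigzag_at f q x y \<longrightarrow> k x = aq_class f q y)" for f q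
  proof (cases "1 \<le> f")
    case True
    then show ?thesis
      using nat_double_augmented.zigzag_presents[OF double_biDer[OF True] presents_aq_cohomology[OF True], of q]
      unfolding zigzag_at_def by blast
  qed simp
  then show ?thesis by metis
qed

lemma zigzag_at_total: "1 \<le> f \<Longrightarrow> x \<in> ZX f q \<Longrightarrow> \<exists>y\<in>ZA f q. zigzag_at f q x y"
  unfolding zigzag_at_def by (rule nat_double_augmented.zigzag_total[OF double_biDer])

text \<open>A map \<open>\<Gamma>\<close> of mixed resolutions carries zigzags to zigzags, hence
  commutes with the comparison \<open>\<kappa>\<close> as soon as it does so on the Andre-Quillen
  edge. This covers \<open>pushf\<close> and \<open>pullf\<close> at once.\<close>

lemma kappa_natural:
  assumes K: "\<And>f q. 1 \<le> f \<Longrightarrow> \<forall>x\<in>ZX f q. \<forall>y\<in>ZA f q. zigzag_at f q x y \<longrightarrow> \<kappa> f q x = aq_class f q y"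
    and f: "1 \<le> f" and g: "1 \<le> g" and \<Gamma>: "\<And>a b. additive (\<Gamma> a b)"
    and \<Gamma>L: "\<And>a b \<phi>. \<phi> \<in> biDer f a b \<Longrightarrow> \<Gamma> a b \<phi> \<in> biDer g a b"
    and \<Gamma>N: "\<And>a b \<phi>. \<phi> \<in> biNul a b \<Longrightarrow> \<Gamma> a b \<phi> \<in> biNul a b"
    and \<Gamma>A: "\<And>a b \<phi>. \<Gamma> (Suc a) b (diffA a b \<phi>) - diffA a b (\<Gamma> a b \<phi>) \<in> biNul (Suc a) b"
    and \<Gamma>B: "\<And>a b \<phi>. \<Gamma> a (Suc b) (diffB a b \<phi>) - diffB a b (\<Gamma> a b \<phi>) \<in> biNul a (Suc b)"
    and G: "\<And>y. y \<in> LA f q \<Longrightarrow> G (aq_class f q y) = aq_class g q (\<Gamma> (Suc q) 0 y)"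
    and x: "x \<in> ZX f q"
  shows "G (\<kappa> f q x) = \<kappa> g q (\<Gamma> 0 (Suc q) x)" "\<Gamma> 0 (Suc q) x \<in> ZX g q"
proof -
  have cocyc: "diffB 0 (Suc q) (\<Gamma> 0 (Suc q) x) \<in> biNul 0 (Suc (Suc q))" if "diffB 0 (Suc q) x \<in> biNul 0 (Suc (Suc q))" for x
    using subgrp_cong[OF subgrp_biNul \<Gamma>B] \<Gamma>N[OF that] by blast
  then show xg: "\<Gamma> 0 (Suc q) x \<in> ZX g q" using x \<Gamma>L by (simp add: cocycle_set_def)
  obtain y where y: "y \<in> ZA f q" and xy: "zigzag_at f q x y" using zigzag_at_total[OF f x] by blast
  have "diffA (Suc q) 0 (\<Gamma> (Suc q) 0 y) \<in> biNul (Suc (Suc q)) 0"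
    using subgrp_cong[OF subgrp_biNul \<Gamma>A] \<Gamma>N y by (simp add: cocycle_set_def) blast
  then have yg: "\<Gamma> (Suc q) 0 y \<in> ZA g q" using y \<Gamma>L by (simp add: cocycle_set_def)
  have "zigzag_at g q (\<Gamma> 0 (Suc q) x) (\<Gamma> (Suc q) 0 y)"
    unfolding zigzag_at_def
    by (rule zigzag_map[where \<Gamma> = "\<lambda>p q. \<Gamma> (Suc p) (Suc q)" and \<gamma>B = "\<lambda>q. \<Gamma> 0 (Suc q)" and \<gamma>A = "\<lambda>p. \<Gamma> (Suc p) 0",
          OF double_biDer[OF f] double_biDer[OF g] \<Gamma> \<Gamma>L \<Gamma>N \<Gamma>A \<Gamma>B \<Gamma>A \<Gamma>B])
      (use x y xy in \<open>auto simp: cocycle_set_def zigzag_at_def\<close>)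
  then have "\<kappa> g q (\<Gamma> 0 (Suc q) x) = aq_class g q (\<Gamma> (Suc q) 0 y)" using K[OF g] xg yg by blast
  moreover have "\<kappa> f q x = aq_class f q y" using K[OF f] x y xy by blast
  moreover have "y \<in> LA f q" using y by (simp add: cocycle_set_def)
  ultimately show "G (\<kappa> f q x) = \<kappa> g q (\<Gamma> 0 (Suc q) x)" using G by simp
qed

text \<open>The complexes of derivations out of the Psi-ring resolution have the Andre-Quillen
  groups for their cohomology, and \<open>pushf\<close> and \<open>pullf\<close> induce the
  structure maps of the natural system.\<close>

theorem kappa:
  "\<exists>\<kappa>. \<forall>f q. 1 \<le> f \<longrightarrow> presents (ZX f q) (BX f q) (grp (aq_nat_sys R M q) f) (\<kappa> f q) \<and>
     (\<forall>x\<in>ZX f q. \<forall>u\<ge>1. pushf u x \<in> ZX (u * f) q \<and>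
        push (aq_nat_sys R M q) u f (\<kappa> f q x) = \<kappa> (u * f) q (pushf u x)) \<and>
     (\<forall>x\<in>ZX f q. \<forall>v\<ge>1. pullf 0 (Suc q) v x \<in> ZX (f * v) q \<and>
        pull (aq_nat_sys R M q) v f (\<kappa> f q x) = \<kappa> (f * v) q (pullf 0 (Suc q) v x))"
proof -
  obtain \<kappa> where k: "\<And>f q. 1 \<le> f \<Longrightarrow> presents (ZX f q) (BX f q) (aq_cohomology R (twist R M f) q) (\<kappa> f q)"
    and K: "\<And>f q. 1 \<le> f \<Longrightarrow> \<forall>x\<in>ZX f q. \<forall>y\<in>ZA f q. zigzag_at f q x y \<longrightarrow> \<kappa> f q x = aq_class f q y"
    using kappa_exists by metis
  show ?thesis
  proof (intro exI[of _ \<kappa>] allI impI)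
    fix f q :: nat assume f: "1 \<le> f"
    have push: "pushf u x \<in> ZX (u * f) q \<and> push (aq_nat_sys R M q) u f (\<kappa> f q x) = \<kappa> (u * f) q (pushf u x)"
      if x: "x \<in> ZX f q" and u: "1 \<le> u" for x u
    proof -
      have uf: "1 \<le> u * f" using u f by simp
      show ?thesis
        using kappa_natural[where \<kappa> = \<kappa> and \<Gamma> = "\<lambda>_ _. pushf u" and G = "push (aq_nat_sys R M q) u f",
            OF K f uf additive_pushf pushf_biDer[OF u f] pushf_biNul[OF u] _ _ push_aq_class[OF u f] x]
        by (simp add: pushf_diffA pushf_diffB subgrp_0[OF subgrp_biNul])
    qed
    have pull: "pullf 0 (Suc q) v x \<in> ZX (f * v) q \<and> pull (aq_nat_sys R M q) v f (\<kappa> f q x) = \<kappa> (f * v) q (pullf 0 (Suc q) v x)"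
      if x: "x \<in> ZX f q" and v: "1 \<le> v" for x v
    proof -
      have fv: "1 \<le> f * v" using v f by simp
      show ?thesis
        using kappa_natural[where \<kappa> = \<kappa> and \<Gamma> = "\<lambda>a b. pullf a b v" and G = "pull (aq_nat_sys R M q) v f",
            OF K f fv additive_pullf pullf_biDer[OF v f] pullf_biNul[OF v] pullf_diffA[OF v] pullf_diffB[OF v] pull_aq_class[OF v f] x]
        by simp
    qed
    show "presents (ZX f q) (BX f q) (grp (aq_nat_sys R M q) f) (\<kappa> f q) \<and>
     (\<forall>x\<in>ZX f q. \<forall>u\<ge>1. pushf u x \<in> ZX (u * f) q \<and>
        push (aq_nat_sys R M q) u f (\<kappa> f q x) = \<kappa> (u * f) q (pushf u x)) \<and>
     (\<forall>x\<in>ZX f q. \<forall>v\<ge>1. pullf 0 (Suc q) v x \<in> ZX (f * v) q \<and>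
        pull (aq_nat_sys R M q) v f (\<kappa> f q x) = \<kappa> (f * v) q (pullf 0 (Suc q) v x))"
      using push pull k[OF f] by (simp add: aq_nat_sys_def)
  qed
qed

end


section \<open>Baues--Wirsching cochains on the multiplicative monoid\<close>

abbreviation "cmp \<equiv> compose_at Nmult"

lemma cmp_append: "cmp (Suc (length r)) (r @ a # b # s) = r @ (a * b) # s"
  by (simp add: compose_at_def Nmult_def nth_append)

text \<open>Every composition in a chain happens between two marked neighbours, which reduces the
  identities between compositions to \<open>cmp_append\<close>.\<close>

lemma split_at:
  assumes "0 < j" "j < length as"
  obtains r a b s where "as = r @ a # b # s" "j = Suc (length r)"
proof -
  have "as = take (j - 1) as @ as ! (j - 1) # drop j as"
    using id_take_nth_drop[of "j - 1" as] assms by simp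
  moreover have "drop j as = as ! j # drop (Suc j) as" using assms by (simp add: Cons_nth_drop_Suc)
  ultimately have "as = take (j - 1) as @ as ! (j - 1) # as ! j # drop (Suc j) as" by simp
  then show ?thesis by (rule that) (use assms in auto)
qed

text \<open>The \<open>n\<close>-chains of the monoid; the object at their end carries no
  information.\<close>

definition pos_lists :: "nat \<Rightarrow> nat list set" where
  "pos_lists n = {as. length as = n \<and> (\<forall>a\<in>set as. 1 \<le> a)}"

lemma prod_pos_lists: "as \<in> pos_lists n \<Longrightarrow> 1 \<le> prod_list as"
  unfolding pos_lists_def by (induction as arbitrary: n) auto

lemma cmp_pos_lists:
  assumes "as \<in> pos_lists (Suc n)" "0 < j" "j \<le> n"
  shows "cmp j as \<in> pos_lists n" "prod_list (cmp j as) = prod_list as"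
proof -
  have "j < length as" using assms by (simp add: pos_lists_def)
  then obtain r a b s where "as = r @ a # b # s" "j = Suc (length r)" using split_at assms(2) by blast
  then show "cmp j as \<in> pos_lists n" "prod_list (cmp j as) = prod_list as"
    using assms(1) by (auto simp: cmp_append pos_lists_def mult.assoc)
qed

lemma hd_pos_lists:
  assumes "as \<in> pos_lists (Suc n)"
  shows "1 \<le> hd as" "tl as \<in> pos_lists n" "hd as * prod_list (tl as) = prod_list as"
  using assms by (cases as; auto simp: pos_lists_def)+

lemma last_pos_lists:
  assumes "as \<in> pos_lists (Suc n)"
  shows "1 \<le> last as" "butlast as \<in> pos_lists n" "prod_list (butlast as) * last as = prod_list as"
  using assms by (cases as rule: rev_cases; auto simp: pos_lists_def)+

lemma cmp_cmp:
  assumes "0 < i" "i < j" "j < length as"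
  shows "cmp i (cmp j as) = cmp (j - 1) (cmp i as)"
proof -
  have "0 < j" using assms by simp
  then obtain r a b s where j: "as = r @ a # b # s" "j = Suc (length r)"
    using split_at assms(3) by blast
  show ?thesis
  proof (cases "i < length r")
    case True
    then obtain t c d u where i: "r = t @ c # d # u" "i = Suc (length t)"
      using split_at assms(1) by blast
    have "cmp (Suc (length t)) (t @ c # d # (u @ (a * b) # s)) = t @ (c * d) # u @ (a * b) # s"
      "cmp (Suc (length t)) (t @ c # d # (u @ a # b # s)) = t @ (c * d) # u @ a # b # s"
      by (rule cmp_append)+
    moreover have "cmp (Suc (length (t @ (c * d) # u))) ((t @ (c * d) # u) @ a # b # s) = (t @ (c * d) # u) @ (a * b) # s"
      by (rule cmp_append)
    ultimately show ?thesis using i j cmp_append[of r a b s] by simp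
  next
    case False
    then have il: "i = length r" using assms j by simp
    then obtain t c where r: "r = t @ [c]" using assms(1) by (cases r rule: rev_cases) auto
    have "cmp (Suc (length t)) (t @ c # (a * b) # s) = t @ (c * (a * b)) # s"
      "cmp (Suc (length t)) (t @ c # a # (b # s)) = t @ (c * a) # b # s"
      "cmp (Suc (length t)) (t @ (c * a) # b # s) = t @ (c * a * b) # s"
      by (rule cmp_append)+
    then show ?thesis using il j r cmp_append[of r a b s] by (simp add: mult.assoc)
  qed
qed

lemma cmp_first:
  assumes "Suc 0 < length as"
  shows "hd (cmp (Suc 0) as) = hd as * hd (tl as)" "tl (cmp (Suc 0) as) = tl (tl as)"
proof -
  obtain a b s where "as = a # b # s" using assms by (cases as; cases "tl as") auto
  then show "hd (cmp (Suc 0) as) = hd as * hd (tl as)" "tl (cmp (Suc 0) as) = tl (tl as)"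
    using cmp_append[of "[]" a b s] by simp_all
qed

lemma cmp_later:
  assumes "Suc 0 < j" "j < length as"
  shows "hd (cmp j as) = hd as" "tl (cmp j as) = cmp (j - 1) (tl as)"
proof -
  have "0 < j" using assms by simp
  then obtain r a b s where j: "as = r @ a # b # s" "j = Suc (length r)" using split_at assms(2) by blast
  moreover obtain c t where "r = c # t" using j assms by (cases r) auto
  ultimately show "hd (cmp j as) = hd as" "tl (cmp j as) = cmp (j - 1) (tl as)"
    using cmp_append[of r a b s] cmp_append[of t a b s] by simp_all
qed

lemma cmp_earlier:
  assumes "0 < j" "Suc j < length as"
  shows "last (cmp j as) = last as" "butlast (cmp j as) = cmp j (butlast as)"
proof -
  have "j < length as" using assms by simp
  then obtain r a b s where j: "as = r @ a # b # s" "j = Suc (length r)" using split_at assms(1) by blast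
  moreover obtain c t where "s = t @ [c]" using j assms by (cases s rule: rev_cases) auto
  ultimately show "last (cmp j as) = last as" "butlast (cmp j as) = cmp j (butlast as)"
    using cmp_append[of r a b s] cmp_append[of r a b t] by (simp_all add: butlast_append)
qed

lemma cmp_last:
  assumes "0 < j" "Suc j = length as"
  shows "last (cmp j as) = last (butlast as) * last as" "butlast (cmp j as) = butlast (butlast as)"
proof -
  have "j < length as" using assms by simp
  then obtain r a b s where j: "as = r @ a # b # s" "j = Suc (length r)" using split_at assms(1) by blast
  moreover have "s = []" using j assms by simp
  ultimately show "last (cmp j as) = last (butlast as) * last as" "butlast (cmp j as) = butlast (butlast as)"
    using cmp_append[of r a b s] by (simp_all add: butlast_append)
qed

text \<open>Baues--Wirsching cochains on representatives, with coefficients \<open>S f\<close> at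
  the morphism \<open>f\<close>.\<close>

definition cochains_in :: "(nat \<Rightarrow> 'c::ab_group_add set) \<Rightarrow> nat \<Rightarrow> (nat list \<Rightarrow> 'c) set" where
  "cochains_in S n = {c. \<forall>as\<in>pos_lists n. c as \<in> S (prod_list as)}"

lemma cochains_in_D: "c \<in> cochains_in S n \<Longrightarrow> as \<in> pos_lists n \<Longrightarrow> c as \<in> S (prod_list as)"
  by (simp add: cochains_in_def)

lemma subgrp_cochains_in:
  fixes S :: "nat \<Rightarrow> 'a::ab_group_add set"
  assumes "\<And>f. 1 \<le> f \<Longrightarrow> subgrp (S f)"
  shows "subgrp (cochains_in S n)"
  unfolding subgrp_def
proof (intro conjI ballI)
  show "0 \<in> cochains_in S n"
    unfolding cochains_in_def
  proof (intro CollectI ballI)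
    fix as assume "as \<in> pos_lists n"
    from subgrp_0[OF assms[OF prod_pos_lists[OF this]]] show "(0 :: nat list \<Rightarrow> 'a) as \<in> S (prod_list as)" by simp
  qed
  show "x - y \<in> cochains_in S n" if "x \<in> cochains_in S n" "y \<in> cochains_in S n" for x y
    unfolding cochains_in_def
  proof (intro CollectI ballI)
    fix as assume as: "as \<in> pos_lists n"
    from subgrp_diff[OF assms[OF prod_pos_lists[OF as]] cochains_in_D[OF that(1) as] cochains_in_D[OF that(2) as]]
    show "(x - y) as \<in> S (prod_list as)" by simp
  qed
qed

text \<open>A natural system on representatives: \<open>L\<close> and \<open>R\<close> are the two
  actions, functorial modulo \<open>N\<close>.\<close>

locale bw_coefficients =
  fixes Z N :: "nat \<Rightarrow> 'c::ab_group_add set" and L R :: "nat \<Rightarrow> 'c \<Rightarrow> 'c"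
  assumes subgrp_Z: "1 \<le> f \<Longrightarrow> subgrp (Z f)" and subgrp_N: "1 \<le> f \<Longrightarrow> subgrp (N f)"
    and additive_L: "additive (L u)" and additive_R: "additive (R u)"
    and L_Z: "1 \<le> u \<Longrightarrow> 1 \<le> f \<Longrightarrow> x \<in> Z f \<Longrightarrow> L u x \<in> Z (u * f)"
    and R_Z: "1 \<le> u \<Longrightarrow> 1 \<le> f \<Longrightarrow> x \<in> Z f \<Longrightarrow> R u x \<in> Z (f * u)"
    and L_N: "1 \<le> u \<Longrightarrow> 1 \<le> f \<Longrightarrow> x \<in> N f \<Longrightarrow> L u x \<in> N (u * f)"
    and R_N: "1 \<le> u \<Longrightarrow> 1 \<le> f \<Longrightarrow> x \<in> N f \<Longrightarrow> R u x \<in> N (f * u)"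
    and L_L: "1 \<le> u \<Longrightarrow> 1 \<le> v \<Longrightarrow> 1 \<le> f \<Longrightarrow> x \<in> Z f \<Longrightarrow> L (u * v) x - L u (L v x) \<in> N (u * v * f)"
    and R_R: "1 \<le> u \<Longrightarrow> 1 \<le> v \<Longrightarrow> 1 \<le> f \<Longrightarrow> x \<in> Z f \<Longrightarrow> R v (R u x) - R (u * v) x \<in> N (u * v * f)"
    and R_L: "1 \<le> u \<Longrightarrow> 1 \<le> v \<Longrightarrow> 1 \<le> f \<Longrightarrow> x \<in> Z f \<Longrightarrow> R v (L u x) - L u (R v x) \<in> N (u * v * f)"
begin

definition bwface :: "nat \<Rightarrow> nat \<Rightarrow> (nat list \<Rightarrow> 'c) \<Rightarrow> nat list \<Rightarrow> 'c" where
  "bwface n j c as = (if j = 0 then L (hd as) (c (tl as)) else if j \<le> n then c (cmp j as)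
     else R (last as) (c (butlast as)))"

definition bwdiff :: "nat \<Rightarrow> (nat list \<Rightarrow> 'c) \<Rightarrow> nat list \<Rightarrow> 'c" where
  "bwdiff n = altsum (bwface n) (Suc n)"

lemma additive_bwface: "additive (bwface n j)"
  by (auto simp: additive_def bwface_def fun_eq_iff additive.add[OF additive_L] additive.add[OF additive_R])

lemma additive_bwdiff: "additive (bwdiff n)"
  unfolding bwdiff_def by (rule additive_altsum[OF additive_bwface])

lemma bwdiff_apply: "bwdiff n c as = (\<Sum>k\<le>Suc n. alt k (bwface n k c as))"
  unfolding bwdiff_def altsum_def fun_sum_apply alt_fun ..

lemma bwface_cochains_in:
  assumes S: "\<And>u f x. 1 \<le> u \<Longrightarrow> 1 \<le> f \<Longrightarrow> x \<in> S f \<Longrightarrow> L u x \<in> S (u * f) \<and> R u x \<in> S (f * u)"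
    and c: "c \<in> cochains_in S n" and j: "j \<le> Suc n"
  shows "bwface n j c \<in> cochains_in S (Suc n)"
  unfolding cochains_in_def
proof (intro CollectI ballI)
  fix as assume as: "as \<in> pos_lists (Suc n)"
  show "bwface n j c as \<in> S (prod_list as)"
    using S[OF hd_pos_lists(1)[OF as] prod_pos_lists[OF hd_pos_lists(2)[OF as]] cochains_in_D[OF c hd_pos_lists(2)[OF as]]]
      S[OF last_pos_lists(1)[OF as] prod_pos_lists[OF last_pos_lists(2)[OF as]] cochains_in_D[OF c last_pos_lists(2)[OF as]]]
      cochains_in_D[OF c cmp_pos_lists(1)[OF as]] cmp_pos_lists(2)[OF as] hd_pos_lists(3)[OF as] last_pos_lists(3)[OF as]
    by (auto simp: bwface_def)
qed

lemma bwface_Z: "c \<in> cochains_in Z n \<Longrightarrow> j \<le> Suc n \<Longrightarrow> bwface n j c \<in> cochains_in Z (Suc n)"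
  by (rule bwface_cochains_in) (auto simp: L_Z R_Z)

lemma bwdiff_Z: "c \<in> cochains_in Z n \<Longrightarrow> bwdiff n c \<in> cochains_in Z (Suc n)"
  unfolding bwdiff_def by (intro altsum_mem subgrp_cochains_in subgrp_Z bwface_Z)

lemma bwdiff_N: "c \<in> cochains_in N n \<Longrightarrow> bwdiff n c \<in> cochains_in N (Suc n)"
  unfolding bwdiff_def by (intro altsum_mem subgrp_cochains_in subgrp_N bwface_cochains_in) (auto simp: L_N R_N)

lemma bwface_simps:
  "bwface n 0 c as = L (hd as) (c (tl as))"
  "0 < j \<Longrightarrow> j \<le> n \<Longrightarrow> bwface n j c as = c (cmp j as)"
  "bwface n (Suc n) c as = R (last as) (c (butlast as))"
  by (simp_all add: bwface_def)

text \<open>The cosimplicial identities. The outer faces give functoriality of \<open>L\<close>,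
  functoriality of \<open>R\<close> and their commutation; all other cases are identities between
  chains.\<close>

lemma bwface_bwface:
  assumes c: "c \<in> cochains_in Z n" and ij: "i < j" "j \<le> Suc (Suc n)"
  shows "bwface (Suc n) j (bwface n i c) - bwface (Suc n) i (bwface n (j - 1) c) \<in> cochains_in N (Suc (Suc n))"
  unfolding cochains_in_def
proof (intro CollectI ballI)
  fix as assume as: "as \<in> pos_lists (Suc (Suc n))"
  have len: "length as = Suc (Suc n)" using as by (simp add: pos_lists_def)
  have N0: "x = y \<Longrightarrow> x - y \<in> N (prod_list as)" for x y
    using subgrp_0[OF subgrp_N[OF prod_pos_lists[OF as]]] by simp
  note h = hd_pos_lists[OF as] and l = last_pos_lists[OF as]
  note hh = hd_pos_lists[OF h(2)] and ll = last_pos_lists[OF l(2)] and hl = last_pos_lists[OF h(2)]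
  have t: "tl (butlast as) = butlast (tl as)" "hd (butlast as) = hd as" "last as = last (tl as)"
    using len by (cases as; cases "tl as"; auto)+
  have "bwface (Suc n) j (bwface n i c) as - bwface (Suc n) i (bwface n (j - 1) c) as \<in> N (prod_list as)"
  proof (cases "i = 0")
    case i: True
    consider "j = 1" | "1 < j" "j \<le> Suc n" | "j = Suc (Suc n)" using ij by linarith
    then show ?thesis
    proof cases
      case 1
      have "L (hd as * hd (tl as)) (c (tl (tl as))) - L (hd as) (L (hd (tl as)) (c (tl (tl as)))) \<in>
          N (hd as * hd (tl as) * prod_list (tl (tl as)))"
        by (rule L_L[OF h(1) hh(1) prod_pos_lists[OF hh(2)] cochains_in_D[OF c hh(2)]])
      moreover have "hd as * hd (tl as) * prod_list (tl (tl as)) = prod_list as"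
        unfolding mult.assoc hh(3) h(3) ..
      ultimately show ?thesis using 1 i len by (simp add: bwface_simps cmp_first)
    next
      case 2
      have j: "0 < j" "Suc 0 < j" "0 < j - 1" "j - 1 \<le> n" "j < length as" using 2 len by auto
      show ?thesis
        unfolding i by (rule N0) (simp only: bwface_simps(1) bwface_simps(2)[OF j(1) 2(2)] bwface_simps(2)[OF j(3,4)] cmp_later[OF j(2,5)])
    next
      case 3
      have "R (last as) (L (hd as) (c (butlast (tl as)))) - L (hd as) (R (last as) (c (butlast (tl as)))) \<in>
          N (hd as * last as * prod_list (butlast (tl as)))"
        using R_L[OF h(1) l(1) prod_pos_lists[OF hl(2)] cochains_in_D[OF c hl(2)]] .
      moreover have "hd as * last as * prod_list (butlast (tl as)) = prod_list as"
      proof -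
        have "hd as * last as * prod_list (butlast (tl as)) = hd as * (prod_list (butlast (tl as)) * last (tl as))"
          unfolding t(3) by (simp only: mult_ac)
        also have "\<dots> = prod_list as" unfolding hl(3) h(3) ..
        finally show ?thesis .
      qed
      moreover have "bwface (Suc n) j (bwface n i c) as = R (last as) (L (hd as) (c (butlast (tl as))))"
        unfolding i 3 bwface_simps t(1,2) ..
      moreover have "bwface (Suc n) i (bwface n (j - 1) c) as = L (hd as) (R (last as) (c (butlast (tl as))))"
        unfolding i 3 bwface_simps diff_Suc_1 t(3) ..
      ultimately show ?thesis by simp
    qed
  next
    case False
    then have i: "0 < i" by simp
    consider "j \<le> Suc n" | "i \<le> n" "j = Suc (Suc n)" | "i = Suc n" "j = Suc (Suc n)"
      using ij by linarith
    then show ?thesis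
    proof cases
      case 1
      have j: "0 < j" "i \<le> n" "i \<le> Suc n" "0 < j - 1" "j - 1 \<le> n" "j < length as" using ij i 1 len by auto
      show ?thesis
        by (rule N0) (simp only: bwface_simps(2)[OF j(1) 1] bwface_simps(2)[OF i j(2)] bwface_simps(2)[OF i j(3)]
            bwface_simps(2)[OF j(4,5)] cmp_cmp[OF i ij(1) j(6)])
    next
      case 2
      have j: "i \<le> Suc n" "Suc i < length as" using 2 len by auto
      show ?thesis
        unfolding 2(2)
        by (rule N0) (simp only: bwface_simps(3) bwface_simps(2)[OF i 2(1)] bwface_simps(2)[OF i j(1)] diff_Suc_1 cmp_earlier[OF i j(2)])
    next
      case 3
      have j: "0 < Suc n" "Suc (Suc n) = length as" using len by simp_all
      have "R (last as) (R (last (butlast as)) (c (butlast (butlast as)))) -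
          R (last (butlast as) * last as) (c (butlast (butlast as))) \<in>
          N (last (butlast as) * last as * prod_list (butlast (butlast as)))"
        by (rule R_R[OF ll(1) l(1) prod_pos_lists[OF ll(2)] cochains_in_D[OF c ll(2)]])
      moreover have "last (butlast as) * last as * prod_list (butlast (butlast as)) = prod_list as"
      proof -
        have "last (butlast as) * last as * prod_list (butlast (butlast as)) =
            prod_list (butlast (butlast as)) * last (butlast as) * last as"
          by (simp only: mult_ac)
        also have "\<dots> = prod_list as" unfolding ll(3) l(3) ..
        finally show ?thesis .
      qed
      moreover have "bwface (Suc n) j (bwface n i c) as = R (last as) (R (last (butlast as)) (c (butlast (butlast as))))"
        unfolding 3 bwface_simps ..
      moreover have "bwface (Suc n) i (bwface n (j - 1) c) as = R (last (butlast as) * last as) (c (butlast (butlast as)))"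
        unfolding 3 diff_Suc_1 bwface_simps(2)[OF j(1) order_refl] bwface_simps(3) cmp_last[OF j] ..
      ultimately show ?thesis by simp
    qed
  qed
  then show "(bwface (Suc n) j (bwface n i c) - bwface (Suc n) i (bwface n (j - 1) c)) as \<in> N (prod_list as)"
    by simp
qed

lemma bwdiff_bwdiff: "c \<in> cochains_in Z n \<Longrightarrow> bwdiff (Suc n) (bwdiff n c) \<in> cochains_in N (Suc (Suc n))"
  unfolding bwdiff_def by (intro altsum_square subgrp_cochains_in subgrp_N additive_bwface bwface_bwface)

end

lemma chain_Nmult: "is_chain Nmult i as \<longleftrightarrow> (\<forall>a\<in>set as. 1 \<le> a)" "chain_comp Nmult i as = prod_list as"
  by (induction as arbitrary: i) (auto simp: Nmult_def)

lemma chains_Nmult: "(i, as) \<in> chains Nmult n \<longleftrightarrow> as \<in> pos_lists n"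
  by (auto simp: chains_def pos_lists_def chain_Nmult)

locale bw_presentation = bw_coefficients Z N L R
  for Z N :: "nat \<Rightarrow> 'c::ab_group_add set" and L R :: "nat \<Rightarrow> 'c \<Rightarrow> 'c" +
  fixes D :: "(nat, 'd) nat_sys" and \<kappa> :: "nat \<Rightarrow> 'c \<Rightarrow> 'd"
  assumes presents_grp: "1 \<le> f \<Longrightarrow> presents (Z f) (N f) (grp D f) (\<kappa> f)"
    and push_\<kappa>: "1 \<le> u \<Longrightarrow> 1 \<le> f \<Longrightarrow> x \<in> Z f \<Longrightarrow> push D u f (\<kappa> f x) = \<kappa> (u * f) (L u x)"
    and pull_\<kappa>: "1 \<le> u \<Longrightarrow> 1 \<le> f \<Longrightarrow> x \<in> Z f \<Longrightarrow> pull D u f (\<kappa> f x) = \<kappa> (f * u) (R u x)"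
begin

definition cochain_of :: "nat \<Rightarrow> (nat list \<Rightarrow> 'c) \<Rightarrow> unit \<times> nat list \<Rightarrow> 'd" where
  "cochain_of n c = (\<lambda>(i, as)\<in>chains Nmult n. \<kappa> (prod_list as) (c as))"

lemma cochain_of_apply: "as \<in> pos_lists n \<Longrightarrow> cochain_of n c (i, as) = \<kappa> (prod_list as) (c as)"
  by (simp add: cochain_of_def chains_Nmult)

lemma presents_bw_cochains: "presents (cochains_in Z n) (cochains_in N n) (bw_cochains Nmult D n) (cochain_of n)"
proof -
  let ?G = "bw_cochains Nmult D n"
  have P: "presents (Z (prod_list as)) (N (prod_list as)) (grp D (prod_list as)) (\<kappa> (prod_list as))"
    if "as \<in> pos_lists n" for as
    using presents_grp[OF prod_pos_lists[OF that]] .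
  have G: "carrier ?G = (\<Pi>\<^sub>E (i, as)\<in>chains Nmult n. carrier (grp D (prod_list as)))"
    "x \<otimes>\<^bsub>?G\<^esub> y = (\<lambda>(i, as)\<in>chains Nmult n. x (i, as) \<otimes>\<^bsub>grp D (prod_list as)\<^esub> y (i, as))"
    "\<one>\<^bsub>?G\<^esub> = (\<lambda>(i, as)\<in>chains Nmult n. \<one>\<^bsub>grp D (prod_list as)\<^esub>)" for x y
    unfolding bw_cochains_def product_group_def chain_Nmult by (auto simp: case_prod_unfold intro!: restrict_ext)
  have eqI: "(\<lambda>(i, as)\<in>chains Nmult n. f as) = (\<lambda>(i, as)\<in>chains Nmult n. g as)"
    if "\<And>as. as \<in> pos_lists n \<Longrightarrow> f as = g as" for f g :: "nat list \<Rightarrow> 'd"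
    using that by (intro restrict_ext) (auto simp: chains_Nmult split: prod.splits)
  have eqD: "f as = g as" if "(\<lambda>(i, as)\<in>chains Nmult n. f as) = (\<lambda>(i, as)\<in>chains Nmult n. g as)" "as \<in> pos_lists n"
    for f g :: "nat list \<Rightarrow> 'd" and as
    using fun_cong[OF that(1), of "((), as)"] that(2) by (simp add: chains_Nmult)
  show ?thesis
    unfolding presents_def
  proof (intro conjI ballI subgrp_cochains_in subgrp_Z subgrp_N)
    fix c e assume c: "c \<in> cochains_in Z n" and e: "e \<in> cochains_in Z n"
    have "cochain_of n c \<otimes>\<^bsub>?G\<^esub> cochain_of n e = (\<lambda>(i, as)\<in>chains Nmult n.
        \<kappa> (prod_list as) (c as) \<otimes>\<^bsub>grp D (prod_list as)\<^esub> \<kappa> (prod_list as) (e as))"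
      unfolding G(2)
      by (rule restrict_ext) (auto simp: chains_Nmult cochain_of_apply split: prod.splits)
    also have "\<dots> = cochain_of n (c + e)"
      unfolding cochain_of_def
    proof (rule eqI)
      fix as assume as: "as \<in> pos_lists n"
      show "\<kappa> (prod_list as) (c as) \<otimes>\<^bsub>grp D (prod_list as)\<^esub> \<kappa> (prod_list as) (e as) = \<kappa> (prod_list as) ((c + e) as)"
        using presentsD(3)[OF P[OF as] cochains_in_D[OF c as] cochains_in_D[OF e as]] by simp
    qed
    finally show "cochain_of n (c + e) = cochain_of n c \<otimes>\<^bsub>?G\<^esub> cochain_of n e" ..
  next
    show "cochain_of n ` cochains_in Z n = carrier ?G"
    proof (intro equalityI subsetI)
      fix f assume "f \<in> cochain_of n ` cochains_in Z n"
      then obtain c where c: "c \<in> cochains_in Z n" and f: "f = cochain_of n c" by blast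
      have "\<kappa> (prod_list as) (c as) \<in> carrier (grp D (prod_list as))" if "as \<in> pos_lists n" for as
        by (rule presentsD(4)[OF P[OF that] cochains_in_D[OF c that]])
      then show "f \<in> carrier ?G"
        unfolding f G(1) cochain_of_def by (intro restrict_PiE_iff[THEN iffD2] ballI) (auto simp: chains_Nmult split: prod.splits)
    next
      fix f assume f: "f \<in> carrier ?G"
      have fe: "f \<in> extensional (chains Nmult n)" using f unfolding G(1) by (simp add: PiE_iff)
      have "\<exists>z. as \<in> pos_lists n \<longrightarrow> z \<in> Z (prod_list as) \<and> f ((), as) = \<kappa> (prod_list as) z" for as
      proof (cases "as \<in> pos_lists n")
        case True
        then have as: "((), as) \<in> chains Nmult n" by (simp add: chains_Nmult)
        have "f ((), as) \<in> carrier (grp D (prod_list as))" using PiE_mem[OF f[unfolded G(1)] as] by simp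
        from presentsD(5)[OF P[OF True] this] obtain z where "z \<in> Z (prod_list as)" "f ((), as) = \<kappa> (prod_list as) z" ..
        then show ?thesis by (intro exI[of _ z]) simp
      qed simp
      then have "\<exists>c. \<forall>as. as \<in> pos_lists n \<longrightarrow> c as \<in> Z (prod_list as) \<and> f ((), as) = \<kappa> (prod_list as) (c as)"
        by (intro choice allI)
      then obtain c where c: "\<forall>as. as \<in> pos_lists n \<longrightarrow> c as \<in> Z (prod_list as) \<and> f ((), as) = \<kappa> (prod_list as) (c as)" ..
      have "f = cochain_of n c"
      proof (rule extensionalityI[OF fe])
        show "cochain_of n c \<in> extensional (chains Nmult n)" unfolding cochain_of_def by simp
        fix x assume x: "x \<in> chains Nmult n"
        obtain as where "x = ((), as)" by (cases x) auto
        then show "f x = cochain_of n c x" using x c[rule_format, of as] by (simp add: chains_Nmult cochain_of_apply)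
      qed
      moreover have "c \<in> cochains_in Z n" using c by (simp add: cochains_in_def)
      ultimately show "f \<in> cochain_of n ` cochains_in Z n" by blast
    qed
  next
    fix c assume c: "c \<in> cochains_in Z n"
    have "cochain_of n c = \<one>\<^bsub>?G\<^esub> \<longleftrightarrow> (\<forall>as\<in>pos_lists n. \<kappa> (prod_list as) (c as) = \<one>\<^bsub>grp D (prod_list as)\<^esub>)"
      unfolding G(3) cochain_of_def by (intro iffI ballI) (erule (1) eqD, rule eqI, erule (1) bspec)
    also have "\<dots> \<longleftrightarrow> (\<forall>as\<in>pos_lists n. c as \<in> N (prod_list as))"
      by (rule ball_cong[OF refl]) (rule presentsD(6)[OF P cochains_in_D[OF c]])
    finally show "cochain_of n c = \<one>\<^bsub>?G\<^esub> \<longleftrightarrow> c \<in> cochains_in N n" by (simp add: cochains_in_def)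
  qed
qed

lemma bw_diff_cochain_of:
  assumes c: "c \<in> cochains_in Z n"
  shows "bw_diff Nmult D n (cochain_of n c) = cochain_of (Suc n) (bwdiff n c)"
proof -
  have "alternating_sum (grp D (prod_list as)) (Suc n) (\<lambda>j. bw_face Nmult D n j (cochain_of n c) (i, as)) =
      \<kappa> (prod_list as) (bwdiff n c as)" if as: "as \<in> pos_lists (Suc n)" for i as
    unfolding bwdiff_apply
  proof (rule presents_alternating_sum[OF presents_grp[OF prod_pos_lists[OF as]]])
    fix k assume k: "k \<le> Suc n"
    show "bwface n k c as \<in> Z (prod_list as)" by (rule cochains_in_D[OF bwface_Z[OF c k] as])
    have h: "push D (hd as) (prod_list (tl as)) (\<kappa> (prod_list (tl as)) (c (tl as))) = \<kappa> (prod_list as) (L (hd as) (c (tl as)))"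
      using push_\<kappa>[OF hd_pos_lists(1)[OF as] prod_pos_lists[OF hd_pos_lists(2)[OF as]] cochains_in_D[OF c hd_pos_lists(2)[OF as]]]
      unfolding hd_pos_lists(3)[OF as] .
    have l: "pull D (last as) (prod_list (butlast as)) (\<kappa> (prod_list (butlast as)) (c (butlast as))) =
        \<kappa> (prod_list as) (R (last as) (c (butlast as)))"
      using pull_\<kappa>[OF last_pos_lists(1)[OF as] prod_pos_lists[OF last_pos_lists(2)[OF as]] cochains_in_D[OF c last_pos_lists(2)[OF as]]]
      unfolding last_pos_lists(3)[OF as] .
    consider "k = 0" | "0 < k" "k \<le> n" | "k = Suc n" using k by linarith
    then show "bw_face Nmult D n k (cochain_of n c) (i, as) = \<kappa> (prod_list as) (bwface n k c as)"
    proof cases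
      case 1
      show ?thesis
        unfolding bw_face_def bwface_def chain_Nmult cochain_of_apply[OF hd_pos_lists(2)[OF as]] prod.case if_P[OF 1] by (rule h)
    next
      case 2
      have k: "k \<noteq> 0" using 2 by simp
      show ?thesis
        unfolding bw_face_def bwface_def prod.case if_not_P[OF k] if_P[OF 2(2)]
          cochain_of_apply[OF cmp_pos_lists(1)[OF as 2]] cmp_pos_lists(2)[OF as 2] ..
    next
      case 3
      have k: "k \<noteq> 0" "\<not> k \<le> n" using 3 by simp_all
      show ?thesis
        unfolding bw_face_def bwface_def chain_Nmult cochain_of_apply[OF last_pos_lists(2)[OF as]] prod.case
          if_not_P[OF k(1)] if_not_P[OF k(2)] by (rule l)
    qed
  qed
  then show ?thesis
    unfolding bw_diff_def cochain_of_def[of "Suc n"] chain_Nmult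
    by (intro restrict_ext) (auto simp: chains_Nmult split: prod.splits)
qed

theorem presents_bw_cohomology:
  "\<exists>h. presents (cocycle_set (cochains_in Z) (cochains_in N) bwdiff n) (coboundary_set (cochains_in Z) (cochains_in N) bwdiff n) (bw_cohomology Nmult D n) h"
  unfolding bw_cohomology_def
  by (rule exI, rule presents_cohomology[where h = cochain_of])
    (rule presents_bw_cochains additive_bwdiff bwdiff_Z bwdiff_bwdiff bw_diff_cochain_of; assumption)+

end


section \<open>Natural systems of complexes\<close>

text \<open>A cochain complex of natural systems, indexed by \<open>q\<close>, and the bicomplex
  of its Baues--Wirsching cochains.\<close>

locale natural_complexes =
  fixes X :: "nat \<Rightarrow> nat \<Rightarrow> 'c::ab_group_add set" and N :: "nat \<Rightarrow> 'c set"
    and L R :: "nat \<Rightarrow> nat \<Rightarrow> 'c \<Rightarrow> 'c" and \<delta> :: "nat \<Rightarrow> 'c \<Rightarrow> 'c"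
  assumes coefficients: "bw_coefficients (X q) (\<lambda>_. N q) (L q) (R q)"
    and N_X: "1 \<le> f \<Longrightarrow> N q \<subseteq> X q f" and additive_\<delta>: "additive (\<delta> q)"
    and \<delta>_X: "1 \<le> f \<Longrightarrow> x \<in> X q f \<Longrightarrow> \<delta> q x \<in> X (Suc q) f"
    and \<delta>_N: "x \<in> N q \<Longrightarrow> \<delta> q x \<in> N (Suc q)"
    and \<delta>_\<delta>: "1 \<le> f \<Longrightarrow> x \<in> X q f \<Longrightarrow> \<delta> (Suc q) (\<delta> q x) \<in> N (Suc (Suc q))"
    and L_\<delta>: "1 \<le> u \<Longrightarrow> L (Suc q) u (\<delta> q x) - \<delta> q (L q u x) \<in> N (Suc q)"
    and R_\<delta>: "1 \<le> u \<Longrightarrow> R (Suc q) u (\<delta> q x) - \<delta> q (R q u x) \<in> N (Suc q)"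
begin

definition d where "d q = bw_coefficients.bwdiff (L q) (R q)"

definition vert :: "nat \<Rightarrow> (nat list \<Rightarrow> 'c) \<Rightarrow> nat list \<Rightarrow> 'c" where
  "vert q c = (\<lambda>as. \<delta> q (c as))"

abbreviation "KC \<equiv> (\<lambda>p q. cochains_in (X q) p)"
abbreviation "KN \<equiv> (\<lambda>p q. cochains_in (\<lambda>_. N q) p)"
abbreviation "K1 \<equiv> (\<lambda>p q. d q p)"
abbreviation "K2 \<equiv> (\<lambda>p q :: nat. vert q)"

abbreviation "Zc q f \<equiv> cocycle_set (\<lambda>q. X q f) N \<delta> q"
abbreviation "Bc q f \<equiv> coboundary_set (\<lambda>q. X q f) N \<delta> q"

lemma subgrp_N: "subgrp (N q)"
  using bw_coefficients.subgrp_N[OF coefficients, of 1] by simp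

lemma subgrp_X: "1 \<le> f \<Longrightarrow> subgrp (X q f)"
  by (rule bw_coefficients.subgrp_Z[OF coefficients])

lemma additive_vert: "additive (vert q)"
  by (simp add: additive_def vert_def additive.add[OF additive_\<delta>] fun_eq_iff)

lemma vert_cochains_in:
  assumes "\<And>f x. 1 \<le> f \<Longrightarrow> x \<in> S f \<Longrightarrow> \<delta> q x \<in> T f" and c: "c \<in> cochains_in S p"
  shows "vert q c \<in> cochains_in T p"
  unfolding cochains_in_def vert_def
proof (intro CollectI ballI)
  fix as assume as: "as \<in> pos_lists p"
  show "\<delta> q (c as) \<in> T (prod_list as)" by (rule assms(1)[OF prod_pos_lists[OF as] cochains_in_D[OF c as]])
qed

lemma d_vert: "d (Suc q) p (vert q c) - vert q (d q p c) \<in> KN (Suc p) (Suc q)"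
proof -
  have "vert q (d q p c) - d (Suc q) p (vert q c) \<in> KN (Suc p) (Suc q)"
    unfolding d_def bw_coefficients.bwdiff_def[OF coefficients]
  proof (rule altsum_commute[OF subgrp_cochains_in[OF subgrp_N] additive_vert])
    fix k assume k: "k \<le> Suc p"
    show "vert q (bw_coefficients.bwface (L q) (R q) p k c) - bw_coefficients.bwface (L (Suc q)) (R (Suc q)) p k (vert q c)
        \<in> KN (Suc p) (Suc q)"
      unfolding cochains_in_def
    proof (intro CollectI ballI)
      fix as assume as: "as \<in> pos_lists (Suc p)"
      have "\<delta> q (L q (hd as) x) - L (Suc q) (hd as) (\<delta> q x) \<in> N (Suc q)"
        "\<delta> q (R q (last as) x) - R (Suc q) (last as) (\<delta> q x) \<in> N (Suc q)" for x
        using subgrp_minus[OF subgrp_N L_\<delta>[OF hd_pos_lists(1)[OF as], of q x]]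
          subgrp_minus[OF subgrp_N R_\<delta>[OF last_pos_lists(1)[OF as], of q x]] by simp_all
      then show "(vert q (bw_coefficients.bwface (L q) (R q) p k c) - bw_coefficients.bwface (L (Suc q)) (R (Suc q)) p k (vert q c)) as
          \<in> N (Suc q)"
        using subgrp_0[OF subgrp_N] by (simp add: vert_def bw_coefficients.bwface_def[OF coefficients])
    qed
  qed
  from subgrp_minus[OF subgrp_cochains_in[OF subgrp_N] this] show ?thesis by simp
qed

lemma bicomplex_K: "nat_bicomplex KC KN K1 K2"
proof
  fix p q and x y :: "nat list \<Rightarrow> 'c"
  show "subgrp (KC p q)" by (rule subgrp_cochains_in[OF subgrp_X])
  show "subgrp (KN p q)" by (rule subgrp_cochains_in[OF subgrp_N])
  show "KN p q \<subseteq> KC p q" using N_X prod_pos_lists unfolding cochains_in_def by blast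
  show "K1 p q (x + y) = K1 p q x + K1 p q y"
    unfolding d_def by (rule additive.add[OF bw_coefficients.additive_bwdiff[OF coefficients]])
  show "K2 p q (x + y) = K2 p q x + K2 p q y" by (rule additive.add[OF additive_vert])
  show "K1 p q x \<in> KC (Suc p) q" if "x \<in> KC p q"
    unfolding d_def by (rule bw_coefficients.bwdiff_Z[OF coefficients that])
  show "K1 p q x \<in> KN (Suc p) q" if "x \<in> KN p q"
    unfolding d_def by (rule bw_coefficients.bwdiff_N[OF coefficients that])
  show "K2 p q x \<in> KC p (Suc q)" if "x \<in> KC p q" by (rule vert_cochains_in[OF \<delta>_X that])
  show "K2 p q x \<in> KN p (Suc q)" if "x \<in> KN p q" by (rule vert_cochains_in[OF \<delta>_N that])
  show "K1 (Suc p) q (K1 p q x) \<in> KN (Suc (Suc p)) q" if "x \<in> KC p q"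
    unfolding d_def by (rule bw_coefficients.bwdiff_bwdiff[OF coefficients that])
  show "K2 p (Suc q) (K2 p q x) \<in> KN p (Suc (Suc q))" if "x \<in> KC p q"
    using \<delta>_\<delta>[OF prod_pos_lists cochains_in_D[OF that]] by (auto simp: cochains_in_def vert_def)
  show "K1 p (Suc q) (K2 p q x) - K2 (Suc p) q (K1 p q x) \<in> KN (Suc p) (Suc q)" by (rule d_vert)
qed

sublocale K: nat_bicomplex KC KN K1 K2 by (rule bicomplex_K)

lemma K_cocycles: "c \<in> cochains_in (Zc q) p \<longleftrightarrow> c \<in> KC p q \<and> vert q c \<in> KN p (Suc q)"
  by (auto simp: cochains_in_def cocycle_set_def vert_def)

text \<open>A cochain whose values are all coboundaries is a coboundary of the bicomplex: the
  primitives are chosen separately for each chain. The sign of the vertical differential is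
  absorbed into them.\<close>

lemma K_coboundaries:
  "c \<in> cochains_in (Bc q) p \<longleftrightarrow> (\<exists>w\<in>K.IC (int p) (int q - 1). c - K.I2 (int p) (int q - 1) w \<in> KN p q)"
proof (cases q)
  case 0
  have "c \<in> cochains_in (Bc q) p \<longleftrightarrow> c \<in> KN p q" by (simp add: cochains_in_def coboundary_set_def 0)
  then show ?thesis by (simp add: 0 ext_outside)
next
  case (Suc m)
  have m: "int q - 1 = int m" using Suc by simp
  have "c \<in> cochains_in (Bc q) p \<longleftrightarrow> (\<exists>w\<in>KC p m. c - vert m w \<in> KN p q)"
  proof
    assume c: "c \<in> cochains_in (Bc q) p"
    have "\<exists>y. as \<in> pos_lists p \<longrightarrow> y \<in> X m (prod_list as) \<and> c as - \<delta> m y \<in> N q" for as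
    proof (cases "as \<in> pos_lists p")
      case True
      from cochains_in_D[OF c True] obtain y where "y \<in> X m (prod_list as)" "c as - \<delta> m y \<in> N q"
        by (auto simp: coboundary_set_def Suc)
      then show ?thesis by (intro exI[of _ y]) simp
    qed simp
    then have "\<exists>w. \<forall>as. as \<in> pos_lists p \<longrightarrow> w as \<in> X m (prod_list as) \<and> c as - \<delta> m (w as) \<in> N q"
      by (intro choice allI)
    then obtain w where w: "\<forall>as. as \<in> pos_lists p \<longrightarrow> w as \<in> X m (prod_list as) \<and> c as - \<delta> m (w as) \<in> N q" ..
    then show "\<exists>w\<in>KC p m. c - vert m w \<in> KN p q"
      by (intro bexI[of _ w]) (simp_all add: cochains_in_def vert_def)
  next
    assume "\<exists>w\<in>KC p m. c - vert m w \<in> KN p q"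
    then obtain w where w: "w \<in> KC p m" "c - vert m w \<in> KN p q" ..
    show "c \<in> cochains_in (Bc q) p"
      unfolding cochains_in_def
    proof (intro CollectI ballI)
      fix as assume as: "as \<in> pos_lists p"
      show "c as \<in> Bc q (prod_list as)"
        using cochains_in_D[OF w(1) as] cochains_in_D[OF w(2) as] by (auto simp: coboundary_set_def Suc vert_def)
    qed
  qed
  also have "\<dots> \<longleftrightarrow> (\<exists>w\<in>KC p m. c - alt p (vert m w) \<in> KN p q)"
  proof -
    have a: "alt p w \<in> KC p m" if "w \<in> KC p m" for w by (rule alt_mem[OF K.subgrp_C that])
    have b: "alt p (vert m (alt p w)) = vert m w" for w
      by (simp add: additive_alt_apply[OF additive_vert]) (simp add: alt_def)
    have b': "vert m (alt p w) = alt p (vert m w)" for w by (rule additive_alt_apply[OF additive_vert])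
    show ?thesis
    proof
      assume "\<exists>w\<in>KC p m. c - vert m w \<in> KN p q"
      then obtain w where "w \<in> KC p m" "c - vert m w \<in> KN p q" ..
      then show "\<exists>w\<in>KC p m. c - alt p (vert m w) \<in> KN p q"
        by (intro bexI[of _ "alt p w"] a) (simp_all only: b)
    next
      assume "\<exists>w\<in>KC p m. c - alt p (vert m w) \<in> KN p q"
      then obtain w where "w \<in> KC p m" "c - alt p (vert m w) \<in> KN p q" ..
      then show "\<exists>w\<in>KC p m. c - vert m w \<in> KN p q"
        by (intro bexI[of _ "alt p w"] a) (simp_all only: b')
    qed
  qed
  finally show ?thesis by (simp add: m Suc)
qed

lemma I2_minus: "K.I2 p q (- w) = - K.I2 p q w"
  by (rule additive.minus[OF K.additive_I(2)])

lemma IC_minus: "w \<in> K.IC p q \<Longrightarrow> - w \<in> K.IC p q"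
  by (rule subgrp_minus[OF subgrp_ext(2)[OF K.subgrp_C]])

lemma Z2_K: "K.Z2 (int p) (int q) = cocycle_set (cochains_in (Zc q)) (cochains_in (Bc q)) (d q) p"
proof (rule Set.set_eqI)
  fix x
  have s: "int p + 1 = int (Suc p)" by simp
  have "(\<exists>y\<in>K.IC (int p + 1) (int q - 1). d q p x + K.I2 (int p + 1) (int q - 1) y \<in> KN (Suc p) q) \<longleftrightarrow>
      d q p x \<in> cochains_in (Bc q) (Suc p)"
    unfolding K_coboundaries s
  proof
    assume "\<exists>y\<in>K.IC (int (Suc p)) (int q - 1). d q p x + K.I2 (int (Suc p)) (int q - 1) y \<in> KN (Suc p) q"
    then obtain y where "y \<in> K.IC (int (Suc p)) (int q - 1)" "d q p x + K.I2 (int (Suc p)) (int q - 1) y \<in> KN (Suc p) q" ..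
    then show "\<exists>y\<in>K.IC (int (Suc p)) (int q - 1). d q p x - K.I2 (int (Suc p)) (int q - 1) y \<in> KN (Suc p) q"
      by (intro bexI[of _ "- y"] IC_minus) (simp_all only: I2_minus diff_minus_eq_add)
  next
    assume "\<exists>y\<in>K.IC (int (Suc p)) (int q - 1). d q p x - K.I2 (int (Suc p)) (int q - 1) y \<in> KN (Suc p) q"
    then obtain y where "y \<in> K.IC (int (Suc p)) (int q - 1)" "d q p x - K.I2 (int (Suc p)) (int q - 1) y \<in> KN (Suc p) q" ..
    then show "\<exists>y\<in>K.IC (int (Suc p)) (int q - 1). d q p x + K.I2 (int (Suc p)) (int q - 1) y \<in> KN (Suc p) q"
      by (intro bexI[of _ "- y"] IC_minus) (simp_all only: I2_minus add_uminus_conv_diff)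
  qed
  then show "x \<in> K.Z2 (int p) (int q) \<longleftrightarrow> x \<in> cocycle_set (cochains_in (Zc q)) (cochains_in (Bc q)) (d q) p"
    unfolding K.Z2_def cocycle_set_def[of "cochains_in (Zc q)"] mem_Collect_eq K_cocycles ext_int
    by (simp add: alt_mem_iff[OF K.subgrp_N])
qed

lemma B2_K: "K.B2 (int p) (int q) = coboundary_set (cochains_in (Zc q)) (cochains_in (Bc q)) (d q) p"
proof (rule Set.set_eqI)
  fix x
  have r: "x - K.I2 (int p) (int q - 1) w - K.I1 (int p - 1) (int q) v = x - K.I1 (int p - 1) (int q) v - K.I2 (int p) (int q - 1) w" for w v
    by simp
  have "x \<in> K.B2 (int p) (int q) \<longleftrightarrow>
      (\<exists>v\<in>K.IC (int p - 1) (int q). K.I2 (int p - 1) (int q) v \<in> K.IN (int p - 1) (int q + 1) \<and>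
         x - K.I1 (int p - 1) (int q) v \<in> cochains_in (Bc q) p)"
    unfolding K.B2_def K_coboundaries mem_Collect_eq ext_int
    by (subst r) blast
  also have "\<dots> \<longleftrightarrow> x \<in> coboundary_set (cochains_in (Zc q)) (cochains_in (Bc q)) (d q) p"
  proof (cases p)
    case 0
    then show ?thesis by (simp add: coboundary_set_def[of "cochains_in (Zc q)"] ext_outside)
  next
    case (Suc m)
    have m: "int p - 1 = int m" using Suc by simp
    show ?thesis
      unfolding m coboundary_set_def[of "cochains_in (Zc q)"] Suc nat.case mem_Collect_eq ext_int bex_simps
      using K_cocycles[of _ q m] by (auto simp: alt_mem_iff[OF K.subgrp_N])
  qed
  finally show "x \<in> K.B2 (int p) (int q) \<longleftrightarrow> x \<in> coboundary_set (cochains_in (Zc q)) (cochains_in (Bc q)) (d q) p" .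
qed

lemma cohomology_coefficients: "bw_coefficients (Zc q) (Bc q) (L q) (R q)"
proof -
  interpret c: bw_coefficients "X q" "\<lambda>_. N q" "L q" "R q" by (rule coefficients)
  have sZ: "subgrp (Zc q f)" and sB: "subgrp (Bc q f)" if "1 \<le> f" for f q
  proof -
    show "subgrp (Zc q f)"
      unfolding cocycle_set_def by (intro subgrp_kernel additive_\<delta> subgrp_X that subgrp_N)
    have "subgrp (case q of 0 \<Rightarrow> {0} | Suc m \<Rightarrow> \<delta> m ` X m f)"
      using subgrp_image[OF additive_\<delta> subgrp_X[OF that]] by (cases q) (auto simp: subgrp_def)
    then show "subgrp (Bc q f)"
      unfolding coboundary_set_def by (rule subgrp_extend[OF _ subgrp_N])
  qed
  have NB: "x \<in> N q \<Longrightarrow> x \<in> Bc q f" if "1 \<le> f" for x f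
  proof -
    assume x: "x \<in> N q"
    have "0 \<in> (case q of 0 \<Rightarrow> {0} | Suc m \<Rightarrow> \<delta> m ` X m f)"
      using subgrp_0[OF subgrp_image[OF additive_\<delta> subgrp_X[OF that]]] by (cases q) auto
    then show "x \<in> Bc q f" unfolding coboundary_set_def using x by (intro CollectI bexI[of _ 0]) simp_all
  qed
  have Z: "\<gamma> q x \<in> Zc q g" if "1 \<le> f" "x \<in> Zc q f"
    and X: "\<And>y. y \<in> X q f \<Longrightarrow> \<gamma> q y \<in> X q g" and n: "\<And>y. y \<in> N (Suc q) \<Longrightarrow> \<gamma> (Suc q) y \<in> N (Suc q)"
    and cm: "\<And>y. \<gamma> (Suc q) (\<delta> q y) - \<delta> q (\<gamma> q y) \<in> N (Suc q)" for \<gamma> :: "nat \<Rightarrow> 'c \<Rightarrow> 'c" and f g x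
    using that(2) X n[of "\<delta> q x"] subgrp_cong[OF subgrp_N cm[of x]] by (simp add: cocycle_set_def)
  have B: "\<gamma> q x \<in> Bc q g" if f: "1 \<le> f" and x: "x \<in> Bc q f" and a: "additive (\<gamma> q)"
    and X: "\<And>m y. y \<in> X m f \<Longrightarrow> \<gamma> m y \<in> X m g" and n: "\<And>y. y \<in> N q \<Longrightarrow> \<gamma> q y \<in> N q"
    and cm: "\<And>m y. \<gamma> (Suc m) (\<delta> m y) - \<delta> m (\<gamma> m y) \<in> N (Suc m)" for \<gamma> :: "nat \<Rightarrow> 'c \<Rightarrow> 'c" and f g x
  proof (cases q)
    case 0
    then show ?thesis using x n by (simp add: coboundary_set_def)
  next
    case (Suc m)
    then obtain w where w: "w \<in> X m f" "x - \<delta> m w \<in> N q" using x by (auto simp: coboundary_set_def)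
    have "\<gamma> q x - \<delta> m (\<gamma> m w) = \<gamma> q (x - \<delta> m w) + (\<gamma> q (\<delta> m w) - \<delta> m (\<gamma> m w))"
      by (simp add: additive.diff[OF a])
    also have "\<dots> \<in> N q" using subgrp_add[OF subgrp_N n[OF w(2)]] cm[of m w] Suc by simp
    finally show ?thesis using X[OF w(1)] Suc by (auto simp: coboundary_set_def)
  qed
  show ?thesis
  proof
    fix f u v :: nat and x y
    show "L q u (x + y) = L q u x + L q u y" "R q u (x + y) = R q u x + R q u y"
      by (rule additive.add[OF c.additive_L], rule additive.add[OF c.additive_R])
    assume f: "1 \<le> f"
    show "subgrp (Zc q f)" "subgrp (Bc q f)" by (rule sZ[OF f], rule sB[OF f])
    assume u: "1 \<le> u"
    note LX = bw_coefficients.L_Z[OF coefficients u f] and RX = bw_coefficients.R_Z[OF coefficients u f]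
    have LN: "L m u x \<in> N m" and RN: "R m u x \<in> N m" if "x \<in> N m" for m x
      using bw_coefficients.L_N[OF coefficients u f that] bw_coefficients.R_N[OF coefficients u f that] by simp_all
    show "L q u x \<in> Zc q (u * f)" if "x \<in> Zc q f"
      by (rule Z[where ?\<gamma>1 = "\<lambda>q. L q u", OF f that LX LN L_\<delta>[OF u]])
    show "R q u x \<in> Zc q (f * u)" if "x \<in> Zc q f"
      by (rule Z[where ?\<gamma>1 = "\<lambda>q. R q u", OF f that RX RN R_\<delta>[OF u]])
    show "L q u x \<in> Bc q (u * f)" if "x \<in> Bc q f"
      by (rule B[where ?\<gamma>1 = "\<lambda>q. L q u", OF f that c.additive_L LX LN L_\<delta>[OF u]])
    show "R q u x \<in> Bc q (f * u)" if "x \<in> Bc q f"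
      by (rule B[where ?\<gamma>1 = "\<lambda>q. R q u", OF f that c.additive_R RX RN R_\<delta>[OF u]])
    assume v: "1 \<le> v" and x: "x \<in> Zc q f"
    have xX: "x \<in> X q f" using x by (simp add: cocycle_set_def)
    have uvf: "1 \<le> u * v * f" using u v f by simp
    show "L q (u * v) x - L q u (L q v x) \<in> Bc q (u * v * f)"
      by (rule NB[OF uvf c.L_L[OF u v f xX]])
    show "R q v (R q u x) - R q (u * v) x \<in> Bc q (u * v * f)"
      by (rule NB[OF uvf c.R_R[OF u v f xX]])
    show "R q v (L q u x) - L q u (R q v x) \<in> Bc q (u * v * f)"
      by (rule NB[OF uvf c.R_L[OF u v f xX]])
  qed
qed

text \<open>Cochains with values in the vertical cohomology compute the second page, since
  cohomology commutes with the product over all chains.\<close>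

theorem presents_second_page_bw:
  assumes P: "\<And>f. 1 \<le> f \<Longrightarrow> presents (Zc q f) (Bc q f) (grp D f) (\<kappa> f)"
    and push: "\<And>u f x. 1 \<le> u \<Longrightarrow> 1 \<le> f \<Longrightarrow> x \<in> Zc q f \<Longrightarrow> push D u f (\<kappa> f x) = \<kappa> (u * f) (L q u x)"
    and pull: "\<And>u f x. 1 \<le> u \<Longrightarrow> 1 \<le> f \<Longrightarrow> x \<in> Zc q f \<Longrightarrow> pull D u f (\<kappa> f x) = \<kappa> (f * u) (R q u x)"
  shows "\<exists>h. presents (K.Z2 (int p) (int q)) (K.B2 (int p) (int q)) (bw_cohomology Nmult D p) h"
proof -
  have "bw_presentation (Zc q) (Bc q) (L q) (R q) D \<kappa>"
    by (intro bw_presentation.intro[OF cohomology_coefficients] bw_presentation_axioms.intro) (rule P push pull; assumption)+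
  from bw_presentation.presents_bw_cohomology[OF this] show ?thesis
    unfolding Z2_K B2_K unfolding d_def .
qed

end


section \<open>The spectral sequence\<close>

lemma pos_lists_0 [simp]: "pos_lists 0 = {[]}"
  by (auto simp: pos_lists_def)

context psi_module
begin

lemma bitower_0: "bitower 0 b = ytower R b" and biaug_0: "biaug 0 b = psi_aug R b"
  by (simp_all add: bitower_def biaug_def)

lemma biNul_diff_iff: "\<phi> - \<psi> \<in> biNul a b \<longleftrightarrow> (\<forall>x\<in>carrier (bitower a b). ev (\<phi> x) = ev (\<psi> x))"
  unfolding biNul_def by (rule Nul_diff_iff)

lemma pullf_0: "pullf 0 b v \<phi> = (\<lambda>x. \<phi> (psi (psi_tower R b) v x))"
  by (simp add: pullf_def)

lemma bw_coefficients_biDer: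
  "bw_coefficients (\<lambda>f. biDer f 0 b) (\<lambda>_. biNul 0 b) pushf (pullf 0 b)"
proof
  fix u v f :: nat and x y
  show "pushf u (x + y) = pushf u x + pushf u y" for x y :: "'a poly_tower \<Rightarrow> ('b \<Rightarrow>\<^sub>0 int)"
    by (rule additive.add[OF additive_pushf])
  show "pullf 0 b u (x + y) = pullf 0 b u x + pullf 0 b u y" by (rule additive.add[OF additive_pullf])
  show "subgrp (biNul 0 b)" by (rule subgrp_biNul)
  assume f: "1 \<le> f"
  show "subgrp (biDer f 0 b)" by (rule subgrp_biDer[OF f])
  assume u: "1 \<le> u"
  show "pushf u x \<in> biNul 0 b" "pullf 0 b u x \<in> biNul 0 b" if "x \<in> biNul 0 b"
    by (rule pushf_biNul[OF u that], rule pullf_biNul[OF u that])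
  show "pushf u x \<in> biDer (u * f) 0 b" "pullf 0 b u x \<in> biDer (f * u) 0 b" if "x \<in> biDer f 0 b"
    by (rule pushf_biDer[OF u f that], rule pullf_biDer[OF u f that])
  assume v: "1 \<le> v"
  show "pushf (u * v) x - pushf u (pushf v x) \<in> biNul 0 b"
    unfolding biNul_diff_iff using u v by (simp add: ev_pushf mpsi_comp)
  show "pullf 0 b v (pullf 0 b u x) - pullf 0 b (u * v) x \<in> biNul 0 b"
    unfolding biNul_diff_iff pullf_0 bitower_0 carrier_psi_tower[symmetric]
    using psi_ring.psi_comp[OF psi_ring_psi_tower[OF psi_ring_R] u v] by simp
  show "pullf 0 b v (pushf u x) - pushf u (pullf 0 b v x) \<in> biNul 0 b"
    using subgrp_0[OF subgrp_biNul] by (simp add: pullf_0 pushf_def)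
qed

lemma natural_complexes_biDer:
  "natural_complexes (\<lambda>q f. biDer f 0 (Suc q)) (\<lambda>q. biNul 0 (Suc q)) (\<lambda>q. pushf) (\<lambda>q. pullf 0 (Suc q)) (\<lambda>q. diffB 0 (Suc q))"
proof (rule natural_complexes.intro)
  fix q u f :: nat and x
  show "bw_coefficients (\<lambda>f. biDer f 0 (Suc q)) (\<lambda>_. biNul 0 (Suc q)) pushf (pullf 0 (Suc q))"
    by (rule bw_coefficients_biDer)
  show "additive (diffB 0 (Suc q))" by (rule additive_diffB)
  show "diffB 0 (Suc q) x \<in> biNul 0 (Suc (Suc q))" if "x \<in> biNul 0 (Suc q)" by (rule diffB_biNul[OF that])
  show "pushf u (diffB 0 (Suc q) x) - diffB 0 (Suc q) (pushf u x) \<in> biNul 0 (Suc (Suc q))"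
    unfolding pushf_diffB using subgrp_0[OF subgrp_biNul] by simp
  show "pullf 0 (Suc (Suc q)) u (diffB 0 (Suc q) x) - diffB 0 (Suc q) (pullf 0 (Suc q) u x) \<in> biNul 0 (Suc (Suc q))" if "1 \<le> u"
    by (rule pullf_diffB[OF that])
  assume f: "1 \<le> f"
  show "biNul 0 (Suc q) \<subseteq> biDer f 0 (Suc q)" by (rule biNul_biDer[OF f])
  assume x: "x \<in> biDer f 0 (Suc q)"
  show "diffB 0 (Suc q) x \<in> biDer f 0 (Suc (Suc q))" by (rule diffB_biDer[OF f x])
  show "diffB 0 (Suc (Suc q)) (diffB 0 (Suc q) x) \<in> biNul 0 (Suc (Suc (Suc q)))" by (rule diffB_diffB)
qed

sublocale W: natural_complexes "\<lambda>q f. biDer f 0 (Suc q)" "\<lambda>q. biNul 0 (Suc q)" "\<lambda>q. pushf" "\<lambda>q. pullf 0 (Suc q)" "\<lambda>q. diffB 0 (Suc q)"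
  by (rule natural_complexes_biDer)

lemma biDer_free: "biDer f 0 (Suc q) = Der (free_cring (ops (carrier (ytower R q)))) (\<lambda>x. psi R f (psi_aug R (Suc q) x))"
  unfolding biDer_def bitower_0 biaug_0 ytower_simps carrier_psi_tower ..

lemma free_sigma_hom: "1 \<le> f \<Longrightarrow>
    (\<lambda>x. psi R f (psi_aug R (Suc q) x)) \<in> ring_hom (free_cring (ops (carrier (ytower R q)))) R"
  using sigma_hom[of f 0 "Suc q"] unfolding bitower_0 biaug_0 ytower_simps carrier_psi_tower .

lemma biDer_extend:
  assumes f: "1 \<le> f" and g: "\<And>n s. 1 \<le> n \<Longrightarrow> s \<in> carrier (ytower R q) \<Longrightarrow> g n s \<in> carrier M"
  shows "\<exists>\<phi>\<in>biDer f 0 (Suc q). \<forall>n\<ge>1. \<forall>s\<in>carrier (ytower R q). ev (\<phi> (var (Op n s))) = g n s"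
proof -
  let ?V = "ops (carrier (ytower R q))"
  have "op_eval g v \<in> carrier M" if "v \<in> ?V" for v
    using that g by (auto simp: ops_def)
  from Der_free_extend[where S = ?V and g = "op_eval g", OF free_sigma_hom[OF f] this]
  obtain \<phi> where "\<phi> \<in> biDer f 0 (Suc q)" "\<forall>v\<in>?V. ev (\<phi> (var v)) = op_eval g v"
    unfolding biDer_free by blast
  moreover have "Op n s \<in> ?V" if "1 \<le> n" "s \<in> carrier (ytower R q)" for n s
    using that by (auto simp: ops_def)
  ultimately show ?thesis by (metis op_eval.simps(1))
qed

lemma biDer_eq:
  assumes f: "1 \<le> f" and p: "\<phi> \<in> biDer f 0 (Suc q)" "\<psi> \<in> biDer f 0 (Suc q)"
    and e: "\<And>n s. 1 \<le> n \<Longrightarrow> s \<in> carrier (ytower R q) \<Longrightarrow> ev (\<phi> (var (Op n s)) - \<psi> (var (Op n s))) = \<zero>\<^bsub>M\<^esub>"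
  shows "\<phi> - \<psi> \<in> biNul 0 (Suc q)"
proof -
  have "\<phi> - \<psi> \<in> Nul (free_cring (ops (carrier (ytower R q))))"
  proof (rule Der_free_eq[OF p[unfolded biDer_free] free_sigma_hom[OF f]])
    fix v assume "v \<in> ops (carrier (ytower R q))"
    then obtain n s where "v = Op n s" "1 \<le> n" "s \<in> carrier (ytower R q)" by (auto simp: ops_def)
    then show "ev (\<phi> (var v)) = ev (\<psi> (var v))" using e[of n s] ev_eq_iff by simp
  qed
  then show ?thesis unfolding biNul_def bitower_0 ytower_simps carrier_psi_tower .
qed

lemma psi_var: "psi (psi_tower R (Suc q)) m (var (Op n s)) = var (Op (m * n) s)"
  by (simp only: psi_psi_tower(2) free_map_var op_mult.simps)

lemma subgrp_ev: "subgrp {z. ev z = \<zero>\<^bsub>M\<^esub>}"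
  by (auto simp: subgrp_def ev_diff)

lemma cmp_snoc:
  assumes "as \<in> pos_lists (Suc p)" "0 < k"
  shows "k \<le> p \<Longrightarrow> cmp k (as @ [n]) = cmp k as @ [n]"
    and "k = Suc p \<Longrightarrow> cmp k (as @ [n]) = butlast as @ [last as * n]"
proof -
  let ?cs = "as @ [n]"
  have len: "length as = Suc p" using assms by (simp add: pos_lists_def)
  have e: "cmp k ?cs \<noteq> [] \<Longrightarrow> cmp k ?cs = butlast (cmp k ?cs) @ [last (cmp k ?cs)]" by simp
  have ne: "cmp k ?cs \<noteq> []" by (simp add: compose_at_def)
  show "cmp k ?cs = cmp k as @ [n]" if "k \<le> p"
    using e[OF ne] cmp_earlier[of k ?cs] that assms(2) len by simp
  show "cmp k ?cs = butlast as @ [last as * n]" if "k = Suc p"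
    using e[OF ne] cmp_last[of k ?cs] that len by simp
qed

text \<open>The contraction \<open>y(as)(\<Psi>\<^sup>n s) = c(as, n)(\<Psi>\<^sup>1 s)\<close>.
  Evaluating the cocycle identity for \<open>c\<close> at the chain \<open>(as, n)\<close> and the
  element \<open>\<Psi>\<^sup>1 s\<close>, all terms but the last are the corresponding terms of
  the differential of \<open>y\<close> at \<open>\<Psi>\<^sup>n s\<close>, and the last one is
  \<open>c(as)(\<Psi>\<^sup>n (\<Psi>\<^sup>1 s)) = c(as)(\<Psi>\<^sup>n s)\<close>.\<close>

lemma W_exact:
  assumes c: "c \<in> W.KC (Suc p) q" and dc: "W.d q (Suc p) c \<in> W.KN (Suc (Suc p)) q"
  shows "\<exists>y\<in>W.KC p q. c - W.d q p y \<in> W.KN (Suc p) q"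
proof -
  interpret b: bw_coefficients "\<lambda>f. biDer f 0 (Suc q)" "\<lambda>_. biNul 0 (Suc q)" pushf "pullf 0 (Suc q)"
    by (rule W.coefficients)
  let ?Y = "carrier (ytower R q)"
  let ?P = "\<lambda>as \<phi>. \<phi> \<in> biDer (prod_list as) 0 (Suc q) \<and>
      (\<forall>n\<ge>1. \<forall>s\<in>?Y. ev (\<phi> (var (Op n s))) = ev (c (as @ [n]) (var (Op 1 s))))"
  have "\<exists>\<phi>. as \<in> pos_lists p \<longrightarrow> ?P as \<phi>" for as
  proof (cases "as \<in> pos_lists p")
    case True
    have "\<exists>\<phi>\<in>biDer (prod_list as) 0 (Suc q). \<forall>n\<ge>1. \<forall>s\<in>?Y. ev (\<phi> (var (Op n s))) = ev (c (as @ [n]) (var (Op 1 s)))"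
      by (rule biDer_extend[OF prod_pos_lists[OF True]]) simp
    then obtain \<phi> where "?P as \<phi>" by auto
    then show ?thesis by (intro exI[of _ \<phi>] impI)
  qed simp
  then have "\<exists>y. \<forall>as. as \<in> pos_lists p \<longrightarrow> ?P as (y as)" by (intro choice allI)
  then obtain y where y: "\<forall>as. as \<in> pos_lists p \<longrightarrow> ?P as (y as)" ..
  have yC: "y \<in> W.KC p q" using y by (simp add: cochains_in_def)
  have yv: "ev (y as (var (Op n s))) = ev (c (as @ [n]) (var (Op 1 s)))"
    if "as \<in> pos_lists p" "1 \<le> n" "s \<in> ?Y" for as n s
    using y that by simp
  have "c - W.d q p (alt (Suc p) y) \<in> W.KN (Suc p) q"
    unfolding cochains_in_def
  proof (intro CollectI ballI)
    fix as assume as: "as \<in> pos_lists (Suc p)"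
    have len: "length as = Suc p" and ne: "as \<noteq> []" using as by (auto simp: pos_lists_def)
    note h = hd_pos_lists[OF as] and l = last_pos_lists[OF as]
    have "c as - W.d q p (alt (Suc p) y) as \<in> biNul 0 (Suc q)"
    proof (rule biDer_eq[OF prod_pos_lists[OF as] cochains_in_D[OF c as]])
      show "W.d q p (alt (Suc p) y) as \<in> biDer (prod_list as) 0 (Suc q)"
        unfolding W.d_def by (intro cochains_in_D[OF b.bwdiff_Z as] alt_mem W.K.subgrp_C yC)
      fix n :: nat and s assume n: "1 \<le> n" and s: "s \<in> ?Y"
      let ?v = "var (Op n s)" and ?w = "var (Op 1 s)" and ?cs = "as @ [n]"
      define a where "a k = b.bwface p k y as ?v" for k
      define e where "e k = b.bwface (Suc p) k c ?cs ?w" for k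
      have cs: "?cs \<in> pos_lists (Suc (Suc p))" using as n by (simp add: pos_lists_def)
      have ae: "ev (a k) = ev (e k)" if k: "k \<le> Suc p" for k
      proof -
        consider "k = 0" | "0 < k" "k \<le> p" | "k = Suc p" using k by linarith
        then show ?thesis
        proof cases
          case 1
          show ?thesis
            unfolding a_def e_def 1 b.bwface_simps ev_pushf[OF h(1)] hd_append2[OF ne] tl_append2[OF ne]
              yv[OF h(2) n s] ..
        next
          case 2
          have k': "k \<le> Suc p" using 2 by simp
          show ?thesis
            unfolding a_def e_def b.bwface_simps(2)[OF 2] b.bwface_simps(2)[OF 2(1) k']
              cmp_snoc(1)[OF as 2] yv[OF cmp_pos_lists(1)[OF as 2] n s] ..
        next
          case 3
          have k': "0 < Suc p" by simp
          have m: "1 \<le> last as * n" using l(1) n by simp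
          show ?thesis
            unfolding a_def e_def 3 b.bwface_simps(3) b.bwface_simps(2)[OF k' order_refl]
              cmp_snoc(2)[OF as k' refl] pullf_0 psi_var yv[OF l(2) m s] ..
        qed
      qed
      have last: "e (Suc (Suc p)) = c as ?v"
        unfolding e_def b.bwface_simps pullf_0 by (simp only: last_snoc butlast_snoc psi_var mult_1_right)
      let ?S = "\<Sum>k\<le>Suc p. alt k (a k)" and ?T = "\<Sum>k\<le>Suc p. alt k (e k)"
      let ?K = "{z. ev z = \<zero>\<^bsub>M\<^esub>}"
      have ST: "?S - ?T \<in> ?K"
        by (rule mem_sum_diff[OF subgrp_ev], unfold alt_diff[symmetric], rule alt_mem[OF subgrp_ev])
          (use ae ev_eq_iff in auto)
      have wY: "?w \<in> carrier (bitower 0 (Suc q))"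
        unfolding bitower_0 ytower_simps carrier_psi_tower by (rule var_carrier) (use s in \<open>auto simp: ops_def\<close>)
      have "W.d q (Suc p) c ?cs ?w = ?T + alt (Suc (Suc p)) (c as ?v)"
        unfolding W.d_def b.bwdiff_apply fun_sum_apply alt_fun last[symmetric] unfolding e_def by (rule sum.atMost_Suc)
      moreover have "W.d q (Suc p) c ?cs ?w \<in> ?K"
        using cochains_in_D[OF dc cs] wY by (simp add: biNul_def Nul_def)
      ultimately have T: "?T + alt (Suc (Suc p)) (c as ?v) \<in> ?K" by simp
      have "W.d q p (alt (Suc p) y) as ?v = alt (Suc p) ?S"
      proof -
        have "W.d q p (alt (Suc p) y) as ?v = alt (Suc p) (W.d q p y) as ?v"
          unfolding W.d_def additive_alt_apply[OF b.additive_bwdiff] ..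
        also have "\<dots> = alt (Suc p) ?S"
          unfolding alt_fun W.d_def b.bwdiff_apply fun_sum_apply a_def ..
        finally show ?thesis .
      qed
      moreover have "c as ?v - alt (Suc p) ?S = - alt (Suc p) (?S - ?T + (?T + alt (Suc (Suc p)) (c as ?v)))"
        by (simp add: alt_def)
      moreover have "- alt (Suc p) (?S - ?T + (?T + alt (Suc (Suc p)) (c as ?v))) \<in> ?K"
        by (intro subgrp_minus alt_mem subgrp_add subgrp_ev ST T)
      ultimately show "ev (c as ?v - W.d q p (alt (Suc p) y) as ?v) = \<zero>\<^bsub>M\<^esub>" by simp
    qed
    then show "(c - W.d q p (alt (Suc p) y)) as \<in> biNul 0 (Suc q)" by simp
  qed
  moreover have "alt (Suc p) y \<in> W.KC p q" by (rule alt_mem[OF W.K.subgrp_C yC])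
  ultimately show ?thesis by blast
qed

text \<open>Psi-derivations are the \<open>0\<close>-cocycles of the natural system
  (\<open>psi_derivations_iff\<close>).\<close>

definition psi_derivations :: "nat \<Rightarrow> ('a poly_tower \<Rightarrow> ('b \<Rightarrow>\<^sub>0 int)) set" where
  "psi_derivations b = PsiDer (psi_tower R b) (psi_aug R b)"

lemma psi_derivations_iff: "\<phi> \<in> psi_derivations b \<longleftrightarrow> \<phi> \<in> biDer 1 0 b \<and> (\<forall>n\<ge>1. pushf n \<phi> - pullf 0 b n \<phi> \<in> biNul 0 b)"
proof -
  have "Der (psi_tower R b) (psi_aug R b) = Der (ytower R b) (psi_aug R b)"
    unfolding Der_def carrier_psi_tower
    by (cases b) (simp_all add: ytower_def base_psi_ring_def free_psi_ring_def ring.defs ops_def carrier_psi_tower)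
  also have "\<dots> = biDer 1 0 b"
    unfolding biDer_def bitower_0 biaug_0 by (rule Der_cong) (simp add: psi_one[unfolded One_nat_def] ring_hom_closed[OF psi_aug_ring_hom])
  finally have D: "Der (psi_tower R b) (psi_aug R b) = biDer 1 0 b" .
  show ?thesis
    unfolding psi_derivations_def PsiDer_def D biNul_diff_iff bitower_0 carrier_psi_tower pullf_0 mem_Collect_eq
    using ev_pushf by (metis (no_types, lifting))
qed

lemma subgrp_psi_derivations: "subgrp (psi_derivations b)"
  unfolding psi_derivations_def by (rule subgrp_PsiDer) (simp add: ring_hom_psi_tower1 psi_aug_ring_hom)

lemma faceB_psi_derivations:
  assumes k: "k \<le> b" and p: "\<phi> \<in> psi_derivations b"
  shows "faceB 0 b k \<phi> \<in> psi_derivations (Suc b)"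
  unfolding psi_derivations_iff
proof (intro conjI allI impI)
  have L: "\<phi> \<in> biDer 1 0 b" and e: "\<And>n x. 1 \<le> n \<Longrightarrow> x \<in> carrier (ytower R b) \<Longrightarrow>
      ev (pushf n \<phi> x) = ev (\<phi> (psi (psi_tower R b) n x))"
    using p unfolding psi_derivations_iff biNul_diff_iff bitower_0 pullf_0 by auto
  show "faceB 0 b k \<phi> \<in> biDer 1 0 (Suc b)" by (rule faceB_biDer[OF k L])
  fix n :: nat assume n: "1 \<le> n"
  show "pushf n (faceB 0 b k \<phi>) - pullf 0 (Suc b) n (faceB 0 b k \<phi>) \<in> biNul 0 (Suc b)"
    unfolding biNul_diff_iff bitower_0
  proof
    fix x assume x: "x \<in> carrier (ytower R (Suc b))"
    have m: "psi_face R b k (psi (psi_tower R (Suc b)) n x) = psi (psi_tower R b) n (psi_face R b k x)"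
      using psi_face_mor[OF psi_ring_R k] n x unfolding psi_mor_def by blast
    have "ev (pushf n (faceB 0 b k \<phi>) x) = ev (pushf n \<phi> (psi_face R b k x))"
      by (simp add: pushf_def faceB_def)
    also have "\<dots> = ev (\<phi> (psi (psi_tower R b) n (psi_face R b k x)))"
      by (rule e[OF n ring_hom_closed[OF psi_face_hom[OF k] x]])
    also have "\<dots> = ev (pullf 0 (Suc b) n (faceB 0 b k \<phi>) x)"
      unfolding pullf_0 faceB_def funpow_0 m ..
    finally show "ev (pushf n (faceB 0 b k \<phi>) x) = ev (pullf 0 (Suc b) n (faceB 0 b k \<phi>) x)" .
  qed
qed

lemma diffB_psi_derivations: "\<phi> \<in> psi_derivations b \<Longrightarrow> diffB 0 b \<phi> \<in> psi_derivations (Suc b)"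
  unfolding diffB_def by (intro altsum_mem[OF subgrp_psi_derivations] faceB_psi_derivations)

lemma W_d_0: "W.d q 0 c [n] = pushf n (c []) - pullf 0 (Suc q) n (c [])"
  unfolding W.d_def bw_coefficients.bwdiff_apply[OF W.coefficients]
  by (simp add: bw_coefficients.bwface_simps[OF W.coefficients] bw_coefficients.bwface_def[OF W.coefficients] alt_Suc)

text \<open>For a free Psi-ring the Psi-derivations are resolved by the Baues--Wirsching
  cochains.\<close>

lemma row_psi_derivations:
  "nat_row_augmented W.KC W.KN W.K1 W.K2 (\<lambda>q. psi_derivations (Suc q)) (\<lambda>q. biNul 0 (Suc q)) (\<lambda>q. diffB 0 (Suc q)) (\<lambda>q \<phi> as. \<phi>)"
proof
  have pl1: "pos_lists (Suc 0) = (\<lambda>n. [n]) ` {n. 1 \<le> n}"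
    by (auto simp: pos_lists_def length_Suc_conv)
  have d0: "W.d q 0 c \<in> W.KN (Suc 0) q \<longleftrightarrow> (\<forall>n\<ge>1. pushf n (c []) - pullf 0 (Suc q) n (c []) \<in> biNul 0 (Suc q))" for q c
    unfolding cochains_in_def pl1 by (simp add: W_d_0)
  fix q p :: nat and x y :: "'a poly_tower \<Rightarrow> ('b \<Rightarrow>\<^sub>0 int)" and c :: "nat list \<Rightarrow> 'a poly_tower \<Rightarrow> ('b \<Rightarrow>\<^sub>0 int)"
  show "subgrp (psi_derivations (Suc q))" "subgrp (biNul 0 (Suc q))" by (rule subgrp_psi_derivations, rule subgrp_biNul)
  show "diffB 0 (Suc q) (x + y) = diffB 0 (Suc q) x + diffB 0 (Suc q) y" by (rule additive.add[OF additive_diffB])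
  show "(\<lambda>as. x + y) = (\<lambda>as :: nat list. x) + (\<lambda>as. y)" by (simp add: fun_eq_iff)
  show "\<exists>b\<in>psi_derivations (Suc q). c - (\<lambda>as. b) \<in> W.KN 0 q" if c: "c \<in> W.KC 0 q" and d: "W.d q 0 c \<in> W.KN (Suc 0) q"
  proof (rule bexI[of _ "c []"])
    show "c - (\<lambda>as. c []) \<in> W.KN 0 q" using subgrp_0[OF subgrp_biNul] by (simp add: cochains_in_def)
    show "c [] \<in> psi_derivations (Suc q)" using c d unfolding psi_derivations_iff d0 by (simp add: cochains_in_def)
  qed
  show "\<exists>y\<in>W.KC p q. c - W.d q p y \<in> W.KN (Suc p) q" if "c \<in> W.KC (Suc p) q" "W.d q (Suc p) c \<in> W.KN (Suc (Suc p)) q"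
    by (rule W_exact[OF that])
  assume x: "x \<in> psi_derivations (Suc q)"
  show "diffB 0 (Suc q) x \<in> psi_derivations (Suc (Suc q))" by (rule diffB_psi_derivations[OF x])
  show "(\<lambda>as. x) \<in> W.KC 0 q" using x by (simp add: cochains_in_def psi_derivations_iff)
  show "(\<lambda>as. diffB 0 (Suc q) x) - W.vert q (\<lambda>as. x) \<in> W.KN 0 (Suc q)"
    using subgrp_0[OF subgrp_biNul] by (simp add: cochains_in_def W.vert_def)
  show "W.d q 0 (\<lambda>as. x) \<in> W.KN (Suc 0) q" using x unfolding d0 psi_derivations_iff by simp
  show "(\<lambda>as. x) \<in> W.KN 0 q \<longleftrightarrow> x \<in> biNul 0 (Suc q)" by (simp add: cochains_in_def)
qed

definition psi_section :: "nat \<Rightarrow> ('a poly_tower \<Rightarrow> ('b \<Rightarrow>\<^sub>0 int)) \<Rightarrow> 'a poly_tower \<Rightarrow> 'a poly_tower \<times> 'a \<times> 'b" where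
  "psi_section q = sec (psi_tower R (Suc q)) (psi_aug R (Suc q))"

lemma presents_psi_cochains: "presents (psi_derivations (Suc q)) (biNul 0 (Suc q)) (psi_cochains R M q) (psi_section q)"
proof -
  have N: "Nul (psi_tower R (Suc q)) = biNul 0 (Suc q)"
    unfolding biNul_def bitower_0 Nul_def carrier_psi_tower ..
  have a: "psi_aug R (Suc q) \<in> ring_hom (psi_tower R (Suc q)) R"
    unfolding ring_hom_psi_tower1 by (rule psi_aug_ring_hom)
  have ap: "psi_aug R (Suc q) (psi (psi_tower R (Suc q)) n x) = psi R n (psi_aug R (Suc q) x)"
    if "1 \<le> n" "x \<in> carrier (psi_tower R (Suc q))" for n x
    by (rule psi_aug_psi[OF psi_ring_R that[unfolded carrier_psi_tower]])
  show ?thesis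
    using presents_psi_ring_sections[OF psi_ring_psi_tower[OF psi_ring_R] a ap]
    unfolding N psi_cochains_def Let_def psi_section_def psi_derivations_def .
qed

lemma psi_diff_sec:
  assumes p: "\<phi> \<in> psi_derivations (Suc q)"
  shows "psi_diff R M q (psi_section q \<phi>) = psi_section (Suc q) (diffB 0 (Suc q) \<phi>)"
proof -
  have s: "section_pullback (psi_tower R (Suc (Suc q))) (psi_face R (Suc q) k) (psi_section q \<phi>) = psi_section (Suc q) (faceB 0 (Suc q) k \<phi>)"
    if k: "k \<le> Suc q" for k
    unfolding psi_section_def faceB_def funpow_0
  proof (rule section_pullback_sec)
    fix x assume x: "x \<in> carrier (psi_tower R (Suc (Suc q)))"
    show "psi_face R (Suc q) k x \<in> carrier (psi_tower R (Suc q)) \<and>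
        psi_aug R (Suc q) (psi_face R (Suc q) k x) = psi_aug R (Suc (Suc q)) x"
      unfolding carrier_psi_tower
      by (intro conjI ring_hom_closed[OF psi_face_hom[OF k]] psi_aug_face[OF psi_ring_R k])
        (rule x[unfolded carrier_psi_tower])+
  qed
  show ?thesis
    unfolding psi_diff_def diffB_def altsum_def
    by (rule presents_alternating_sum[OF presents_psi_cochains]) (rule faceB_psi_derivations[OF _ p] s; assumption)+
qed

lemma presents_psi_cohomology:
  "presents (cocycle_set (\<lambda>q. psi_derivations (Suc q)) (\<lambda>q. biNul 0 (Suc q)) (\<lambda>q. diffB 0 (Suc q)) n)
    (coboundary_set (\<lambda>q. psi_derivations (Suc q)) (\<lambda>q. biNul 0 (Suc q)) (\<lambda>q. diffB 0 (Suc q)) n)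
    (psi_cohomology R M n) (\<lambda>x. coboundaries (psi_cochains R M) (psi_diff R M) n #>\<^bsub>psi_cochains R M n\<^esub> psi_section n x)"
  unfolding psi_cohomology_def
  by (rule presents_cohomology[where C = "\<lambda>q. psi_derivations (Suc q)" and N = "\<lambda>q. biNul 0 (Suc q)" and G = "psi_cochains R M"
        and h = psi_section and \<delta> = "\<lambda>q. diffB 0 (Suc q)" and d = "psi_diff R M"])
    (rule presents_psi_cochains additive_diffB diffB_diffB diffB_psi_derivations psi_diff_sec; assumption)+

text \<open>The total cohomology of the bicomplex is computed along the rows, its second page
  along the columns.\<close>

theorem spectral_sequence_psi:
  "\<exists>E d. spectral_sequence E d \<and> second_page E (\<lambda>p q. bw_cohomology Nmult (aq_nat_sys R M q) p) \<and>
     converges_to E d (psi_cohomology R M)"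
proof -
  interpret row: nat_row_augmented W.KC W.KN W.K1 W.K2 "\<lambda>q. psi_derivations (Suc q)" "\<lambda>q. biNul 0 (Suc q)" "\<lambda>q. diffB 0 (Suc q)" "\<lambda>q \<phi> as. \<phi>"
    by (rule row_psi_derivations)
  obtain \<kappa> where \<kappa>: "\<And>f q. 1 \<le> f \<Longrightarrow> presents (W.Zc q f) (W.Bc q f) (grp (aq_nat_sys R M q) f) (\<kappa> f q)"
    and push: "\<And>f q x u. 1 \<le> f \<Longrightarrow> x \<in> W.Zc q f \<Longrightarrow> 1 \<le> u \<Longrightarrow>
        push (aq_nat_sys R M q) u f (\<kappa> f q x) = \<kappa> (u * f) q (pushf u x)"
    and pull: "\<And>f q x v. 1 \<le> f \<Longrightarrow> x \<in> W.Zc q f \<Longrightarrow> 1 \<le> v \<Longrightarrow>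
        pull (aq_nat_sys R M q) v f (\<kappa> f q x) = \<kappa> (f * v) q (pullf 0 (Suc q) v x)"
    using kappa by metis
  have "\<exists>a. presents (W.K.Z2 (int p) (int q)) (W.K.B2 (int p) (int q)) (bw_cohomology Nmult (aq_nat_sys R M q) p) a" for p q
    by (rule W.presents_second_page_bw[where \<kappa> = "\<lambda>f. \<kappa> f q"]) (rule \<kappa> push pull; assumption)+
  then obtain a where a: "\<And>p q. presents (W.K.Z2 (int p) (int q)) (W.K.B2 (int p) (int q))
      (bw_cohomology Nmult (aq_nat_sys R M q) p) (a p q)"
    by metis
  have "\<exists>h. presents (Ztot W.K.IC W.K.IN W.K.I1 W.K.I2 (int n)) (Btot W.K.IC W.K.IN W.K.I1 W.K.I2 (int n))
      (psi_cohomology R M n) h" for n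
    using row.row.presents_total[of "int n"] presents_psi_cohomology[of n] unfolding row.row_ZB row.row_BB by blast
  then obtain h where h: "\<And>n. presents (Ztot W.K.IC W.K.IN W.K.I1 W.K.I2 (int n)) (Btot W.K.IC W.K.IN W.K.I1 W.K.I2 (int n))
      (psi_cohomology R M n) (h n)"
    by metis
  show ?thesis by (rule W.K.spectral_sequence_exists[OF a h])
qed

end

theorem mainTheorem3:
  fixes R :: "'a psi_ring" and M :: "('a, 'b) psi_module"
  assumes "psi_ring R" and "psi_module R M"
  shows "\<exists>E d. spectral_sequence E d \<and>
           second_page E (\<lambda>p q. bw_cohomology Nmult (aq_nat_sys R M q) p) \<and>
           converges_to E d (psi_cohomology R M)"
  by (rule psi_module.spectral_sequence_psi[OF assms(2)])

end
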